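(* Let $d\in\{1,2\}$ and let $X$ be a centered isotropic Gaussian random field on $\mathbb{R}^d$ satisfying the standing assumptions in the context, with $\gamma=-C'(0)>0$ and $\sigma=\frac{C''(0)-C'(0)^2}{2C''(0)}\in(-1/d,1/2)$. Let $F_d(\nu;z)=\sum_{m=0}^df_{m,d}(\nu)z^m$ be the generating function of the expected number densities $f_{m,d}$ of critical points of index $m$, and $\phi(\nu)=\frac1{\sqrt{2\pi}}e^{-\nu^2/2}$. Then for all $\nu\in\mathbb{R}$: If $d=1$, $$F_1(\nu;z)=\Bigl(\frac\gamma{2\pi}\Bigr)^{1/2}\phi(\nu)\Biggl[\Biggl(\frac{\sqrt{2+2\sigma}\,e^{-\frac{(1-2\sigma)\nu^2}{2(2+2\sigma)}}}{\sqrt{2\pi}\sqrt{1-2\sigma}}-\frac12\nu\,\mathrm{erfc}\Bigl(\frac{\sqrt{1-2\sigma}\,\nu}{\sqrt2\sqrt{2+2\sigma}}\Bigr)\Biggr)+z\Biggl(\frac{\sqrt{2+2\sigma}\,e^{-\frac{(1-2\sigma)\nu^2}{2(2+2\sigma)}}}{\sqrt{2\pi}\sqrt{1-2\sigma}}+\frac12\nu\,\mathrm{erfc}\Bigl(-\frac{\sqrt{1-2\sigma}\,\nu}{\sqrt2\sqrt{2+2\sigma}}\Bigr)\Biggr)\Biggr].$$ If $d=2$, $$F_2(\nu;z)=\frac\gamma{2\pi}\,\phi(\nu)\bigl[A_0(\nu)+zA_1(\nu)+z^2A_2(\nu)\bigr],$$ where $$A_0(\nu)=-\frac{\sqrt{1+2\sigma}\,\nu\,e^{-\frac{(1-2\sigma)\nu^2}{2(1+2\sigma)}}}{\sqrt{2\pi}\sqrt{1-2\sigma}}+\frac{e^{-\frac{(1-2\sigma)\nu^2}{2(2+2\sigma)}}\,\mathrm{erfc}\Bigl(\frac{\sqrt{1-2\sigma}\,\nu}{\sqrt2\sqrt{1+2\sigma}\sqrt{2+2\sigma}}\Bigr)}{(1-2\sigma)\sqrt{2+2\sigma}}+\frac12(\nu^2-1)\,\mathrm{erfc}\Bigl(\frac{\sqrt{1-2\sigma}\,\nu}{\sqrt2\sqrt{1+2\sigma}}\Bigr),$$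 $$A_1(\nu)=\frac{2e^{-\frac{(1-2\sigma)\nu^2}{2(2+2\sigma)}}}{(1-2\sigma)\sqrt{2+2\sigma}},$$ $$A_2(\nu)=\frac{\sqrt{1+2\sigma}\,\nu\,e^{-\frac{(1-2\sigma)\nu^2}{2(1+2\sigma)}}}{\sqrt{2\pi}\sqrt{1-2\sigma}}+\frac{e^{-\frac{(1-2\sigma)\nu^2}{2(2+2\sigma)}}\,\mathrm{erfc}\Bigl(-\frac{\sqrt{1-2\sigma}\,\nu}{\sqrt2\sqrt{1+2\sigma}\sqrt{2+2\sigma}}\Bigr)}{(1-2\sigma)\sqrt{2+2\sigma}}+\frac12(\nu^2-1)\,\mathrm{erfc}\Bigl(-\frac{\sqrt{1-2\sigma}\,\nu}{\sqrt2\sqrt{1+2\sigma}}\Bigr).$$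
   Context: $\mathrm{erfc}(x)=\frac2{\sqrt\pi}\int_x^\infty e^{-t^2}dt$. **Random field.** $X(x)$, $x\in\mathbb{R}^d$, is a Gaussian random field with $C^2$ sample paths, $E[X(x)]=0$, $E[X(x)X(y)]=C(\tfrac12\|x-y\|^2)$, $C(0)=1$, where $C$ is sufficiently smooth, $C'(0)<0$. Write $\nabla X=(X_i)$, $\nabla^2X=(X_{ij})$ for the gradient and Hessian. For each $x$, $(X,\nabla X,\nabla^2X)$ is centered Gaussian with $E[X^2]=1$, $E[XX_i]=0$, $E[XX_{kl}]=C'(0)\delta_{kl}$, $E[X_iX_k]=-C'(0)\delta_{ik}$, $E[X_iX_{kl}]=0$, $E[X_{ij}X_{kl}]=C''(0)(\delta_{ik}\delta_{jl}+\delta_{ij}\delta_{kl}+\delta_{il}\delta_{jk})$. **Regularity (conditions for the Kac–Rice formula, Adler–Taylor, Theorem 11.2.1).** Put $f=\nabla X$ (with Jacobian $\nabla f=\nabla^2X$), $g=(X,(X_{ij})_{i\le j})$, $u=0\in\mathbb{R}^d$. For every compact $T\subset\mathbb{R}^d$ whose boundary has finite $(d-1)$-dimensional Hausdorff measure: (a) all components of $f,\nabla f,g$ are a.s. continuous and have finite variances on $T$; (b) for all $t\in T$ the density of $f(t)$ exists and is continuous at $u$; (c) the conditional densities of $f(t)$ given $\nabla f(t)$ and $g(t)$ exist, are bounded above and are continuous at $u$, uniformly in $t\in T$; (d) the conditional densities of $\det\nabla f(t)$ at $s$ given $f(t)=y$ are continuous for $s$ and $y$ in neighborhoods of $0$ and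 $u$ respectively, uniformly in $t\in T$; (e) the conditional densities of $g(t)$ at $s$ given $f(t)=y$ are continuous for all $s$ and for $y$ in a neighborhood of $u$, uniformly in $t\in T$; (f) $\sup_{t\in T}\max_{i,j}E|X_{ij}(t)|^d<\infty$; (g) the modulus of continuity $\omega(\eta)$ on $T$ of each component of $f,\nabla f,g$ satisfies $P(\omega(\eta)>\varepsilon)=o(\eta^d)$ as $\eta\downarrow0$ for every $\varepsilon>0$. **Expected number density.** $\mathrm{ind}(\cdot)$ is the number of negative eigenvalues of a symmetric matrix. $CP(m)=\{x\in\mathbb{R}^d:\nabla X(x)=0,\ \mathrm{ind}(\nabla^2X(x))=m\}$. The density $f_{m,d}$ (continuous version) is defined by $\int_\nu^\infty f_{m,d}(v)\,dv=\frac1{|V|}E\bigl[\#\{x\in CP(m)\cap V:\ X(x)>\nu\}\bigr]$ for all $\nu\in\mathbb{R}$, where $V\subset\mathbb{R}^d$ is a domain with volume $|V|\in(0,\infty)$; it does not depend on $V$. *)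

theory Defs
  imports "HOL-Probability.Probability" "HOL-Library.Landau_Symbols"
begin

subsection \<open>Calculus and linear algebra\<close>

definition erfc :: "real \<Rightarrow> real" where
  "erfc x = 2 / sqrt pi * (LINT t:{x..}|lborel. exp (- t\<^sup>2))"

definition grad :: "(real^'n \<Rightarrow> real) \<Rightarrow> real^'n \<Rightarrow> real^'n" where
  "grad u x = (\<chi> i. frechet_derivative u (at x) (axis i 1))"

definition hessian :: "(real^'n \<Rightarrow> real) \<Rightarrow> real^'n \<Rightarrow> real^'n^'n" where
  "hessian u x = jacobian (grad u) (at x)"

definition twice_cont_diff :: "(real^'n \<Rightarrow> real) \<Rightarrow> bool" where
  "twice_cont_diff u \<longleftrightarrow>
     (\<forall>x. u differentiable at x) \<and> (\<forall>x. grad u differentiable at x) \<and>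
     continuous_on UNIV (hessian u)"

text \<open>Negative eigenvalues are counted with multiplicity, i.e. with the dimension of the
  eigenspace; this is only used for symmetric matrices.\<close>

definition neg_index :: "real^'n^'n \<Rightarrow> nat" where
  "neg_index A =
     (\<Sum>l | l < 0 \<and> (\<exists>v. v \<noteq> 0 \<and> A *v v = l *\<^sub>R v). dim {v. A *v v = l *\<^sub>R v})"

text \<open>Hausdorff measure up to the usual normalising constant. For \<open>k = 0\<close> every nonempty
  covering set contributes 1, so this is the counting measure.\<close>

definition hausdorff_pre :: "real \<Rightarrow> nat \<Rightarrow> 'a::metric_space set \<Rightarrow> ennreal" where
  "hausdorff_pre \<delta> k A =
     (INF U \<in> {U :: nat \<Rightarrow> 'a set. A \<subseteq> (\<Union>i. U i) \<and> (\<forall>i. bounded (U i) \<and> diameter (U i) \<le> \<delta>)}.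
        \<Sum>i. if U i = {} then 0 else ennreal (diameter (U i) ^ k))"

definition hausdorff_measure :: "nat \<Rightarrow> 'a::metric_space set \<Rightarrow> ennreal" where
  "hausdorff_measure k A = (SUP \<delta>\<in>{0<..}. hausdorff_pre \<delta> k A)"

definition modulus_cont :: "('a::metric_space \<Rightarrow> real) \<Rightarrow> 'a set \<Rightarrow> real \<Rightarrow> ennreal" where
  "modulus_cont h T \<eta> = (SUP s\<in>T. SUP t\<in>{t\<in>T. dist s t \<le> \<eta>}. ennreal \<bar>h s - h t\<bar>)"

text \<open>Continuity at the point \<open>a\<close>, uniformly in the parameter \<open>t \<in> T\<close>.\<close>

definition unif_isCont :: "'t set \<Rightarrow> ('t \<Rightarrow> 'a::metric_space \<Rightarrow> real) \<Rightarrow> 'a \<Rightarrow> bool" where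
  "unif_isCont T h a \<longleftrightarrow>
     (\<forall>\<epsilon>>0. \<exists>\<delta>>0. \<forall>t\<in>T. \<forall>x. dist x a < \<delta> \<longrightarrow> \<bar>h t x - h t a\<bar> < \<epsilon>)"


subsection \<open>Gaussian variables and conditional densities\<close>

text \<open>One-dimensional normal law, degenerate (constant) case included.\<close>

definition gaussian_rv :: "'w measure \<Rightarrow> ('w \<Rightarrow> real) \<Rightarrow> bool" where
  "gaussian_rv M Y \<longleftrightarrow> Y \<in> borel_measurable M \<and>
     (\<exists>\<mu> s. 0 \<le> s \<and>
        distr M borel Y = (if s = 0 then return borel \<mu> else density lborel (normal_density \<mu> s)))"

definition gaussian_field :: "'w measure \<Rightarrow> ('a \<Rightarrow> 'w \<Rightarrow> real) \<Rightarrow> bool" where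
  "gaussian_field M X \<longleftrightarrow>
     (\<forall>S a. finite S \<longrightarrow> gaussian_rv M (\<lambda>\<omega>. \<Sum>x\<in>S. a x * X x \<omega>))"

text \<open>\<open>q z\<close> is a version of the conditional density (with respect to Lebesgue measure)
  of \<open>Y\<close> given \<open>Z = z\<close>.\<close>

definition is_cond_density ::
  "'w measure \<Rightarrow> ('w \<Rightarrow> 'a::euclidean_space) \<Rightarrow> ('w \<Rightarrow> 'b::topological_space) \<Rightarrow> ('b \<Rightarrow> 'a \<Rightarrow> real) \<Rightarrow> bool"
  where
  "is_cond_density M Y Z q \<longleftrightarrow>
     Y \<in> borel_measurable M \<and> Z \<in> borel_measurable M \<and>
     (\<lambda>(z, y). q z y) \<in> borel_measurable (borel \<Otimes>\<^sub>M borel) \<and> (\<forall>z y. 0 \<le> q z y) \<and>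
     (\<forall>A\<in>sets borel. \<forall>B\<in>sets borel.
        emeasure M {\<omega>\<in>space M. Y \<omega> \<in> A \<and> Z \<omega> \<in> B} =
        (\<integral>\<^sup>+\<omega>. indicator B (Z \<omega>) * (\<integral>\<^sup>+y. ennreal (q (Z \<omega>) y) * indicator A y \<partial>lborel) \<partial>M))"


subsection \<open>The random field\<close>

abbreviation gradf :: "(real^'n \<Rightarrow> 'w \<Rightarrow> real) \<Rightarrow> real^'n \<Rightarrow> 'w \<Rightarrow> real^'n" where
  "gradf X x \<omega> \<equiv> grad (\<lambda>y. X y \<omega>) x"

abbreviation hessf :: "(real^'n \<Rightarrow> 'w \<Rightarrow> real) \<Rightarrow> real^'n \<Rightarrow> 'w \<Rightarrow> real^'n^'n" where
  "hessf X x \<omega> \<equiv> hessian (\<lambda>y. X y \<omega>) x"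

text \<open>\<open>C'\<close> and \<open>C''\<close> are the first two derivatives of \<open>C\<close> on \<open>[0,\<infinity>)\<close> (one-sided at 0).
  Joint normality is expressed through linear
  combinations.\<close>

locale isotropic_gaussian_field = prob_space M
  for M :: "'w measure" +
  fixes X :: "real^'n \<Rightarrow> 'w \<Rightarrow> real"
    and C C' C'' :: "real \<Rightarrow> real"
  assumes C2_paths: "\<And>\<omega>. \<omega> \<in> space M \<Longrightarrow> twice_cont_diff (\<lambda>x. X x \<omega>)"
    and gaussian: "gaussian_field M X"
    and mean: "\<And>x. expectation (X x) = 0"
    and covariance: "\<And>x y. expectation (\<lambda>\<omega>. X x \<omega> * X y \<omega>) = C ((norm (x - y))\<^sup>2 / 2)"
    and C_0: "C 0 = 1"
    and C_deriv: "\<And>r. 0 \<le> r \<Longrightarrow> (C has_real_derivative C' r) (at r within {0..})"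
    and C_deriv2: "\<And>r. 0 \<le> r \<Longrightarrow> (C' has_real_derivative C'' r) (at r within {0..})"
    and C''_cont: "continuous_on {0..} C''"
    and C'_0: "C' 0 < 0"
    and jet_gaussian:
      "\<And>x a b c. gaussian_rv M (\<lambda>\<omega>. a * X x \<omega> + (\<Sum>i\<in>UNIV. b i * gradf X x \<omega> $ i)
         + (\<Sum>i\<in>UNIV. \<Sum>j\<in>UNIV. c i j * hessf X x \<omega> $ i $ j))"
    and jet_mean:
      "\<And>x i. expectation (\<lambda>\<omega>. gradf X x \<omega> $ i) = 0"
      "\<And>x i j. expectation (\<lambda>\<omega>. hessf X x \<omega> $ i $ j) = 0"
    and jet_covariance:
      "\<And>x. expectation (\<lambda>\<omega>. (X x \<omega>)\<^sup>2) = 1"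
      "\<And>x i. expectation (\<lambda>\<omega>. X x \<omega> * gradf X x \<omega> $ i) = 0"
      "\<And>x k l. expectation (\<lambda>\<omega>. X x \<omega> * hessf X x \<omega> $ k $ l) = C' 0 * of_bool (k = l)"
      "\<And>x i k. expectation (\<lambda>\<omega>. gradf X x \<omega> $ i * gradf X x \<omega> $ k) = - C' 0 * of_bool (i = k)"
      "\<And>x i k l. expectation (\<lambda>\<omega>. gradf X x \<omega> $ i * hessf X x \<omega> $ k $ l) = 0"
      "\<And>x i j k l. expectation (\<lambda>\<omega>. hessf X x \<omega> $ i $ j * hessf X x \<omega> $ k $ l) =
         C'' 0 * (of_bool (i = k \<and> j = l) + of_bool (i = j \<and> k = l) + of_bool (i = l \<and> j = k))"


subsection \<open>Regularity conditions for the Kac--Rice formula\<close>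

text \<open>Index pairs \<open>i \<le> j\<close>: the law of the full (symmetric) Hessian has no density on
  the space of all matrices, hence only the upper triangle enters the vector \<open>g\<close>.\<close>

typedef (overloaded) ('n::linorder) upper = "{p :: 'n \<times> 'n. fst p \<le> snd p}"
  by (rule exI[of _ "(undefined, undefined)"]) simp

instance upper :: ("{finite, linorder}") finite
proof
  have "inj (Rep_upper :: 'a upper \<Rightarrow> _)"
    by (simp add: Rep_upper_inject inj_on_def)
  then show "finite (UNIV :: 'a upper set)"
    by (rule finite_imageD[rotated]) (rule finite)
qed

definition gvec ::
  "(real^'n::{finite,linorder} \<Rightarrow> 'w \<Rightarrow> real) \<Rightarrow> real^'n::{finite,linorder} \<Rightarrow> 'w \<Rightarrow> real \<times> (real^('n::{finite,linorder} upper))" where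
  "gvec X x \<omega> = (X x \<omega>, \<chi> p. hessf X x \<omega> $ fst (Rep_upper p) $ snd (Rep_upper p))"

definition jet_components :: "(real^'n \<Rightarrow> 'w \<Rightarrow> real) \<Rightarrow> (real^'n \<Rightarrow> 'w \<Rightarrow> real) set" where
  "jet_components X =
     {X} \<union> range (\<lambda>i x \<omega>. gradf X x \<omega> $ i) \<union> range (\<lambda>(i, j) x \<omega>. hessf X x \<omega> $ i $ j)"

text \<open>The conjuncts are, in this order, the conditions (a)--(g) of Adler and Taylor,
  Random Fields and Geometry, Theorem 11.2.1, for \<open>f = \<nabla>X\<close>, \<open>g\<close> as above and \<open>u = 0\<close>.\<close>

definition kac_rice_on ::
  "'w measure \<Rightarrow> (real^'n::{finite,linorder} \<Rightarrow> 'w \<Rightarrow> real) \<Rightarrow> (real^'n::{finite,linorder}) set \<Rightarrow> bool" where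
  "kac_rice_on M X T \<longleftrightarrow>
    (\<forall>h\<in>jet_components X.
       (AE \<omega> in M. continuous_on T (\<lambda>t. h t \<omega>)) \<and>
       (\<forall>t\<in>T. h t \<in> borel_measurable M \<and> integrable M (\<lambda>\<omega>. (h t \<omega>)\<^sup>2))) \<and>
    (\<forall>t\<in>T. \<exists>p. (\<forall>y. 0 \<le> p y) \<and> distributed M lborel (gradf X t) (\<lambda>y. ennreal (p y)) \<and> isCont p 0) \<and>
    (\<exists>q. (\<forall>t\<in>T. is_cond_density M (gradf X t) (\<lambda>\<omega>. (hessf X t \<omega>, gvec X t \<omega>)) (q t)) \<and>
       (\<exists>B. \<forall>t\<in>T. \<forall>w y. q t w y \<le> B) \<and>
       (\<forall>w. unif_isCont T (\<lambda>t. q t w) 0)) \<and>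
    (\<exists>q. (\<forall>t\<in>T. is_cond_density M (\<lambda>\<omega>. det (hessf X t \<omega>)) (gradf X t) (q t)) \<and>
       (\<exists>\<epsilon>>0. \<forall>s\<in>ball 0 \<epsilon>. \<forall>y\<in>ball 0 \<epsilon>. unif_isCont T (\<lambda>t (s, y). q t y s) (s, y))) \<and>
    (\<exists>q. (\<forall>t\<in>T. is_cond_density M (gvec X t) (gradf X t) (q t)) \<and>
       (\<exists>\<epsilon>>0. \<forall>s. \<forall>y\<in>ball 0 \<epsilon>. unif_isCont T (\<lambda>t (s, y). q t y s) (s, y))) \<and>
    (SUP t\<in>T. MAX (i, j)\<in>UNIV. \<integral>\<^sup>+\<omega>. ennreal (\<bar>hessf X t \<omega> $ i $ j\<bar> ^ CARD('n)) \<partial>M) < \<infinity> \<and>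
    (\<forall>h\<in>jet_components X. \<forall>\<epsilon>>0.
       (\<lambda>\<eta>. measure M {\<omega>\<in>space M. modulus_cont (\<lambda>t. h t \<omega>) T \<eta> > ennreal \<epsilon>})
         \<in> o[at_right 0](\<lambda>\<eta>. \<eta> ^ CARD('n)))"

definition kac_rice_regular ::
  "'w measure \<Rightarrow> (real^'n::{finite,linorder} \<Rightarrow> 'w \<Rightarrow> real) \<Rightarrow> bool" where
  "kac_rice_regular M X \<longleftrightarrow>
     (\<forall>T. compact T \<and> hausdorff_measure (CARD('n) - 1) (frontier T) < \<infinity> \<longrightarrow> kac_rice_on M X T)"


subsection \<open>Expected number densities of critical points\<close>

definition CP :: "(real^'n \<Rightarrow> 'w \<Rightarrow> real) \<Rightarrow> nat \<Rightarrow> 'w \<Rightarrow> (real^'n) set" where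
  "CP X m \<omega> = {x. gradf X x \<omega> = 0 \<and> neg_index (hessf X x \<omega>) = m}"

definition expected_number ::
  "'w measure \<Rightarrow> (real^'n \<Rightarrow> 'w \<Rightarrow> real) \<Rightarrow> nat \<Rightarrow> (real^'n) set \<Rightarrow> real \<Rightarrow> ennreal" where
  "expected_number M X m V \<nu> =
     (\<integral>\<^sup>+\<omega>. emeasure (count_space UNIV) {x \<in> CP X m \<omega> \<inter> V. X x \<omega> > \<nu>} \<partial>M)"

definition is_number_density ::
  "'w measure \<Rightarrow> (real^'n \<Rightarrow> 'w \<Rightarrow> real) \<Rightarrow> nat \<Rightarrow> (real \<Rightarrow> real) \<Rightarrow> bool" where
  "is_number_density M X m f \<longleftrightarrow> continuous_on UNIV f \<and>
     (\<forall>V. open V \<and> connected V \<and> 0 < emeasure lborel V \<and> emeasure lborel V < \<infinity> \<longrightarrow>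
       (\<forall>\<nu>. expected_number M X m V \<nu> < \<infinity> \<and> set_integrable lborel {\<nu><..} f \<and>
            (LINT v:{\<nu><..}|lborel. f v) = enn2real (expected_number M X m V \<nu>) / measure lborel V))"

definition number_density ::
  "'w measure \<Rightarrow> (real^'n \<Rightarrow> 'w \<Rightarrow> real) \<Rightarrow> nat \<Rightarrow> real \<Rightarrow> real" where
  "number_density M X m = (THE f. is_number_density M X m f)"

definition gen_fun :: "'w measure \<Rightarrow> (real^'n \<Rightarrow> 'w \<Rightarrow> real) \<Rightarrow> real \<Rightarrow> real \<Rightarrow> real" where
  "gen_fun M X \<nu> z = (\<Sum>m=0..CARD('n). number_density M X m \<nu> * z ^ m)"


subsection \<open>Coefficients in dimension two\<close>

definition A0 :: "real \<Rightarrow> real \<Rightarrow> real" where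
  "A0 \<sigma> \<nu> =
     - (sqrt (1 + 2*\<sigma>) * \<nu> * exp (- ((1 - 2*\<sigma>) * \<nu>\<^sup>2) / (2 * (1 + 2*\<sigma>)))) / (sqrt (2*pi) * sqrt (1 - 2*\<sigma>))
     + exp (- ((1 - 2*\<sigma>) * \<nu>\<^sup>2) / (2 * (2 + 2*\<sigma>)))
         * erfc (sqrt (1 - 2*\<sigma>) * \<nu> / (sqrt 2 * sqrt (1 + 2*\<sigma>) * sqrt (2 + 2*\<sigma>)))
         / ((1 - 2*\<sigma>) * sqrt (2 + 2*\<sigma>))
     + 1/2 * (\<nu>\<^sup>2 - 1) * erfc (sqrt (1 - 2*\<sigma>) * \<nu> / (sqrt 2 * sqrt (1 + 2*\<sigma>)))"

definition A1 :: "real \<Rightarrow> real \<Rightarrow> real" where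
  "A1 \<sigma> \<nu> = 2 * exp (- ((1 - 2*\<sigma>) * \<nu>\<^sup>2) / (2 * (2 + 2*\<sigma>))) / ((1 - 2*\<sigma>) * sqrt (2 + 2*\<sigma>))"

definition A2 :: "real \<Rightarrow> real \<Rightarrow> real" where
  "A2 \<sigma> \<nu> =
     sqrt (1 + 2*\<sigma>) * \<nu> * exp (- ((1 - 2*\<sigma>) * \<nu>\<^sup>2) / (2 * (1 + 2*\<sigma>))) / (sqrt (2*pi) * sqrt (1 - 2*\<sigma>))
     + exp (- ((1 - 2*\<sigma>) * \<nu>\<^sup>2) / (2 * (2 + 2*\<sigma>)))
         * erfc (- (sqrt (1 - 2*\<sigma>) * \<nu>) / (sqrt 2 * sqrt (1 + 2*\<sigma>) * sqrt (2 + 2*\<sigma>)))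
         / ((1 - 2*\<sigma>) * sqrt (2 + 2*\<sigma>))
     + 1/2 * (\<nu>\<^sup>2 - 1) * erfc (- (sqrt (1 - 2*\<sigma>) * \<nu>) / (sqrt 2 * sqrt (1 + 2*\<sigma>)))"

end

theory Submission
  imports Defs "HOL-Probability.Probability"
begin

text \<open>
  Critical points are the zeros of the random vector field \<open>\<nabla>X\<close>. At a fixed point \<open>t\<close> the
  gradient is independent of the pair \<open>(X t, H t)\<close> of field and Hessian, with a Gaussian density whose
  value at 0 is \<open>q\<close>. The Kac--Rice formula (theorem \<open>kac_rice\<close>) says that the mean number of critical
  points in \<open>V\<close> for which \<open>(X t, H t)\<close> satisfies an open condition is the integral over \<open>t \<in> V\<close> of
  \<open>q\<close> times the mean of \<open>\<bar>det H\<bar>\<close> on this condition. The law of \<open>(X t, H t)\<close> is the same at all points,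
  hence the number density is \<open>q \<phi>(v) J(v)\<close>, where \<open>J(v)\<close> is the conditional mean of \<open>\<bar>det H\<bar>\<close> on matrices
  of the given index, given \<open>X = v\<close>. A continuous density is determined by its tail integrals.

  Kac--Rice is proved without smoothing the zero count. Close to a point \<open>s\<close> the field is written as
  \<open>R t + (\<Sum>i. a i t * Y i)\<close>, where the \<open>Y i\<close> are the differences \<open>X (s + \<delta> e_i) - X (s - \<delta> e_i)\<close> and
  \<open>R\<close>, the residual of the regression on them, is independent of \<open>Y\<close>. Given a path of \<open>R\<close>, the
  equation \<open>\<nabla>X t = 0\<close> is a linear system for \<open>Y\<close> with an invertible matrix, that is, it has
  the form \<open>Y = G t\<close>. Averaging the number of solutions \<open>t\<close> over \<open>Y\<close> is exactly what the area
  formula for \<open>G\<close> does (\<open>expected_count_local\<close>), and Sard's theorem for \<open>G\<close> shows that degenerate critical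
  points almost surely do not occur. This leaves, for each single \<open>t\<close>, an identity between two
  densities: the mean of the density of \<open>Y\<close> at \<open>G t\<close> with Jacobian weights, and \<open>q\<close> times a mean over the jet. It holds
  with the level 0 of the gradient replaced by almost every level \<open>u\<close>, since both sides then describe the same
  measure, and at 0 by continuity in \<open>u\<close> (\<open>slice_identity\<close>).

  It remains to compute \<open>J\<close>. Put \<open>\<tau> = C''(0)\<close>, so that \<open>\<gamma>\<^sup>2 = \<tau> (1 - 2\<sigma>)\<close>, and let \<open>L\<close> be the trace of \<open>H\<close> divided
  by the dimension. Then \<open>L + \<gamma> X\<close> is independent of \<open>X\<close>, so given \<open>X = v\<close> the variable \<open>L\<close> is normal with
  mean \<open>-\<gamma> v\<close> and variance \<open>\<tau> (2 + 2\<sigma>)\<close> in dimension one and \<open>\<tau> (1 + 2\<sigma>)\<close> in dimension two. In dimension one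
  \<open>J\<close> is the mean of \<open>\<bar>L\<bar>\<close> over a half line. In dimension two
  \<open>det H = L\<^sup>2 - r\<^sup>2\<close> with \<open>r\<^sup>2 = ((H_11 - H_22) / 2)\<^sup>2 + H_12\<^sup>2\<close>; here \<open>r\<close> is the modulus of a planar Gaussian
  vector independent of \<open>(X, L)\<close>, the index is decided by the signs of \<open>det H\<close> and \<open>L\<close>, and the integral over
  \<open>r\<close> is elementary. The remaining integrals over \<open>L\<close> are Gaussian and produce \<open>erfc\<close>.
\<close>

section \<open>Area formula and Sard's theorem over an arbitrary finite index type\<close>

text \<open>Change of variables is proved coordinate by coordinate, so \<open>has_measure_differentiable_image\<close> and
  \<open>baby_Sard\<close> speak of vectors with a well-ordered index type. Lebesgue measure, determinants and derivatives do
  not see the order: the index type is copied, the copy is ordered by an enumeration, and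
  everything is transported along the reindexing \<open>to_wo\<close>.\<close>

typedef ('a) wo = "UNIV :: 'a set" ..

instance wo :: (finite) finite
  by standard (metis finite finite_imageI type_definition.Abs_image type_definition_wo)

definition wo_rank :: "'a::finite wo \<Rightarrow> nat" where
  "wo_rank x = to_nat_on UNIV (Rep_wo x)"

lemma wo_rank_eq_iff: "wo_rank x = wo_rank y \<longleftrightarrow> x = y"
  unfolding wo_rank_def by (metis Rep_wo_inject UNIV_I countable_finite finite to_nat_on_inj)

instantiation wo :: (finite) linorder
begin
definition less_eq_wo :: "'a wo \<Rightarrow> 'a wo \<Rightarrow> bool" where
  "less_eq_wo x y \<longleftrightarrow> wo_rank x \<le> wo_rank y"
definition less_wo :: "'a wo \<Rightarrow> 'a wo \<Rightarrow> bool" where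
  "less_wo x y \<longleftrightarrow> wo_rank x < wo_rank y"
instance
proof
  fix x y z :: "'a wo"
  show "x < y \<longleftrightarrow> x \<le> y \<and> \<not> y \<le> x"
    unfolding less_eq_wo_def less_wo_def by linarith
  show "x \<le> x" unfolding less_eq_wo_def by simp
  show "x \<le> z" if "x \<le> y" "y \<le> z" using that unfolding less_eq_wo_def by linarith
  show "x = y" if "x \<le> y" "y \<le> x"
    using that unfolding less_eq_wo_def wo_rank_eq_iff[symmetric] by linarith
  show "x \<le> y \<or> y \<le> x" unfolding less_eq_wo_def by linarith
qed
end

instance wo :: (finite) wellorder
proof
  fix P :: "'a wo \<Rightarrow> bool" and a
  assume *: "\<And>x. (\<And>y. y < x \<Longrightarrow> P y) \<Longrightarrow> P x"
  show "P a"
  proof (induction a rule: measure_induct_rule[where f="wo_rank"])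
    case (less x)
    then show ?case by (rule *) (simp add: less_wo_def)
  qed
qed

definition to_wo :: "'b^'n \<Rightarrow> 'b^'n wo" where "to_wo x = (\<chi> i. x $ Rep_wo i)"
definition of_wo :: "'b^'n wo \<Rightarrow> 'b^'n" where "of_wo x = (\<chi> i. x $ Abs_wo i)"

lemma of_to_wo [simp]: "of_wo (to_wo x) = x" and to_of_wo [simp]: "to_wo (of_wo y) = y"
  by (simp_all add: to_wo_def of_wo_def vec_eq_iff Abs_wo_inverse Rep_wo_inverse)

lemma bij_Rep_wo: "bij Rep_wo"
  by (metis Abs_wo_inverse Rep_wo_inverse UNIV_I bijI')

lemma bounded_linear_to_wo: "bounded_linear (to_wo :: real^'n \<Rightarrow> _)"
  by (intro linear_conv_bounded_linear[THEN iffD1] linearI) (simp_all add: to_wo_def vec_eq_iff)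

lemma bounded_linear_of_wo: "bounded_linear (of_wo :: _ \<Rightarrow> real^'n)"
  by (intro linear_conv_bounded_linear[THEN iffD1] linearI) (simp_all add: of_wo_def vec_eq_iff)

text \<open>Conjugation with \<open>Rep_wo\<close> is a bijection between the permutations of the two index types. It
  preserves signs because it maps transpositions to transpositions.\<close>

lemma det_reindex_wo: "det (\<chi> i j. A $ Rep_wo i $ Rep_wo j) = det (A :: real^'n^'n)"
proof -
  define c :: "('n wo \<Rightarrow> 'n wo) \<Rightarrow> 'n \<Rightarrow> 'n" where "c p = Rep_wo \<circ> p \<circ> Abs_wo" for p
  have AR: "Abs_wo \<circ> Rep_wo = id" "Rep_wo \<circ> Abs_wo = id"
    by (auto simp: Rep_wo_inverse Abs_wo_inverse)
  have c_comp: "c (p \<circ> q) = c p \<circ> c q" for p q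
    by (auto simp: c_def fun_eq_iff Rep_wo_inverse)
  have c_transpose: "c (Transposition.transpose a b) = Transposition.transpose (Rep_wo a) (Rep_wo b)" for a b
    by (auto simp: c_def fun_eq_iff Transposition.transpose_def Rep_wo_inject Abs_wo_inverse Rep_wo_inverse)
  have c_id: "c (\<lambda>x. x) = (\<lambda>x. x)" by (auto simp: c_def Abs_wo_inverse)
  have bijc: "bij (c p)" if "bij p" for p
    unfolding c_def by (intro bij_comp that bij_Rep_wo o_bij[OF AR(2) AR(1)])
  have sgn: "sign (c p) = sign p" if "p permutes UNIV" for p
    using that finite[of UNIV]
  proof (induction rule: permutes_induct)
    case id show ?case by (simp add: c_id id_def)
  next
    case (swap a b p)
    have "permutation (c p)" "permutation p"
      using swap bijc[of p] by (auto simp: permutation permutes_imp_bij)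
    then show ?case
      using swap unfolding c_comp c_transpose
      by (subst (1 2) sign_compose) (simp_all add: permutation_swap_id sign_swap_id Rep_wo_inject)
  qed
  have bb: "bij_betw c {p. p permutes UNIV} {p. p permutes UNIV}"
  proof (rule bij_betwI[where g="\<lambda>q. Abs_wo \<circ> q \<circ> Rep_wo"])
    show "c \<in> {p. p permutes UNIV} \<rightarrow> {p. p permutes UNIV}"
    proof (rule funcsetI, unfold mem_Collect_eq)
      fix p :: "'n wo \<Rightarrow> 'n wo" assume "p permutes UNIV"
      then have "bij (c p)" by (intro bijc) (rule permutes_bij)
      then show "c p permutes UNIV" by (rule bij_imp_permutes) simp
    qed
    show "(\<lambda>q. Abs_wo \<circ> q \<circ> Rep_wo) \<in> {p. p permutes UNIV} \<rightarrow> {p. p permutes (UNIV::'n wo set)}"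
    proof (rule funcsetI, unfold mem_Collect_eq)
      fix q :: "'n \<Rightarrow> 'n" assume "q permutes UNIV"
      then have "bij q" by (rule permutes_bij)
      then have "bij (Abs_wo \<circ> q \<circ> Rep_wo)"
        by (intro bij_comp bij_Rep_wo o_bij[OF AR(2) AR(1)])
      then show "(Abs_wo \<circ> q \<circ> Rep_wo) permutes UNIV" by (rule bij_imp_permutes) simp
    qed
  qed (auto simp: c_def fun_eq_iff Rep_wo_inverse Abs_wo_inverse)
  have prod: "(\<Prod>i\<in>UNIV. A $ Rep_wo i $ Rep_wo (p i)) = (\<Prod>i\<in>UNIV. A $ i $ c p i)" for p
    using prod.reindex_bij_betw[OF bij_Rep_wo, of "\<lambda>i. A $ i $ c p i"]
    by (simp add: c_def Rep_wo_inverse)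
  show ?thesis
    unfolding det_def
    by (subst sum.reindex_bij_betw[OF bb, symmetric]) (auto simp: prod sgn intro!: sum.cong)
qed

text \<open>A box is mapped to a box with the same side lengths in another order.\<close>

lemma distr_to_wo: "distr lborel lborel (to_wo :: real^'n \<Rightarrow> _) = lborel"
proof (rule lborel_eqI[symmetric])
  have [measurable]: "(to_wo :: real^'n \<Rightarrow> _) \<in> borel_measurable borel"
    by (intro borel_measurable_continuous_onI linear_continuous_on bounded_linear_to_wo)
  fix l u :: "real^'n wo"
  assume le: "\<And>b. b \<in> Basis \<Longrightarrow> l \<bullet> b \<le> u \<bullet> b"
  have le': "l $ i \<le> u $ i" for i
    using le[of "axis i 1"] by (simp add: inner_axis axis_in_Basis_iff)
  have vim: "to_wo -` box l u = box (of_wo l) (of_wo u)"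
    by (auto simp: mem_box_cart to_wo_def of_wo_def)
       (metis Rep_wo_inverse Abs_wo_inverse UNIV_I)+
  have B: "(\<Prod>b\<in>Basis. (y - x) \<bullet> b) = (\<Prod>i\<in>UNIV. y $ i - x $ i)" for x y :: "real^'m"
  proof -
    have "Basis = range (\<lambda>i. axis i (1::real) :: real^'m)" by (auto simp: Basis_vec_def)
    moreover have "inj (\<lambda>i. axis i (1::real) :: real^'m)" by (auto simp: inj_on_def axis_eq_axis)
    ultimately show ?thesis
      using prod.reindex[of "\<lambda>i. axis i (1::real) :: real^'m" UNIV "\<lambda>b. (y - x) \<bullet> b"]
      by (simp only: o_def) (simp add: inner_axis)
  qed
  have "(\<Prod>i\<in>UNIV. of_wo u $ i - of_wo l $ i) = (\<Prod>i\<in>UNIV. u $ i - l $ i)"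
    using prod.reindex_bij_betw[OF bij_Rep_wo, of "\<lambda>i. of_wo u $ i - of_wo l $ i"]
    by (simp add: of_wo_def Rep_wo_inverse)
  moreover have "\<forall>b\<in>Basis. of_wo l \<bullet> b \<le> of_wo u \<bullet> b"
    using le' by (auto simp: Basis_vec_def inner_axis of_wo_def)
  ultimately show "emeasure (distr lborel lborel to_wo) (box l u) = ennreal (\<Prod>b\<in>Basis. (u - l) \<bullet> b)"
    by (simp add: emeasure_distr vim emeasure_lborel_box B)
qed simp

text \<open>A Lebesgue measurable set differs from a Borel set by a subset of a Borel null set, which reduces
  the claim to \<open>distr_to_wo\<close>.\<close>

lemma lebesgue_of_wo:
  assumes "T \<in> sets lebesgue"
  shows "(of_wo ` T :: (real^'n) set) \<in> sets lebesgue"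
    and "emeasure lebesgue (of_wo ` T :: (real^'n) set) = emeasure lebesgue T"
proof -
  have m[measurable]: "(to_wo :: real^'n \<Rightarrow> _) \<in> lborel \<rightarrow>\<^sub>M lborel"
    using borel_measurable_continuous_onI[OF linear_continuous_on[OF bounded_linear_to_wo]] by simp
  have img: "of_wo ` A = to_wo -` A" for A :: "(real^'n wo) set"
    by (auto simp: image_iff) (metis of_to_wo)
  have b: "to_wo -` A \<in> sets lborel" "emeasure lborel (to_wo -` A :: (real^'n) set) = emeasure lborel A"
    if "A \<in> sets lborel" for A :: "(real^'n wo) set"
    using that measurable_sets[OF m, of A] emeasure_distr[OF m, of A] by (simp_all add: distr_to_wo)
  obtain S N N' where T: "T = S \<union> N" "N \<subseteq> N'" "N' \<in> null_sets lborel" "S \<in> sets lborel"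
    using assms by (rule sets_completionE)
  have "to_wo -` N' \<in> null_sets (lborel :: (real^'n) measure)"
    using b[of N'] T by (auto simp: null_sets_def)
  then have N: "to_wo -` N \<in> null_sets (lebesgue :: (real^'n) measure)"
    using T(2) by (meson null_sets_completion_subset null_sets_completionI vimage_mono)
  have N2: "N \<in> null_sets lebesgue"
    using T by (meson null_sets_completion_subset null_sets_completionI)
  have S: "to_wo -` S \<in> sets (lebesgue :: (real^'n) measure)" using b(1)[OF T(4)] by simp
  show "of_wo ` T \<in> sets (lebesgue :: (real^'n) measure)"
    using S N by (auto simp: img T(1))
  show "emeasure lebesgue (of_wo ` T :: (real^'n) set) = emeasure lebesgue T"
    using S N N2 b(2)[OF T(4)] b(1)[OF T(4)] T(4)
    by (simp add: img T(1) emeasure_Un_null_set)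
qed

lemma emeasure_differentiable_image_wo:
  fixes f :: "real^'n::{finite,wellorder} \<Rightarrow> real^'n::_"
  assumes S: "S \<in> sets borel" "bounded S"
    and der: "\<And>x. x \<in> S \<Longrightarrow> (f has_derivative f' x) (at x within S)"
    and inj: "inj_on f S"
    and J: "J \<in> borel_measurable borel" "\<And>x. x \<in> S \<Longrightarrow> J x = \<bar>det (matrix (f' x))\<bar>"
    and bd: "\<And>x. x \<in> S \<Longrightarrow> J x \<le> B"
  shows "f ` S \<in> sets lebesgue"
    and "emeasure lebesgue (f ` S) = (\<integral>\<^sup>+x. ennreal (J x) * indicator S x \<partial>lborel)"
proof -
  note [measurable] = S(1) J(1)
  have fin: "emeasure lborel S < \<infinity>" using emeasure_bounded_finite[OF S(2)] .
  have int: "set_integrable lborel S J"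
    unfolding set_integrable_def using fin bd J(2)
    by (intro integrableI_bounded_set_indicator[where B=B]) auto
  have "(J has_integral (LINT x:S|lborel. J x)) S"
    using set_borel_integral_eq_integral[OF int] by (simp add: has_integral_iff)
  then have h: "((\<lambda>x. \<bar>det (matrix (f' x))\<bar>) has_integral (LINT x:S|lborel. J x)) S"
    by (rule has_integral_eq[rotated]) (simp add: J(2))
  then have *: "f ` S \<in> lmeasurable \<and> measure lebesgue (f ` S) = (LINT x:S|lborel. J x)"
    using has_measure_differentiable_image[of S f f' "LINT x:S|lborel. J x"] der inj by auto
  then show "f ` S \<in> sets lebesgue" by auto
  have "emeasure lebesgue (f ` S) = ennreal (LINT x:S|lborel. J x)"
    using * by (simp add: emeasure_eq_measure2)
  also have "\<dots> = (\<integral>\<^sup>+x. ennreal (indicator S x *\<^sub>R J x) \<partial>lborel)"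
    unfolding set_lebesgue_integral_def
    by (rule nn_integral_eq_integral[symmetric])
       (use int in \<open>auto simp: set_integrable_def indicator_def J(2)\<close>)
  also have "\<dots> = (\<integral>\<^sup>+x. ennreal (J x) * indicator S x \<partial>lborel)"
    by (intro nn_integral_cong) (auto simp: indicator_def)
  finally show "emeasure lebesgue (f ` S) = \<dots>" .
qed

context
  fixes f :: "real^'n \<Rightarrow> real^'n" and f' S
  assumes der: "\<And>x. x \<in> S \<Longrightarrow> (f has_derivative f' x) (at x within S)"
begin

private lemma der_wo:
  assumes "y \<in> to_wo ` S"
  shows "((\<lambda>y. to_wo (f (of_wo y))) has_derivative (\<lambda>v. to_wo (f' (of_wo y) (of_wo v)))) (at y within to_wo ` S)"
proof -
  have S: "of_wo ` to_wo ` S = S" by (force simp: image_iff)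
  have y: "of_wo y \<in> S" using assms by auto
  have 1: "(of_wo has_derivative of_wo) (at y within to_wo ` S)"
    by (simp add: bounded_linear_imp_has_derivative bounded_linear_of_wo)
  have 2: "((\<lambda>y. f (of_wo y)) has_derivative (\<lambda>v. f' (of_wo y) (of_wo v))) (at y within to_wo ` S)"
    by (rule has_derivative_in_compose[OF 1]) (simp only: S der[OF y])
  show ?thesis
    by (rule bounded_linear.has_derivative[OF bounded_linear_to_wo 2])
qed

private lemma matrix_wo: "x \<in> S \<Longrightarrow> matrix (\<lambda>v. to_wo (f' x (of_wo v))) = (\<chi> i j. matrix (f' x) $ Rep_wo i $ Rep_wo j)"
proof -
  have "of_wo (axis j (1::real)) = axis (Rep_wo j) 1" for j :: "'n wo"
    unfolding vec_eq_iff by (auto simp: of_wo_def axis_def Rep_wo_inverse Abs_wo_inverse)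
  then show ?thesis by (simp add: matrix_def to_wo_def)
qed

private lemma image_wo: "f ` S = of_wo ` ((\<lambda>y. to_wo (f (of_wo y))) ` to_wo ` S)"
  by (simp add: image_image)

lemma emeasure_differentiable_image:
  assumes S: "S \<in> sets borel" "bounded S"
    and inj: "inj_on f S"
    and J: "J \<in> borel_measurable borel" "\<And>x. x \<in> S \<Longrightarrow> J x = \<bar>det (matrix (f' x))\<bar>"
    and bd: "\<And>x. x \<in> S \<Longrightarrow> J x \<le> B"
  shows "f ` S \<in> sets lebesgue"
    and "emeasure lebesgue (f ` S) = (\<integral>\<^sup>+x. ennreal (J x) * indicator S x \<partial>lborel)"
proof -
  note [measurable] = S(1) J(1)
  have m: "(to_wo :: real^'n \<Rightarrow> _) \<in> lborel \<rightarrow>\<^sub>M lborel"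
    using borel_measurable_continuous_onI[OF linear_continuous_on[OF bounded_linear_to_wo]] by simp
  have m': "(of_wo :: _ \<Rightarrow> real^'n) \<in> borel_measurable borel"
    using borel_measurable_continuous_onI[OF linear_continuous_on[OF bounded_linear_of_wo]] by simp
  have "to_wo ` S = of_wo -` S" by (auto simp: image_iff) (metis to_of_wo)
  then have S': "to_wo ` S \<in> sets borel" using measurable_sets[OF m' S(1)] by simp
  have J': "(\<lambda>y. J (of_wo y)) \<in> borel_measurable borel"
    using m' by measurable
  have inj': "inj_on (\<lambda>y. to_wo (f (of_wo y))) (to_wo ` S)"
    using inj by (auto simp: inj_on_def) (metis of_to_wo)
  have J2: "J (of_wo y) = \<bar>det (matrix (\<lambda>v. to_wo (f' (of_wo y) (of_wo v))))\<bar>" if "y \<in> to_wo ` S" for y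
    using that by (auto simp: J(2) matrix_wo det_reindex_wo)
  have bS: "bounded (to_wo ` S)"
    using bounded_linear_image[OF S(2) bounded_linear_to_wo] .
  have B: "J (of_wo y) \<le> B" if "y \<in> to_wo ` S" for y using that bd by auto
  note * = emeasure_differentiable_image_wo[OF S' bS der_wo inj' J' J2 B, simplified]
  show "f ` S \<in> sets lebesgue"
    unfolding image_wo by (intro lebesgue_of_wo *)
  have "emeasure lebesgue (f ` S) = (\<integral>\<^sup>+y. ennreal (J (of_wo y)) * indicator (to_wo ` S) y \<partial>lborel)"
    unfolding image_wo lebesgue_of_wo(2)[OF *(1)] by (rule *)
  also have "\<dots> = (\<integral>\<^sup>+y. ennreal (J (of_wo y)) * indicator (to_wo ` S) y \<partial>distr lborel lborel to_wo)"
    by (simp only: distr_to_wo)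
  also have "\<dots> = (\<integral>\<^sup>+x. ennreal (J (of_wo (to_wo x))) * indicator (to_wo ` S) (to_wo x) \<partial>lborel)"
    by (rule nn_integral_distr[OF m]) (use J' S' in measurable)
  also have "\<dots> = (\<integral>\<^sup>+x. ennreal (J x) * indicator S x \<partial>lborel)"
  proof (rule nn_integral_cong)
    fix x :: "real^'n"
    have "to_wo x \<in> to_wo ` S \<longleftrightarrow> x \<in> S" by (metis image_iff of_to_wo)
    then show "ennreal (J (of_wo (to_wo x))) * indicator (to_wo ` S) (to_wo x) = ennreal (J x) * indicator S x"
      by (simp add: indicator_def)
  qed
  finally show "emeasure lebesgue (f ` S) = \<dots>" .
qed

lemma Sard_same_dimension:
  assumes "\<And>x. x \<in> S \<Longrightarrow> det (matrix (f' x)) = 0"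
  shows "negligible (f ` S)"
proof -
  have "rank (matrix (\<lambda>v. to_wo (f' (of_wo y) (of_wo v)))) < CARD('n wo)" if "y \<in> to_wo ` S" for y
    using that assms by (subst det_eq_0_rank[symmetric]) (auto simp: matrix_wo det_reindex_wo)
  then have "negligible ((\<lambda>y. to_wo (f (of_wo y))) ` to_wo ` S)"
    by (intro baby_Sard[OF _ der_wo]) auto
  then show ?thesis
    using lebesgue_of_wo[of "(\<lambda>y. to_wo (f (of_wo y))) ` to_wo ` S"]
    unfolding image_wo negligible_iff_null_sets null_sets_def by auto
qed

end

lemma continuous_on_det [continuous_intros]:
  fixes A :: "'a::topological_space \<Rightarrow> real^'n^'n"
  assumes "continuous_on S A"
  shows "continuous_on S (\<lambda>x. det (A x))"
  unfolding det_def by (intro continuous_intros assms)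

text \<open>Both sides are integrals of \<open>\<phi>\<close> with respect to a measure on the target space. By the formula for
  the measure of a differentiable injective image, applied to the sets \<open>f -` B \<inter> S\<close>, the two measures
  agree on Borel sets \<open>B\<close>.\<close>

lemma area_formula_injective:
  fixes f :: "real^'n \<Rightarrow> real^'n" and \<phi> :: "real^'n \<Rightarrow> ennreal"
  assumes S: "S \<in> sets borel" "bounded S"
    and der: "\<And>x. x \<in> S \<Longrightarrow> (f has_derivative (\<lambda>v. D x *v v)) (at x within S)"
    and inj: "inj_on f S"
    and J: "J \<in> borel_measurable borel" "\<And>x. x \<in> S \<Longrightarrow> J x = \<bar>det (D x)\<bar>"
    and bd: "\<And>x. x \<in> S \<Longrightarrow> J x \<le> B"
    and \<phi>[measurable]: "\<phi> \<in> borel_measurable borel"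
  shows "f ` S \<in> sets lebesgue"
    and "(\<integral>\<^sup>+y. \<phi> y * indicator (f ` S) y \<partial>lebesgue) =
         (\<integral>\<^sup>+x. \<phi> (f x) * ennreal (J x) * indicator S x \<partial>lborel)"
proof -
  note [measurable] = S(1) J(1)
  have contf: "continuous_on S f"
    using der by (meson continuous_on_eq_continuous_within has_derivative_continuous)
  define g where "g x = indicator S x *\<^sub>R f x" for x
  have [measurable]: "g \<in> borel_measurable borel"
    unfolding g_def by (intro borel_measurable_continuous_on_indicator S contf)
  have g: "g x = f x" if "x \<in> S" for x using that by (simp add: g_def)
  have sub: "f ` S' \<in> sets lebesgue \<and> emeasure lebesgue (f ` S') = (\<integral>\<^sup>+x. ennreal (J x) * indicator S' x \<partial>lborel)"
    if "S' \<subseteq> S" and [measurable]: "S' \<in> sets borel" for S'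
  proof -
    have d: "(f has_derivative (\<lambda>v. D x *v v)) (at x within S')" if "x \<in> S'" for x
      using has_derivative_subset[OF der \<open>S' \<subseteq> S\<close>] that \<open>S' \<subseteq> S\<close> by blast
    have J': "J x = \<bar>det (matrix ((*v) (D x)))\<bar>" "J x \<le> B" if "x \<in> S'" for x
      using that \<open>S' \<subseteq> S\<close> J(2) bd by (auto simp: matrix_of_matrix_vector_mul)
    show ?thesis
      using emeasure_differentiable_image[of S' f "\<lambda>x. (*v) (D x)", OF d \<open>S' \<in> sets borel\<close>
        bounded_subset[OF S(2) \<open>S' \<subseteq> S\<close>] inj_on_subset[OF inj \<open>S' \<subseteq> S\<close>] J(1) J'] by blast
  qed
  show fS: "f ` S \<in> sets lebesgue" using sub[of S] S by auto
  define N1 where "N1 = distr (density lborel (\<lambda>x. ennreal (J x) * indicator S x)) borel g"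
  define N2 where "N2 = distr (density lebesgue (indicator (f ` S))) borel (\<lambda>y. y)"
  have id[measurable]: "(\<lambda>y. y) \<in> lebesgue \<rightarrow>\<^sub>M (borel :: (real^'n) measure)"
    by (rule measurable_completion) simp
  note [measurable] = fS
  have "N1 = N2"
  proof (rule measure_eqI)
    show "sets N1 = sets N2" by (simp add: N1_def N2_def)
    fix B assume "B \<in> sets N1"
    then have B[measurable]: "B \<in> sets borel" by (simp add: N1_def)
    have gB: "g -` B \<in> sets borel"
      using measurable_sets_borel[OF \<open>g \<in> borel_measurable borel\<close> B] .
    have [measurable]: "g -` B \<inter> S \<in> sets borel"
      by (metis B S(1) \<open>g \<in> borel_measurable borel\<close> inf_top.right_neutral measurable_sets sets.Int space_borel)
    have "emeasure N1 B = (\<integral>\<^sup>+x. ennreal (J x) * indicator (g -` B \<inter> S) x \<partial>lborel)"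
      unfolding N1_def
      by (subst emeasure_distr) (auto simp: emeasure_density gB intro!: nn_integral_cong split: split_indicator)
    also have "\<dots> = emeasure lebesgue (f ` (g -` B \<inter> S))"
      using sub[of "g -` B \<inter> S"] by simp
    also have "f ` (g -` B \<inter> S) = f ` S \<inter> B"
      using g by auto
    also have "emeasure lebesgue (f ` S \<inter> B) = emeasure N2 B"
    proof -
      have "emeasure N2 B = (\<integral>\<^sup>+y. indicator (f ` S) y * indicator ((\<lambda>y. y) -` B \<inter> space lebesgue) y \<partial>lebesgue)"
        unfolding N2_def using fS measurable_sets[OF id B]
        by (subst emeasure_distr) (auto simp: emeasure_density)
      also have "\<dots> = (\<integral>\<^sup>+y. indicator (f ` S \<inter> B) y \<partial>lebesgue)"
        by (intro nn_integral_cong) (auto split: split_indicator)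
      also have "\<dots> = emeasure lebesgue (f ` S \<inter> B)"
        using fS B by (intro nn_integral_indicator) auto
      finally show ?thesis ..
    qed
    finally show "emeasure N1 B = emeasure N2 B" .
  qed
  have "(\<integral>\<^sup>+y. \<phi> y * indicator (f ` S) y \<partial>lebesgue) = (\<integral>\<^sup>+y. \<phi> y \<partial>N2)"
    unfolding N2_def using fS
    by (subst nn_integral_distr) (auto simp: nn_integral_density mult.commute)
  also have "\<dots> = (\<integral>\<^sup>+x. \<phi> (g x) * (ennreal (J x) * indicator S x) \<partial>lborel)"
    unfolding \<open>N1 = N2\<close>[symmetric] N1_def
    by (subst nn_integral_distr) (auto simp: nn_integral_density mult.commute)
  also have "\<dots> = (\<integral>\<^sup>+x. \<phi> (f x) * ennreal (J x) * indicator S x \<partial>lborel)"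
    by (intro nn_integral_cong) (auto split: split_indicator simp: g)
  finally show "(\<integral>\<^sup>+y. \<phi> y * indicator (f ` S) y \<partial>lebesgue) = \<dots>" .
qed

text \<open>By the inverse function theorem \<open>W\<close> is a countable union of open sets on which \<open>G\<close> is injective and the
  Jacobian is bounded. Cutting \<open>V\<close> into disjoint pieces accordingly, the number of preimages of \<open>y\<close> becomes the number
  of pieces whose image contains \<open>y\<close>.\<close>

theorem area_formula:
  fixes G :: "real^'n \<Rightarrow> real^'n" and \<phi> :: "real^'n \<Rightarrow> ennreal"
  assumes W: "open W" and V: "V \<in> sets borel" "V \<subseteq> W"
    and der: "\<And>x. x \<in> W \<Longrightarrow> (G has_derivative (\<lambda>v. D x *v v)) (at x)"
    and cont: "continuous_on W D"
    and nz: "\<And>x. x \<in> W \<Longrightarrow> det (D x) \<noteq> 0"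
    and \<phi>[measurable]: "\<phi> \<in> borel_measurable borel"
  shows "(\<integral>\<^sup>+y. \<phi> y * emeasure (count_space UNIV) {t\<in>V. G t = y} \<partial>lborel) =
         (\<integral>\<^sup>+t. \<phi> (G t) * ennreal \<bar>det (D t)\<bar> * indicator V t \<partial>lborel)"
proof -
  note [measurable] = V(1)
  have [measurable]: "W \<in> sets borel" using W by simp
  define J where "J x = indicator W x *\<^sub>R \<bar>det (D x)\<bar>" for x
  have J[measurable]: "J \<in> borel_measurable borel"
    unfolding J_def by (intro borel_measurable_continuous_on_indicator continuous_intros cont) simp
  have contG: "continuous_on W G"
    using der W by (meson continuous_on_eq_continuous_at has_derivative_continuous)
  define g where "g x = indicator W x *\<^sub>R G x" for x
  have [measurable]: "g \<in> borel_measurable borel"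
    unfolding g_def by (intro borel_measurable_continuous_on_indicator contG) simp
  define good where "good U \<longleftrightarrow> open U \<and> bounded U \<and> inj_on G U \<and> U \<subseteq> W \<and> (\<exists>B. \<forall>x\<in>U. J x \<le> B)" for U
  have ex: "\<exists>U. good U \<and> x \<in> U" if x: "x \<in> W" for x
  proof -
    obtain C where C: "C ** D x = mat 1"
      using nz[OF x] by (metis invertible_det_nz invertible_def)
    have cx: "isCont D x" using cont W x by (simp add: continuous_on_eq_continuous_at)
    define k where "k = real CARD('n) * real CARD('n)"
    have k: "k > 0" by (simp add: k_def)
    have on: "\<exists>d>0. \<forall>y. dist x y < d \<longrightarrow> onorm (\<lambda>v. D y *v v - D x *v v) < e" if "e > 0" for e
    proof -
      obtain d where d: "d > 0" "\<And>y. dist y x < d \<Longrightarrow> dist (D y) (D x) < e / k"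
        using cx \<open>e > 0\<close> k unfolding continuous_at_eps_delta by (metis divide_pos_pos)
      have "onorm (\<lambda>v. D y *v v - D x *v v) < e" if "dist x y < d" for y
      proof -
        have "\<bar>(D y - D x) $ i $ j\<bar> \<le> norm (D y - D x)" for i j
          by (meson component_le_norm_cart Finite_Cartesian_Product.norm_nth_le order_trans)
        then have "onorm ((*v) (D y - D x)) \<le> k * norm (D y - D x)"
          unfolding k_def by (rule onorm_le_matrix_component)
        also have "\<dots> < e" using d(2)[of y] that k by (simp add: norm_minus_commute[of x] dist_norm field_simps)
        finally show ?thesis by (simp flip: matrix_vector_mult_diff_rdistrib)
      qed
      then show ?thesis using d(1) by blast
    qed
    obtain r where r: "r > 0" "ball x r \<subseteq> W" "inj_on G (ball x r)"
    proof (rule has_derivative_locally_injective[OF x W, of "(*v) C" "\<lambda>x v. D x *v v" G])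
      show "(*v) C \<circ> (*v) (D x) = id"
        using C by (simp add: fun_eq_iff matrix_vector_mul_assoc)
    qed (use der on in auto)
    have "isCont (\<lambda>y. \<bar>det (D y)\<bar>) x"
      using cont W x by (metis continuous_on_det continuous_on_eq_continuous_at continuous_on_rabs)
    then have "\<exists>d>0. \<forall>y. dist y x < d \<longrightarrow> dist \<bar>det (D y)\<bar> \<bar>det (D x)\<bar> < 1"
      unfolding continuous_at_eps_delta using zero_less_one by blast
    then obtain d where d: "d > 0" "\<And>y. dist y x < d \<Longrightarrow> dist \<bar>det (D y)\<bar> \<bar>det (D x)\<bar> < 1"
      by blast
    have "J y \<le> \<bar>det (D x)\<bar> + 1" if "y \<in> ball x (min r d)" for y
      using that d(2)[of y] by (auto simp: J_def dist_commute indicator_def dist_real_def)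
    then have "\<exists>B. \<forall>y\<in>ball x (min r d). J y \<le> B" by blast
    then have "good (ball x (min r d))"
      using r(2) inj_on_subset[OF r(3), of "ball x (min r d)"] unfolding good_def
      by (auto simp: subset_iff)
    then show ?thesis using r d by (intro exI[of _ "ball x (min r d)"]) auto
  qed
  have "{} \<in> {U. good U}" by (simp add: good_def)
  have "\<And>S. S \<in> {U. good U} \<Longrightarrow> open S" by (simp add: good_def)
  then obtain F where F: "F \<subseteq> {U. good U}" "countable F" "\<Union>F = \<Union>{U. good U}"
    by (rule Lindelof)
  define U where "U = from_nat_into (insert {} F)"
  have "range U = insert {} F" using F(2) by (simp add: U_def range_from_nat_into)
  then have Ug: "good (U n)" for n
    using F(1) \<open>{} \<in> {U. good U}\<close> by (metis insert_iff mem_Collect_eq rangeI subsetD)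
  have "\<Union>(range U) = \<Union>F" using \<open>range U = insert {} F\<close> by simp
  then have UW: "(\<Union>n. U n) = W" using F(3) ex by (auto simp: good_def)
  define P where "P n = disjointed U n \<inter> V" for n
  have PU: "P n \<subseteq> U n" "P n \<subseteq> V" for n using disjointed_subset[of U n] by (auto simp: P_def)
  have Pdisj: "disjoint_family P"
    using disjoint_family_disjointed[of U] by (auto simp: P_def disjoint_family_on_def)
  have "(\<Union>n. P n) = (\<Union>n. disjointed U n) \<inter> V" by (auto simp: P_def)
  then have PV: "(\<Union>n. P n) = V" using V(2) UW by (auto simp: UN_disjointed_eq)
  have Pm[measurable]: "P n \<in> sets borel" for n
  proof -
    have "range U \<subseteq> sets borel" using Ug by (auto simp: good_def)
    then have "disjointed U n \<in> sets borel" by (metis range_subsetD sets.range_disjointed_sets)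
    then show ?thesis using V by (auto simp: P_def)
  qed
  have injP: "inj_on G (P n)" for n using Ug[of n] PU(1)[of n] by (auto simp: good_def inj_on_subset)
  have piece: "G ` P n \<in> sets lebesgue \<and> (\<integral>\<^sup>+y. \<phi> y * indicator (G ` P n) y \<partial>lebesgue) =
      (\<integral>\<^sup>+x. \<phi> (G x) * ennreal (J x) * indicator (P n) x \<partial>lborel)" for n
  proof -
    obtain B where B: "\<And>x. x \<in> U n \<Longrightarrow> J x \<le> B" using Ug[of n] by (auto simp: good_def)
    have bnd: "bounded (P n)" using Ug[of n] PU(1)[of n] by (auto simp: good_def bounded_subset)
    have d: "(G has_derivative (\<lambda>v. D x *v v)) (at x within P n)" if "x \<in> P n" for x
      using der[of x] that PU(2)[of n] V(2) by (auto intro: has_derivative_at_withinI)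
    have j: "J x = \<bar>det (D x)\<bar>" "J x \<le> B" if "x \<in> P n" for x
      using that PU[of n] V(2) B[of x] by (auto simp: J_def)
    show ?thesis
      using area_formula_injective[OF Pm bnd d injP J j \<phi>] by blast
  qed
  have count: "emeasure (count_space UNIV) {t\<in>V. G t = y} = (\<Sum>n. indicator (G ` P n) y)" for y
  proof -
    have "{t\<in>V. G t = y} = (\<Union>n. {t\<in>P n. G t = y})" using PV by auto
    moreover have "disjoint_family (\<lambda>n. {t\<in>P n. G t = y})"
      using Pdisj by (auto simp: disjoint_family_on_def)
    ultimately have e1: "emeasure (count_space UNIV) {t\<in>V. G t = y} = (\<Sum>n. emeasure (count_space UNIV) {t\<in>P n. G t = y})"
      by (subst suminf_emeasure) auto
    have e2: "emeasure (count_space UNIV) {t\<in>P n. G t = y} = indicator (G ` P n) y" for n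
    proof (cases "y \<in> G ` P n")
      case True
      then obtain t where "t \<in> P n" "y = G t" by auto
      then have "{t\<in>P n. G t = y} = {t}" using injP[of n] by (auto simp: inj_on_def)
      then show ?thesis using True by simp
    next
      case False
      then have "{t\<in>P n. G t = y} = {}" by auto
      then show ?thesis using False by (metis emeasure_empty indicator_simps(2))
    qed
    show ?thesis unfolding e1 e2 ..
  qed
  have [measurable]: "\<phi> \<in> borel_measurable lebesgue"
    by (rule measurable_completion) simp
  note [measurable] = piece[THEN conjunct1]
  have ind: "(\<Sum>n. indicator (P n) x) = (indicator V x :: ennreal)" for x
    using suminf_indicator[OF Pdisj, of x] by (simp add: PV)
  have "(\<integral>\<^sup>+y. \<phi> y * emeasure (count_space UNIV) {t\<in>V. G t = y} \<partial>lborel) =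
        (\<integral>\<^sup>+y. (\<Sum>n. \<phi> y * indicator (G ` P n) y) \<partial>lebesgue)"
    by (simp add: nn_integral_completion count ennreal_suminf_cmult)
  also have "\<dots> = (\<Sum>n. \<integral>\<^sup>+y. \<phi> y * indicator (G ` P n) y \<partial>lebesgue)"
    by (rule nn_integral_suminf) measurable
  also have "\<dots> = (\<Sum>n. \<integral>\<^sup>+x. \<phi> (g x) * ennreal (J x) * indicator (P n) x \<partial>lborel)"
    using piece PU(2) V(2) by (auto simp: g_def subset_iff intro!: suminf_cong nn_integral_cong split: split_indicator)
  also have "\<dots> = (\<integral>\<^sup>+x. (\<Sum>n. \<phi> (g x) * ennreal (J x) * indicator (P n) x) \<partial>lborel)"
    by (rule nn_integral_suminf[symmetric]) measurable
  also have "\<dots> = (\<integral>\<^sup>+t. \<phi> (G t) * ennreal \<bar>det (D t)\<bar> * indicator V t \<partial>lborel)"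
    using V(2) by (auto simp: ind ennreal_suminf_cmult g_def J_def intro!: nn_integral_cong split: split_indicator)
  finally show ?thesis .
qed

section \<open>Measurability of the number of zeros of a random function\<close>

text \<open>A nonnegative continuous function on a compact set has a zero iff its infimum over a countable dense subset is 0.\<close>

lemma sets_exists_zero_compact:
  fixes k :: "'b \<Rightarrow> 'a::euclidean_space \<Rightarrow> real"
  assumes K: "compact K"
    and meas: "\<And>t. t \<in> K \<Longrightarrow> (\<lambda>n. k n t) \<in> borel_measurable N"
    and cont: "\<And>n. n \<in> space N \<Longrightarrow> continuous_on K (k n)"
    and nonneg: "\<And>n t. 0 \<le> k n t"
  shows "{n\<in>space N. \<exists>t\<in>K. k n t = 0} \<in> sets N"
proof -
  obtain D where D: "countable D" "D \<subseteq> K" "K \<subseteq> closure D"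
    using separable[of K] by blast
  have eq: "{n\<in>space N. \<exists>t\<in>K. k n t = 0} = {n\<in>space N. \<forall>m::nat. \<exists>q\<in>D. k n q < 1 / Suc m}"
  proof (intro Collect_cong conj_cong refl iffI allI)
    fix n m assume n: "n \<in> space N" and "\<exists>t\<in>K. k n t = 0"
    then obtain t where t: "t \<in> K" "k n t = 0" by blast
    obtain d where d: "d > 0" "\<And>s. s \<in> K \<Longrightarrow> dist s t < d \<Longrightarrow> dist (k n s) (k n t) < 1 / Suc m"
      using cont[OF n] t(1) unfolding continuous_on_iff
      by (metis divide_pos_pos of_nat_0_less_iff zero_less_Suc zero_less_one)
    obtain q where "q \<in> D" "dist q t < d"
      using D(3) t(1) d(1) by (metis closure_approachable subsetD)
    then show "\<exists>q\<in>D. k n q < 1 / Suc m"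
      using d(2)[of q] D(2) t(2) nonneg[of n q] by (auto simp: dist_real_def)
  next
    fix n assume n: "n \<in> space N" and *: "\<forall>m::nat. \<exists>q\<in>D. k n q < 1 / Suc m"
    have "K \<noteq> {}" using * D(2) by blast
    then obtain t where t: "t \<in> K" "\<And>s. s \<in> K \<Longrightarrow> k n t \<le> k n s"
      using continuous_attains_inf[OF K _ cont[OF n]] by blast
    have "k n t < 1 / Suc m" for m
      using * t(2) D(2) by (meson order_le_less_trans subsetD)
    then have "\<not> 0 < k n t"
      by (metis nat_approx_posE order_less_asym)
    then show "\<exists>t\<in>K. k n t = 0" using t(1) nonneg[of n t] by (intro bexI[of _ t]) auto
  qed
  have "(\<lambda>n. k n q) \<in> borel_measurable N" if "q \<in> D" for q using that D(2) meas by auto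
  then show ?thesis unfolding eq using D(1)
    by (intro sets.sets_Collect_countable_All sets.sets_Collect_countable_Bex) simp_all
qed

lemma fsigma_compact_decomp:
  fixes V :: "'a::euclidean_space set"
  assumes "fsigma_in euclidean V"
  obtains K :: "nat \<Rightarrow> 'a set" where "\<And>n. compact (K n)" "V = (\<Union>n. K n)"
proof -
  obtain C :: "nat \<Rightarrow> 'a set" where C: "\<And>n. closed (C n)" "\<And>n. C n \<subseteq> C (Suc n)" "\<Union>(range C) = V"
    using assms by (auto simp: fsigma_in_ascending closed_closedin[symmetric])
  have "compact (C n \<inter> cball 0 n)" for n by (simp add: C closed_Int_compact)
  moreover have "V = (\<Union>n. C n \<inter> cball 0 (real n))"
  proof -
    have "\<exists>n. x \<in> C n \<and> norm x \<le> real n" if x: "x \<in> V" for x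
    proof -
      obtain m where "x \<in> C m" using x C(3) by blast
      moreover obtain l where "norm x \<le> real l" using real_arch_simple by blast
      moreover have "C m \<subseteq> C (max m l)" by (rule lift_Suc_mono_le[of C]) (use C in auto)
      ultimately show ?thesis by (intro exI[of _ "max m l"]) (auto intro: order_trans)
    qed
    then show ?thesis using C(3) by fastforce
  qed
  ultimately show ?thesis by (rule that)
qed

text \<open>On each compact piece of \<open>V\<close>, the condition says that for some \<open>j\<close> the single nonnegative function
  \<open>\<bar>h\<bar> + max 0 (1 / Suc j - \<psi>)\<close> has a zero.\<close>

lemma sets_exists_zero:
  fixes h \<psi> :: "'b \<Rightarrow> 'a::euclidean_space \<Rightarrow> real"
  assumes V: "fsigma_in euclidean V"
    and h: "\<And>t. t \<in> V \<Longrightarrow> (\<lambda>n. h n t) \<in> borel_measurable N" "\<And>n. n \<in> space N \<Longrightarrow> continuous_on V (h n)"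
    and \<psi>: "\<And>t. t \<in> V \<Longrightarrow> (\<lambda>n. \<psi> n t) \<in> borel_measurable N" "\<And>n. n \<in> space N \<Longrightarrow> continuous_on V (\<psi> n)"
  shows "{n\<in>space N. \<exists>t\<in>V. h n t = 0 \<and> \<psi> n t > 0} \<in> sets N"
proof -
  obtain K :: "nat \<Rightarrow> 'a set" where K: "\<And>n. compact (K n)" "V = (\<Union>n. K n)"
    using fsigma_compact_decomp[OF V] by blast
  define k where "k j n t = \<bar>h n t\<bar> + max 0 (1 / Suc j - \<psi> n t)" for j :: nat and n t
  have k0: "k j n t = 0 \<longleftrightarrow> h n t = 0 \<and> 1 / Suc j \<le> \<psi> n t" for j n t
    unfolding k_def by (auto simp: max_def)
  have eq: "{n\<in>space N. \<exists>t\<in>V. h n t = 0 \<and> \<psi> n t > 0} = (\<Union>i. \<Union>j. {n\<in>space N. \<exists>t\<in>K i. k j n t = 0})"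
  proof safe
    fix n t assume "n \<in> space N" "t \<in> V" "h n t = 0" "\<psi> n t > 0"
    moreover from \<open>\<psi> n t > 0\<close> obtain j where "1 / Suc j < \<psi> n t" by (metis nat_approx_posE)
    moreover obtain i where "t \<in> K i" using \<open>t \<in> V\<close> K by auto
    ultimately show "n \<in> (\<Union>i. \<Union>j. {n \<in> space N. \<exists>t\<in>K i. k j n t = 0})"
      by (intro UN_I[of i] UN_I[of j] CollectI conjI bexI[of _ t]) (auto simp: k0)
  next
    fix n i j t assume "t \<in> K i" "k j n t = 0"
    moreover have "0 < 1 / real (Suc j)" by simp
    moreover have "1 / real (Suc j) \<le> \<psi> n t" using k0[of j n t] \<open>k j n t = 0\<close> by blast
    ultimately have "\<psi> n t > 0" by (blast intro: less_le_trans)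
    moreover have "t \<in> V" "h n t = 0" using \<open>t \<in> K i\<close> \<open>k j n t = 0\<close> K k0[of j n t] by auto
    ultimately show "\<exists>t\<in>V. h n t = 0 \<and> \<psi> n t > 0" by blast
  qed
  have KV: "K i \<subseteq> V" for i using K by auto
  have "{n\<in>space N. \<exists>t\<in>K i. k j n t = 0} \<in> sets N" for i j
  proof (rule sets_exists_zero_compact[OF K(1)])
    show "(\<lambda>n. k j n t) \<in> borel_measurable N" if "t \<in> K i" for t
      unfolding k_def using h(1)[of t] \<psi>(1)[of t] that KV[of i] by (auto intro!: borel_measurable_add)
    show "continuous_on (K i) (k j n)" if "n \<in> space N" for n
      unfolding k_def[abs_def] using h(2)[OF that] \<psi>(2)[OF that] KV[of i]
      by (intro continuous_intros) (auto intro: continuous_on_subset)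
  qed (simp add: k_def)
  then show ?thesis unfolding eq by auto
qed

text \<open>A dyadic cell of side length \<open>1 / 2 ^ m\<close> is represented by its lower corner, in units of the side length.
  Cells are half-open, hence countable unions of closed sets.\<close>

definition cell :: "nat \<Rightarrow> real^'n \<Rightarrow> 'n \<Rightarrow> int" where
  "cell m t = (\<lambda>i. \<lfloor>2 ^ m * t $ i\<rfloor>)"

lemma cell_eq_iff: "cell m t = k \<longleftrightarrow> (\<forall>i. of_int (k i) \<le> 2 ^ m * t $ i \<and> 2 ^ m * t $ i < of_int (k i) + 1)"
  unfolding cell_def fun_eq_iff by (simp add: floor_eq_iff)

lemma fsigma_cell: "fsigma_in euclidean {t :: real^'n. cell m t = k}"
proof -
  have eq: "{t :: real^'n. cell m t = k} =
      (\<Inter>i. {t. of_int (k i) \<le> 2 ^ m * t $ i}) \<inter> (\<Inter>i. {t. 2 ^ m * t $ i < of_int (k i) + 1})"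
    by (auto simp: cell_eq_iff)
  have "closed (\<Inter>i. {t :: real^'n. of_int (k i) \<le> 2 ^ m * t $ i})"
    by (intro closed_INT ballI closed_Collect_le continuous_intros)
  moreover have "open (\<Inter>i. {t :: real^'n. 2 ^ m * t $ i < of_int (k i) + 1})"
    by (intro open_INT ballI open_Collect_less continuous_intros) simp
  ultimately show ?thesis unfolding eq
    by (intro fsigma_in_Int closed_imp_fsigma_in open_imp_fsigma_in)
       (auto simp: metrizable_space_euclidean)
qed

lemma fsigma_imp_borel:
  assumes "fsigma_in euclidean V" shows "V \<in> sets (borel :: 'a::euclidean_space measure)"
  using assms by (elim fsigma_compact_decomp) (auto intro: borel_compact)

lemma filterlim_pow_at_top_2: "filterlim (\<lambda>m. 2 ^ m :: real) at_top sequentially"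
  using filterlim_compose[OF exp_at_top filterlim_tendsto_pos_mult_at_top[OF tendsto_const _ filterlim_real_sequentially], of "ln 2"]
  by (simp add: exp_of_nat_mult[symmetric] mult.commute flip: powr_realpow) (simp add: powr_def mult.commute)

lemma cells_separate:
  assumes xy: "x \<noteq> (y :: real^'n)"
  shows "\<forall>\<^sub>F m in sequentially. cell m x \<noteq> cell m y"
proof -
  obtain i where i: "x $ i \<noteq> y $ i" using xy unfolding vec_eq_iff by blast
  have "\<forall>\<^sub>F m in sequentially. 1 / \<bar>x $ i - y $ i\<bar> < 2 ^ m"
    using filterlim_pow_at_top_2 by (simp add: filterlim_at_top_dense)
  then show ?thesis
  proof eventually_elim
    case (elim m)
    then have "1 < \<bar>2 ^ m * x $ i - 2 ^ m * y $ i\<bar>"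
      using i by (simp add: abs_mult flip: right_diff_distrib) (simp add: field_simps)
    then have "\<lfloor>2 ^ m * x $ i\<rfloor> \<noteq> \<lfloor>2 ^ m * y $ i\<rfloor>" by linarith
    then show ?case by (auto simp: cell_def fun_eq_iff)
  qed
qed

text \<open>Finitely many distinct points lie in distinct cells once the cells are small enough, so the number of occupied
  cells exhausts the number of points. Occupation of one cell is a measurable event by \<open>sets_exists_zero\<close>.\<close>

lemma emeasure_count_eq_SUP_cells:
  fixes Z :: "(real^'n) set"
  shows "emeasure (count_space UNIV) Z =
    (SUP m. \<Sum>j. if (\<exists>t\<in>Z. to_nat (cell m t) = j) then 1 else 0)" (is "_ = (SUP m. ?s m)")
proof (rule antisym)
  have pt: "(if \<exists>t\<in>Z. to_nat (cell m t) = j then 1 else 0) \<le> emeasure (count_space UNIV) {t\<in>Z. to_nat (cell m t) = j}" for m j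
  proof (cases "\<exists>t\<in>Z. to_nat (cell m t) = j")
    case True
    then obtain t where "t \<in> Z" "to_nat (cell m t) = j" by blast
    then have "emeasure (count_space UNIV) {t} \<le> emeasure (count_space UNIV) {t\<in>Z. to_nat (cell m t) = j}"
      by (intro emeasure_mono) auto
    then show ?thesis using True by simp
  qed simp
  have "?s m \<le> emeasure (count_space UNIV) Z" for m
  proof -
    have "?s m \<le> (\<Sum>j. emeasure (count_space UNIV) {t\<in>Z. to_nat (cell m t) = j})"
      by (intro suminf_le pt) auto
    also have "\<dots> = emeasure (count_space UNIV) (\<Union>j. {t\<in>Z. to_nat (cell m t) = j})"
      by (intro suminf_emeasure) (auto simp: disjoint_family_on_def)
    also have "(\<Union>j. {t\<in>Z. to_nat (cell m t) = j}) = Z" by auto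
    finally show ?thesis .
  qed
  then show "(SUP m. ?s m) \<le> emeasure (count_space UNIV) Z" by (rule SUP_least)
  have fin: "of_nat (card F) \<le> (SUP m. ?s m)" if F: "finite F" "F \<subseteq> Z" for F
  proof -
    have "\<forall>\<^sub>F m in sequentially. \<forall>p\<in>F\<times>F. fst p \<noteq> snd p \<longrightarrow> cell m (fst p) \<noteq> cell m (snd p)"
      using F(1) by (intro eventually_ball_finite ballI) (auto intro: eventually_mono[OF cells_separate])
    then obtain m where "\<forall>p\<in>F\<times>F. fst p \<noteq> snd p \<longrightarrow> cell m (fst p) \<noteq> cell m (snd p)"
      using eventually_happens by force
    then have inj: "inj_on (\<lambda>t. to_nat (cell m t)) F"
      by (auto simp: inj_on_def)
    let ?J = "(\<lambda>t. to_nat (cell m t)) ` F"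
    have "of_nat (card F) = (\<Sum>j\<in>?J. 1 :: ennreal)"
      using card_image[OF inj] by simp
    also have "\<dots> = (\<Sum>j\<in>?J. if (\<exists>t\<in>Z. to_nat (cell m t) = j) then 1 else 0)"
      using F(2) by (intro sum.cong) auto
    also have "\<dots> \<le> ?s m" using F(1) by (intro sum_le_suminf) auto
    also have "\<dots> \<le> (SUP m. ?s m)" by (rule SUP_upper) simp
    finally show ?thesis .
  qed
  show "emeasure (count_space UNIV) Z \<le> (SUP m. ?s m)"
  proof (cases "finite Z")
    case True then show ?thesis using fin[of Z] by (simp add: emeasure_count_space)
  next
    case False
    have "of_nat n \<le> (SUP m. ?s m)" for n
    proof -
      obtain F where "finite F" "card F = n" "F \<subseteq> Z" using infinite_arbitrarily_large[OF False] by blast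
      then show ?thesis using fin[of F] by simp
    qed
    then have "\<not> (SUP m. ?s m) < \<top>"
      using ennreal_Ex_less_of_nat[of "SUP m. ?s m"] by (auto simp: not_less[symmetric])
    then show ?thesis by (simp only: less_top[symmetric] not_not top_greatest)
  qed
qed

lemma measurable_zero_count:
  fixes h \<psi> :: "'b \<Rightarrow> real^'n \<Rightarrow> real"
  assumes V: "fsigma_in euclidean V"
    and h: "\<And>t. t \<in> V \<Longrightarrow> (\<lambda>n. h n t) \<in> borel_measurable N" "\<And>n. n \<in> space N \<Longrightarrow> continuous_on V (h n)"
    and \<psi>: "\<And>t. t \<in> V \<Longrightarrow> (\<lambda>n. \<psi> n t) \<in> borel_measurable N" "\<And>n. n \<in> space N \<Longrightarrow> continuous_on V (\<psi> n)"
  shows "(\<lambda>n. emeasure (count_space UNIV) {t\<in>V. h n t = 0 \<and> \<psi> n t > 0}) \<in> borel_measurable N"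
proof -
  have "{n\<in>space N. \<exists>t\<in>{t\<in>V. h n t = 0 \<and> \<psi> n t > 0}. to_nat (cell m t) = j} \<in> sets N" for m j
  proof -
    have "fsigma_in euclidean {t::real^'n. to_nat (cell m t) = j}"
    proof (cases "\<exists>k :: 'n \<Rightarrow> int. to_nat k = j")
      case True
      then obtain k :: "'n \<Rightarrow> int" where "to_nat k = j" by blast
      then have "{t::real^'n. to_nat (cell m t) = j} = {t. cell m t = k}" by auto
      then show ?thesis using fsigma_cell[of m k] by simp
    next
      case False
      then have "{t::real^'n. to_nat (cell m t) = j} = {}" by auto
      then show ?thesis by simp
    qed
    then have "fsigma_in euclidean (V \<inter> {t. to_nat (cell m t) = j})" using V by (intro fsigma_in_Int)
    then have "{n\<in>space N. \<exists>t\<in>V \<inter> {t. to_nat (cell m t) = j}. h n t = 0 \<and> \<psi> n t > 0} \<in> sets N"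
      by (rule sets_exists_zero) (auto intro: h \<psi> continuous_on_subset)
    also have "{n\<in>space N. \<exists>t\<in>V \<inter> {t. to_nat (cell m t) = j}. h n t = 0 \<and> \<psi> n t > 0} =
        {n\<in>space N. \<exists>t\<in>{t\<in>V. h n t = 0 \<and> \<psi> n t > 0}. to_nat (cell m t) = j}" by auto
    finally show ?thesis .
  qed
  then have [measurable]: "Measurable.pred N (\<lambda>n. \<exists>t\<in>{t\<in>V. h n t = 0 \<and> \<psi> n t > 0}. to_nat (cell m t) = j)" for m j
    by (simp add: pred_def)
  show ?thesis unfolding emeasure_count_eq_SUP_cells by measurable
qed

lemma measurable_cell [measurable]: "(cell m :: real^'n \<Rightarrow> _) \<in> borel \<rightarrow>\<^sub>M count_space UNIV"
proof -
  have "cell m -` {k} = {t :: real^'n. cell m t = k}" for k by auto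
  then show ?thesis using fsigma_imp_borel[OF fsigma_cell]
    by (subst measurable_count_space_eq2_countable) auto
qed

lemma cell_tendsto: "(\<lambda>m. \<chi> i. of_int (cell m t i) / 2 ^ m) \<longlonglongrightarrow> (t :: real^'n)"
proof (rule vec_tendstoI)
  fix i
  have a: "\<bar>of_int (cell m t i) / 2 ^ m - t $ i\<bar> \<le> (1/2) ^ m" for m
  proof -
    have "\<bar>of_int (cell m t i) - 2 ^ m * t $ i\<bar> \<le> 1" unfolding cell_def by linarith
    then have "\<bar>of_int (cell m t i) - 2 ^ m * t $ i\<bar> / 2 ^ m \<le> 1 / 2 ^ m" by (simp add: divide_right_mono)
    moreover have "of_int (cell m t i) / 2 ^ m - t $ i = (of_int (cell m t i) - 2 ^ m * t $ i) / 2 ^ m"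
      by (simp add: field_simps)
    ultimately show ?thesis by (simp add: power_one_over)
  qed
  have "(\<lambda>m. of_int (cell m t i) / 2 ^ m - t $ i) \<longlonglongrightarrow> 0"
    by (rule Lim_null_comparison[where g="\<lambda>m. (1/2::real)^m"]) (use a in \<open>auto intro: LIMSEQ_power_zero\<close>)
  then show "(\<lambda>m. (\<chi> i. of_int (cell m t i) / 2 ^ m) $ i) \<longlonglongrightarrow> t $ i"
    by (simp add: LIM_zero_iff)
qed

text \<open>Replacing the argument by the corner of its dyadic cell leaves only countably many arguments, and continuity gives convergence.\<close>

lemma measurable_continuous_field:
  fixes F :: "'b \<Rightarrow> real^'n \<Rightarrow> 'c::metric_space"
  assumes meas: "\<And>t. (\<lambda>n. F n t) \<in> borel_measurable N"
    and cont: "\<And>n. n \<in> space N \<Longrightarrow> continuous_on UNIV (F n)"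
  shows "(\<lambda>(n, t). F n t) \<in> borel_measurable (N \<Otimes>\<^sub>M borel)"
proof (rule borel_measurable_LIMSEQ_metric)
  show "(\<lambda>p. F (fst p) (\<chi> i. of_int (cell m (snd p) i) / 2 ^ m)) \<in> borel_measurable (N \<Otimes>\<^sub>M borel)" for m
    by (rule measurable_compose_countable[where f="\<lambda>c p. F (fst p) (\<chi> i. of_int (c i) / 2 ^ m)"])
       (auto intro!: measurable_compose[OF measurable_fst meas] measurable_compose[OF measurable_snd measurable_cell])
  fix p assume "p \<in> space (N \<Otimes>\<^sub>M (borel :: (real^'n) measure))"
  then have "fst p \<in> space N" by (auto simp: space_pair_measure)
  from cont[OF this] have "isCont (F (fst p)) (snd p)" by (simp add: continuous_on_eq_continuous_at)
  then show "(\<lambda>m. F (fst p) (\<chi> i. of_int (cell m (snd p) i) / 2 ^ m)) \<longlonglongrightarrow> (case p of (n, t) \<Rightarrow> F n t)"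
    using isCont_tendsto_compose[OF _ cell_tendsto[of "snd p"]] by (simp add: case_prod_beta)
qed

section \<open>Uncorrelated jointly Gaussian families are independent\<close>

text \<open>The analogue of \<open>indep_var\<close> for two random elements with values in different types.\<close>

definition indep_pair :: "'w measure \<Rightarrow> 'a measure \<Rightarrow> ('w \<Rightarrow> 'a) \<Rightarrow> 'b measure \<Rightarrow> ('w \<Rightarrow> 'b) \<Rightarrow> bool" where
  "indep_pair M N1 F N2 H \<longleftrightarrow> F \<in> M \<rightarrow>\<^sub>M N1 \<and> H \<in> M \<rightarrow>\<^sub>M N2 \<and>
     distr M N1 F \<Otimes>\<^sub>M distr M N2 H = distr M (N1 \<Otimes>\<^sub>M N2) (\<lambda>\<omega>. (F \<omega>, H \<omega>))"

context prob_space
begin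

text \<open>Adding a constant to \<open>w\<close> and normalising makes it a probability density \<open>u\<close>. Under \<open>M\<close> and under \<open>M\<close> reweighted by
  \<open>u\<close> the variable \<open>W\<close> has the same characteristic function, hence the same law.\<close>

lemma integral_vanish_real:
  assumes w[measurable]: "w \<in> borel_measurable M" and bd: "\<And>\<omega>. \<bar>w \<omega>\<bar> \<le> B"
    and W[measurable]: "W \<in> borel_measurable M"
    and zero: "\<And>t. (LINT \<omega>|M. complex_of_real (w \<omega>) * iexp (t * W \<omega>)) = 0"
    and D[measurable]: "D \<in> sets borel"
  shows "(LINT \<omega>|M. w \<omega> * indicator D (W \<omega>)) = (0::real)"
proof -
  define c where "c = \<bar>B\<bar> + 1"
  have c: "c > 0" "\<And>\<omega>. 0 \<le> w \<omega> + c" using bd by (auto simp: c_def) (smt (verit))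
  define u where "u \<omega> = (w \<omega> + c) / c" for \<omega>
  have [measurable]: "u \<in> borel_measurable M" by (simp add: u_def[abs_def])
  have u0: "0 \<le> u \<omega>" for \<omega> using c by (simp add: u_def)
  have int_w: "integrable M (\<lambda>\<omega>. w \<omega> * g \<omega>)" if [measurable]: "g \<in> borel_measurable M" and "\<And>\<omega>. \<bar>g \<omega>\<bar> \<le> 1" for g :: "_ \<Rightarrow> real"
  proof (rule integrable_const_bound[where B="\<bar>B\<bar>"])
    have "\<bar>w \<omega>\<bar> * \<bar>g \<omega>\<bar> \<le> \<bar>B\<bar> * 1" for \<omega>
      by (intro mult_mono order_trans[OF bd]) (auto simp: that)
    then show "AE \<omega> in M. norm (w \<omega> * g \<omega>) \<le> \<bar>B\<bar>" by (simp add: abs_mult)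
  qed simp
  have int_wc: "integrable M (\<lambda>\<omega>. complex_of_real (w \<omega>) * iexp (t * W \<omega>))" for t
    by (rule integrable_const_bound[where B="\<bar>B\<bar>"])
       (use order_trans[OF bd abs_ge_self] in \<open>auto simp: norm_mult\<close>)
  have int_e: "integrable M (\<lambda>\<omega>. iexp (t * W \<omega>))" for t
    by (rule integrable_const_bound[where B=1]) auto
  have Ew: "(LINT \<omega>|M. w \<omega>) = 0"
    using zero[of 0] by (simp only: of_real_0 mult_zero_left mult_zero_right exp_zero mult_1_right integral_complex_of_real of_real_eq_0_iff)
  have iw: "integrable M w" using int_w[of "\<lambda>_. 1"] by simp
  define Q where "Q = density M (\<lambda>\<omega>. ennreal (u \<omega>))"
  have iu: "integrable M u" unfolding u_def[abs_def] using iw by auto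
  have Eu: "(LINT \<omega>|M. u \<omega>) = 1" unfolding u_def using iw c by (simp add: Ew prob_space)
  interpret Q: prob_space Q
  proof
    show "emeasure Q (space Q) = 1"
      using nn_integral_eq_integral[OF iu] u0 Eu
      by (simp add: Q_def emeasure_density cong: nn_integral_cong)
  qed
  have [measurable]: "W \<in> borel_measurable Q" by (simp add: Q_def)
  have "char (distr Q borel W) t = char (distr M borel W) t" for t
  proof -
    have "char (distr Q borel W) t = (LINT \<omega>|M. u \<omega> *\<^sub>R iexp (t * W \<omega>))"
      unfolding char_def by (subst integral_distr) (auto simp: Q_def integral_density u0)
    also have "\<dots> = (LINT \<omega>|M. (complex_of_real (w \<omega>) * iexp (t * W \<omega>)) / c + iexp (t * W \<omega>))"
      using c by (intro Bochner_Integration.integral_cong) (auto simp: u_def scaleR_conv_of_real field_simps)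
    also have "\<dots> = (LINT \<omega>|M. (complex_of_real (w \<omega>) * iexp (t * W \<omega>)) / c) + (LINT \<omega>|M. iexp (t * W \<omega>))"
      using int_wc[of t] int_e[of t] by (intro Bochner_Integration.integral_add integrable_divide) auto
    also have "(LINT \<omega>|M. (complex_of_real (w \<omega>) * iexp (t * W \<omega>)) / c) = 0"
      using zero[of t] by (simp only: integral_divide_zero) simp
    also have "0 + (LINT \<omega>|M. iexp (t * W \<omega>)) = char (distr M borel W) t"
      unfolding char_def by (subst integral_distr) auto
    finally show ?thesis .
  qed
  moreover have "real_distribution (distr Q borel W)" "real_distribution (distr M borel W)"
    by (auto intro!: Q.real_distribution_distr real_distribution_distr)
  ultimately have eq: "distr Q borel W = distr M borel W"
    by (intro Levy_uniqueness) auto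
  have "(LINT \<omega>|M. u \<omega> * indicator D (W \<omega>)) = (LINT x|distr Q borel W. indicator D x)"
    by (subst integral_distr) (auto simp: Q_def integral_density u0)
  also have "\<dots> = (LINT \<omega>|M. indicator D (W \<omega>))"
    unfolding eq by (subst integral_distr) auto
  finally have "(LINT \<omega>|M. u \<omega> * indicator D (W \<omega>)) - (LINT \<omega>|M. indicator D (W \<omega>)) = (0::real)" by simp
  moreover have "(LINT \<omega>|M. u \<omega> * indicator D (W \<omega>)) = (LINT \<omega>|M. w \<omega> * indicator D (W \<omega>) / c + indicator D (W \<omega>))"
    using c by (intro Bochner_Integration.integral_cong) (auto simp: u_def field_simps)
  moreover have "\<dots> = (LINT \<omega>|M. w \<omega> * indicator D (W \<omega>)) / c + (LINT \<omega>|M. indicator D (W \<omega>))"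
  proof -
    have "integrable M (\<lambda>\<omega>. w \<omega> * indicator D (W \<omega>) :: real)"
      by (rule int_w) (auto split: split_indicator)
    moreover have "integrable M (\<lambda>\<omega>. indicator D (W \<omega>) :: real)"
      by (rule integrable_const_bound[where B=1]) auto
    ultimately show ?thesis by simp
  qed
  ultimately show ?thesis using c by simp
qed

text \<open>The hypothesis at \<open>- t\<close>, conjugated, is the hypothesis for \<open>cnj w\<close>; so the real and the imaginary part of \<open>w\<close>
  satisfy it as well.\<close>

lemma integral_vanish_complex:
  fixes w :: "'a \<Rightarrow> complex"
  assumes w[measurable]: "w \<in> borel_measurable M" and bd: "\<And>\<omega>. norm (w \<omega>) \<le> B"
    and W[measurable]: "W \<in> borel_measurable M"
    and zero: "\<And>t. (LINT \<omega>|M. w \<omega> * iexp (t * W \<omega>)) = 0"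
    and D[measurable]: "D \<in> sets borel"
  shows "(LINT \<omega>|M. w \<omega> * indicator D (W \<omega>)) = 0"
proof -
  have int: "integrable M (\<lambda>\<omega>. w \<omega> * g \<omega>)" if [measurable]: "g \<in> borel_measurable M" and "\<And>\<omega>. norm (g \<omega>) \<le> 1" for g :: "_ \<Rightarrow> complex"
  proof (rule integrable_const_bound[where B="\<bar>B\<bar>"])
    have "norm (w \<omega>) * norm (g \<omega>) \<le> \<bar>B\<bar> * 1" for \<omega>
      by (intro mult_mono order_trans[OF bd]) (auto simp: that)
    then show "AE \<omega> in M. norm (w \<omega> * g \<omega>) \<le> \<bar>B\<bar>" by (simp add: norm_mult)
  qed simp
  have [measurable]: "(\<lambda>\<omega>. cnj (w \<omega>)) \<in> borel_measurable M"
    by (rule measurable_compose[OF w borel_measurable_continuous_onI]) (intro continuous_intros)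
  have zero': "(LINT \<omega>|M. cnj (w \<omega>) * iexp (t * W \<omega>)) = 0" for t
  proof -
    have "(LINT \<omega>|M. cnj (w \<omega>) * iexp (t * W \<omega>)) = (LINT \<omega>|M. cnj (w \<omega> * iexp (- t * W \<omega>)))"
      by (intro Bochner_Integration.integral_cong refl) (simp add: exp_cnj)
    also have "\<dots> = cnj (LINT \<omega>|M. w \<omega> * iexp (- t * W \<omega>))" by (rule integral_bounded_linear[OF bounded_linear_cnj]) (use bd in \<open>auto intro!: int\<close>)
    finally show ?thesis using zero[of "-t"] by simp
  qed
  have inte: "integrable M (\<lambda>\<omega>. w \<omega> * iexp (t * W \<omega>))" for t by (rule int) auto
  have inte': "integrable M (\<lambda>\<omega>. cnj (w \<omega>) * iexp (t * W \<omega>))" for t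
    by (rule integrable_const_bound[where B="\<bar>B\<bar>"]) (use order_trans[OF bd abs_ge_self] in \<open>auto simp: norm_mult\<close>)
  have re: "(LINT \<omega>|M. complex_of_real (Re (w \<omega>)) * iexp (t * W \<omega>)) = 0" for t
  proof -
    have "(LINT \<omega>|M. complex_of_real (Re (w \<omega>)) * iexp (t * W \<omega>)) =
      (LINT \<omega>|M. (w \<omega> * iexp (t * W \<omega>) + cnj (w \<omega>) * iexp (t * W \<omega>)) / 2)"
      by (intro Bochner_Integration.integral_cong refl) (simp add: complex_add_cnj flip: distrib_right)
    also have "\<dots> = 0"
      using inte[of t] inte'[of t] zero[of t] zero'[of t]
      by (simp only: integral_divide_zero Bochner_Integration.integral_add) simp
    finally show ?thesis .
  qed
  have im: "(LINT \<omega>|M. complex_of_real (Im (w \<omega>)) * iexp (t * W \<omega>)) = 0" for t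
  proof -
    have "(LINT \<omega>|M. complex_of_real (Im (w \<omega>)) * iexp (t * W \<omega>)) =
      (LINT \<omega>|M. (w \<omega> * iexp (t * W \<omega>) - cnj (w \<omega>) * iexp (t * W \<omega>)) / (2 * \<i>))"
      by (intro Bochner_Integration.integral_cong refl) (simp add: complex_diff_cnj flip: left_diff_distrib, simp add: mult_ac)
    also have "\<dots> = 0"
      using inte[of t] inte'[of t] zero[of t] zero'[of t]
      by (simp only: integral_divide_zero Bochner_Integration.integral_diff) simp
    finally show ?thesis .
  qed
  have bre: "\<bar>Re (w \<omega>)\<bar> \<le> B" "\<bar>Im (w \<omega>)\<bar> \<le> B" for \<omega>
    using bd[of \<omega>] abs_Re_le_cmod[of "w \<omega>"] abs_Im_le_cmod[of "w \<omega>"] by linarith+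
  have R: "(LINT \<omega>|M. Re (w \<omega>) * indicator D (W \<omega>)) = (0::real)"
    by (rule integral_vanish_real[OF _ bre(1) W re D]) simp
  have I: "(LINT \<omega>|M. Im (w \<omega>) * indicator D (W \<omega>)) = (0::real)"
    by (rule integral_vanish_real[OF _ bre(2) W im D]) simp
  have i: "integrable M (\<lambda>\<omega>. w \<omega> * indicator D (W \<omega>))" by (rule int) (auto split: split_indicator)
  show ?thesis
  proof (rule complex_eqI)
    have "Re (LINT \<omega>|M. w \<omega> * indicator D (W \<omega>)) = (LINT \<omega>|M. Re (w \<omega> * indicator D (W \<omega>)))"
      using i by (simp only: integral_Re)
    also have "\<dots> = (LINT \<omega>|M. Re (w \<omega>) * indicator D (W \<omega>))"
      by (intro Bochner_Integration.integral_cong) (auto split: split_indicator)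
    finally show "Re (LINT \<omega>|M. w \<omega> * indicator D (W \<omega>)) = Re 0" using R by simp
    have "Im (LINT \<omega>|M. w \<omega> * indicator D (W \<omega>)) = (LINT \<omega>|M. Im (w \<omega> * indicator D (W \<omega>)))"
      using i by (simp only: integral_Im)
    also have "\<dots> = (LINT \<omega>|M. Im (w \<omega>) * indicator D (W \<omega>))"
      by (intro Bochner_Integration.integral_cong) (auto split: split_indicator)
    finally show "Im (LINT \<omega>|M. w \<omega> * indicator D (W \<omega>)) = Im 0" using I by simp
  qed
qed

text \<open>The coordinates are passed from exponentials to indicators one at a time; what stands in front of the current
  coordinate is absorbed into the complex weight \<open>w\<close>.\<close>

lemma integral_vanish_family:
  fixes w :: "'a \<Rightarrow> complex" and W :: "'j \<Rightarrow> 'a \<Rightarrow> real"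
  assumes "finite J"
    and "w \<in> borel_measurable M" and "\<And>\<omega>. norm (w \<omega>) \<le> B"
    and "\<And>j. W j \<in> borel_measurable M"
    and "\<And>t. (LINT \<omega>|M. w \<omega> * iexp (\<Sum>j\<in>J. t j * W j \<omega>)) = 0"
    and "\<And>j. D j \<in> sets borel"
  shows "(LINT \<omega>|M. w \<omega> * (\<Prod>j\<in>J. indicator (D j) (W j \<omega>))) = 0"
  using assms
proof (induction J arbitrary: w rule: finite_induct)
  case (insert x F)
  note [measurable] = insert.prems(1,3,5)
  have pb: "norm (\<Prod>j\<in>F. indicator (D j) (W j \<omega>) :: complex) \<le> 1" for \<omega>
    unfolding prod_norm[symmetric] by (intro prod_le_1) (auto split: split_indicator)
  have "(LINT \<omega>|M. (w \<omega> * (\<Prod>j\<in>F. indicator (D j) (W j \<omega>))) * indicator (D x) (W x \<omega>)) = 0"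
  proof (rule integral_vanish_complex)
    fix t :: real
    have "(LINT \<omega>|M. (w \<omega> * iexp (t * W x \<omega>)) * (\<Prod>j\<in>F. indicator (D j) (W j \<omega>))) = 0"
    proof (rule insert.IH)
      fix s :: "'j \<Rightarrow> real"
      have "(\<Sum>j\<in>insert x F. (if j = x then t else s j) * W j \<omega>) = t * W x \<omega> + (\<Sum>j\<in>F. s j * W j \<omega>)" for \<omega>
        using insert.hyps by (auto intro!: sum.cong)
      then show "(LINT \<omega>|M. (w \<omega> * iexp (t * W x \<omega>)) * iexp (\<Sum>j\<in>F. s j * W j \<omega>)) = 0"
        using insert.prems(4)[of "\<lambda>j. if j = x then t else s j"]
        by (simp only: of_real_add distrib_left exp_add mult.assoc)
    qed (use insert.prems in \<open>auto simp: norm_mult\<close>)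
    then show "(LINT \<omega>|M. (w \<omega> * (\<Prod>j\<in>F. indicator (D j) (W j \<omega>))) * iexp (t * W x \<omega>)) = 0"
      by (simp only: mult_ac)
    show "norm (w \<omega> * (\<Prod>j\<in>F. indicator (D j) (W j \<omega>))) \<le> B" for \<omega>
      using mult_mono[OF insert.prems(2)[of \<omega>] pb[of \<omega>]] insert.prems(2)[of \<omega>] 
      by (simp add: norm_mult order_trans[OF norm_ge_zero insert.prems(2)])
  qed (use insert.prems in auto)
  then show ?case using insert.hyps by (simp add: mult_ac)
qed simp

lemma gaussian_rvD:
  assumes Y: "gaussian_rv M Y"
  shows "Y \<in> borel_measurable M" "integrable M Y" "integrable M (\<lambda>\<omega>. (Y \<omega>)\<^sup>2)"
    and "expectation Y = 0 \<Longrightarrow> (LINT \<omega>|M. iexp (Y \<omega>)) = exp (- (expectation (\<lambda>\<omega>. (Y \<omega>)\<^sup>2)) / 2)"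
    and "expectation Y = 0 \<Longrightarrow> expectation (\<lambda>\<omega>. (Y \<omega>)\<^sup>2) = s\<^sup>2 \<Longrightarrow> s > 0 \<Longrightarrow> distributed M lborel Y (normal_density 0 s)"
proof -
  obtain \<mu> \<sigma> where s: "0 \<le> \<sigma>" "distr M borel Y = (if \<sigma> = 0 then return borel \<mu> else density lborel (normal_density \<mu> \<sigma>))"
    and m[measurable]: "Y \<in> borel_measurable M"
    using Y unfolding gaussian_rv_def by blast
  show "Y \<in> borel_measurable M" by fact
  have "integrable M Y \<and> integrable M (\<lambda>\<omega>. (Y \<omega>)\<^sup>2) \<and>
    (expectation Y = 0 \<longrightarrow> (LINT \<omega>|M. iexp (Y \<omega>)) = exp (- (expectation (\<lambda>\<omega>. (Y \<omega>)\<^sup>2)) / 2) \<and>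
     (\<forall>s>0. expectation (\<lambda>\<omega>. (Y \<omega>)\<^sup>2) = s\<^sup>2 \<longrightarrow> distributed M lborel Y (normal_density 0 s)))"
  proof (cases "\<sigma> = 0")
    case True
    then have d: "distr M borel Y = return borel \<mu>" using s by simp
    have "AE x in distr M borel Y. x = \<mu>" unfolding d by (simp add: AE_return)
    then have ae: "AE \<omega> in M. Y \<omega> = \<mu>" by (subst (asm) AE_distr_iff) auto
    have i: "integrable M (\<lambda>\<omega>. (Y \<omega>)^k)" for k
      by (rule integrable_cong_AE_imp[of M "\<lambda>_. \<mu>^k"]) (use ae in auto)
    have e: "(LINT \<omega>|M. f (Y \<omega>)) = f \<mu>" if [measurable]: "f \<in> borel_measurable borel" for f :: "real \<Rightarrow> 'b::{banach,second_countable_topology}"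
    proof -
      have "(LINT \<omega>|M. f (Y \<omega>)) = (LINT \<omega>|M. f \<mu>)"
        by (intro integral_cong_AE) (use ae in auto)
      then show ?thesis by (simp add: prob_space)
    qed
    show ?thesis using i[of 1] i[of 2] e[of "\<lambda>x. x"] e[of "\<lambda>x. x\<^sup>2"] e[of iexp] by simp
  next
    case False
    then have pos: "\<sigma> > 0" and d: "distr M borel Y = density lborel (normal_density \<mu> \<sigma>)" using s by auto
    have D: "distributed M lborel Y (normal_density \<mu> \<sigma>)"
      using d by (simp add: distributed_def cong: distr_cong)
    have ic: "integrable M (\<lambda>\<omega>. (Y \<omega> - \<mu>)^k)" for k
      using distributed_integrable[OF D, of "\<lambda>x. (x - \<mu>)^k"] integrable_normal_moment[OF pos, of \<mu> k] by simp
    have i1: "integrable M Y"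
      using Bochner_Integration.integrable_add[OF ic[of 1] integrable_const[of \<mu>]] by simp
    have e1: "expectation Y = \<mu>" using normal_distributed_expectation[OF pos D] .
    have v: "expectation (\<lambda>\<omega>. (Y \<omega> - \<mu>)\<^sup>2) = \<sigma>\<^sup>2"
      using normal_distributed_variance[OF pos D] e1 by simp
    have i: "integrable M (\<lambda>\<omega>. (Y \<omega>)^k)" for k
    proof -
      have "(\<lambda>\<omega>. (Y \<omega>)^k) = (\<lambda>\<omega>. \<Sum>l\<le>k. of_nat (k choose l) * (Y \<omega> - \<mu>)^l * \<mu>^(k-l))"
        using binomial_ring[of "Y _ - \<mu>" \<mu> k] by auto
      then show ?thesis using ic by simp
    qed
    have c: "(LINT \<omega>|M. iexp (Y \<omega>)) = exp (- (expectation (\<lambda>\<omega>. (Y \<omega>)\<^sup>2)) / 2)" if "expectation Y = 0"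
    proof -
      have mu: "\<mu> = 0" using e1 that by simp
      have "distributed M lborel (\<lambda>x. Y x / \<sigma>) std_normal_density"
        using normal_standard_normal_convert[OF pos, of Y 0] D mu by simp
      then have dd: "distr M borel (\<lambda>x. Y x / \<sigma>) = std_normal_distribution"
        by (simp add: distributed_def cong: distr_cong)
      have "(LINT \<omega>|M. iexp (Y \<omega>)) = (LINT x|distr M borel (\<lambda>x. Y x / \<sigma>). iexp (\<sigma> * x))"
        using pos by (subst integral_distr) auto
      also have "\<dots> = char std_normal_distribution \<sigma>" unfolding dd char_def ..
      also have "\<dots> = exp (- (expectation (\<lambda>\<omega>. (Y \<omega>)\<^sup>2)) / 2)"
        using v mu by (simp add: char_std_normal_distribution)
      finally show ?thesis .
    qed
    have n: "distributed M lborel Y (normal_density 0 s)" if "expectation Y = 0" "expectation (\<lambda>\<omega>. (Y \<omega>)\<^sup>2) = s\<^sup>2" "s > 0" for s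
    proof -
      have "\<mu> = 0" using e1 that by simp
      moreover have "\<sigma> = s" using v that pos \<open>\<mu> = 0\<close> by (simp add: power2_eq_iff_nonneg)
      ultimately show ?thesis using D by simp
    qed
    show ?thesis using i[of 2] i1 c n by simp
  qed
  then show "integrable M Y" "integrable M (\<lambda>\<omega>. (Y \<omega>)\<^sup>2)"
    "expectation Y = 0 \<Longrightarrow> (LINT \<omega>|M. iexp (Y \<omega>)) = exp (- (expectation (\<lambda>\<omega>. (Y \<omega>)\<^sup>2)) / 2)"
    "expectation Y = 0 \<Longrightarrow> expectation (\<lambda>\<omega>. (Y \<omega>)\<^sup>2) = s\<^sup>2 \<Longrightarrow> s > 0 \<Longrightarrow> distributed M lborel Y (normal_density 0 s)"
    by blast+
qed

lemma integrable_mult_square: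
  assumes [measurable]: "f \<in> borel_measurable M" "g \<in> borel_measurable M"
    and "integrable M (\<lambda>\<omega>. (f \<omega>)\<^sup>2)" "integrable M (\<lambda>\<omega>. (g \<omega>)\<^sup>2)"
  shows "integrable M (\<lambda>\<omega>. f \<omega> * g \<omega> :: real)"
proof (rule Bochner_Integration.integrable_bound)
  show "integrable M (\<lambda>\<omega>. (f \<omega>)\<^sup>2 + (g \<omega>)\<^sup>2)" using assms by auto
  have "\<bar>x * y\<bar> \<le> x\<^sup>2 + y\<^sup>2" for x y :: real
  proof -
    have "2 * \<bar>x * y\<bar> \<le> x\<^sup>2 + y\<^sup>2"
      using sum_squares_bound[of "\<bar>x\<bar>" "\<bar>y\<bar>"] by (simp add: abs_mult)
    then show ?thesis using abs_ge_zero[of "x * y"] by linarith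
  qed
  then show "AE \<omega> in M. norm (f \<omega> * g \<omega>) \<le> norm ((f \<omega>)\<^sup>2 + (g \<omega>)\<^sup>2)"
    by (intro AE_I2) (simp add: order_trans[OF _ abs_ge_self])
qed auto

definition gen_algebra :: "('i \<Rightarrow> 'a \<Rightarrow> real) \<Rightarrow> 'a measure" where
  "gen_algebra U = sigma (space M) {U i -` A \<inter> space M | i A. A \<in> sets borel}"

lemma space_gen_algebra [simp]: "space (gen_algebra U) = space M"
  by (simp add: gen_algebra_def space_measure_of_conv)

lemma sets_gen_algebra: "sets (gen_algebra U) = sigma_sets (space M) {U i -` A \<inter> space M | i A. A \<in> sets borel}"
  unfolding gen_algebra_def by (rule sets_measure_of) auto

lemma measurable_gen_algebra: "U i \<in> borel_measurable (gen_algebra U)"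
  by (rule measurableI) (auto simp: sets_gen_algebra intro: sigma_sets.Basic)

lemma subalgebra_gen_algebra:
  assumes "\<And>i. U i \<in> borel_measurable M"
  shows "sets (gen_algebra U) \<subseteq> events"
  unfolding sets_gen_algebra using assms by (intro sets.sigma_sets_subset) (auto intro: measurable_sets)

lemma Int_stable_cylinders:
  fixes U :: "'k \<Rightarrow> 'a \<Rightarrow> real"
  shows "Int_stable {{\<omega>\<in>space M. \<forall>i\<in>I. U i \<omega> \<in> A i} | I A. finite I \<and> (\<forall>i. A i \<in> sets borel)}"
  proof (rule Int_stableI, clarify)
    fix I I' :: "'k set" and A A' :: "'k \<Rightarrow> real set"
    assume *: "finite I" "finite I'" "\<forall>i. A i \<in> sets borel" "\<forall>i. A' i \<in> sets borel"
    define A'' where "A'' i = (if i \<in> I then A i else UNIV) \<inter> (if i \<in> I' then A' i else UNIV)" for i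
    have "{\<omega>\<in>space M. \<forall>i\<in>I. U i \<omega> \<in> A i} \<inter> {\<omega>\<in>space M. \<forall>i\<in>I'. U i \<omega> \<in> A' i} = {\<omega>\<in>space M. \<forall>i\<in>I\<union>I'. U i \<omega> \<in> A'' i}"
      by (auto simp: A''_def)
    moreover have "\<forall>i. A'' i \<in> sets borel" using * by (auto simp: A''_def)
    ultimately show "\<exists>J B. {\<omega>\<in>space M. \<forall>i\<in>I. U i \<omega> \<in> A i} \<inter> {\<omega>\<in>space M. \<forall>i\<in>I'. U i \<omega> \<in> A' i} =
        {\<omega>\<in>space M. \<forall>i\<in>J. U i \<omega> \<in> B i} \<and> finite J \<and> (\<forall>i. B i \<in> sets borel)"
      using * by (intro exI[of _ "I \<union> I'"] exI[of _ A'']) auto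
  qed

lemma sets_gen_algebra_subset:
  fixes U :: "'k \<Rightarrow> 'a \<Rightarrow> real"
  shows "sets (gen_algebra U) \<subseteq> sigma_sets (space M) {{\<omega>\<in>space M. \<forall>i\<in>I. U i \<omega> \<in> A i} | I A. finite I \<and> (\<forall>i. A i \<in> sets borel)}"
    unfolding sets_gen_algebra
  proof (rule sigma_sets_mono', clarify)
    fix i and A :: "real set" assume "A \<in> sets borel"
    then show "\<exists>I A'. U i -` A \<inter> space M = {\<omega>\<in>space M. \<forall>i\<in>I. U i \<omega> \<in> A' i} \<and> finite I \<and> (\<forall>i. A' i \<in> sets borel)"
      by (intro exI[of _ "{i}"] exI[of _ "\<lambda>_. A"]) auto
  qed

text \<open>Without covariance between the two families, the joint characteristic function of finitely many members factorises.
  By \<open>integral_vanish_family\<close> exponentials may be replaced by indicators, first for \<open>U\<close> and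
  then for \<open>W\<close>, which is independence of cylinder events. These form intersection-stable
  generators of the two algebras.\<close>

lemma gaussian_indep:
  fixes U :: "'i \<Rightarrow> 'a \<Rightarrow> real" and W :: "'j \<Rightarrow> 'a \<Rightarrow> real"
  assumes lin: "\<And>I J a b. finite I \<Longrightarrow> finite J \<Longrightarrow>
      gaussian_rv M (\<lambda>\<omega>. (\<Sum>i\<in>I. a i * U i \<omega>) + (\<Sum>j\<in>J. b j * W j \<omega>))"
    and mean: "\<And>i. expectation (U i) = 0" "\<And>j. expectation (W j) = 0"
    and cov: "\<And>i j. expectation (\<lambda>\<omega>. U i \<omega> * W j \<omega>) = 0"
    and F: "F \<in> gen_algebra U \<rightarrow>\<^sub>M N1" and H: "H \<in> gen_algebra W \<rightarrow>\<^sub>M N2"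
  shows "indep_pair M N1 F N2 H"
proof -
  have gU: "gaussian_rv M (\<lambda>\<omega>. \<Sum>i\<in>I. a i * U i \<omega>)" if "finite I" for I a
    using lin[OF that, of "{}"] by simp
  have gW: "gaussian_rv M (\<lambda>\<omega>. \<Sum>j\<in>J. b j * W j \<omega>)" if "finite J" for J b
    using lin[OF _ that, of "{}"] by simp
  have gU1: "gaussian_rv M (U i)" for i using gU[of "{i}" "\<lambda>_. 1"] by simp
  have gW1: "gaussian_rv M (W j)" for j using gW[of "{j}" "\<lambda>_. 1"] by simp
  note [measurable] = gaussian_rvD(1)[OF gU1] gaussian_rvD(1)[OF gW1]
  note iU = gaussian_rvD(2,3)[OF gU1] and iW = gaussian_rvD(2,3)[OF gW1]
  have iUW: "integrable M (\<lambda>\<omega>. U i \<omega> * W j \<omega>)" for i j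
    by (rule integrable_mult_square) (auto simp: iU iW)
  have cf: "(LINT \<omega>|M. iexp ((\<Sum>i\<in>I. a i * U i \<omega>) + (\<Sum>j\<in>J. b j * W j \<omega>))) =
      (LINT \<omega>|M. iexp (\<Sum>i\<in>I. a i * U i \<omega>)) * (LINT \<omega>|M. iexp (\<Sum>j\<in>J. b j * W j \<omega>))"
    if fin: "finite I" "finite J" for I J a b
  proof -
    let ?S = "\<lambda>\<omega>. \<Sum>i\<in>I. a i * U i \<omega>" and ?T = "\<lambda>\<omega>. \<Sum>j\<in>J. b j * W j \<omega>"
    note S = gaussian_rvD[OF gU[OF fin(1), of a]] and T = gaussian_rvD[OF gW[OF fin(2), of b]]
      and ST = gaussian_rvD[OF lin[OF fin, of a b]]
    have e: "expectation ?S = 0" "expectation ?T = 0" using iU iW mean by (simp_all)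
    have est: "expectation (\<lambda>\<omega>. ?S \<omega> + ?T \<omega>) = 0" using e S(2) T(2) by simp
    have c: "expectation (\<lambda>\<omega>. ?S \<omega> * ?T \<omega>) = 0"
    proof -
      have "expectation (\<lambda>\<omega>. ?S \<omega> * ?T \<omega>) = expectation (\<lambda>\<omega>. \<Sum>i\<in>I. \<Sum>j\<in>J. (a i * b j) * (U i \<omega> * W j \<omega>))"
        by (simp add: sum_product mult_ac)
      also have "\<dots> = 0" using iUW cov by simp
      finally show ?thesis .
    qed
    have ist: "integrable M (\<lambda>\<omega>. ?S \<omega> * ?T \<omega>)"
      by (rule integrable_mult_square[OF S(1) T(1) S(3) T(3)])
    have "expectation (\<lambda>\<omega>. (?S \<omega> + ?T \<omega>)\<^sup>2) = expectation (\<lambda>\<omega>. (?S \<omega>)\<^sup>2 + (?T \<omega>)\<^sup>2 + 2 * (?S \<omega> * ?T \<omega>))"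
      by (simp add: power2_sum mult.assoc)
    also have "\<dots> = expectation (\<lambda>\<omega>. (?S \<omega>)\<^sup>2) + expectation (\<lambda>\<omega>. (?T \<omega>)\<^sup>2)"
      using S(3) T(3) ist c by simp
    finally have "expectation (\<lambda>\<omega>. (?S \<omega> + ?T \<omega>)\<^sup>2) = expectation (\<lambda>\<omega>. (?S \<omega>)\<^sup>2) + expectation (\<lambda>\<omega>. (?T \<omega>)\<^sup>2)" .
    then show ?thesis
      unfolding ST(4)[OF est] S(4)[OF e(1)] T(4)[OF e(2)]
      by (simp flip: exp_add of_real_mult add: add_divide_distrib)
  qed
  have prod_indep: "prob {\<omega>\<in>space M. (\<forall>i\<in>I. U i \<omega> \<in> A i) \<and> (\<forall>j\<in>J. W j \<omega> \<in> B j)} =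
      prob {\<omega>\<in>space M. \<forall>i\<in>I. U i \<omega> \<in> A i} * prob {\<omega>\<in>space M. \<forall>j\<in>J. W j \<omega> \<in> B j}"
    if fin: "finite I" "finite J" and A[measurable]: "\<And>i. A i \<in> sets borel" and B[measurable]: "\<And>j. B j \<in> sets borel"
    for I J and A :: "'i \<Rightarrow> real set" and B :: "'j \<Rightarrow> real set"
  proof -
    let ?A = "\<lambda>\<omega>. \<Prod>i\<in>I. indicator (A i) (U i \<omega>) :: complex" and ?B = "\<lambda>\<omega>. \<Prod>j\<in>J. indicator (B j) (W j \<omega>) :: complex"
    have nA: "norm (?A \<omega>) \<le> 1" and nB: "norm (?B \<omega>) \<le> 1" for \<omega>
      unfolding prod_norm[symmetric] by (intro prod_le_1; auto split: split_indicator)+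
    have ne: "norm (LINT \<omega>|M. iexp (f \<omega>)) \<le> 1" for f :: "'a \<Rightarrow> real"
      using integral_norm_bound[of M "\<lambda>\<omega>. iexp (f \<omega>)"] by (simp add: prob_space)
    have ie: "integrable M (\<lambda>\<omega>. iexp (f \<omega>))" if [measurable]: "f \<in> borel_measurable M" for f :: "'a \<Rightarrow> real"
      by (rule integrable_const_bound[where B=1]) auto
    have iA: "integrable M ?A" and iB: "integrable M ?B"
      using nA nB by (auto intro!: integrable_const_bound[where B=1] borel_measurable_prod)
    \<comment> \<open>indicators for \<open>U\<close>, still exponentials for \<open>W\<close>\<close>
    have 1: "(LINT \<omega>|M. ?A \<omega> * iexp (\<Sum>j\<in>J. b j * W j \<omega>)) = (LINT \<omega>|M. ?A \<omega>) * (LINT \<omega>|M. iexp (\<Sum>j\<in>J. b j * W j \<omega>))" for b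
    proof -
      let ?e = "\<lambda>\<omega>. iexp (\<Sum>j\<in>J. b j * W j \<omega>)"
      have "(LINT \<omega>|M. (?e \<omega> - (LINT \<omega>|M. ?e \<omega>)) * ?A \<omega>) = 0"
      proof (rule integral_vanish_family[OF fin(1), where B=2])
        show "norm (?e \<omega> - (LINT \<omega>|M. ?e \<omega>)) \<le> 2" for \<omega>
          using norm_triangle_ineq4[of "?e \<omega>" "LINT \<omega>|M. ?e \<omega>"] ne[of "\<lambda>\<omega>. \<Sum>j\<in>J. b j * W j \<omega>"] by simp
        fix a :: "'i \<Rightarrow> real"
        let ?f = "\<lambda>\<omega>. iexp (\<Sum>i\<in>I. a i * U i \<omega>)"
        have "(LINT \<omega>|M. (?e \<omega> - (LINT \<omega>|M. ?e \<omega>)) * ?f \<omega>) =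
          (LINT \<omega>|M. iexp ((\<Sum>i\<in>I. a i * U i \<omega>) + (\<Sum>j\<in>J. b j * W j \<omega>)) - (LINT \<omega>|M. ?e \<omega>) * ?f \<omega>)"
          by (intro Bochner_Integration.integral_cong refl)
             (simp only: of_real_add distrib_left exp_add left_diff_distrib right_diff_distrib mult_ac)
        also have "\<dots> = (LINT \<omega>|M. iexp ((\<Sum>i\<in>I. a i * U i \<omega>) + (\<Sum>j\<in>J. b j * W j \<omega>))) - (LINT \<omega>|M. ?e \<omega>) * (LINT \<omega>|M. ?f \<omega>)"
        proof -
          have "integrable M ?f" "integrable M (\<lambda>\<omega>. iexp ((\<Sum>i\<in>I. a i * U i \<omega>) + (\<Sum>j\<in>J. b j * W j \<omega>)))"
            by (rule ie; measurable)+
          then show ?thesis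
            by (simp only: Bochner_Integration.integral_diff integrable_mult_right integral_mult_right_zero)
        qed
        also have "\<dots> = 0" unfolding cf[OF fin] by simp
        finally show "(LINT \<omega>|M. (?e \<omega> - (LINT \<omega>|M. ?e \<omega>)) * ?f \<omega>) = 0" .
      qed auto
      moreover have "(LINT \<omega>|M. (?e \<omega> - (LINT \<omega>|M. ?e \<omega>)) * ?A \<omega>) = (LINT \<omega>|M. ?A \<omega> * ?e \<omega> - (LINT \<omega>|M. ?e \<omega>) * ?A \<omega>)"
        by (intro Bochner_Integration.integral_cong refl) (simp add: algebra_simps)
      moreover have "integrable M (\<lambda>\<omega>. ?A \<omega> * ?e \<omega>)"
        using nA by (intro integrable_const_bound[where B=1]) (auto simp: norm_mult)
      ultimately show ?thesis using iA by simp
    qed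
    have 2: "(LINT \<omega>|M. ?A \<omega> * ?B \<omega>) = (LINT \<omega>|M. ?A \<omega>) * (LINT \<omega>|M. ?B \<omega>)"
    proof -
      have "(LINT \<omega>|M. (?A \<omega> - (LINT \<omega>|M. ?A \<omega>)) * ?B \<omega>) = 0"
      proof (rule integral_vanish_family[OF fin(2), where B=2])
        have "expectation (\<lambda>\<omega>. norm (?A \<omega>)) \<le> 1"
          using integral_mono[of M "\<lambda>\<omega>. norm (?A \<omega>)" "\<lambda>_. 1"] iA nA by (simp add: prob_space)
        then have "norm (LINT \<omega>|M. ?A \<omega>) \<le> 1" by (rule order_trans[OF integral_norm_bound])
        then show "norm (?A \<omega> - (LINT \<omega>|M. ?A \<omega>)) \<le> 2" for \<omega>
          using norm_triangle_ineq4[of "?A \<omega>" "LINT \<omega>|M. ?A \<omega>"] nA[of \<omega>] by simp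
        fix b :: "'j \<Rightarrow> real"
        let ?e = "\<lambda>\<omega>. iexp (\<Sum>j\<in>J. b j * W j \<omega>)"
        have "integrable M (\<lambda>\<omega>. ?A \<omega> * ?e \<omega>)"
          using nA by (intro integrable_const_bound[where B=1]) (auto simp: norm_mult)
        then show "(LINT \<omega>|M. (?A \<omega> - (LINT \<omega>|M. ?A \<omega>)) * ?e \<omega>) = 0"
          using 1[of b] ie[of "\<lambda>\<omega>. \<Sum>j\<in>J. b j * W j \<omega>"] by (simp add: left_diff_distrib)
      qed auto
      moreover have "integrable M (\<lambda>\<omega>. ?A \<omega> * ?B \<omega>)"
        using nA nB by (intro integrable_const_bound[where B=1]) (auto simp: norm_mult intro!: mult_le_one)
      ultimately show ?thesis using iB by (simp add: left_diff_distrib)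
    qed
    have P: "(LINT \<omega>|M. (if P \<omega> then 1 else 0 :: complex)) = prob {\<omega>\<in>space M. P \<omega>}" if [measurable]: "Measurable.pred M P" for P
    proof -
      have "(LINT \<omega>|M. (if P \<omega> then 1 else 0 :: complex)) = (LINT \<omega>|M. complex_of_real (indicator {\<omega>\<in>space M. P \<omega>} \<omega>))"
        by (intro Bochner_Integration.integral_cong) auto
      then show ?thesis by simp
    qed
    have pA: "?A \<omega> = (if \<forall>i\<in>I. U i \<omega> \<in> A i then 1 else 0)" and pB: "?B \<omega> = (if \<forall>j\<in>J. W j \<omega> \<in> B j then 1 else 0)" for \<omega>
      using fin by (auto simp: prod_zero_iff indicator_def)
    have pAB: "?A \<omega> * ?B \<omega> = (if (\<forall>i\<in>I. U i \<omega> \<in> A i) \<and> (\<forall>j\<in>J. W j \<omega> \<in> B j) then 1 else 0)" for \<omega>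
      unfolding pA pB by auto
    have [measurable]: "Measurable.pred M (\<lambda>\<omega>. \<forall>i\<in>I. U i \<omega> \<in> A i)" "Measurable.pred M (\<lambda>\<omega>. \<forall>j\<in>J. W j \<omega> \<in> B j)"
      using fin by (auto intro!: pred_intros_finite)
    have "complex_of_real (prob {\<omega>\<in>space M. (\<forall>i\<in>I. U i \<omega> \<in> A i) \<and> (\<forall>j\<in>J. W j \<omega> \<in> B j)}) =
      prob {\<omega>\<in>space M. \<forall>i\<in>I. U i \<omega> \<in> A i} * prob {\<omega>\<in>space M. \<forall>j\<in>J. W j \<omega> \<in> B j}"
      using 2 unfolding pAB unfolding pA pB by (subst (asm) (1 2 3) P) auto
    then show ?thesis by (simp only: of_real_mult[symmetric] of_real_eq_iff)
  qed
  define EU where "EU = {{\<omega>\<in>space M. \<forall>i\<in>I. U i \<omega> \<in> A i} | I A. finite I \<and> (\<forall>i. A i \<in> sets borel)}"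
  define EW where "EW = {{\<omega>\<in>space M. \<forall>j\<in>J. W j \<omega> \<in> B j} | J B. finite J \<and> (\<forall>j. B j \<in> sets borel)}"
  have "indep_set EU EW"
  proof (rule indep_setI)
    show "EU \<subseteq> events" unfolding EU_def by (auto intro!: sets.sets_Collect_finite_All)
    show "EW \<subseteq> events" unfolding EW_def by (auto intro!: sets.sets_Collect_finite_All)
    fix a b assume "a \<in> EU" "b \<in> EW"
    then obtain I A J B where *: "a = {\<omega>\<in>space M. \<forall>i\<in>I. U i \<omega> \<in> A i}" "finite I" "\<And>i. A i \<in> sets borel"
      "b = {\<omega>\<in>space M. \<forall>j\<in>J. W j \<omega> \<in> B j}" "finite J" "\<And>j. B j \<in> sets borel"
      unfolding EU_def EW_def by blast
    have "a \<inter> b = {\<omega>\<in>space M. (\<forall>i\<in>I. U i \<omega> \<in> A i) \<and> (\<forall>j\<in>J. W j \<omega> \<in> B j)}" using * by auto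
    then show "prob (a \<inter> b) = prob a * prob b" using prod_indep[OF *(2,5,3,6)] * by simp
  qed
  moreover have "Int_stable EU" "Int_stable EW"
    unfolding EU_def EW_def by (rule Int_stable_cylinders)+
  ultimately have ind: "indep_set (sigma_sets (space M) EU) (sigma_sets (space M) EW)"
    by (rule indep_set_sigma_sets)
  have FM: "random_variable N1 F"
    using F subalgebra_gen_algebra[of U] by (auto intro!: measurable_from_subalg[of M "gen_algebra U"] simp: subalgebra_def)
  have HM: "random_variable N2 H"
    using H subalgebra_gen_algebra[of W] by (auto intro!: measurable_from_subalg[of M "gen_algebra W"] simp: subalgebra_def)
  have FU: "F -` A \<inter> space M \<in> sigma_sets (space M) EU" if "A \<in> sets N1" for A
    using measurable_sets[OF F that] sets_gen_algebra_subset[of U] by (auto simp: EU_def)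
  have HW: "H -` B \<inter> space M \<in> sigma_sets (space M) EW" if "B \<in> sets N2" for B
    using measurable_sets[OF H that] sets_gen_algebra_subset[of W] by (auto simp: EW_def)
  interpret P1: prob_space "distr M N1 F" by (rule prob_space_distr[OF FM])
  interpret P2: prob_space "distr M N2 H" by (rule prob_space_distr[OF HM])
  have FHM: "(\<lambda>\<omega>. (F \<omega>, H \<omega>)) \<in> M \<rightarrow>\<^sub>M N1 \<Otimes>\<^sub>M N2" by (rule measurable_Pair[OF FM HM])
  have "distr M N1 F \<Otimes>\<^sub>M distr M N2 H = distr M (N1 \<Otimes>\<^sub>M N2) (\<lambda>\<omega>. (F \<omega>, H \<omega>))"
  proof (rule pair_measure_eqI)
    show "sigma_finite_measure (distr M N1 F)" "sigma_finite_measure (distr M N2 H)" by unfold_locales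
    show "sets (distr M N1 F \<Otimes>\<^sub>M distr M N2 H) = sets (distr M (N1 \<Otimes>\<^sub>M N2) (\<lambda>\<omega>. (F \<omega>, H \<omega>)))"
      by (simp cong: sets_pair_measure_cong)
    fix A B assume "A \<in> sets (distr M N1 F)" "B \<in> sets (distr M N2 H)"
    then have AB: "A \<in> sets N1" "B \<in> sets N2" by auto
    have "(\<lambda>\<omega>. (F \<omega>, H \<omega>)) -` (A \<times> B) \<inter> space M = (F -` A \<inter> space M) \<inter> (H -` B \<inter> space M)" by auto
    then have "emeasure (distr M (N1 \<Otimes>\<^sub>M N2) (\<lambda>\<omega>. (F \<omega>, H \<omega>))) (A \<times> B) =
        ennreal (prob ((F -` A \<inter> space M) \<inter> (H -` B \<inter> space M)))"
      using AB by (subst emeasure_distr[OF FHM]) (auto simp: emeasure_eq_measure)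
    also have "\<dots> = ennreal (prob (F -` A \<inter> space M)) * ennreal (prob (H -` B \<inter> space M))"
      using indep_setD[OF ind FU HW] AB by (simp add: ennreal_mult)
    finally show "emeasure (distr M N1 F) A * emeasure (distr M N2 H) B =
        emeasure (distr M (N1 \<Otimes>\<^sub>M N2) (\<lambda>\<omega>. (F \<omega>, H \<omega>))) (A \<times> B)"
      using AB by (simp add: emeasure_distr[OF FM] emeasure_distr[OF HM] emeasure_eq_measure)
  qed
  then show ?thesis unfolding indep_pair_def using FM HM by simp
qed

lemma nn_integral_indep_pair:
  fixes Y :: "'a \<Rightarrow> 'c::euclidean_space" and \<Phi> :: "'c \<Rightarrow> 'b \<Rightarrow> ennreal"
  assumes ind: "indep_pair M borel Y N Z" and Y: "distributed M lborel Y (\<lambda>x. ennreal (f x))"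
    and \<Phi>[measurable]: "(\<lambda>(x, z). \<Phi> x z) \<in> borel_measurable (borel \<Otimes>\<^sub>M N)"
  shows "(\<integral>\<^sup>+\<omega>. \<Phi> (Y \<omega>) (Z \<omega>) \<partial>M) = (\<integral>\<^sup>+x. ennreal (f x) * (\<integral>\<^sup>+\<omega>. \<Phi> x (Z \<omega>) \<partial>M) \<partial>lborel)"
proof -
  have Ym[measurable]: "Y \<in> borel_measurable M" and Zm[measurable]: "Z \<in> M \<rightarrow>\<^sub>M N"
    and d: "distr M borel Y \<Otimes>\<^sub>M distr M N Z = distr M (borel \<Otimes>\<^sub>M N) (\<lambda>\<omega>. (Y \<omega>, Z \<omega>))"
    using ind by (auto simp: indep_pair_def)
  have fm[measurable]: "(\<lambda>x. ennreal (f x)) \<in> borel_measurable borel"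
    and dY: "distr M lborel Y = density lborel (\<lambda>x. ennreal (f x))"
    using Y by (auto simp: distributed_def)
  have dY': "distr M borel Y = density lborel (\<lambda>x. ennreal (f x))"
    unfolding dY[symmetric] by (rule distr_cong) auto
  interpret Z: prob_space "distr M N Z" by (rule prob_space_distr) simp
  have "(\<integral>\<^sup>+\<omega>. \<Phi> (Y \<omega>) (Z \<omega>) \<partial>M) = (\<integral>\<^sup>+p. (\<lambda>(x, z). \<Phi> x z) p \<partial>distr M (borel \<Otimes>\<^sub>M N) (\<lambda>\<omega>. (Y \<omega>, Z \<omega>)))"
    by (subst nn_integral_distr) auto
  also have "\<dots> = (\<integral>\<^sup>+x. \<integral>\<^sup>+z. \<Phi> x z \<partial>distr M N Z \<partial>distr M borel Y)"
    unfolding d[symmetric] by (subst Z.nn_integral_fst[symmetric]) auto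
  also have "\<dots> = (\<integral>\<^sup>+x. \<integral>\<^sup>+\<omega>. \<Phi> x (Z \<omega>) \<partial>M \<partial>distr M borel Y)"
    by (intro nn_integral_cong nn_integral_distr) auto
  also have "\<dots> = (\<integral>\<^sup>+x. ennreal (f x) * (\<integral>\<^sup>+\<omega>. \<Phi> x (Z \<omega>) \<partial>M) \<partial>lborel)"
    unfolding dY' by (rule nn_integral_density) auto
  finally show ?thesis .
qed

end

section \<open>Linear systems and vector calculus\<close>

lemma borel_measurable_vecI:
  assumes "\<And>i. (\<lambda>x. f x $ i) \<in> borel_measurable N"
  shows "(f :: _ \<Rightarrow> real^'n) \<in> borel_measurable N"
  by (rule borel_measurable_euclidean_space[THEN iffD2])
     (auto simp: Basis_vec_def inner_axis assms)

lemma borel_measurable_matI: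
  assumes "\<And>i j. (\<lambda>x. f x $ i $ j) \<in> borel_measurable N"
  shows "(f :: _ \<Rightarrow> real^'n^'m) \<in> borel_measurable N"
  by (rule borel_measurable_euclidean_space[THEN iffD2])
     (auto simp: Basis_vec_def inner_axis assms)

lemma continuous_on_compose_pair:
  assumes "continuous_on UNIV (\<lambda>(x, y). \<psi> x y)" "continuous_on S f" "continuous_on S h"
  shows "continuous_on S (\<lambda>x. \<psi> (f x) (h x))"
  using continuous_on_compose2[OF assms(1) continuous_on_Pair[OF assms(2,3)]] by simp

lemma borel_measurable_compose_pair:
  fixes \<psi> :: "'a::second_countable_topology \<Rightarrow> 'b::second_countable_topology \<Rightarrow> 'c::topological_space"
  assumes "continuous_on UNIV (\<lambda>(x, y). \<psi> x y)" "f \<in> borel_measurable K" "h \<in> borel_measurable K"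
  shows "(\<lambda>x. \<psi> (f x) (h x)) \<in> borel_measurable K"
  using measurable_compose[OF borel_measurable_Pair[OF assms(2,3)] borel_measurable_continuous_onI[OF assms(1)]] by simp

lemma borel_measurable_vec_nth [measurable (raw)]:
  assumes "f \<in> borel_measurable N"
  shows "(\<lambda>x. (f x :: 'b::real_normed_vector^'n) $ i) \<in> borel_measurable N"
  by (rule measurable_compose[OF assms borel_measurable_continuous_onI]) (intro continuous_intros)

lemma borel_measurable_det [measurable (raw)]:
  assumes "f \<in> borel_measurable N"
  shows "(\<lambda>x. det (f x :: real^'n^'n)) \<in> borel_measurable N"
  by (rule measurable_compose[OF assms borel_measurable_continuous_onI]) (intro continuous_intros)

lemma continuous_on_matrix_vector_mult [continuous_intros]:
  fixes A :: "'a::topological_space \<Rightarrow> real^'n^'m"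
  assumes "continuous_on S A" "continuous_on S b"
  shows "continuous_on S (\<lambda>x. A x *v b x)"
  unfolding matrix_vector_mult_def by (intro continuous_intros assms)

lemma borel_measurable_matrix_vector_mult [measurable (raw)]:
  fixes A :: "'a \<Rightarrow> real^'n^'m"
  assumes [measurable]: "A \<in> borel_measurable N" "b \<in> borel_measurable N"
  shows "(\<lambda>x. A x *v b x) \<in> borel_measurable N"
  by (rule borel_measurable_vecI) (simp add: matrix_vector_mult_def)

text \<open>Cramer's rule: an expression for the solution of a linear system which is evidently continuous and measurable
  in matrix and right-hand side.\<close>

definition solve :: "real^'n^'n \<Rightarrow> real^'n \<Rightarrow> real^'n" where
  "solve A b = (\<chi> k. det (\<chi> i j. if j = k then b $ i else A $ i $ j) / det A)"

lemma solve_iff: "det A \<noteq> 0 \<Longrightarrow> A *v x = b \<longleftrightarrow> x = solve A b"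
  unfolding solve_def by (rule cramer)

lemma mult_solve: "det A \<noteq> 0 \<Longrightarrow> A *v solve A b = b"
  using solve_iff by blast

lemma continuous_on_solve [continuous_intros]:
  fixes A :: "'a::topological_space \<Rightarrow> real^'n^'n"
  assumes A: "continuous_on S A" and b: "continuous_on S b" and nz: "\<And>x. x \<in> S \<Longrightarrow> det (A x) \<noteq> 0"
  shows "continuous_on S (\<lambda>x. solve (A x) (b x))"
proof -
  have "continuous_on S (\<lambda>x. if j = k then b x $ i else A x $ i $ j)" for i j k
    by (cases "j = k") (simp_all add: continuous_on_component A b)
  then show ?thesis unfolding solve_def using nz
    by (intro continuous_intros A) auto
qed

lemma borel_measurable_solve [measurable (raw)]:
  fixes A :: "'a \<Rightarrow> real^'n^'n"
  assumes [measurable]: "A \<in> borel_measurable N" "b \<in> borel_measurable N"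
  shows "(\<lambda>x. solve (A x) (b x)) \<in> borel_measurable N"
proof -
  have "(\<lambda>x. if j = k then b x $ i else A x $ i $ j) \<in> borel_measurable N" for i j k
    by (cases "j = k") simp_all
  then have "(\<lambda>x. \<chi> i j. if j = k then b x $ i else A x $ i $ j) \<in> borel_measurable N" for k
    by (intro borel_measurable_matI) simp
  then show ?thesis
    by (intro borel_measurable_vecI) (simp add: solve_def borel_measurable_det borel_measurable_divide)
qed

lemma solve_matrix:
  assumes nz: "det (A :: real^'n^'n) \<noteq> 0"
  obtains C where "C ** A = mat 1" "A ** C = mat 1" "\<And>b. solve A b = C *v b" "det C = 1 / det A"
proof -
  obtain C where C: "C ** A = mat 1" "A ** C = mat 1"
    using nz by (metis invertible_det_nz invertible_def)
  have "solve A b = C *v b" for b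
    using C solve_iff[OF nz, of "C *v b" b] by (simp add: matrix_vector_mul_assoc)
  moreover have "det C = 1 / det A"
    using C(1) nz det_mul[of C A] by (simp add: det_I field_simps)
  ultimately show ?thesis using C that by blast
qed

text \<open>At a zero of \<open>k\<close> continuity of the other factor is enough.\<close>

lemma has_derivative_mult_vanishing:
  fixes c k :: "'a::real_normed_vector \<Rightarrow> real"
  assumes c: "isCont c s" and k: "(k has_derivative k') (at s)" and 0: "k s = 0"
  shows "((\<lambda>t. c t * k t) has_derivative (\<lambda>v. c s * k' v)) (at s)"
proof -
  have bl: "bounded_linear k'" using k by (rule has_derivative_bounded_linear)
  obtain K where K: "\<And>v. norm (k' v) \<le> norm v * K" "K > 0"
    using bounded_linear.pos_bounded[OF bl] by auto
  have lim: "((\<lambda>t. norm (k t - k s - k' (t - s)) / norm (t - s)) \<longlongrightarrow> 0) (at s)"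
    using k by (simp add: has_derivative_iff_norm)
  have cz: "((\<lambda>t. c t - c s) \<longlongrightarrow> 0) (at s)" using c by (simp add: isCont_def LIM_zero)
  have "((\<lambda>t. \<bar>c t - c s\<bar> * (norm (k t - k s - k' (t - s)) / norm (t - s) + K)) \<longlongrightarrow> 0 * (0 + K)) (at s)"
    by (intro tendsto_intros lim tendsto_rabs_zero cz)
  then have lim2: "((\<lambda>t. \<bar>c t - c s\<bar> * (norm (k t - k s - k' (t - s)) / norm (t - s) + K)) \<longlongrightarrow> 0) (at s)" by simp
  have "((\<lambda>t. norm ((c t - c s) * k t - (c s - c s) * k s - 0) / norm (t - s)) \<longlongrightarrow> 0) (at s)"
  proof (rule tendsto_sandwich[OF _ _ tendsto_const lim2])
    show "\<forall>\<^sub>F t in at s. norm ((c t - c s) * k t - (c s - c s) * k s - 0) / norm (t - s)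
        \<le> \<bar>c t - c s\<bar> * (norm (k t - k s - k' (t - s)) / norm (t - s) + K)"
      unfolding eventually_at_filter
    proof (intro always_eventually allI impI)
      fix t assume "t \<noteq> s"
      then have p: "norm (t - s) > 0" by simp
      have "norm (k t) \<le> norm (k t - k s - k' (t - s)) + norm (k' (t - s))"
        using norm_triangle_ineq[of "k t - k s - k' (t - s)" "k' (t - s)"] 0 by simp
      also have "\<dots> \<le> norm (k t - k s - k' (t - s)) + norm (t - s) * K" using K(1) by simp
      finally have "norm (k t) / norm (t - s) \<le> norm (k t - k s - k' (t - s)) / norm (t - s) + K"
        using p by (simp add: field_simps)
      then have "\<bar>c t - c s\<bar> * (norm (k t) / norm (t - s)) \<le> \<bar>c t - c s\<bar> * (norm (k t - k s - k' (t - s)) / norm (t - s) + K)"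
        by (rule mult_left_mono) simp
      then show "norm ((c t - c s) * k t - (c s - c s) * k s - 0) / norm (t - s)
        \<le> \<bar>c t - c s\<bar> * (norm (k t - k s - k' (t - s)) / norm (t - s) + K)" by (simp add: abs_mult)
    qed
  qed auto
  then have "((\<lambda>t. (c t - c s) * k t) has_derivative (\<lambda>_. 0)) (at s)"
    by (simp add: has_derivative_iff_norm)
  from has_derivative_add[OF has_derivative_mult_right[OF k, of "c s"] this]
  show ?thesis by (simp add: algebra_simps)
qed

lemma has_derivative_vecI:
  assumes "\<And>i. ((\<lambda>x. f x $ i) has_derivative (\<lambda>v. f' v $ i)) (at s)"
  shows "((f :: 'a::real_normed_vector \<Rightarrow> real^'n) has_derivative f') (at s)"
  unfolding has_derivative_componentwise_within[of f]
  using assms by (auto simp: Basis_vec_def inner_axis)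

lemma has_derivative_matrix_mult_vanishing:
  fixes C :: "'a::real_normed_vector \<Rightarrow> real^'n^'m" and k :: "'a \<Rightarrow> real^'n"
  assumes C: "isCont C s" and k: "(k has_derivative k') (at s)" and 0: "k s = 0"
  shows "((\<lambda>t. C t *v k t) has_derivative (\<lambda>v. C s *v k' v)) (at s)"
proof (rule has_derivative_vecI)
  fix i
  have kj: "((\<lambda>t. k t $ j) has_derivative (\<lambda>v. k' v $ j)) (at s)" for j
    by (rule bounded_linear.has_derivative[OF bounded_linear_vec_nth k])
  have Cij: "isCont (\<lambda>t. C t $ i $ j) s" for j
    using C by (intro continuous_intros)
  show "((\<lambda>t. (C t *v k t) $ i) has_derivative (\<lambda>v. (C s *v k' v) $ i)) (at s)"
    unfolding matrix_vector_mult_def vec_lambda_beta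
    by (intro has_derivative_sum has_derivative_mult_vanishing Cij kj) (simp add: 0)
qed

text \<open>The solution at \<open>t\<close> differs from the solution at \<open>s\<close> by the inverse of \<open>A t\<close> applied to the residual of
  the old solution in the new system. The residual vanishes at \<open>s\<close>, so the inverse contributes only its value at \<open>s\<close>.\<close>

lemma has_derivative_solve:
  fixes A :: "real^'n \<Rightarrow> real^'n^'n" and g :: "real^'n \<Rightarrow> real^'n"
  assumes D: "open D" "s \<in> D" and nz: "\<And>t. t \<in> D \<Longrightarrow> det (A t) \<noteq> 0"
    and contA: "continuous_on UNIV A"
    and g: "(g has_derivative (\<lambda>v. H *v v)) (at s)"
    and A: "((\<lambda>t. A t *v solve (A s) (- g s)) has_derivative (\<lambda>v. B *v v)) (at s)"
  shows "((\<lambda>t. solve (A t) (- g t)) has_derivative (\<lambda>v. - solve (A s) ((H + B) *v v))) (at s)"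
proof -
  let ?G = "\<lambda>t. solve (A t) (- g t)"
  define k where "k t = - g t - A t *v ?G s" for t
  define C where "C t = (\<chi> i j. solve (A t) (axis j 1) $ i)" for t
  have CA: "C t *v b = solve (A t) b" if t: "t \<in> D" for t b
  proof -
    obtain C' where C': "\<And>b. solve (A t) b = C' *v b" using solve_matrix[OF nz[OF t]] by metis
    have "C t = C'" unfolding C_def C'
      by (simp add: vec_eq_iff matrix_vector_mult_def axis_def if_distrib[of "\<lambda>x. _ * x"] cong: if_cong)
    then show ?thesis by (simp add: C')
  qed
  have ad: "solve (A t) (b + c) = solve (A t) b + solve (A t) c" if "t \<in> D" for t b c
    using CA[OF that] by (metis matrix_vector_right_distrib)
  have mn: "solve (A t) (- b) = - solve (A t) b" if t: "t \<in> D" for t b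
    using solve_matrix[OF nz[OF t]] by (metis (no_types, lifting) scaleR_minus1_left matrix_vector_mult_scaleR)
  have "continuous_on D C" unfolding C_def using contA nz
    by (intro continuous_intros) (auto intro: continuous_on_subset)
  then have contC: "isCont C s" using D by (simp add: continuous_on_eq_continuous_at)
  have ks: "k s = 0" using mult_solve[OF nz[OF D(2)], of "- g s"] by (simp add: k_def)
  have kd: "(k has_derivative (\<lambda>v. - (H *v v) - B *v v)) (at s)"
    unfolding k_def by (intro has_derivative_diff has_derivative_minus g A)
  have "((\<lambda>t. C t *v k t + ?G s) has_derivative (\<lambda>v. C s *v (- (H *v v) - B *v v))) (at s)"
    using has_derivative_add[OF has_derivative_matrix_mult_vanishing[OF contC kd ks] has_derivative_const[of "?G s"]] by simp
  then have "(?G has_derivative (\<lambda>v. C s *v (- (H *v v) - B *v v))) (at s)"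
  proof (rule has_derivative_transform_within_open[OF _ D])
    fix t assume t: "t \<in> D"
    have "C t *v k t = solve (A t) (- g t + - (A t *v ?G s))" using CA[OF t] by (simp add: k_def)
    also have "\<dots> = ?G t - solve (A t) (A t *v ?G s)" by (simp only: ad[OF t] mn[OF t]) simp
    also have "solve (A t) (A t *v ?G s) = ?G s" using solve_iff[OF nz[OF t]] by metis
    finally show "C t *v k t + ?G s = ?G t" by simp
  qed
  moreover have "C s *v (- (H *v v) - B *v v) = - solve (A s) ((H + B) *v v)" for v
  proof -
    have "- (H *v v) - B *v v = - ((H + B) *v v)" by (simp add: matrix_vector_mult_add_rdistrib)
    then show ?thesis using CA[OF D(2)] mn[OF D(2)] by simp
  qed
  ultimately show ?thesis by simp
qed

section \<open>A Kac--Rice formula for a field with an independent finite-dimensional part\<close>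

text \<open>The field \<open>x0 \<omega> t + a t (Y \<omega>)\<close>: all information about \<open>x0\<close> is contained in the \<open>\<sigma>\<close>-algebra \<open>N\<close>, and \<open>Y\<close> has
  density \<open>p\<close> and is independent of \<open>N\<close>. Gradient and Hessian of \<open>x0\<close> are \<open>g0\<close> and \<open>H0\<close>, those of the
  second summand are \<open>A t *v y\<close> and \<open>B t y\<close>. At a point of \<open>D\<close> the gradient takes every prescribed value for exactly one value of \<open>Y\<close>.\<close>

locale split_field = prob_space M
  for M :: "'w measure" +
  fixes N :: "'w measure"
    and x0 :: "'w \<Rightarrow> real^'n \<Rightarrow> real" and g0 :: "'w \<Rightarrow> real^'n \<Rightarrow> real^'n" and H0 :: "'w \<Rightarrow> real^'n \<Rightarrow> real^'n^'n"
    and Y :: "'w \<Rightarrow> real^'n" and p :: "real^'n \<Rightarrow> real"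
    and a :: "real^'n \<Rightarrow> real^'n \<Rightarrow> real" and A :: "real^'n \<Rightarrow> real^'n^'n" and B :: "real^'n \<Rightarrow> real^'n \<Rightarrow> real^'n^'n"
    and D :: "(real^'n) set"
  assumes space_N: "space N = space M" and sets_N: "sets N \<subseteq> sets M"
    and x0_meas: "\<And>t. (\<lambda>\<omega>. x0 \<omega> t) \<in> borel_measurable N"
    and g0_meas: "\<And>t. (\<lambda>\<omega>. g0 \<omega> t) \<in> borel_measurable N"
    and H0_meas: "\<And>t. (\<lambda>\<omega>. H0 \<omega> t) \<in> borel_measurable N"
    and x0_cont: "\<And>\<omega>. \<omega> \<in> space M \<Longrightarrow> continuous_on UNIV (x0 \<omega>)"
    and g0_deriv: "\<And>\<omega> t. \<omega> \<in> space M \<Longrightarrow> (g0 \<omega> has_derivative (\<lambda>v. H0 \<omega> t *v v)) (at t)"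
    and H0_cont: "\<And>\<omega>. \<omega> \<in> space M \<Longrightarrow> continuous_on UNIV (H0 \<omega>)"
    and indep: "indep_pair M N (\<lambda>\<omega>. \<omega>) borel Y"
    and Y_dist: "distributed M lborel Y (\<lambda>y. ennreal (p y))" and p_nonneg: "\<And>y. 0 \<le> p y"
    and p_meas [measurable]: "p \<in> borel_measurable borel"
    and a_cont: "continuous_on UNIV (\<lambda>(t, y). a t y)"
    and A_cont: "continuous_on UNIV A"
    and A_deriv: "\<And>t y. ((\<lambda>t. A t *v y) has_derivative (\<lambda>v. B t y *v v)) (at t)"
    and B_cont: "continuous_on UNIV (\<lambda>(t, y). B t y)"
    and D_open: "open D" and A_nz: "\<And>t. t \<in> D \<Longrightarrow> det (A t) \<noteq> 0"
begin

text \<open>The value of the finite-dimensional part which produces a critical point at \<open>t\<close>.\<close>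

definition G :: "'w \<Rightarrow> real^'n \<Rightarrow> real^'n" where "G \<omega> t = solve (A t) (- g0 \<omega> t)"

abbreviation xv :: "'w \<Rightarrow> real^'n \<Rightarrow> real^'n \<Rightarrow> real" where "xv \<omega> t y \<equiv> x0 \<omega> t + a t y"
abbreviation gv :: "'w \<Rightarrow> real^'n \<Rightarrow> real^'n \<Rightarrow> real^'n" where "gv \<omega> t y \<equiv> g0 \<omega> t + A t *v y"
abbreviation Hv :: "'w \<Rightarrow> real^'n \<Rightarrow> real^'n \<Rightarrow> real^'n^'n" where "Hv \<omega> t y \<equiv> H0 \<omega> t + B t y"

lemma gv_eq_0_iff: "t \<in> D \<Longrightarrow> gv \<omega> t y = 0 \<longleftrightarrow> G \<omega> t = y"
  using solve_iff[OF A_nz, of t y "- g0 \<omega> t"] unfolding G_def by (auto simp: add_eq_0_iff)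

lemma g0_cont: "\<omega> \<in> space M \<Longrightarrow> continuous_on UNIV (g0 \<omega>)"
  using g0_deriv by (meson continuous_at_imp_continuous_on has_derivative_continuous)

lemma G_cont: "\<omega> \<in> space M \<Longrightarrow> continuous_on D (G \<omega>)"
  unfolding G_def[abs_def] using A_nz
  by (intro continuous_intros continuous_on_subset[OF A_cont] continuous_on_subset[OF g0_cont]) auto

lemmas a_cont' = continuous_on_compose_pair[OF a_cont]
  and B_cont' = continuous_on_compose_pair[OF B_cont]
  and measurable_a [measurable (raw)] = borel_measurable_compose_pair[OF a_cont]
  and measurable_B [measurable (raw)] = borel_measurable_compose_pair[OF B_cont]

lemma measurable_A [measurable]: "A \<in> borel_measurable borel"
  by (rule borel_measurable_continuous_onI[OF A_cont])

lemma x0_joint [measurable]: "(\<lambda>p. x0 (fst p) (snd p)) \<in> borel_measurable (N \<Otimes>\<^sub>M borel)"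
  using measurable_continuous_field[where F=x0 and N=N, OF x0_meas] x0_cont space_N by (simp add: case_prod_beta)
lemma g0_joint [measurable]: "(\<lambda>p. g0 (fst p) (snd p)) \<in> borel_measurable (N \<Otimes>\<^sub>M borel)"
  using measurable_continuous_field[where F=g0 and N=N, OF g0_meas] g0_cont space_N by (simp add: case_prod_beta)
lemma H0_joint [measurable]: "(\<lambda>p. H0 (fst p) (snd p)) \<in> borel_measurable (N \<Otimes>\<^sub>M borel)"
  using measurable_continuous_field[where F=H0 and N=N, OF H0_meas] H0_cont space_N by (simp add: case_prod_beta)

lemma G_joint [measurable]: "(\<lambda>p. G (fst p) (snd p)) \<in> borel_measurable (N \<Otimes>\<^sub>M borel)"
  unfolding G_def by measurable

text \<open>Implicit differentiation of \<open>g0 \<omega> t + A t *v G \<omega> t = 0\<close>.\<close>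

lemma G_deriv:
  assumes \<omega>: "\<omega> \<in> space M" and t: "t \<in> D"
  shows "(G \<omega> has_derivative (\<lambda>v. - solve (A t) (Hv \<omega> t (G \<omega> t) *v v))) (at t)"
  unfolding G_def[abs_def]
  by (rule has_derivative_solve[OF D_open t A_nz A_cont g0_deriv[OF \<omega>]])
     (use A_deriv in \<open>auto simp: G_def\<close>)

lemma G_deriv_matrix:
  assumes \<omega>: "\<omega> \<in> space M"
  obtains DG where "\<And>t. t \<in> D \<Longrightarrow> (G \<omega> has_derivative (\<lambda>v. DG t *v v)) (at t)"
    "continuous_on D DG" "\<And>t. t \<in> D \<Longrightarrow> \<bar>det (DG t)\<bar> = \<bar>det (Hv \<omega> t (G \<omega> t))\<bar> / \<bar>det (A t)\<bar>"
proof -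
  define DG where "DG t = (\<chi> i j. (- solve (A t) (Hv \<omega> t (G \<omega> t) *v axis j 1)) $ i)" for t
  have *: "DG t *v v = - solve (A t) (Hv \<omega> t (G \<omega> t) *v v) \<and> \<bar>det (DG t)\<bar> = \<bar>det (Hv \<omega> t (G \<omega> t))\<bar> / \<bar>det (A t)\<bar>"
    if t: "t \<in> D" for t v
  proof -
    obtain C where C: "\<And>b. solve (A t) b = C *v b" "det C = 1 / det (A t)"
      using solve_matrix[OF A_nz[OF t]] by metis
    have "DG t = - (C ** Hv \<omega> t (G \<omega> t))"
    proof -
      have "(C *v (Hv \<omega> t (G \<omega> t) *v axis j 1)) $ i = (C ** Hv \<omega> t (G \<omega> t)) $ i $ j" for i j
        by (simp only: matrix_vector_mul_assoc matrix_vector_mul_component inner_axis) (simp add: inner_axis)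
      then show ?thesis unfolding DG_def C(1) by (simp add: vec_eq_iff)
    qed
    moreover have "\<bar>det (- K)\<bar> = \<bar>det K\<bar>" for K :: "real^'n^'n"
    proof -
      have "- K = (\<chi> i. (- 1) *s (K $ i))" by (simp add: vec_eq_iff)
      then show ?thesis using det_rows_mul[of "\<lambda>_. - 1" "\<lambda>i. K $ i"] by (simp add: abs_mult power_abs)
    qed
    ultimately show ?thesis
      using scaleR_matrix_vector_assoc[of "-1" "C ** Hv \<omega> t (G \<omega> t)" v]
      by (simp add: C det_mul abs_mult abs_divide matrix_vector_mul_assoc)
  qed
  have "continuous_on D DG"
    unfolding DG_def[abs_def] using A_nz \<omega>
    by (intro continuous_intros continuous_on_subset[OF A_cont] B_cont' G_cont continuous_on_subset[OF H0_cont]) auto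
  then show ?thesis using G_deriv[OF \<omega>] * that[of DG] by simp
qed

lemma nn_integral_indep:
  assumes F[measurable]: "(\<lambda>p. F (fst p) (snd p)) \<in> borel_measurable (N \<Otimes>\<^sub>M borel)"
  shows "(\<integral>\<^sup>+\<omega>. F \<omega> (Y \<omega>) \<partial>M) = (\<integral>\<^sup>+\<omega>. (\<integral>\<^sup>+y. ennreal (p y) * F \<omega> y \<partial>lborel) \<partial>M)"
proof -
  have id[measurable]: "(\<lambda>\<omega>. \<omega>) \<in> M \<rightarrow>\<^sub>M N"
    using space_N sets_N by (auto intro!: measurableI)
  have Ym[measurable]: "Y \<in> borel_measurable M" using Y_dist by (simp add: distributed_def)
  have Yd: "distr M borel Y = density lborel (\<lambda>y. ennreal (p y))"
    using Y_dist by (simp add: distributed_def cong: distr_cong)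
  interpret Q: prob_space "distr M borel Y" by (rule prob_space_distr) simp
  have pair: "distr M N (\<lambda>\<omega>. \<omega>) \<Otimes>\<^sub>M distr M borel Y = distr M (N \<Otimes>\<^sub>M borel) (\<lambda>\<omega>. (\<omega>, Y \<omega>))"
    using indep unfolding indep_pair_def by simp
  have "(\<integral>\<^sup>+\<omega>. F \<omega> (Y \<omega>) \<partial>M) = (\<integral>\<^sup>+q. F (fst q) (snd q) \<partial>distr M (N \<Otimes>\<^sub>M borel) (\<lambda>\<omega>. (\<omega>, Y \<omega>)))"
    by (subst nn_integral_distr) auto
  also have "\<dots> = (\<integral>\<^sup>+\<omega>. \<integral>\<^sup>+y. F \<omega> y \<partial>distr M borel Y \<partial>distr M N (\<lambda>\<omega>. \<omega>))"
    unfolding pair[symmetric] by (subst Q.nn_integral_fst[symmetric]) (auto cong: measurable_cong_sets)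
  also have "\<dots> = (\<integral>\<^sup>+\<omega>. \<integral>\<^sup>+y. F \<omega> y \<partial>distr M borel Y \<partial>M)"
    using Q.borel_measurable_nn_integral_fst[of "\<lambda>q. F (fst q) (snd q)" N]
    by (subst nn_integral_distr) (auto cong: measurable_cong_sets)
  also have "\<dots> = (\<integral>\<^sup>+\<omega>. (\<integral>\<^sup>+y. ennreal (p y) * F \<omega> y \<partial>lborel) \<partial>M)"
  proof (rule nn_integral_cong)
    fix \<omega> assume "\<omega> \<in> space M"
    then have "F \<omega> \<in> borel_measurable borel"
      using measurable_compose[OF measurable_Pair1'[of \<omega> N borel] F] space_N by simp
    then show "(\<integral>\<^sup>+y. F \<omega> y \<partial>distr M borel Y) = (\<integral>\<^sup>+y. ennreal (p y) * F \<omega> y \<partial>lborel)"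
      unfolding Yd by (subst nn_integral_density) auto
  qed
  finally show ?thesis .
qed

text \<open>For fixed \<open>\<omega>\<close>, a point \<open>t\<close> of \<open>D\<close> is critical when \<open>Y\<close> takes the value \<open>G \<omega> t\<close> and for no other value. The average over the
  values of \<open>Y\<close> of the number of critical points is therefore given by the area formula for \<open>G \<omega>\<close>.
  The condition \<open>\<psi> > 0\<close> is open and restricts to points where \<open>G \<omega>\<close> is a local diffeomorphism.\<close>

lemma expected_count_local:
  fixes \<psi> :: "real \<Rightarrow> real^'n^'n \<Rightarrow> real"
  assumes V: "fsigma_in euclidean V" "V \<subseteq> D"
    and \<psi>: "continuous_on UNIV (\<lambda>(x, h). \<psi> x h)"
    and nd: "\<And>x h. \<psi> x h > 0 \<Longrightarrow> det h \<noteq> 0"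
  shows "(\<integral>\<^sup>+\<omega>. emeasure (count_space UNIV) {t\<in>V. gv \<omega> t (Y \<omega>) = 0 \<and> \<psi> (xv \<omega> t (Y \<omega>)) (Hv \<omega> t (Y \<omega>)) > 0} \<partial>M) =
    (\<integral>\<^sup>+t. (\<integral>\<^sup>+\<omega>. ennreal (p (G \<omega> t) * (\<bar>det (Hv \<omega> t (G \<omega> t))\<bar> / \<bar>det (A t)\<bar>) *
        of_bool (\<psi> (xv \<omega> t (G \<omega> t)) (Hv \<omega> t (G \<omega> t)) > 0)) \<partial>M) * indicator V t \<partial>lborel)"
proof -
  note \<psi>' = continuous_on_compose_pair[OF \<psi>]
    and [measurable (raw)] = borel_measurable_compose_pair[OF \<psi>]
  have [measurable]: "V \<in> sets borel" using V(1) by (rule fsigma_imp_borel)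
  note [measurable] = x0_meas g0_meas H0_meas
  define F where "F \<omega> y = emeasure (count_space UNIV) {t\<in>V. gv \<omega> t y = 0 \<and> \<psi> (xv \<omega> t y) (Hv \<omega> t y) > 0}" for \<omega> y
  have Fm: "(\<lambda>q. F (fst q) (snd q)) \<in> borel_measurable (N \<Otimes>\<^sub>M borel)"
  proof -
    have "(\<lambda>q. emeasure (count_space UNIV) {t\<in>V. norm (gv (fst q) t (snd q)) = 0 \<and> \<psi> (xv (fst q) t (snd q)) (Hv (fst q) t (snd q)) > 0})
        \<in> borel_measurable (N \<Otimes>\<^sub>M borel)"
    proof (rule measurable_zero_count[OF V(1)])
      fix q assume "q \<in> space (N \<Otimes>\<^sub>M (borel :: (real^'n) measure))"
      then have q: "fst q \<in> space M" by (simp add: space_pair_measure mem_Times_iff space_N)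
      show "continuous_on V (\<lambda>t. norm (gv (fst q) t (snd q)))"
        by (intro continuous_intros continuous_on_subset[OF g0_cont[OF q]] continuous_on_subset[OF A_cont]) auto
      show "continuous_on V (\<lambda>t. \<psi> (xv (fst q) t (snd q)) (Hv (fst q) t (snd q)))"
        by (intro \<psi>' continuous_intros a_cont' B_cont' continuous_on_subset[OF x0_cont[OF q]] continuous_on_subset[OF H0_cont[OF q]]) auto
    qed measurable
    then show ?thesis by (simp add: F_def)
  qed
  define K where "K \<omega> t = p (G \<omega> t) * (\<bar>det (Hv \<omega> t (G \<omega> t))\<bar> / \<bar>det (A t)\<bar>) *
        of_bool (\<psi> (xv \<omega> t (G \<omega> t)) (Hv \<omega> t (G \<omega> t)) > 0)" for \<omega> t
  have inner: "(\<integral>\<^sup>+y. ennreal (p y) * F \<omega> y \<partial>lborel) = (\<integral>\<^sup>+t. ennreal (K \<omega> t) * indicator V t \<partial>lborel)"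
    if \<omega>: "\<omega> \<in> space M" for \<omega>
  proof -
    obtain DG where DG: "\<And>t. t \<in> D \<Longrightarrow> (G \<omega> has_derivative (\<lambda>v. DG t *v v)) (at t)"
      "continuous_on D DG" "\<And>t. t \<in> D \<Longrightarrow> \<bar>det (DG t)\<bar> = \<bar>det (Hv \<omega> t (G \<omega> t))\<bar> / \<bar>det (A t)\<bar>"
      using G_deriv_matrix[OF \<omega>] by blast
    define W where "W = {t\<in>D. \<psi> (xv \<omega> t (G \<omega> t)) (Hv \<omega> t (G \<omega> t)) > 0}"
    have c: "continuous_on D (\<lambda>t. \<psi> (xv \<omega> t (G \<omega> t)) (Hv \<omega> t (G \<omega> t)))"
      by (intro \<psi>' continuous_intros a_cont' B_cont' continuous_on_subset[OF x0_cont[OF \<omega>]]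
          continuous_on_subset[OF H0_cont[OF \<omega>]] G_cont \<omega>) auto
    have W: "open W" unfolding W_def using continuous_open_preimage[OF c D_open open_greaterThan[of 0]]
      by (simp add: vimage_def Int_def)
    then have [measurable]: "W \<in> sets borel" by simp
    have Feq: "F \<omega> y = emeasure (count_space UNIV) {t\<in>V \<inter> W. G \<omega> t = y}" for y
      unfolding F_def W_def using V(2) gv_eq_0_iff by (intro arg_cong[where f="emeasure _"]) auto
    have VW: "V \<inter> W \<in> sets borel" by measurable
    have WD: "W \<subseteq> D" by (auto simp: W_def)
    have nz: "det (DG t) \<noteq> 0" if "t \<in> W" for t
      using that DG(3)[of t] nd A_nz[of t] unfolding W_def by auto
    have "(\<integral>\<^sup>+y. ennreal (p y) * F \<omega> y \<partial>lborel) =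
        (\<integral>\<^sup>+t. ennreal (p (G \<omega> t)) * ennreal \<bar>det (DG t)\<bar> * indicator (V \<inter> W) t \<partial>lborel)"
      unfolding Feq
    proof (rule area_formula[OF W VW _ _ _ nz])
      show "(G \<omega> has_derivative (*v) (DG t)) (at t)" if "t \<in> W" for t using DG(1) WD that by blast
      show "continuous_on W DG" by (rule continuous_on_subset[OF DG(2) WD])
    qed simp_all
    also have "\<dots> = (\<integral>\<^sup>+t. ennreal (K \<omega> t) * indicator V t \<partial>lborel)"
      using V(2) DG(3) p_nonneg
      by (intro nn_integral_cong) (auto simp: K_def W_def simp flip: ennreal_mult split: split_indicator)
    finally show ?thesis .
  qed
  have Km: "(\<lambda>q. ennreal (K (fst q) (snd q)) * indicator V (snd q)) \<in> borel_measurable (N \<Otimes>\<^sub>M borel)"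
    unfolding K_def by measurable
  have id[measurable]: "(\<lambda>\<omega>. \<omega>) \<in> M \<rightarrow>\<^sub>M N"
    using space_N sets_N by (auto intro!: measurableI)
  have Km': "(\<lambda>(\<omega>, t). ennreal (K \<omega> t) * indicator V t) \<in> borel_measurable (M \<Otimes>\<^sub>M lborel)"
  proof -
    have "(\<lambda>q. (fst q, snd q)) \<in> M \<Otimes>\<^sub>M lborel \<rightarrow>\<^sub>M N \<Otimes>\<^sub>M borel"
      by (intro measurable_Pair measurable_compose[OF measurable_fst id]) simp
    from measurable_compose[OF this Km] show ?thesis by (simp add: case_prod_beta)
  qed
  interpret pair_sigma_finite M lborel ..
  have "(\<integral>\<^sup>+\<omega>. F \<omega> (Y \<omega>) \<partial>M) = (\<integral>\<^sup>+\<omega>. (\<integral>\<^sup>+t. ennreal (K \<omega> t) * indicator V t \<partial>lborel) \<partial>M)"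
    unfolding nn_integral_indep[OF Fm] by (rule nn_integral_cong) (rule inner)
  also have "\<dots> = (\<integral>\<^sup>+t. (\<integral>\<^sup>+\<omega>. ennreal (K \<omega> t) * indicator V t \<partial>M) \<partial>lborel)"
    by (rule Fubini'[symmetric, OF Km'])
  also have "\<dots> = (\<integral>\<^sup>+t. (\<integral>\<^sup>+\<omega>. ennreal (K \<omega> t) \<partial>M) * indicator V t \<partial>lborel)"
    by (intro nn_integral_cong) (auto split: split_indicator)
  finally show ?thesis unfolding F_def K_def .
qed

text \<open>A degenerate critical point makes \<open>Y\<close> a critical value of \<open>G \<omega>\<close>. By Sard's theorem these values are negligible, and
  \<open>Y\<close> has a density.\<close>

lemma AE_no_degenerate_local:
  assumes V: "fsigma_in euclidean V" "V \<subseteq> D"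
  shows "AE \<omega> in M. \<not> (\<exists>t\<in>V. gv \<omega> t (Y \<omega>) = 0 \<and> det (Hv \<omega> t (Y \<omega>)) = 0)"
proof -
  note [measurable] = x0_meas g0_meas H0_meas
  let ?P = "\<lambda>\<omega> y. \<exists>t\<in>V. gv \<omega> t y = 0 \<and> det (Hv \<omega> t y) = 0"
  have id[measurable]: "(\<lambda>\<omega>. \<omega>) \<in> M \<rightarrow>\<^sub>M N"
    using space_N sets_N by (auto intro!: measurableI)
  have Ym[measurable]: "Y \<in> borel_measurable M" using Y_dist by (simp add: distributed_def)
  have "{q\<in>space (N \<Otimes>\<^sub>M borel). \<exists>t\<in>V. norm (gv (fst q) t (snd q)) + \<bar>det (Hv (fst q) t (snd q))\<bar> = 0 \<and> (1::real) > 0}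
      \<in> sets (N \<Otimes>\<^sub>M borel)"
  proof (rule sets_exists_zero[OF V(1)])
    fix q assume "q \<in> space (N \<Otimes>\<^sub>M (borel :: (real^'n) measure))"
    then have q: "fst q \<in> space M" by (simp add: space_pair_measure mem_Times_iff space_N)
    show "continuous_on V (\<lambda>t. norm (gv (fst q) t (snd q)) + \<bar>det (Hv (fst q) t (snd q))\<bar>)"
      by (intro continuous_intros B_cont' continuous_on_subset[OF g0_cont[OF q]] continuous_on_subset[OF A_cont]
          continuous_on_subset[OF H0_cont[OF q]]) auto
  qed measurable
  moreover have "(norm u + \<bar>r\<bar> = 0 \<and> (1::real) > 0) = (u = 0 \<and> r = 0)" for u :: "real^'n" and r :: real
    by (simp add: add_nonneg_eq_0_iff)
  ultimately have Pm[measurable]: "Measurable.pred (N \<Otimes>\<^sub>M borel) (\<lambda>q. ?P (fst q) (snd q))"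
    by (simp add: pred_def)
  have "(\<integral>\<^sup>+\<omega>. of_bool (?P \<omega> (Y \<omega>)) \<partial>M) = (\<integral>\<^sup>+\<omega>. (\<integral>\<^sup>+y. ennreal (p y) * of_bool (?P \<omega> y) \<partial>lborel) \<partial>M)"
    by (rule nn_integral_indep) measurable
  also have "\<dots> = (\<integral>\<^sup>+\<omega>. 0 \<partial>M)"
  proof (rule nn_integral_cong)
    fix \<omega> assume \<omega>: "\<omega> \<in> space M"
    obtain DG where DG: "\<And>t. t \<in> D \<Longrightarrow> (G \<omega> has_derivative (\<lambda>v. DG t *v v)) (at t)"
      "\<And>t. t \<in> D \<Longrightarrow> \<bar>det (DG t)\<bar> = \<bar>det (Hv \<omega> t (G \<omega> t))\<bar> / \<bar>det (A t)\<bar>"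
      using G_deriv_matrix[OF \<omega>] by metis
    have "negligible (G \<omega> ` {t\<in>D. det (DG t) = 0})"
      by (rule Sard_same_dimension[where f'="\<lambda>t. (*v) (DG t)"])
         (auto intro!: has_derivative_at_withinI DG(1))
    moreover have "{y. ?P \<omega> y} \<subseteq> G \<omega> ` {t\<in>D. det (DG t) = 0}"
      using gv_eq_0_iff V(2) DG(2) by fastforce
    ultimately have "negligible {y. ?P \<omega> y}" by (rule negligible_subset)
    then have "AE y in lebesgue. \<not> ?P \<omega> y"
      unfolding negligible_iff_null_sets by (drule_tac AE_not_in) simp
    then have "AE y in lborel. \<not> ?P \<omega> y" by (simp add: AE_completion_iff)
    then have "(\<integral>\<^sup>+y. ennreal (p y) * of_bool (?P \<omega> y) \<partial>lborel) = (\<integral>\<^sup>+(y::real^'n). 0 \<partial>lborel)"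
      by (intro nn_integral_cong_AE) auto
    then show "(\<integral>\<^sup>+y. ennreal (p y) * of_bool (?P \<omega> y) \<partial>lborel) = 0" by simp
  qed
  finally have z: "(\<integral>\<^sup>+\<omega>. of_bool (?P \<omega> (Y \<omega>)) \<partial>M) = 0" by simp
  have [measurable]: "Measurable.pred M (\<lambda>\<omega>. ?P \<omega> (Y \<omega>))"
  proof -
    have "(\<lambda>\<omega>. (\<omega>, Y \<omega>)) \<in> M \<rightarrow>\<^sub>M N \<Otimes>\<^sub>M borel" by measurable
    from measurable_compose[OF this Pm] show ?thesis by simp
  qed
  have "AE \<omega> in M. of_bool (?P \<omega> (Y \<omega>)) = (0::ennreal)"
    using z by (subst (asm) nn_integral_0_iff_AE) auto
  then show ?thesis by eventually_elim (simp add: of_bool_def split: if_splits)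
qed

text \<open>Let \<open>y \<omega> u\<close> be the value of \<open>Y\<close> for which the gradient at \<open>t\<close> equals \<open>u\<close>, so that \<open>y \<omega> 0 = G \<omega> t\<close>. Substituting
  \<open>Y = y \<omega> u\<close>, the left-hand side with \<open>y \<omega> u\<close> in place of \<open>G \<omega> t\<close> is a density of the measure
  \<open>U \<mapsto> E(w; gradient at t lies in U)\<close>. By independence the same measure has density \<open>u \<mapsto> q u * E w\<close>. Both densities are
  continuous in \<open>u\<close>, the first one by dominated convergence since \<open>p\<close> and \<open>w\<close> are bounded, so
  they agree at \<open>u = 0\<close> too.\<close>

lemma slice_identity:
  fixes w :: "real \<Rightarrow> real^'n^'n \<Rightarrow> real"
  assumes t: "t \<in> D"
    and ind: "indep_pair M borel (\<lambda>\<omega>. gv \<omega> t (Y \<omega>)) borel (\<lambda>\<omega>. (xv \<omega> t (Y \<omega>), Hv \<omega> t (Y \<omega>)))"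
    and q: "distributed M lborel (\<lambda>\<omega>. gv \<omega> t (Y \<omega>)) (\<lambda>u. ennreal (q u))" "\<And>u. 0 \<le> q u" "continuous_on UNIV q"
    and p: "continuous_on UNIV p" "\<And>y. p y \<le> Kp"
    and w: "continuous_on UNIV (\<lambda>(x, h). w x h)" "\<And>x h. 0 \<le> w x h" "\<And>x h. w x h \<le> Kw"
  shows "(\<integral>\<^sup>+\<omega>. ennreal (p (G \<omega> t) * w (xv \<omega> t (G \<omega> t)) (Hv \<omega> t (G \<omega> t)) / \<bar>det (A t)\<bar>) \<partial>M) =
    ennreal (q 0) * (\<integral>\<^sup>+\<omega>. ennreal (w (xv \<omega> t (Y \<omega>)) (Hv \<omega> t (Y \<omega>))) \<partial>M)"
proof -
  note [measurable] = x0_meas g0_meas H0_meas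
  have [measurable]: "q \<in> borel_measurable borel" using q(3) by (rule borel_measurable_continuous_onI)
  note [measurable (raw)] = borel_measurable_compose_pair[OF w(1)]
  have wm3[measurable]: "(\<lambda>z. w (fst z) (snd z)) \<in> borel_measurable borel"
    using borel_measurable_continuous_onI[OF w(1)] by (simp add: case_prod_unfold)
  have idM[measurable]: "(\<lambda>\<omega>. \<omega>) \<in> M \<rightarrow>\<^sub>M N"
    using space_N sets_N by (auto intro!: measurableI)
  have [measurable]: "(\<lambda>\<omega>. x0 \<omega> t) \<in> borel_measurable M" "(\<lambda>\<omega>. g0 \<omega> t) \<in> borel_measurable M"
    "(\<lambda>\<omega>. H0 \<omega> t) \<in> borel_measurable M"
    using measurable_compose[OF idM] x0_meas g0_meas H0_meas by blast+
  have Ym[measurable]: "Y \<in> borel_measurable M" using Y_dist by (simp add: distributed_def)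
  define d where "d = \<bar>det (A t)\<bar>"
  have d: "d > 0" using A_nz[OF t] by (simp add: d_def)
  obtain C where C: "C ** A t = mat 1" "A t ** C = mat 1" "\<And>b. solve (A t) b = C *v b" "det C = 1 / det (A t)"
    using solve_matrix[OF A_nz[OF t]] by metis
  define y where "y \<omega> u = C *v (u - g0 \<omega> t)" for \<omega> u
  have y0: "y \<omega> 0 = G \<omega> t" for \<omega> by (simp add: y_def G_def C(3))
  have gy: "gv \<omega> t (y \<omega> u) = u" for \<omega> u
    by (simp add: y_def matrix_vector_mul_assoc C(2))
  have yg: "y \<omega> u = v \<longleftrightarrow> u = gv \<omega> t v" for \<omega> u v
    using gy[of \<omega> u] by (auto simp: y_def matrix_vector_mul_assoc C(1))
  define k where "k \<omega> u = p (y \<omega> u) * w (xv \<omega> t (y \<omega> u)) (Hv \<omega> t (y \<omega> u)) / d" for \<omega> u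
  have k0: "0 \<le> k \<omega> u" for \<omega> u using p_nonneg w(2) d by (simp add: k_def)
  define Kb where "Kb = Kp * Kw / d"
  have kb: "k \<omega> u \<le> Kb" for \<omega> u
    unfolding k_def Kb_def using d p(2) w(2,3) p_nonneg
    by (intro divide_right_mono mult_mono) (auto intro: order_trans[OF p_nonneg])
  have km[measurable]: "(\<lambda>\<omega>. k \<omega> u) \<in> borel_measurable M" for u
    unfolding k_def y_def by measurable
  have ki: "integrable M (\<lambda>\<omega>. k \<omega> u)" for u
    by (rule integrable_const_bound[where B=Kb]) (use k0 kb in auto)
  define k1 where "k1 u = expectation (\<lambda>\<omega>. k \<omega> u)" for u
  have k1nn: "(\<integral>\<^sup>+\<omega>. ennreal (k \<omega> u) \<partial>M) = ennreal (k1 u)" for u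
    unfolding k1_def using ki k0 by (intro nn_integral_eq_integral) auto
  have kc: "continuous_on UNIV (k \<omega>)" for \<omega>
  proof -
    have yc: "continuous_on UNIV (y \<omega>)" unfolding y_def[abs_def] by (intro continuous_intros)
    have "continuous_on UNIV (\<lambda>u. xv \<omega> t (y \<omega> u))" "continuous_on UNIV (\<lambda>u. Hv \<omega> t (y \<omega> u))"
      by (intro continuous_intros a_cont' B_cont' yc)+
    from continuous_on_compose2[OF w(1) continuous_on_Pair[OF this]]
    have "continuous_on UNIV (\<lambda>u. w (xv \<omega> t (y \<omega> u)) (Hv \<omega> t (y \<omega> u)))" by simp
    moreover have "continuous_on UNIV (\<lambda>u. p (y \<omega> u))"
      using continuous_on_compose2[OF p(1) yc] by simp
    ultimately show ?thesis unfolding k_def[abs_def] using d by (intro continuous_intros) auto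
  qed
  have k1i: "isCont k1 u" for u
    unfolding continuous_at_sequentially
  proof (rule allI, rule impI)
    fix s assume s: "s \<longlonglongrightarrow> u"
    have lim: "(\<lambda>i. k \<omega> (s i)) \<longlonglongrightarrow> k \<omega> u" for \<omega>
      using kc[of \<omega>] s by (intro isCont_tendsto_compose[of u "k \<omega>"]) (auto simp: continuous_on_eq_continuous_at)
    have "(\<lambda>i. expectation (\<lambda>\<omega>. k \<omega> (s i))) \<longlonglongrightarrow> expectation (\<lambda>\<omega>. k \<omega> u)"
    proof (rule integral_dominated_convergence[where w="\<lambda>_. Kb"])
      show "AE \<omega> in M. (\<lambda>i. k \<omega> (s i)) \<longlonglongrightarrow> k \<omega> u" using lim by simp
    qed (use k0 kb in auto)
    then show "(k1 \<circ> s) \<longlonglongrightarrow> k1 u" by (simp add: k1_def comp_def)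
  qed
  have k1c: "continuous_on UNIV k1"
    using k1i by (simp add: continuous_at_imp_continuous_on)
  have wi: "integrable M (\<lambda>\<omega>. w (xv \<omega> t (Y \<omega>)) (Hv \<omega> t (Y \<omega>)))"
    by (rule integrable_const_bound[where B=Kw]) (use w(2,3) in auto)
  define E where "E = expectation (\<lambda>\<omega>. w (xv \<omega> t (Y \<omega>)) (Hv \<omega> t (Y \<omega>)))"
  have Enn: "(\<integral>\<^sup>+\<omega>. ennreal (w (xv \<omega> t (Y \<omega>)) (Hv \<omega> t (Y \<omega>))) \<partial>M) = ennreal E" and E0: "0 \<le> E"
    unfolding E_def using wi w(2) by (auto intro!: nn_integral_eq_integral integral_nonneg_AE)
  have "AE u in lborel. ennreal (k1 u) = ennreal (q u) * ennreal E"
  proof (rule sigma_finite_measure.density_unique2[OF lborel.sigma_finite_measure_axioms])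
    show "(\<lambda>u. ennreal (k1 u)) \<in> borel_measurable lborel"
      using borel_measurable_continuous_onI[OF k1c] by simp
    show "(\<lambda>u. ennreal (q u) * ennreal E) \<in> borel_measurable lborel" by simp
    fix U :: "(real^'n) set" assume "U \<in> sets lborel"
    then have [measurable]: "U \<in> sets borel" by simp
    define F where "F \<omega> v = indicator U (gv \<omega> t v) * ennreal (w (xv \<omega> t v) (Hv \<omega> t v))" for \<omega> v
    have Fm: "(\<lambda>r. F (fst r) (snd r)) \<in> borel_measurable (N \<Otimes>\<^sub>M borel)"
      unfolding F_def by measurable
    have inner: "(\<integral>\<^sup>+v. ennreal (p v) * F \<omega> v \<partial>lborel) = (\<integral>\<^sup>+u. ennreal (k \<omega> u) * indicator U u \<partial>lborel)"
      if "\<omega> \<in> space M" for \<omega>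
    proof -
      have "(\<integral>\<^sup>+v. ennreal (p v) * F \<omega> v * emeasure (count_space UNIV) {u\<in>UNIV. y \<omega> u = v} \<partial>lborel) =
          (\<integral>\<^sup>+u. ennreal (p (y \<omega> u)) * F \<omega> (y \<omega> u) * ennreal \<bar>det C\<bar> * indicator UNIV u \<partial>lborel)"
      proof (rule area_formula[where W=UNIV])
        show "(y \<omega> has_derivative (*v) C) (at u)" for u
        proof -
          have "((\<lambda>u. C *v u - C *v g0 \<omega> t) has_derivative (\<lambda>v. C *v v - 0)) (at u)"
            by (intro has_derivative_diff has_derivative_const bounded_linear_imp_has_derivative matrix_vector_mul_bounded_linear)
          then show ?thesis by (simp add: y_def[abs_def] matrix_vector_mult_diff_distrib)
        qed
        show "det C \<noteq> 0" using C(4) A_nz[OF t] by simp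
        show "(\<lambda>v. ennreal (p v) * F \<omega> v) \<in> borel_measurable borel"
          unfolding F_def by measurable
      qed auto
      moreover have "{u\<in>UNIV. y \<omega> u = v} = {gv \<omega> t v}" for v using yg by auto
      moreover have "ennreal (p (y \<omega> u)) * F \<omega> (y \<omega> u) * ennreal \<bar>det C\<bar> = ennreal (k \<omega> u) * indicator U u" for u
        using p_nonneg w(2) d unfolding F_def k_def gy C(4)
        by (auto simp: d_def simp flip: ennreal_mult split: split_indicator)
      ultimately show ?thesis by simp
    qed
    interpret pair_sigma_finite M lborel ..
    have "(\<integral>\<^sup>+\<omega>. F \<omega> (Y \<omega>) \<partial>M) = (\<integral>\<^sup>+\<omega>. (\<integral>\<^sup>+u. ennreal (k \<omega> u) * indicator U u \<partial>lborel) \<partial>M)"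
      unfolding nn_integral_indep[OF Fm] by (rule nn_integral_cong) (rule inner)
    also have "\<dots> = (\<integral>\<^sup>+u. (\<integral>\<^sup>+\<omega>. ennreal (k \<omega> u) * indicator U u \<partial>M) \<partial>lborel)"
    proof (rule Fubini'[symmetric])
      show "(\<lambda>(\<omega>, u). ennreal (k \<omega> u) * indicator U u) \<in> borel_measurable (M \<Otimes>\<^sub>M lborel)"
      proof -
        have [measurable]: "(\<lambda>r. f (fst r)) \<in> borel_measurable (M \<Otimes>\<^sub>M lborel)" if "f \<in> borel_measurable M"
          for f :: "'w \<Rightarrow> 'z::topological_space" using that by measurable
        have [measurable]: "(\<lambda>r. x0 (fst r) t) \<in> borel_measurable (M \<Otimes>\<^sub>M (lborel :: (real^'n) measure))"
          "(\<lambda>r. g0 (fst r) t) \<in> borel_measurable (M \<Otimes>\<^sub>M (lborel :: (real^'n) measure))"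
          "(\<lambda>r. H0 (fst r) t) \<in> borel_measurable (M \<Otimes>\<^sub>M (lborel :: (real^'n) measure))"
          by (rule measurable_compose[OF measurable_fst], measurable)+
        show ?thesis unfolding k_def y_def case_prod_beta by measurable
      qed
    qed
    also have "\<dots> = (\<integral>\<^sup>+u\<in>U. ennreal (k1 u) \<partial>lborel)"
      by (intro nn_integral_cong) (auto simp: k1nn split: split_indicator)
    finally have e1: "(\<integral>\<^sup>+\<omega>. F \<omega> (Y \<omega>) \<partial>M) = (\<integral>\<^sup>+u\<in>U. ennreal (k1 u) \<partial>lborel)" .
    let ?f = "\<lambda>\<omega>. gv \<omega> t (Y \<omega>)" and ?Z = "\<lambda>\<omega>. (xv \<omega> t (Y \<omega>), Hv \<omega> t (Y \<omega>))"
    have "(\<integral>\<^sup>+\<omega>. F \<omega> (Y \<omega>) \<partial>M) = (\<integral>\<^sup>+\<omega>. (\<lambda>u z. indicator U u * ennreal (w (fst z) (snd z))) (?f \<omega>) (?Z \<omega>) \<partial>M)"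
      by (simp add: F_def)
    also have "\<dots> = (\<integral>\<^sup>+u. ennreal (q u) * (\<integral>\<^sup>+\<omega>. indicator U u * ennreal (w (xv \<omega> t (Y \<omega>)) (Hv \<omega> t (Y \<omega>))) \<partial>M) \<partial>lborel)"
    proof (subst nn_integral_indep_pair[OF ind q(1)])
      show "(\<lambda>(u, z). indicator U u * ennreal (w (fst z) (snd z))) \<in> borel_measurable (borel \<Otimes>\<^sub>M borel)"
        using measurable_compose[OF measurable_snd wm3] unfolding case_prod_unfold by measurable
    qed simp
    also have "\<dots> = (\<integral>\<^sup>+u\<in>U. ennreal (q u) * ennreal E \<partial>lborel)"
      by (intro nn_integral_cong) (auto simp: Enn split: split_indicator)
    finally show "(\<integral>\<^sup>+u\<in>U. ennreal (k1 u) \<partial>lborel) = (\<integral>\<^sup>+u\<in>U. ennreal (q u) * ennreal E \<partial>lborel)"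
      unfolding e1 .
  qed
  then have ae: "AE u in lborel. k1 u = q u * E"
  proof eventually_elim
    case (elim u)
    have "0 \<le> k1 u" unfolding k1_def using k0 by (intro integral_nonneg_AE) auto
    then show ?case using elim q(2) E0 by (simp flip: ennreal_mult)
  qed
  have "open {u. k1 u \<noteq> q u * E}"
    by (intro open_Collect_neq continuous_intros k1c q(3))
  moreover have "negligible {u. k1 u \<noteq> q u * E}"
  proof -
    have "{u. k1 u \<noteq> q u * E} \<in> null_sets lborel"
      using ae \<open>open {u. k1 u \<noteq> q u * E}\<close> AE_iff_null[of lborel "\<lambda>u. k1 u = q u * E"] by simp
    then show ?thesis by (simp add: negligible_iff_null_sets null_sets_completionI)
  qed
  ultimately have "{u. k1 u \<noteq> q u * E} = {}" using open_not_negligible by blast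
  then have "k1 0 = q 0 * E" by auto
  then have "(\<integral>\<^sup>+\<omega>. ennreal (k \<omega> 0) \<partial>M) = ennreal (q 0) * ennreal E"
    using q(2) E0 by (simp add: k1nn ennreal_mult)
  then show ?thesis unfolding k_def y0 Enn d_def .
qed

text \<open>The weight \<open>\<bar>det h\<bar> * of_bool (\<psi> x h > 0)\<close> is the increasing limit of the bounded continuous weights to which
  \<open>slice_identity\<close> applies.\<close>

theorem expected_count_split:
  fixes \<psi> :: "real \<Rightarrow> real^'n^'n \<Rightarrow> real"
  assumes V: "fsigma_in euclidean V" "V \<subseteq> D"
    and \<psi>: "continuous_on UNIV (\<lambda>(x, h). \<psi> x h)"
    and nd: "\<And>x h. \<psi> x h > 0 \<Longrightarrow> det h \<noteq> 0"
    and ind: "\<And>t. indep_pair M borel (\<lambda>\<omega>. gv \<omega> t (Y \<omega>)) borel (\<lambda>\<omega>. (xv \<omega> t (Y \<omega>), Hv \<omega> t (Y \<omega>)))"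
    and q: "\<And>t. distributed M lborel (\<lambda>\<omega>. gv \<omega> t (Y \<omega>)) (\<lambda>u. ennreal (q u))" "\<And>u. 0 \<le> q u" "continuous_on UNIV q"
    and p: "continuous_on UNIV p" "\<And>y. p y \<le> Kp"
  shows "(\<integral>\<^sup>+\<omega>. emeasure (count_space UNIV) {t\<in>V. gv \<omega> t (Y \<omega>) = 0 \<and> \<psi> (xv \<omega> t (Y \<omega>)) (Hv \<omega> t (Y \<omega>)) > 0} \<partial>M) =
    (\<integral>\<^sup>+t. ennreal (q 0) * (\<integral>\<^sup>+\<omega>. ennreal (\<bar>det (Hv \<omega> t (Y \<omega>))\<bar> *
        of_bool (\<psi> (xv \<omega> t (Y \<omega>)) (Hv \<omega> t (Y \<omega>)) > 0)) \<partial>M) * indicator V t \<partial>lborel)"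
proof (rule trans[OF expected_count_local[OF V \<psi> nd]], assumption, rule nn_integral_cong)
  fix t :: "real^'n"
  note [measurable] = x0_meas g0_meas H0_meas
  define w where "w n x h = min (real n) \<bar>det h\<bar> * min 1 (real n * max 0 (\<psi> x h))" for n x and h :: "real^'n^'n"
  have w0: "0 \<le> w n x h" for n x h by (simp add: w_def)
  have wn: "w n x h \<le> real n" for n x h
    unfolding w_def using mult_mono[of "min (real n) \<bar>det h\<bar>" "real n" "min 1 (real n * max 0 (\<psi> x h))" 1] by simp
  have winc: "w n x h \<le> w (Suc n) x h" for n x h
    unfolding w_def by (intro mult_mono min.mono mult_right_mono) auto
  have wlim: "(\<lambda>n. w n x h) \<longlonglongrightarrow> \<bar>det h\<bar> * of_bool (\<psi> x h > 0)" for x h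
  proof (cases "\<psi> x h > 0")
    case True
    obtain n0 where n0: "\<bar>det h\<bar> \<le> real n0" using real_arch_simple by blast
    obtain n1 where n1: "1 / \<psi> x h \<le> real n1" using real_arch_simple by blast
    have "\<forall>\<^sub>F n in sequentially. w n x h = \<bar>det h\<bar> * of_bool (\<psi> x h > 0)"
      unfolding eventually_sequentially
    proof (intro exI[of _ "max n0 n1"] allI impI)
      fix n assume n: "max n0 n1 \<le> n"
      have "\<bar>det h\<bar> \<le> real n" using n0 n by simp
      moreover have "1 / \<psi> x h \<le> real n" using n1 n by simp
      then have "1 \<le> real n * \<psi> x h" using True by (simp add: field_simps)
      ultimately show "w n x h = \<bar>det h\<bar> * of_bool (\<psi> x h > 0)" using True by (simp add: w_def)
    qed
    then show ?thesis by (rule tendsto_eventually)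
  next
    case False
    then have "w n x h = 0" for n by (simp add: w_def max_def)
    then show ?thesis using False by simp
  qed
  have wc: "continuous_on UNIV (\<lambda>(x, h). w n x h)" for n
    using \<psi> unfolding w_def case_prod_beta by (intro continuous_intros) auto
  have idM[measurable]: "(\<lambda>\<omega>. \<omega>) \<in> M \<rightarrow>\<^sub>M N"
    using space_N sets_N by (auto intro!: measurableI)
  have [measurable]: "(\<lambda>\<omega>. x0 \<omega> t) \<in> borel_measurable M" "(\<lambda>\<omega>. g0 \<omega> t) \<in> borel_measurable M"
    "(\<lambda>\<omega>. H0 \<omega> t) \<in> borel_measurable M"
    using measurable_compose[OF idM] x0_meas g0_meas H0_meas by blast+
  have Ym[measurable]: "Y \<in> borel_measurable M" using Y_dist by (simp add: distributed_def)
  have [measurable]: "(\<lambda>\<omega>. G \<omega> t) \<in> borel_measurable M" unfolding G_def by measurable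
  note wm = borel_measurable_compose_pair[OF wc]
  show "(\<integral>\<^sup>+\<omega>. ennreal (p (G \<omega> t) * (\<bar>det (Hv \<omega> t (G \<omega> t))\<bar> / \<bar>det (A t)\<bar>) *
        of_bool (\<psi> (xv \<omega> t (G \<omega> t)) (Hv \<omega> t (G \<omega> t)) > 0)) \<partial>M) * indicator V t =
    ennreal (q 0) * (\<integral>\<^sup>+\<omega>. ennreal (\<bar>det (Hv \<omega> t (Y \<omega>))\<bar> *
        of_bool (\<psi> (xv \<omega> t (Y \<omega>)) (Hv \<omega> t (Y \<omega>)) > 0)) \<partial>M) * indicator V t"
  proof (cases "t \<in> V")
    case True
    then have t: "t \<in> D" using V(2) by blast
    let ?L = "\<lambda>n \<omega>. ennreal (p (G \<omega> t) * w n (xv \<omega> t (G \<omega> t)) (Hv \<omega> t (G \<omega> t)) / \<bar>det (A t)\<bar>)"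
    let ?R = "\<lambda>n \<omega>. ennreal (w n (xv \<omega> t (Y \<omega>)) (Hv \<omega> t (Y \<omega>)))"
    have eq: "(\<integral>\<^sup>+\<omega>. ?L n \<omega> \<partial>M) = ennreal (q 0) * (\<integral>\<^sup>+\<omega>. ?R n \<omega> \<partial>M)" for n
      by (rule slice_identity[OF t ind q p wc w0 wn])
    have L: "(\<lambda>n. \<integral>\<^sup>+\<omega>. ?L n \<omega> \<partial>M) \<longlonglongrightarrow> (\<integral>\<^sup>+\<omega>. ennreal (p (G \<omega> t) *
        (\<bar>det (Hv \<omega> t (G \<omega> t))\<bar> * of_bool (\<psi> (xv \<omega> t (G \<omega> t)) (Hv \<omega> t (G \<omega> t)) > 0)) / \<bar>det (A t)\<bar>) \<partial>M)"
    proof (rule nn_integral_LIMSEQ)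
      show "incseq ?L"
        using p_nonneg w0 by (intro incseq_SucI le_funI ennreal_leI divide_right_mono mult_left_mono winc) auto
      show "?L n \<in> borel_measurable M" for n using wm by measurable
      show "(\<lambda>n. ?L n \<omega>) \<longlonglongrightarrow> ennreal (p (G \<omega> t) * (\<bar>det (Hv \<omega> t (G \<omega> t))\<bar> *
          of_bool (\<psi> (xv \<omega> t (G \<omega> t)) (Hv \<omega> t (G \<omega> t)) > 0)) / \<bar>det (A t)\<bar>)" for \<omega>
        by (intro tendsto_ennrealI tendsto_divide tendsto_mult wlim tendsto_const) (use A_nz[OF t] in auto)
    qed
    have R: "(\<lambda>n. ennreal (q 0) * (\<integral>\<^sup>+\<omega>. ?R n \<omega> \<partial>M)) \<longlonglongrightarrow> ennreal (q 0) * (\<integral>\<^sup>+\<omega>. ennreal (\<bar>det (Hv \<omega> t (Y \<omega>))\<bar> *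
        of_bool (\<psi> (xv \<omega> t (Y \<omega>)) (Hv \<omega> t (Y \<omega>)) > 0)) \<partial>M)"
    proof (rule ennreal_tendsto_cmult)
      show "(\<lambda>n. \<integral>\<^sup>+\<omega>. ?R n \<omega> \<partial>M) \<longlonglongrightarrow> (\<integral>\<^sup>+\<omega>. ennreal (\<bar>det (Hv \<omega> t (Y \<omega>))\<bar> *
        of_bool (\<psi> (xv \<omega> t (Y \<omega>)) (Hv \<omega> t (Y \<omega>)) > 0)) \<partial>M)"
      proof (rule nn_integral_LIMSEQ)
        show "incseq ?R" by (intro incseq_SucI le_funI ennreal_leI winc)
        show "?R n \<in> borel_measurable M" for n using wm by measurable
        show "(\<lambda>n. ?R n \<omega>) \<longlonglongrightarrow> ennreal (\<bar>det (Hv \<omega> t (Y \<omega>))\<bar> *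
          of_bool (\<psi> (xv \<omega> t (Y \<omega>)) (Hv \<omega> t (Y \<omega>)) > 0))" for \<omega>
          by (intro tendsto_ennrealI wlim)
      qed
    qed simp
    have e: "r * (b / c) * z = r * (b * z) / c" for r b c z :: real by simp
    show ?thesis unfolding e by (simp only: LIMSEQ_unique[OF L[unfolded eq] R])
  qed simp
qed

end

section \<open>Standard Gaussian vectors\<close>

definition normal_vec_density :: "real \<Rightarrow> real^'n \<Rightarrow> real" where
  "normal_vec_density s y = (\<Prod>i\<in>UNIV. normal_density 0 s (y $ i))"

lemma normal_vec_density_nonneg: "0 \<le> normal_vec_density s y"
  unfolding normal_vec_density_def by (intro prod_nonneg) simp

lemma continuous_on_normal_density: "continuous_on S (normal_density \<mu> s)"
  unfolding normal_density_def[abs_def] by (cases "s = 0") (auto intro!: continuous_intros)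

lemma continuous_normal_vec_density: "continuous_on S (normal_vec_density s)"
  unfolding normal_vec_density_def[abs_def]
  by (intro continuous_on_prod continuous_on_compose2[OF continuous_on_normal_density[of UNIV]] continuous_intros) auto

lemma normal_density_le: "normal_density 0 s x \<le> 1 / sqrt (2 * pi * s\<^sup>2)"
  unfolding normal_density_def by (rule mult_right_le_one_le) auto

lemma normal_vec_density_le: "normal_vec_density s (y :: real^'n) \<le> (1 / sqrt (2 * pi * s\<^sup>2)) ^ CARD('n)"
  unfolding normal_vec_density_def
  using prod_mono[of UNIV "\<lambda>i. normal_density 0 s (y $ i)" "\<lambda>_. 1 / sqrt (2 * pi * s\<^sup>2)"] normal_density_le
  by simp

lemma normal_vec_density_0: "normal_vec_density s (0 :: real^'n) = (1 / sqrt (2 * pi * s\<^sup>2)) ^ CARD('n)"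
  by (simp add: normal_vec_density_def normal_density_def)

text \<open>By \<open>gaussian_indep\<close>, applied to one coordinate and the family of those treated before, uncorrelated coordinates are independent.
  So the law of the vector and the product density give the same measure to rectangles.\<close>

lemma (in prob_space) gaussian_vector:
  fixes W :: "'n::finite \<Rightarrow> 'a \<Rightarrow> real"
  assumes lin: "\<And>b. gaussian_rv M (\<lambda>\<omega>. \<Sum>j\<in>UNIV. b j * W j \<omega>)"
    and mean: "\<And>j. expectation (W j) = 0"
    and cov: "\<And>i j. expectation (\<lambda>\<omega>. W i \<omega> * W j \<omega>) = (if i = j then s\<^sup>2 else 0)"
    and s: "s > 0"
  shows "distributed M lborel (\<lambda>\<omega>. \<chi> i. W i \<omega>) (\<lambda>y. ennreal (normal_vec_density s y))"
proof -
  have lin': "gaussian_rv M (\<lambda>\<omega>. \<Sum>j\<in>J. b j * W j \<omega>)" for J b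
  proof -
    have "(\<Sum>j\<in>J. b j * W j \<omega>) = (\<Sum>j\<in>UNIV. (if j \<in> J then b j else 0) * W j \<omega>)" for \<omega>
      by (rule sum.mono_neutral_cong_left) auto
    then show ?thesis using lin[of "\<lambda>j. if j \<in> J then b j else 0"] by simp
  qed
  have g1: "gaussian_rv M (W j)" for j using lin'[of "\<lambda>_. 1" "{j}"] by simp
  note [measurable] = gaussian_rvD(1)[OF g1]
  have d1: "distributed M lborel (W j) (normal_density 0 s)" for j
    using gaussian_rvD(5)[OF g1 mean] cov[of j j] s by (simp add: power2_eq_square)
  have indep: "emeasure M {\<omega>\<in>space M. \<forall>i\<in>I. W i \<omega> \<in> A i} = (\<Prod>i\<in>I. emeasure M {\<omega>\<in>space M. W i \<omega> \<in> A i})"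
    if A[measurable]: "\<And>i. A i \<in> sets borel" for I and A :: "'n \<Rightarrow> real set"
    using finite[of I]
  proof (induction I rule: finite_induct)
    case empty then show ?case by (simp add: emeasure_space_1)
  next
    case (insert x F)
    define V where "V j = (if j \<in> F then W j else (\<lambda>_. 0))" for j
    have Vm[measurable]: "V j \<in> borel_measurable M" for j by (simp add: V_def)
    let ?Q = "{\<omega>\<in>space M. \<forall>i\<in>F. V i \<omega> \<in> A i}"
    have "indep_pair M borel (W x) (gen_algebra V) (\<lambda>\<omega>. \<omega>)"
    proof (rule gaussian_indep[where U="\<lambda>_::unit. W x" and W=V])
      fix I :: "unit set" and J :: "'n set" and a b assume "finite I" "finite J"
      have "I = {} \<or> I = {()}" by auto
      then obtain c where c: "(\<Sum>i\<in>I. a i * W x \<omega>) = c * W x \<omega>" for \<omega>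
        by (metis (no_types, lifting) sum.empty mult_zero_left sum.insert finite.emptyI empty_iff add.right_neutral)
      have "(\<Sum>i\<in>I. a i * W x \<omega>) + (\<Sum>j\<in>J. b j * V j \<omega>) =
          (\<Sum>j\<in>UNIV. (if j = x then c else if j \<in> J \<inter> F then b j else 0) * W j \<omega>)" for \<omega>
      proof -
        have "(\<Sum>j\<in>UNIV. (if j = x then c else if j \<in> J \<inter> F then b j else 0) * W j \<omega>) =
          (\<Sum>j\<in>UNIV. (if j = x then c * W x \<omega> else 0) + (if j \<in> J \<inter> F then b j * W j \<omega> else 0))"
          using insert.hyps by (intro sum.cong) auto
        also have "\<dots> = c * W x \<omega> + (\<Sum>j\<in>UNIV. if j \<in> J \<inter> F then b j * W j \<omega> else 0)"
          by (simp add: sum.distrib)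
        also have "(\<Sum>j\<in>UNIV. if j \<in> J \<inter> F then b j * W j \<omega> else 0) = (\<Sum>j\<in>J. b j * V j \<omega>)"
          by (rule sum.mono_neutral_cong_right) (auto simp: V_def)
        finally show ?thesis using c by simp
      qed
      then show "gaussian_rv M (\<lambda>\<omega>. (\<Sum>i\<in>I. a i * W x \<omega>) + (\<Sum>j\<in>J. b j * V j \<omega>))"
        using lin by simp
    next
      show "expectation (V j) = 0" for j using mean by (simp add: V_def)
      show "expectation (\<lambda>\<omega>. W x \<omega> * V j \<omega>) = 0" for j
        using cov[of x j] insert.hyps by (cases "j \<in> F") (auto simp: V_def)
      show "W x \<in> borel_measurable (gen_algebra (\<lambda>_::unit. W x))"
        using measurable_gen_algebra[of "\<lambda>_::unit. W x" "()"] by simp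
    qed (auto simp: mean)
    then have ip: "distr M borel (W x) \<Otimes>\<^sub>M distr M (gen_algebra V) (\<lambda>\<omega>. \<omega>) = distr M (borel \<Otimes>\<^sub>M gen_algebra V) (\<lambda>\<omega>. (W x \<omega>, \<omega>))"
      and idm[measurable]: "(\<lambda>\<omega>. \<omega>) \<in> M \<rightarrow>\<^sub>M gen_algebra V"
      unfolding indep_pair_def by auto
    have Qm: "?Q \<in> sets (gen_algebra V)"
    proof -
      have VA: "{\<omega>\<in>space (gen_algebra V). V i \<omega> \<in> A i} \<in> sets (gen_algebra V)" for i
      proof -
        have "{\<omega>\<in>space (gen_algebra V). V i \<omega> \<in> A i} = V i -` A i \<inter> space (gen_algebra V)" by auto
        then show ?thesis using measurable_sets[OF measurable_gen_algebra[of V i] A[of i]] by simp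
      qed
      have "{\<omega>\<in>space (gen_algebra V). \<forall>i\<in>F. V i \<omega> \<in> A i} \<in> sets (gen_algebra V)"
        using VA insert.hyps(1) by (intro sets.sets_Collect_finite_All)
      then show ?thesis by simp
    qed
    interpret P2: prob_space "distr M (gen_algebra V) (\<lambda>\<omega>. \<omega>)" by (rule prob_space_distr) simp
    have "emeasure M {\<omega>\<in>space M. \<forall>i\<in>insert x F. W i \<omega> \<in> A i} =
        emeasure (distr M (borel \<Otimes>\<^sub>M gen_algebra V) (\<lambda>\<omega>. (W x \<omega>, \<omega>))) (A x \<times> ?Q)"
      using Qm by (subst emeasure_distr) (auto intro!: arg_cong[where f="emeasure M"] simp: V_def)
    also have "\<dots> = emeasure (distr M borel (W x)) (A x) * emeasure (distr M (gen_algebra V) (\<lambda>\<omega>. \<omega>)) ?Q"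
      unfolding ip[symmetric] using Qm by (intro P2.emeasure_pair_measure_Times) auto
    also have "\<dots> = emeasure M {\<omega>\<in>space M. W x \<omega> \<in> A x} * emeasure M {\<omega>\<in>space M. \<forall>i\<in>F. W i \<omega> \<in> A i}"
      using Qm by (subst (1 2) emeasure_distr) (auto intro!: arg_cong2[where f="(*)"] arg_cong[where f="emeasure M"] simp: V_def)
    finally show ?case using insert by simp
  qed
  let ?W = "\<lambda>\<omega>. \<chi> i. W i \<omega>"
  have Wm[measurable]: "?W \<in> borel_measurable M" by (rule borel_measurable_vecI) simp
  have pm[measurable]: "normal_vec_density s \<in> borel_measurable borel"
    by (rule borel_measurable_continuous_onI[OF continuous_normal_vec_density])
  have prodB: "(\<Prod>b\<in>Basis. h (x \<bullet> b) b) = (\<Prod>i\<in>UNIV. h (x $ i) (axis i 1))" for x :: "real^'n" and h :: "real \<Rightarrow> real^'n \<Rightarrow> 'b::comm_monoid_mult"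
  proof -
    have "Basis = range (\<lambda>i. axis i (1::real) :: real^'n)" by (auto simp: Basis_vec_def)
    moreover have "inj (\<lambda>i. axis i (1::real) :: real^'n)" by (auto simp: inj_on_def axis_eq_axis)
    ultimately show ?thesis
      using prod.reindex[of "\<lambda>i. axis i (1::real) :: real^'n" UNIV "\<lambda>b. h (x \<bullet> b) b"]
      by (simp only: o_def) (simp add: inner_axis)
  qed
  have "distr M borel ?W = density lborel (\<lambda>y. ennreal (normal_vec_density s y))"
  proof (rule measure_eqI_generator_eq[where E="range (\<lambda>(a, b). box a b)" and \<Omega>=UNIV
        and A="\<lambda>n. box (- (real n *\<^sub>R One)) (real n *\<^sub>R One)"])
    show "Int_stable (range (\<lambda>(a, b). box a b :: (real^'n) set))"
      by (auto simp: Int_stable_def box_Int_box)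
    show "sets (distr M borel ?W) = sigma_sets UNIV (range (\<lambda>(a, b). box a b))"
      "sets (density lborel (\<lambda>y. ennreal (normal_vec_density s y))) = sigma_sets UNIV (range (\<lambda>(a, b). box a b :: (real^'n) set))"
      by (simp_all add: borel_eq_box)
    show "(\<Union>i. box (- (real i *\<^sub>R One)) (real i *\<^sub>R One)) = (UNIV :: (real^'n) set)"
      by (rule UN_box_eq_UNIV)
    show "emeasure (distr M borel ?W) (box (- (real i *\<^sub>R One)) (real i *\<^sub>R One)) \<noteq> \<infinity>" for i
      by (subst emeasure_distr) auto
    fix B assume "B \<in> range (\<lambda>(a, b). box a b :: (real^'n) set)"
    then obtain a b where B: "B = box a b" by auto
    have e1: "emeasure M {\<omega>\<in>space M. W i \<omega> \<in> {a$i<..<b$i}} = (\<integral>\<^sup>+x. ennreal (normal_density 0 s x) * indicator {a$i<..<b$i} x \<partial>lborel)" for i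
    proof -
      have "emeasure M {\<omega>\<in>space M. W i \<omega> \<in> {a$i<..<b$i}} = emeasure (distr M lborel (W i)) {a$i<..<b$i}"
        by (subst emeasure_distr) (auto intro!: arg_cong[where f="emeasure M"])
      then show ?thesis using d1[of i] by (simp add: distributed_def emeasure_density)
    qed
    have "emeasure (distr M borel ?W) B = emeasure M {\<omega>\<in>space M. \<forall>i\<in>UNIV. W i \<omega> \<in> {a$i<..<b$i}}"
      unfolding B by (subst emeasure_distr) (auto simp: mem_box_cart intro!: arg_cong[where f="emeasure M"])
    also have "\<dots> = (\<Prod>i\<in>UNIV. \<integral>\<^sup>+x. ennreal (normal_density 0 s x) * indicator {a$i<..<b$i} x \<partial>lborel)"
      unfolding e1[symmetric] by (rule indep) simp
    also have "\<dots> = (\<Prod>i\<in>UNIV. \<integral>\<^sup>+x. ennreal (normal_density 0 s x * indicator {a$i<..<b$i} x) \<partial>lborel)"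
      by (intro prod.cong nn_integral_cong) (auto split: split_indicator)
    also have "\<dots> = (\<Prod>c\<in>Basis. \<integral>\<^sup>+x. ennreal (normal_density 0 s x * indicator {a\<bullet>c<..<b\<bullet>c} x) \<partial>lborel)"
    proof -
      have "Basis = range (\<lambda>i. axis i (1::real) :: real^'n)" by (auto simp: Basis_vec_def)
      moreover have "inj (\<lambda>i. axis i (1::real) :: real^'n)" by (auto simp: inj_on_def axis_eq_axis)
      ultimately show ?thesis
        using prod.reindex[of "\<lambda>i. axis i (1::real) :: real^'n" UNIV
            "\<lambda>c. \<integral>\<^sup>+x. ennreal (normal_density 0 s x * indicator {a\<bullet>c<..<b\<bullet>c} x) \<partial>lborel"]
        by (simp only: o_def) (simp add: inner_axis)
    qed
    also have "\<dots> = (\<integral>\<^sup>+y. (\<Prod>c\<in>Basis. ennreal (normal_density 0 s (y\<bullet>c) * indicator {a\<bullet>c<..<b\<bullet>c} (y\<bullet>c))) \<partial>lborel)"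
      by (rule nn_integral_lborel_prod[symmetric]) auto
    also have "\<dots> = (\<integral>\<^sup>+y. ennreal (normal_vec_density s y) * indicator (box a b) y \<partial>lborel)"
    proof (rule nn_integral_cong)
      fix y :: "real^'n"
      have "(\<Prod>c\<in>Basis. ennreal (normal_density 0 s (y\<bullet>c) * indicator {a\<bullet>c<..<b\<bullet>c} (y\<bullet>c))) =
        (\<Prod>i\<in>UNIV. ennreal (normal_density 0 s (y$i) * indicator {a$i<..<b$i} (y$i)))"
        using prodB[of "\<lambda>r c. ennreal (normal_density 0 s r * indicator {a\<bullet>c<..<b\<bullet>c} r)" y] by (simp add: inner_axis)
      also have "\<dots> = ennreal (\<Prod>i\<in>UNIV. normal_density 0 s (y$i) * indicator {a$i<..<b$i} (y$i))"
        by (rule prod_ennreal) simp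
      also have "(\<Prod>i\<in>UNIV. normal_density 0 s (y$i) * indicator {a$i<..<b$i} (y$i)) = normal_vec_density s y * indicator (box a b) y"
      proof (cases "y \<in> box a b")
        case True then show ?thesis by (simp add: normal_vec_density_def mem_box_cart)
      next
        case False
        then obtain i where "\<not> (a$i < y$i \<and> y$i < b$i)" by (auto simp: mem_box_cart)
        then have "normal_density 0 s (y$i) * indicator {a$i<..<b$i} (y$i) = 0" by auto
        then show ?thesis using False by (auto intro!: prod_zero)
      qed
      finally show "(\<Prod>c\<in>Basis. ennreal (normal_density 0 s (y\<bullet>c) * indicator {a\<bullet>c<..<b\<bullet>c} (y\<bullet>c))) =
        ennreal (normal_vec_density s y) * indicator (box a b) y" by (simp split: split_indicator)
    qed
    also have "\<dots> = emeasure (density lborel (\<lambda>y. ennreal (normal_vec_density s y))) B"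
      unfolding B by (simp add: emeasure_density)
    finally show "emeasure (distr M borel ?W) B = emeasure (density lborel (\<lambda>y. ennreal (normal_vec_density s y))) B" .
  qed auto
  then show ?thesis by (simp add: distributed_def cong: distr_cong)
qed

section \<open>Splitting an isotropic Gaussian field\<close>

lemma has_derivative_imp_LIMSEQ:
  fixes f :: "'a::real_normed_vector \<Rightarrow> real"
  assumes "(f has_derivative f') (at t)"
  shows "(\<lambda>n. (f (t + inverse (real (Suc n)) *\<^sub>R e) - f t) / inverse (real (Suc n))) \<longlonglongrightarrow> f' e"
proof -
  have l: "linear f'" using assms by (rule has_derivative_linear)
  have "((\<lambda>r::real. t + r *\<^sub>R e) has_derivative (\<lambda>r. r *\<^sub>R e)) (at 0)"
    by (auto intro!: derivative_eq_intros)
  moreover have "(f has_derivative f') (at (t + 0 *\<^sub>R e))" using assms by simp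
  ultimately have "((\<lambda>r. f (t + r *\<^sub>R e)) has_derivative (\<lambda>r. f' (r *\<^sub>R e))) (at 0)"
    by (rule has_derivative_compose)
  then have "((\<lambda>r. f (t + r *\<^sub>R e)) has_real_derivative f' e) (at 0)"
    unfolding has_field_derivative_def
    by (rule has_derivative_eq_rhs) (simp add: fun_eq_iff linear_cmul[OF l])
  then have "((\<lambda>h. (f (t + h *\<^sub>R e) - f t) / h) \<longlongrightarrow> f' e) (at 0)"
    by (simp add: DERIV_def)
  moreover have "filterlim (\<lambda>n. inverse (real (Suc n))) (at 0) sequentially"
    by (rule filterlim_atI[OF LIMSEQ_inverse_real_of_nat]) auto
  ultimately show ?thesis by (rule filterlim_compose)
qed

context isotropic_gaussian_field
begin

subsection \<open>Paths\<close>

lemma X_deriv: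
  assumes "\<omega> \<in> space M"
  shows "((\<lambda>t. X t \<omega>) has_derivative (\<lambda>v. gradf X t \<omega> \<bullet> v)) (at t)"
proof -
  have "(\<lambda>t. X t \<omega>) differentiable at t" using C2_paths[OF assms] by (simp add: twice_cont_diff_def)
  then have d: "((\<lambda>t. X t \<omega>) has_derivative frechet_derivative (\<lambda>t. X t \<omega>) (at t)) (at t)"
    by (simp add: frechet_derivative_works)
  have l: "linear (frechet_derivative (\<lambda>t. X t \<omega>) (at t))" using d by (rule has_derivative_linear)
  have "frechet_derivative (\<lambda>t. X t \<omega>) (at t) v = gradf X t \<omega> \<bullet> v" for v
  proof -
    have "v = (\<Sum>i\<in>UNIV. v $ i *\<^sub>R axis i 1)"
      by (simp add: vec_eq_iff axis_def if_distrib[of "\<lambda>x. _ * x"] cong: if_cong)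
    then have "frechet_derivative (\<lambda>t. X t \<omega>) (at t) v =
        (\<Sum>i\<in>UNIV. v $ i *\<^sub>R frechet_derivative (\<lambda>t. X t \<omega>) (at t) (axis i 1))"
      using linear_sum[OF l, of "\<lambda>i. v $ i *\<^sub>R axis i 1" UNIV] by (simp add: linear_cmul[OF l])
    then show ?thesis by (simp add: grad_def inner_vec_def mult.commute)
  qed
  then have "frechet_derivative (\<lambda>t. X t \<omega>) (at t) = (\<lambda>v. gradf X t \<omega> \<bullet> v)" by (rule ext)
  then show ?thesis using d by simp
qed

lemma grad_deriv:
  assumes "\<omega> \<in> space M"
  shows "((\<lambda>t. gradf X t \<omega>) has_derivative (\<lambda>v. hessf X t \<omega> *v v)) (at t)"
  using C2_paths[OF assms] unfolding twice_cont_diff_def hessian_def jacobian_works by simp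

lemma hess_cont: "\<omega> \<in> space M \<Longrightarrow> continuous_on UNIV (\<lambda>t. hessf X t \<omega>)"
  using C2_paths by (auto simp: twice_cont_diff_def)

lemma X_cont: "\<omega> \<in> space M \<Longrightarrow> continuous_on UNIV (\<lambda>t. X t \<omega>)"
  using X_deriv by (meson continuous_at_imp_continuous_on has_derivative_continuous)

subsection \<open>Linear combinations of field values\<close>

definition lincomb :: "('w \<Rightarrow> real) \<Rightarrow> bool" where
  "lincomb f \<longleftrightarrow> (\<exists>S a. finite S \<and> f = (\<lambda>\<omega>. \<Sum>x\<in>S. a x * X x \<omega>))"

lemma lincomb_gauss: "lincomb f \<Longrightarrow> gaussian_rv M f"
  using gaussian by (auto simp: lincomb_def gaussian_field_def)

lemma lincomb_X: "lincomb (X x)"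
  unfolding lincomb_def by (intro exI[of _ "{x}"] exI[of _ "\<lambda>_. 1"]) auto

lemma lincomb_0: "lincomb (\<lambda>_. 0)"
  unfolding lincomb_def by (intro exI[of _ "{}"]) auto

lemma lincomb_cmult: "lincomb f \<Longrightarrow> lincomb (\<lambda>\<omega>. c * f \<omega>)"
  unfolding lincomb_def
proof (elim exE conjE)
  fix S a assume "finite S" "f = (\<lambda>\<omega>. \<Sum>x\<in>S. a x * X x \<omega>)"
  then show "\<exists>S a. finite S \<and> (\<lambda>\<omega>. c * f \<omega>) = (\<lambda>\<omega>. \<Sum>x\<in>S. a x * X x \<omega>)"
    by (intro exI[of _ S] exI[of _ "\<lambda>x. c * a x"]) (simp add: sum_distrib_left mult.assoc)
qed

lemma lincomb_add: "lincomb f \<Longrightarrow> lincomb g \<Longrightarrow> lincomb (\<lambda>\<omega>. f \<omega> + g \<omega>)"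
  unfolding lincomb_def
proof (elim exE conjE)
  fix S a T b assume *: "finite S" "f = (\<lambda>\<omega>. \<Sum>x\<in>S. a x * X x \<omega>)" "finite T" "g = (\<lambda>\<omega>. \<Sum>x\<in>T. b x * X x \<omega>)"
  have "(\<Sum>x\<in>S. a x * X x \<omega>) + (\<Sum>x\<in>T. b x * X x \<omega>) =
      (\<Sum>x\<in>S \<union> T. ((if x \<in> S then a x else 0) + (if x \<in> T then b x else 0)) * X x \<omega>)" for \<omega>
  proof -
    have "(\<Sum>x\<in>S. a x * X x \<omega>) = (\<Sum>x\<in>S \<union> T. (if x \<in> S then a x else 0) * X x \<omega>)"
      using * by (intro sum.mono_neutral_cong_left) auto
    moreover have "(\<Sum>x\<in>T. b x * X x \<omega>) = (\<Sum>x\<in>S \<union> T. (if x \<in> T then b x else 0) * X x \<omega>)"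
      using * by (intro sum.mono_neutral_cong_left) auto
    ultimately show ?thesis by (simp add: sum.distrib distrib_right)
  qed
  then show "\<exists>S a. finite S \<and> (\<lambda>\<omega>. f \<omega> + g \<omega>) = (\<lambda>\<omega>. \<Sum>x\<in>S. a x * X x \<omega>)"
    using * by (intro exI[of _ "S \<union> T"] exI[of _ "\<lambda>x. (if x \<in> S then a x else 0) + (if x \<in> T then b x else 0)"]) simp
qed

lemma lincomb_diff: "lincomb f \<Longrightarrow> lincomb g \<Longrightarrow> lincomb (\<lambda>\<omega>. f \<omega> - g \<omega>)"
  using lincomb_add[of f "\<lambda>\<omega>. -1 * g \<omega>"] lincomb_cmult[of g "-1"] by simp

lemma lincomb_sum:
  assumes "\<And>i. i \<in> I \<Longrightarrow> lincomb (f i)"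
  shows "lincomb (\<lambda>\<omega>. \<Sum>i\<in>I. f i \<omega>)"
proof (cases "finite I")
  case True
  then show ?thesis using assms by (induction I rule: finite_induct) (auto intro: lincomb_0 lincomb_add)
qed (simp add: lincomb_0)

lemma X_meas [measurable]: "X x \<in> borel_measurable M"
  using gaussian_rvD(1)[OF lincomb_gauss[OF lincomb_X]] .

lemma lincomb_integrable:
  assumes "lincomb f" "lincomb g"
  shows "integrable M f" "integrable M (\<lambda>\<omega>. f \<omega> * g \<omega>)"
proof -
  show "integrable M f" using assms gaussian_rvD(2)[OF lincomb_gauss] by auto
  show "integrable M (\<lambda>\<omega>. f \<omega> * g \<omega>)"
    by (rule integrable_mult_square) (use assms gaussian_rvD(1,3)[OF lincomb_gauss] in auto)
qed

subsection \<open>The covariance function\<close>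

text \<open>\<open>K (x - y)\<close> is the covariance of \<open>X x\<close> and \<open>X y\<close>; \<open>Kg\<close> and \<open>KH\<close> are the gradient and the Hessian of \<open>K\<close>.\<close>

definition K :: "real^'n \<Rightarrow> real" where "K x = C ((norm x)\<^sup>2 / 2)"
definition Kg :: "real^'n \<Rightarrow> real^'n" where "Kg x = C' ((norm x)\<^sup>2 / 2) *\<^sub>R x"
definition KH :: "real^'n \<Rightarrow> real^'n^'n" where
  "KH x = (\<chi> i j. C'' ((norm x)\<^sup>2 / 2) * x $ i * x $ j + (if i = j then C' ((norm x)\<^sup>2 / 2) else 0))"

lemma radial_deriv:
  assumes "\<And>r. 0 \<le> r \<Longrightarrow> (f has_real_derivative f' r) (at r within {0..})"
  shows "((\<lambda>x::real^'n. f ((norm x)\<^sup>2 / 2)) has_derivative (\<lambda>v. f' ((norm x)\<^sup>2 / 2) * (x \<bullet> v))) (at x)"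
proof -
  have 1: "((\<lambda>x::real^'n. (norm x)\<^sup>2 / 2) has_derivative (\<lambda>v. x \<bullet> v)) (at x)"
    unfolding power2_norm_eq_inner by (auto intro!: derivative_eq_intros simp: inner_commute)
  have "(f has_derivative (*) (f' ((norm x)\<^sup>2 / 2))) (at ((norm x)\<^sup>2 / 2) within {0..})"
    using assms[of "(norm x)\<^sup>2 / 2"] by (simp add: has_field_derivative_def)
  then have 2: "(f has_derivative (*) (f' ((norm x)\<^sup>2 / 2))) (at ((norm x)\<^sup>2 / 2) within (\<lambda>x::real^'n. (norm x)\<^sup>2 / 2) ` UNIV)"
    by (rule has_derivative_subset) auto
  show ?thesis using has_derivative_in_compose[OF 1 2] by simp
qed

lemma K_deriv: "(K has_derivative (\<lambda>v. Kg x \<bullet> v)) (at x)"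
  using radial_deriv[OF C_deriv, of x] by (simp add: K_def[abs_def] Kg_def)

lemma Kg_deriv: "(Kg has_derivative (\<lambda>v. KH x *v v)) (at x)"
proof -
  have "((\<lambda>x. C' ((norm x)\<^sup>2 / 2) *\<^sub>R x) has_derivative
      (\<lambda>v. C' ((norm x)\<^sup>2 / 2) *\<^sub>R v + (C'' ((norm x)\<^sup>2 / 2) * (x \<bullet> v)) *\<^sub>R x)) (at x)"
    by (intro has_derivative_scaleR radial_deriv[OF C_deriv2] has_derivative_ident)
  moreover have "C' ((norm x)\<^sup>2 / 2) *\<^sub>R v + (C'' ((norm x)\<^sup>2 / 2) * (x \<bullet> v)) *\<^sub>R x = KH x *v v" for v
  proof -
    have "(KH x *v v) $ i = (\<Sum>j\<in>UNIV. (C'' ((norm x)\<^sup>2 / 2) * x $ i) * (x $ j * v $ j)) +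
        (\<Sum>j\<in>UNIV. if i = j then C' ((norm x)\<^sup>2 / 2) * v $ i else 0)" for i
      unfolding KH_def matrix_vector_mult_def vec_lambda_beta sum.distrib[symmetric]
      by (intro sum.cong) (auto simp: algebra_simps)
    also have "\<dots> i = C'' ((norm x)\<^sup>2 / 2) * x $ i * (x \<bullet> v) + C' ((norm x)\<^sup>2 / 2) * v $ i" for i
      by (simp add: inner_vec_def sum_distrib_left)
    finally show ?thesis by (simp add: vec_eq_iff mult_ac)
  qed
  ultimately show ?thesis by (simp add: Kg_def[abs_def])
qed

lemma KH_cont: "continuous_on UNIV KH"
proof -
  have "continuous_on {0..} C'"
    using C_deriv2 by (meson DERIV_continuous atLeast_iff continuous_on_eq_continuous_within)
  moreover have n: "continuous_on UNIV (\<lambda>x::real^'n. (norm x)\<^sup>2 / 2)" by (intro continuous_intros) simp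
  moreover have rng: "range (\<lambda>x::real^'n. (norm x)\<^sup>2 / 2) \<subseteq> {0..}" by auto
  ultimately have 1: "continuous_on UNIV (\<lambda>x::real^'n. C' ((norm x)\<^sup>2 / 2))"
    by (rule continuous_on_compose2)
  have 2: "continuous_on UNIV (\<lambda>x::real^'n. C'' ((norm x)\<^sup>2 / 2))"
    by (rule continuous_on_compose2[OF C''_cont n rng])
  have "continuous_on UNIV (\<lambda>x::real^'n. if i = j then C' ((norm x)\<^sup>2 / 2) else 0)" for i j :: 'n
    using 1 by (cases "i = j") auto
  then show ?thesis unfolding KH_def[abs_def] by (intro continuous_intros 2)
qed

lemma Kg_cont: "continuous_on UNIV Kg"
  using Kg_deriv by (meson continuous_at_imp_continuous_on has_derivative_continuous)

lemma K_cont: "continuous_on UNIV K"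
  using K_deriv by (meson continuous_at_imp_continuous_on has_derivative_continuous)

lemma covK: "expectation (\<lambda>\<omega>. X x \<omega> * X y \<omega>) = K (x - y)"
  using covariance by (simp add: K_def)

text \<open>Near 0 the derivative \<open>C'\<close> is negative. The first property makes the coefficient matrix of the splitting below invertible, the
  second one says that values of the field at distance \<open>2 * \<delta>\<close> are not fully correlated.\<close>

lemma small_step: obtains \<delta> where "\<delta> > 0" "C' (\<delta>\<^sup>2 / 2) \<noteq> 0" "C (2 * \<delta>\<^sup>2) < 1"
proof -
  have "continuous (at 0 within {0..}) C'" using C_deriv2[of 0] by (simp add: DERIV_continuous)
  moreover have "0 < - C' 0" using C'_0 by simp
  ultimately have "\<exists>d>0. \<forall>r\<in>{0..}. dist r 0 < d \<longrightarrow> dist (C' r) (C' 0) < - C' 0"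
    unfolding continuous_within_eps_delta by blast
  then obtain \<eta> where \<eta>: "\<eta> > 0" "\<And>r. 0 \<le> r \<Longrightarrow> r < \<eta> \<Longrightarrow> dist (C' r) (C' 0) < - C' 0"
    by (auto simp: dist_real_def)
  have neg: "C' r < 0" if "0 \<le> r" "r < \<eta>" for r
    using \<eta>(2)[OF that] by (auto simp: dist_real_def)
  define \<delta> where "\<delta> = sqrt (\<eta> / 4)"
  have d: "\<delta> > 0" "\<delta>\<^sup>2 = \<eta> / 4" using \<eta>(1) by (auto simp: \<delta>_def)
  have "\<exists>z\<in>{0<..<2 * \<delta>\<^sup>2}. C (2 * \<delta>\<^sup>2) - C 0 = C' z * (2 * \<delta>\<^sup>2 - 0)"
  proof (rule mvt_simple)
    show "0 < 2 * \<delta>\<^sup>2" using d by simp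
    fix z assume "0 \<le> z" "z \<le> 2 * \<delta>\<^sup>2"
    then show "(C has_derivative (*) (C' z)) (at z within {0..2 * \<delta>\<^sup>2})"
      using C_deriv[of z] unfolding has_field_derivative_def by (rule_tac has_derivative_subset) auto
  qed
  then obtain z where z: "0 < z" "z < 2 * \<delta>\<^sup>2" "C (2 * \<delta>\<^sup>2) - C 0 = C' z * (2 * \<delta>\<^sup>2)" by auto
  have "C' z * (2 * \<delta>\<^sup>2) < 0" using neg[of z] z d \<eta>(1) by (intro mult_neg_pos) auto
  then have "C (2 * \<delta>\<^sup>2) < 1" using z C_0 by simp
  moreover have "C' (\<delta>\<^sup>2 / 2) \<noteq> 0" using neg[of "\<delta>\<^sup>2 / 2"] d \<eta>(1) by auto
  ultimately show ?thesis using that d(1) by blast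
qed

subsection \<open>The splitting\<close>

text \<open>The differences \<open>Yv\<close> of \<open>X\<close> across \<open>s\<close> along the coordinate axes are uncorrelated by isotropy, with common variance \<open>s2\<close>.
  The regression of \<open>X t\<close> on them has the coefficients \<open>coef\<close>, the sum \<open>amap\<close>, and the residual \<open>Rf\<close>; \<open>Amat \<delta> s t *v y\<close> and
  \<open>Bmat \<delta> s t y\<close> are the gradient and the Hessian of \<open>t \<mapsto> amap \<delta> s t y\<close>.\<close>

definition s2 :: "real \<Rightarrow> real" where "s2 \<delta> = 2 * (1 - C (2 * \<delta>\<^sup>2))"
definition Yv :: "real \<Rightarrow> real^'n \<Rightarrow> 'w \<Rightarrow> real^'n" where
  "Yv \<delta> s \<omega> = (\<chi> i. X (s + \<delta> *\<^sub>R axis i 1) \<omega> - X (s - \<delta> *\<^sub>R axis i 1) \<omega>)"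
definition coef :: "real \<Rightarrow> real^'n \<Rightarrow> 'n \<Rightarrow> real^'n \<Rightarrow> real" where
  "coef \<delta> s i t = (K (t - s - \<delta> *\<^sub>R axis i 1) - K (t - s + \<delta> *\<^sub>R axis i 1)) / s2 \<delta>"
definition amap :: "real \<Rightarrow> real^'n \<Rightarrow> real^'n \<Rightarrow> real^'n \<Rightarrow> real" where
  "amap \<delta> s t y = (\<Sum>i\<in>UNIV. y $ i * coef \<delta> s i t)"
definition Amat :: "real \<Rightarrow> real^'n \<Rightarrow> real^'n \<Rightarrow> real^'n^'n" where
  "Amat \<delta> s t = (\<chi> j i. (Kg (t - s - \<delta> *\<^sub>R axis i 1) - Kg (t - s + \<delta> *\<^sub>R axis i 1)) $ j / s2 \<delta>)"
definition Bmat :: "real \<Rightarrow> real^'n \<Rightarrow> real^'n \<Rightarrow> real^'n \<Rightarrow> real^'n^'n" where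
  "Bmat \<delta> s t y = (\<chi> j k. \<Sum>i\<in>UNIV. y $ i * ((KH (t - s - \<delta> *\<^sub>R axis i 1) - KH (t - s + \<delta> *\<^sub>R axis i 1)) $ j $ k / s2 \<delta>))"
definition Rf :: "real \<Rightarrow> real^'n \<Rightarrow> real^'n \<Rightarrow> 'w \<Rightarrow> real" where
  "Rf \<delta> s t \<omega> = X t \<omega> - amap \<delta> s t (Yv \<delta> s \<omega>)"

lemma K_shift:
  "((\<lambda>t. K (t - s + w)) has_derivative (\<lambda>v. Kg (t - s + w) \<bullet> v)) (at t)"
  "((\<lambda>t. K (t - s - w)) has_derivative (\<lambda>v. Kg (t - s - w) \<bullet> v)) (at t)"
proof -
  have "((\<lambda>t. t - s + w) has_derivative (\<lambda>v. v - 0 + 0)) (at t)" "((\<lambda>t. t - s - w) has_derivative (\<lambda>v. v - 0 - 0)) (at t)"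
    by (intro has_derivative_add has_derivative_diff has_derivative_ident has_derivative_const)+
  then have "((\<lambda>t. t - s + w) has_derivative (\<lambda>v. v)) (at t)" "((\<lambda>t. t - s - w) has_derivative (\<lambda>v. v)) (at t)"
    by simp_all
  from this[THEN has_derivative_compose, OF K_deriv]
  show "((\<lambda>t. K (t - s + w)) has_derivative (\<lambda>v. Kg (t - s + w) \<bullet> v)) (at t)"
    "((\<lambda>t. K (t - s - w)) has_derivative (\<lambda>v. Kg (t - s - w) \<bullet> v)) (at t)" .
qed

lemma Kg_shift:
  "((\<lambda>t. Kg (t - s + w)) has_derivative (\<lambda>v. KH (t - s + w) *v v)) (at t)"
  "((\<lambda>t. Kg (t - s - w)) has_derivative (\<lambda>v. KH (t - s - w) *v v)) (at t)"
proof -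
  have "((\<lambda>t. t - s + w) has_derivative (\<lambda>v. v - 0 + 0)) (at t)" "((\<lambda>t. t - s - w) has_derivative (\<lambda>v. v - 0 - 0)) (at t)"
    by (intro has_derivative_add has_derivative_diff has_derivative_ident has_derivative_const)+
  then have "((\<lambda>t. t - s + w) has_derivative (\<lambda>v. v)) (at t)" "((\<lambda>t. t - s - w) has_derivative (\<lambda>v. v)) (at t)"
    by simp_all
  from this[THEN has_derivative_compose, OF Kg_deriv]
  show "((\<lambda>t. Kg (t - s + w)) has_derivative (\<lambda>v. KH (t - s + w) *v v)) (at t)"
    "((\<lambda>t. Kg (t - s - w)) has_derivative (\<lambda>v. KH (t - s - w) *v v)) (at t)" .
qed

lemma amap_deriv: "((\<lambda>t. amap \<delta> s t y) has_derivative (\<lambda>v. (Amat \<delta> s t *v y) \<bullet> v)) (at t)"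
proof -
  have c: "((\<lambda>t. coef \<delta> s i t) has_derivative
      (\<lambda>v. (Kg (t - s - \<delta> *\<^sub>R axis i 1) \<bullet> v - Kg (t - s + \<delta> *\<^sub>R axis i 1) \<bullet> v) / s2 \<delta>)) (at t)" for i
    unfolding coef_def
    by (intro bounded_linear.has_derivative[OF bounded_linear_divide] has_derivative_diff K_shift)
  have "((\<lambda>t. amap \<delta> s t y) has_derivative (\<lambda>v. \<Sum>i\<in>UNIV. y $ i * ((Kg (t - s - \<delta> *\<^sub>R axis i 1) \<bullet> v - Kg (t - s + \<delta> *\<^sub>R axis i 1) \<bullet> v) / s2 \<delta>))) (at t)"
    unfolding amap_def by (intro has_derivative_sum has_derivative_mult_right c)
  moreover have "(\<Sum>i\<in>UNIV. y $ i * ((Kg (t - s - \<delta> *\<^sub>R axis i 1) \<bullet> v - Kg (t - s + \<delta> *\<^sub>R axis i 1) \<bullet> v) / s2 \<delta>)) =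
      (Amat \<delta> s t *v y) \<bullet> v" for v
  proof -
    have "(Amat \<delta> s t *v y) \<bullet> v = (\<Sum>j\<in>UNIV. \<Sum>i\<in>UNIV. Amat \<delta> s t $ j $ i * y $ i * v $ j)"
      by (simp add: inner_vec_def matrix_vector_mult_def sum_distrib_right)
    also have "\<dots> = (\<Sum>i\<in>UNIV. \<Sum>j\<in>UNIV. Amat \<delta> s t $ j $ i * y $ i * v $ j)" by (rule sum.swap)
    also have "\<dots> = (\<Sum>i\<in>UNIV. y $ i * ((Kg (t - s - \<delta> *\<^sub>R axis i 1) - Kg (t - s + \<delta> *\<^sub>R axis i 1)) \<bullet> v / s2 \<delta>))"
      unfolding Amat_def inner_vec_def by (simp add: sum_distrib_left sum_divide_distrib mult_ac)
    finally show ?thesis by (simp add: inner_diff_left)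
  qed
  ultimately show ?thesis by simp
qed

lemma Amat_deriv: "((\<lambda>t. Amat \<delta> s t *v y) has_derivative (\<lambda>v. Bmat \<delta> s t y *v v)) (at t)"
proof (rule has_derivative_vecI)
  fix j
  have c: "((\<lambda>t. (Kg (t - s - \<delta> *\<^sub>R axis i 1) - Kg (t - s + \<delta> *\<^sub>R axis i 1)) $ j / s2 \<delta>) has_derivative
      (\<lambda>v. (KH (t - s - \<delta> *\<^sub>R axis i 1) *v v - KH (t - s + \<delta> *\<^sub>R axis i 1) *v v) $ j / s2 \<delta>)) (at t)" for i
    by (intro bounded_linear.has_derivative[OF bounded_linear_divide] bounded_linear.has_derivative[OF bounded_linear_vec_nth]
          has_derivative_diff Kg_shift)
  have "((\<lambda>t. \<Sum>i\<in>UNIV. ((Kg (t - s - \<delta> *\<^sub>R axis i 1) - Kg (t - s + \<delta> *\<^sub>R axis i 1)) $ j / s2 \<delta>) * y $ i) has_derivative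
      (\<lambda>v. \<Sum>i\<in>UNIV. ((KH (t - s - \<delta> *\<^sub>R axis i 1) *v v - KH (t - s + \<delta> *\<^sub>R axis i 1) *v v) $ j / s2 \<delta>) * y $ i)) (at t)"
    by (intro has_derivative_sum has_derivative_mult_left c)
  moreover have "(\<Sum>i\<in>UNIV. ((KH (t - s - \<delta> *\<^sub>R axis i 1) *v v - KH (t - s + \<delta> *\<^sub>R axis i 1) *v v) $ j / s2 \<delta>) * y $ i) =
      (Bmat \<delta> s t y *v v) $ j" for v
  proof -
    have "(Bmat \<delta> s t y *v v) $ j = (\<Sum>k\<in>UNIV. \<Sum>i\<in>UNIV. (y $ i * ((KH (t - s - \<delta> *\<^sub>R axis i 1) - KH (t - s + \<delta> *\<^sub>R axis i 1)) $ j $ k / s2 \<delta>)) * v $ k)"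
      by (simp add: Bmat_def matrix_vector_mult_def sum_distrib_right)
    also have "\<dots> = (\<Sum>i\<in>UNIV. \<Sum>k\<in>UNIV. (y $ i * ((KH (t - s - \<delta> *\<^sub>R axis i 1) - KH (t - s + \<delta> *\<^sub>R axis i 1)) $ j $ k / s2 \<delta>)) * v $ k)"
      by (rule sum.swap)
    also have "\<dots> = (\<Sum>i\<in>UNIV. (((KH (t - s - \<delta> *\<^sub>R axis i 1) - KH (t - s + \<delta> *\<^sub>R axis i 1)) *v v) $ j / s2 \<delta>) * y $ i)"
      unfolding matrix_vector_mult_def by (simp add: sum_distrib_left sum_distrib_right sum_divide_distrib mult_ac)
    finally show ?thesis by (simp add: matrix_vector_mult_diff_rdistrib)
  qed
  ultimately show "((\<lambda>t. (Amat \<delta> s t *v y) $ j) has_derivative (\<lambda>v. (Bmat \<delta> s t y *v v) $ j)) (at t)"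
    by (simp add: Amat_def matrix_vector_mult_def)
qed

lemma Amat_cont: "continuous_on UNIV (Amat \<delta> s)"
  unfolding Amat_def[abs_def] divide_inverse
  by (intro continuous_intros continuous_on_compose2[OF Kg_cont]) auto

lemma Bmat_cont: "continuous_on UNIV (\<lambda>(t, y). Bmat \<delta> s t y)"
  unfolding Bmat_def case_prod_unfold divide_inverse
  by (intro continuous_intros continuous_on_compose2[OF KH_cont]) auto

lemma amap_cont: "continuous_on UNIV (\<lambda>(t, y). amap \<delta> s t y)"
  unfolding amap_def coef_def case_prod_unfold divide_inverse
  by (intro continuous_intros continuous_on_compose2[OF K_cont]) auto

text \<open>For \<open>t = s\<close> the matrix is a nonzero multiple of the identity, since \<open>Kg\<close> is radial. It depends on \<open>t - s\<close> only, hence the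
  radius is uniform in \<open>s\<close>.\<close>

lemma Amat_nonsing:
  assumes d: "\<delta> > 0" "C' (\<delta>\<^sup>2 / 2) \<noteq> 0" "C (2 * \<delta>\<^sup>2) < 1"
  obtains r where "r > 0" "\<And>s. ball s r \<subseteq> {t. det (Amat \<delta> s t) \<noteq> 0}"
proof -
  have ax: "Kg (c *\<^sub>R axis i 1) = (C' (c\<^sup>2 / 2) * c) *\<^sub>R axis i 1" for c i
  proof -
    have "(norm (c *\<^sub>R axis i 1 :: real^'n))\<^sup>2 = c\<^sup>2"
      unfolding power2_norm_eq_inner by (simp add: inner_axis_axis power2_eq_square)
    then show ?thesis by (simp add: Kg_def)
  qed
  have neg: "Kg (- (\<delta> *\<^sub>R axis i 1)) = (C' (\<delta>\<^sup>2 / 2) * - \<delta>) *\<^sub>R axis i 1" for i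
    using ax[of "- \<delta>" i] by simp
  have "Amat \<delta> 0 0 $ j $ i = mat (- 2 * \<delta> * C' (\<delta>\<^sup>2 / 2) / s2 \<delta>) $ j $ i" for i j
    unfolding Amat_def vec_lambda_beta diff_0_right diff_0 add_0 ax neg by (auto simp: mat_def axis_def)
  then have "Amat \<delta> 0 0 = mat (- 2 * \<delta> * C' (\<delta>\<^sup>2 / 2) / s2 \<delta>)"
    by (simp add: vec_eq_iff)
  then have "det (Amat \<delta> 0 0) = (- 2 * \<delta> * C' (\<delta>\<^sup>2 / 2) / s2 \<delta>) ^ CARD('n)"
    by (simp add: det_diagonal mat_def)
  then have nz: "det (Amat \<delta> 0 0) \<noteq> 0" using d by (simp add: s2_def)
  have "continuous_on UNIV (\<lambda>t. det (Amat \<delta> 0 t))" by (intro continuous_intros Amat_cont)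
  then have "open {t. det (Amat \<delta> 0 t) \<noteq> 0}" by (rule open_Collect_neq[OF _ continuous_on_const])
  then obtain r where r: "r > 0" "ball 0 r \<subseteq> {t. det (Amat \<delta> 0 t) \<noteq> 0}"
    using nz open_contains_ball by blast
  have "ball s r \<subseteq> {t. det (Amat \<delta> s t) \<noteq> 0}" for s
  proof
    fix t assume "t \<in> ball s r"
    then have "t - s \<in> ball 0 r" by (simp add: dist_norm norm_minus_commute)
    moreover have "Amat \<delta> s t = Amat \<delta> 0 (t - s)" by (simp add: Amat_def)
    ultimately show "t \<in> {t. det (Amat \<delta> s t) \<noteq> 0}" using r(2) by auto
  qed
  then show ?thesis using r(1) that by blast
qed

lemma lincomb_Y: "lincomb (\<lambda>\<omega>. Yv \<delta> s \<omega> $ i)"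
  unfolding Yv_def by (simp add: lincomb_diff lincomb_X)

lemma lincomb_R: "lincomb (Rf \<delta> s t)"
  unfolding Rf_def amap_def
  using lincomb_cmult[OF lincomb_Y]
  by (intro lincomb_diff lincomb_X lincomb_sum) (simp add: mult.commute)

lemma mean_Y: "expectation (\<lambda>\<omega>. Yv \<delta> s \<omega> $ i) = 0"
  using lincomb_integrable(1)[OF lincomb_X lincomb_X] by (simp add: Yv_def mean)

lemma mean_R: "expectation (Rf \<delta> s t) = 0"
  unfolding Rf_def amap_def
  using lincomb_integrable(1)[OF lincomb_X lincomb_X] lincomb_integrable(1)[OF lincomb_Y lincomb_Y]
  by (simp add: mean mean_Y)

lemma cov_XY:
  assumes "s2 \<delta> \<noteq> 0"
  shows "expectation (\<lambda>\<omega>. X t \<omega> * Yv \<delta> s \<omega> $ i) = s2 \<delta> * coef \<delta> s i t"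
proof -
  have "expectation (\<lambda>\<omega>. X t \<omega> * Yv \<delta> s \<omega> $ i) =
      K (t - (s + \<delta> *\<^sub>R axis i 1)) - K (t - (s - \<delta> *\<^sub>R axis i 1))"
    using lincomb_integrable(2)[OF lincomb_X lincomb_X] by (simp add: Yv_def right_diff_distrib covK)
  moreover have "t - (s + \<delta> *\<^sub>R axis i 1) = t - s - \<delta> *\<^sub>R axis i 1" "t - (s - \<delta> *\<^sub>R axis i 1) = t - s + \<delta> *\<^sub>R axis i 1"
    by (simp_all add: algebra_simps)
  ultimately show ?thesis using assms by (simp only: coef_def) simp
qed

lemma K_axis:
  "K (\<delta> *\<^sub>R axis i 1 + \<epsilon> *\<^sub>R axis j 1) = (if i = j then C ((\<delta> + \<epsilon>)\<^sup>2 / 2) else C ((\<delta>\<^sup>2 + \<epsilon>\<^sup>2) / 2))"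
proof -
  have "(norm (\<delta> *\<^sub>R axis i 1 + \<epsilon> *\<^sub>R axis j 1 :: real^'n))\<^sup>2 = (if i = j then (\<delta> + \<epsilon>)\<^sup>2 else \<delta>\<^sup>2 + \<epsilon>\<^sup>2)"
    unfolding power2_norm_eq_inner
    by (auto simp: inner_add_left inner_add_right inner_axis_axis power2_eq_square algebra_simps)
  then show ?thesis by (simp add: K_def)
qed

lemma cov_YY: "expectation (\<lambda>\<omega>. Yv \<delta> s \<omega> $ i * Yv \<delta> s \<omega> $ j) = (if i = j then s2 \<delta> else 0)"
proof -
  let ?e = "\<lambda>i. axis i 1 :: real^'n"
  have "expectation (\<lambda>\<omega>. Yv \<delta> s \<omega> $ i * Yv \<delta> s \<omega> $ j) =
     expectation (\<lambda>\<omega>. X (s + \<delta> *\<^sub>R ?e i) \<omega> * X (s + \<delta> *\<^sub>R ?e j) \<omega> - X (s + \<delta> *\<^sub>R ?e i) \<omega> * X (s - \<delta> *\<^sub>R ?e j) \<omega>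
       - X (s - \<delta> *\<^sub>R ?e i) \<omega> * X (s + \<delta> *\<^sub>R ?e j) \<omega> + X (s - \<delta> *\<^sub>R ?e i) \<omega> * X (s - \<delta> *\<^sub>R ?e j) \<omega>)"
    by (simp add: Yv_def algebra_simps)
  also have "\<dots> = K (\<delta> *\<^sub>R ?e i + (- \<delta>) *\<^sub>R ?e j) - K (\<delta> *\<^sub>R ?e i + \<delta> *\<^sub>R ?e j)
      - K ((- \<delta>) *\<^sub>R ?e i + (- \<delta>) *\<^sub>R ?e j) + K ((- \<delta>) *\<^sub>R ?e i + \<delta> *\<^sub>R ?e j)"
  proof -
    have "(s + \<delta> *\<^sub>R ?e i) - (s + \<delta> *\<^sub>R ?e j) = \<delta> *\<^sub>R ?e i + (- \<delta>) *\<^sub>R ?e j"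
      "(s + \<delta> *\<^sub>R ?e i) - (s - \<delta> *\<^sub>R ?e j) = \<delta> *\<^sub>R ?e i + \<delta> *\<^sub>R ?e j"
      "(s - \<delta> *\<^sub>R ?e i) - (s + \<delta> *\<^sub>R ?e j) = (- \<delta>) *\<^sub>R ?e i + (- \<delta>) *\<^sub>R ?e j"
      "(s - \<delta> *\<^sub>R ?e i) - (s - \<delta> *\<^sub>R ?e j) = (- \<delta>) *\<^sub>R ?e i + \<delta> *\<^sub>R ?e j"
      by (simp_all add: algebra_simps)
    note eqs = this[THEN arg_cong[where f=K]]
    show ?thesis unfolding eqs[symmetric] covK[symmetric]
      using lincomb_integrable(2)[OF lincomb_X lincomb_X] by simp
  qed
  also have "\<dots> = (if i = j then s2 \<delta> else 0)"
    unfolding K_axis by (auto simp: s2_def C_0 power2_eq_square)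
  finally show ?thesis .
qed

lemma cov_RY:
  assumes "s2 \<delta> \<noteq> 0"
  shows "expectation (\<lambda>\<omega>. Rf \<delta> s t \<omega> * Yv \<delta> s \<omega> $ j) = 0"
proof -
  have "expectation (\<lambda>\<omega>. Rf \<delta> s t \<omega> * Yv \<delta> s \<omega> $ j) =
    expectation (\<lambda>\<omega>. X t \<omega> * Yv \<delta> s \<omega> $ j - (\<Sum>i\<in>UNIV. coef \<delta> s i t * (Yv \<delta> s \<omega> $ i * Yv \<delta> s \<omega> $ j)))"
    unfolding Rf_def amap_def left_diff_distrib sum_distrib_right by (simp add: mult_ac)
  also have "\<dots> = s2 \<delta> * coef \<delta> s j t - (\<Sum>i\<in>UNIV. coef \<delta> s i t * (if i = j then s2 \<delta> else 0))"
    using lincomb_integrable(2)[OF lincomb_X lincomb_Y] lincomb_integrable(2)[OF lincomb_Y lincomb_Y]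
    by (simp add: cov_XY[OF assms] cov_YY)
  also have "\<dots> = 0" by (simp add: if_distrib[of "\<lambda>x. _ * x"] cong: if_cong)
  finally show ?thesis .
qed

end

section \<open>The Kac--Rice formula for isotropic Gaussian fields\<close>

context isotropic_gaussian_field
begin

abbreviation \<gamma>0 :: real where "\<gamma>0 \<equiv> - C' 0"

text \<open>The jointly Gaussian space spanned by the field and its Hessian at one point.\<close>

definition jetcomb :: "real^'n \<Rightarrow> ('w \<Rightarrow> real) \<Rightarrow> bool" where
  "jetcomb t f \<longleftrightarrow> (\<exists>a c. f = (\<lambda>\<omega>. a * X t \<omega> + (\<Sum>i\<in>UNIV. \<Sum>j\<in>UNIV. c i j * hessf X t \<omega> $ i $ j)))"

lemma jetcomb_gauss:
  assumes "jetcomb t f" shows "gaussian_rv M f"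
proof -
  from assms obtain a c where f: "f = (\<lambda>\<omega>. a * X t \<omega> + (\<Sum>i\<in>UNIV. \<Sum>j\<in>UNIV. c i j * hessf X t \<omega> $ i $ j))"
    unfolding jetcomb_def by blast
  show ?thesis unfolding f using jet_gaussian[of a t "\<lambda>_. 0" c] by simp
qed

lemma jetcomb_X: "jetcomb t (X t)"
  unfolding jetcomb_def by (intro exI[of _ "1::real"] exI[of _ "\<lambda>_ _. 0::real"]) auto

lemma jetcomb_H: "jetcomb t (\<lambda>\<omega>. hessf X t \<omega> $ i $ j)"
proof -
  have d: "(\<Sum>l\<in>UNIV. of_bool (l = j') * f l) = f j'" for f :: "'n \<Rightarrow> real" and j'
    by (simp add: of_bool_def if_distrib[of "\<lambda>x. x * _"] cong: if_cong)
  have "(\<Sum>k\<in>UNIV. \<Sum>l\<in>UNIV. (of_bool (k = i) * of_bool (l = j)) * hessf X t \<omega> $ k $ l) =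
      (\<Sum>k\<in>UNIV. of_bool (k = i) * (\<Sum>l\<in>UNIV. of_bool (l = j) * hessf X t \<omega> $ k $ l))" for \<omega>
    by (simp only: sum_distrib_left mult.assoc)
  then have "(\<Sum>k\<in>UNIV. \<Sum>l\<in>UNIV. (of_bool (k = i) * of_bool (l = j)) * hessf X t \<omega> $ k $ l) = hessf X t \<omega> $ i $ j" for \<omega>
    by (simp only: d)
  then show ?thesis unfolding jetcomb_def
    by (intro exI[of _ "0::real"] exI[of _ "\<lambda>k l. of_bool (k = i) * of_bool (l = j) :: real"]) simp
qed

lemma jetcomb_0: "jetcomb t (\<lambda>_. 0)"
  unfolding jetcomb_def by (intro exI[of _ "0::real"] exI[of _ "\<lambda>_ _. 0::real"]) auto

lemma jetcomb_cmult: assumes "jetcomb t f" shows "jetcomb t (\<lambda>\<omega>. k * f \<omega>)"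
proof -
  from assms obtain a c where f: "f = (\<lambda>\<omega>. a * X t \<omega> + (\<Sum>i\<in>UNIV. \<Sum>j\<in>UNIV. c i j * hessf X t \<omega> $ i $ j))"
    unfolding jetcomb_def by blast
  show ?thesis unfolding jetcomb_def f
    by (intro exI[of _ "k * a"] exI[of _ "\<lambda>i j. k * c i j"]) (simp add: fun_eq_iff distrib_left sum_distrib_left mult.assoc)
qed

lemma jetcomb_add: assumes "jetcomb t f" "jetcomb t g" shows "jetcomb t (\<lambda>\<omega>. f \<omega> + g \<omega>)"
proof -
  from assms obtain a c a' c' where f: "f = (\<lambda>\<omega>. a * X t \<omega> + (\<Sum>i\<in>UNIV. \<Sum>j\<in>UNIV. c i j * hessf X t \<omega> $ i $ j))"
    "g = (\<lambda>\<omega>. a' * X t \<omega> + (\<Sum>i\<in>UNIV. \<Sum>j\<in>UNIV. c' i j * hessf X t \<omega> $ i $ j))"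
    unfolding jetcomb_def by blast
  show ?thesis unfolding jetcomb_def f
    by (intro exI[of _ "a + a'"] exI[of _ "\<lambda>i j. c i j + c' i j"]) (simp add: fun_eq_iff distrib_right sum.distrib)
qed

lemma jetcomb_diff: assumes "jetcomb t f" "jetcomb t g" shows "jetcomb t (\<lambda>\<omega>. f \<omega> - g \<omega>)"
  using jetcomb_add[OF assms(1) jetcomb_cmult[OF assms(2), of "- 1"]] by simp

lemma jetcomb_divide: assumes "jetcomb t f" shows "jetcomb t (\<lambda>\<omega>. f \<omega> / k)"
  using jetcomb_cmult[OF assms, of "1 / k"] by simp

lemma jetcomb_sum:
  assumes "\<And>i. i \<in> I \<Longrightarrow> jetcomb t (f i)"
  shows "jetcomb t (\<lambda>\<omega>. \<Sum>i\<in>I. f i \<omega>)"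
proof (cases "finite I")
  case True
  then show ?thesis using assms by (induction I) (auto simp: jetcomb_0 intro!: jetcomb_add)
qed (simp add: jetcomb_0)

lemmas jetcomb_intros = jetcomb_X jetcomb_H jetcomb_cmult jetcomb_add jetcomb_diff jetcomb_divide

lemma jetcomb_integrable:
  assumes "jetcomb t f" "jetcomb t g"
  shows "integrable M f" "integrable M (\<lambda>\<omega>. f \<omega> * g \<omega>)"
  using gaussian_rvD(1-3)[OF jetcomb_gauss[OF assms(1)]] gaussian_rvD(1-3)[OF jetcomb_gauss[OF assms(2)]]
  by (auto intro: integrable_mult_square)

lemma jetcomb_mean:
  assumes "jetcomb t f" shows "expectation f = 0"
proof -
  from assms obtain a c where f: "f = (\<lambda>\<omega>. a * X t \<omega> + (\<Sum>i\<in>UNIV. \<Sum>j\<in>UNIV. c i j * hessf X t \<omega> $ i $ j))"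
    unfolding jetcomb_def by blast
  have i: "integrable M (X t)" "\<And>i j. integrable M (\<lambda>\<omega>. hessf X t \<omega> $ i $ j)"
    using jetcomb_integrable(1)[OF jetcomb_X jetcomb_X] jetcomb_integrable(1)[OF jetcomb_H jetcomb_X] by blast+
  show ?thesis unfolding f by (simp add: i mean jet_mean)
qed

lemma grad_comp_meas: "(\<lambda>\<omega>. gradf X t \<omega> $ i) \<in> borel_measurable M"
proof -
  have "(\<Sum>k\<in>UNIV. of_bool (k = i) * gradf X t \<omega> $ k) = gradf X t \<omega> $ i" for \<omega>
    by (simp add: of_bool_def if_distrib[of "\<lambda>x. x * _"] cong: if_cong)
  then show ?thesis
    using gaussian_rvD(1)[OF jet_gaussian[where a=0 and b="\<lambda>k. of_bool (k = i)" and c="\<lambda>_ _. 0", of t]] by simp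
qed

lemma hess_comp_meas: "(\<lambda>\<omega>. hessf X t \<omega> $ i $ j) \<in> borel_measurable M"
  by (rule gaussian_rvD(1)[OF jetcomb_gauss[OF jetcomb_H]])

lemma grad_meas [measurable]: "gradf X t \<in> borel_measurable M"
  by (rule borel_measurable_vecI) (rule grad_comp_meas)

lemma hess_meas [measurable]: "hessf X t \<in> borel_measurable M"
  by (rule borel_measurable_matI) (rule hess_comp_meas)

lemma grad_distributed:
  "distributed M lborel (gradf X t) (\<lambda>u. ennreal (normal_vec_density (sqrt \<gamma>0) u))"
proof -
  have "distributed M lborel (\<lambda>\<omega>. \<chi> i. gradf X t \<omega> $ i) (\<lambda>u. ennreal (normal_vec_density (sqrt \<gamma>0) u))"
  proof (rule gaussian_vector[where W="\<lambda>i \<omega>. gradf X t \<omega> $ i"])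
    show "gaussian_rv M (\<lambda>\<omega>. \<Sum>j\<in>UNIV. b j * gradf X t \<omega> $ j)" for b
      using jet_gaussian[of 0 t b "\<lambda>_ _. 0"] by simp
    show "expectation (\<lambda>\<omega>. gradf X t \<omega> $ i * gradf X t \<omega> $ j) = (if i = j then (sqrt \<gamma>0)\<^sup>2 else 0)" for i j
      using C'_0 by (simp add: jet_covariance)
  qed (use C'_0 in \<open>simp_all add: jet_mean\<close>)
  then show ?thesis by simp
qed

lemma grad_indep_jet:
  "indep_pair M borel (gradf X t) borel (\<lambda>\<omega>. (X t \<omega>, hessf X t \<omega>))"
proof -
  define W :: "('n \<times> 'n) option \<Rightarrow> 'w \<Rightarrow> real" where
    "W k = (case k of None \<Rightarrow> X t | Some (i, j) \<Rightarrow> (\<lambda>\<omega>. hessf X t \<omega> $ i $ j))" for k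
  show ?thesis
  proof (rule gaussian_indep[where U="\<lambda>i \<omega>. gradf X t \<omega> $ i" and W=W])
    fix I :: "'n set" and J :: "('n \<times> 'n) option set" and a b
    have "(\<Sum>i\<in>I. a i * gradf X t \<omega> $ i) + (\<Sum>k\<in>J. b k * W k \<omega>) =
        (if None \<in> J then b None else 0) * X t \<omega> + (\<Sum>i\<in>UNIV. (if i \<in> I then a i else 0) * gradf X t \<omega> $ i) +
        (\<Sum>i\<in>UNIV. \<Sum>j\<in>UNIV. (if Some (i, j) \<in> J then b (Some (i, j)) else 0) * hessf X t \<omega> $ i $ j)" for \<omega>
    proof -
      have 1: "(\<Sum>i\<in>I. a i * gradf X t \<omega> $ i) = (\<Sum>i\<in>UNIV. (if i \<in> I then a i else 0) * gradf X t \<omega> $ i)"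
        by (rule sum.mono_neutral_cong_left) auto
      have "(\<Sum>k\<in>J. b k * W k \<omega>) = (\<Sum>k\<in>UNIV. (if k \<in> J then b k else 0) * W k \<omega>)"
        by (rule sum.mono_neutral_cong_left) auto
      also have "\<dots> = (if None \<in> J then b None else 0) * W None \<omega> + (\<Sum>k\<in>range Some. (if k \<in> J then b k else 0) * W k \<omega>)"
        unfolding UNIV_option_conv by (subst sum.insert) auto
      also have "(\<Sum>k\<in>range Some. (if k \<in> J then b k else 0) * W k \<omega>) =
          (\<Sum>p\<in>UNIV. (if Some p \<in> J then b (Some p) else 0) * W (Some p) \<omega>)"
        by (subst sum.reindex) auto
      also have "\<dots> = (\<Sum>i\<in>UNIV. \<Sum>j\<in>UNIV. (if Some (i, j) \<in> J then b (Some (i, j)) else 0) * W (Some (i, j)) \<omega>)"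
        unfolding UNIV_Times_UNIV[symmetric] sum.cartesian_product by (simp only: case_prod_unfold prod.collapse)
      finally show ?thesis using 1 by (simp add: W_def)
    qed
    then show "gaussian_rv M (\<lambda>\<omega>. (\<Sum>i\<in>I. a i * gradf X t \<omega> $ i) + (\<Sum>k\<in>J. b k * W k \<omega>))"
      using jet_gaussian[of "if None \<in> J then b None else 0" t "\<lambda>i. if i \<in> I then a i else 0"
        "\<lambda>i j. if Some (i, j) \<in> J then b (Some (i, j)) else 0"] by simp
  next
    show "expectation (W k) = 0" for k
      by (cases k) (auto simp: W_def mean jet_mean)
    show "expectation (\<lambda>\<omega>. gradf X t \<omega> $ i * W k \<omega>) = 0" for i k
    proof (cases k)
      case None
      then show ?thesis using jet_covariance(2)[of t i] by (simp add: W_def mult.commute)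
    next
      case (Some p)
      then show ?thesis using jet_covariance(5)[of t i "fst p" "snd p"] by (simp add: W_def case_prod_unfold)
    qed
    show "gradf X t \<in> borel_measurable (gen_algebra (\<lambda>i \<omega>. gradf X t \<omega> $ i))"
      by (rule borel_measurable_vecI) (rule measurable_gen_algebra[of "\<lambda>i \<omega>. gradf X t \<omega> $ i"])
    have "(\<lambda>\<omega>. hessf X t \<omega> $ i $ j) \<in> borel_measurable (gen_algebra W)" for i j
      using measurable_gen_algebra[of W "Some (i, j)"] by (simp add: W_def)
    then have 1: "hessf X t \<in> borel_measurable (gen_algebra W)" by (rule borel_measurable_matI)
    have 2: "X t \<in> borel_measurable (gen_algebra W)"
      using measurable_gen_algebra[of W None] by (simp add: W_def)
    show "(\<lambda>\<omega>. (X t \<omega>, hessf X t \<omega>)) \<in> borel_measurable (gen_algebra W)"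
      using borel_measurable_Pair[OF 2 1] .
  qed (simp add: jet_mean)
qed

lemma Rf_deriv:
  assumes "\<omega> \<in> space M"
  shows "((\<lambda>t. Rf \<delta> s t \<omega>) has_derivative (\<lambda>v. (gradf X t \<omega> - Amat \<delta> s t *v Yv \<delta> s \<omega>) \<bullet> v)) (at t)"
  unfolding Rf_def inner_diff_left by (intro has_derivative_diff X_deriv[OF assms] amap_deriv)

lemma Rf_grad_deriv:
  assumes "\<omega> \<in> space M"
  shows "((\<lambda>t. gradf X t \<omega> - Amat \<delta> s t *v Yv \<delta> s \<omega>) has_derivative
     (\<lambda>v. (hessf X t \<omega> - Bmat \<delta> s t (Yv \<delta> s \<omega>)) *v v)) (at t)"
  unfolding matrix_vector_mult_diff_rdistrib by (intro has_derivative_diff grad_deriv[OF assms] Amat_deriv)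

text \<open>The residual is uncorrelated with \<open>Yv\<close>, hence independent of it; its gradient and Hessian are limits of difference
  quotients and so measurable with respect to the algebra generated by the residual.\<close>

lemma split_field_near:
  assumes d: "\<delta> > 0" "C' (\<delta>\<^sup>2 / 2) \<noteq> 0" "C (2 * \<delta>\<^sup>2) < 1"
  shows "split_field M (gen_algebra (Rf \<delta> s)) (\<lambda>\<omega> t. Rf \<delta> s t \<omega>)
     (\<lambda>\<omega> t. gradf X t \<omega> - Amat \<delta> s t *v Yv \<delta> s \<omega>) (\<lambda>\<omega> t. hessf X t \<omega> - Bmat \<delta> s t (Yv \<delta> s \<omega>))
     (Yv \<delta> s) (normal_vec_density (sqrt (s2 \<delta>))) (amap \<delta> s) (Amat \<delta> s) (Bmat \<delta> s) {t. det (Amat \<delta> s t) \<noteq> 0}"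
proof
  have s2: "s2 \<delta> > 0" using d by (simp add: s2_def)
  show "space (gen_algebra (Rf \<delta> s)) = space M" by simp
  have Rm: "Rf \<delta> s t \<in> borel_measurable M" for t using gaussian_rvD(1)[OF lincomb_gauss[OF lincomb_R]] .
  show "sets (gen_algebra (Rf \<delta> s)) \<subseteq> events" by (rule subalgebra_gen_algebra[OF Rm])
  show Rg: "(\<lambda>\<omega>. Rf \<delta> s t \<omega>) \<in> borel_measurable (gen_algebra (Rf \<delta> s))" for t by (rule measurable_gen_algebra)
  note [measurable] = Rg
  have g0j: "(\<lambda>\<omega>. (gradf X t \<omega> - Amat \<delta> s t *v Yv \<delta> s \<omega>) $ j) \<in> borel_measurable (gen_algebra (Rf \<delta> s))" for t j
  proof (rule borel_measurable_LIMSEQ_real)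
    fix \<omega> assume "\<omega> \<in> space (gen_algebra (Rf \<delta> s))"
    then have "\<omega> \<in> space M" by simp
    from has_derivative_imp_LIMSEQ[OF Rf_deriv[OF this, of \<delta> s t], of "axis j 1"]
    show "(\<lambda>n. (Rf \<delta> s (t + inverse (real (Suc n)) *\<^sub>R axis j 1) \<omega> - Rf \<delta> s t \<omega>) / inverse (real (Suc n)))
        \<longlonglongrightarrow> (gradf X t \<omega> - Amat \<delta> s t *v Yv \<delta> s \<omega>) $ j" by (simp add: inner_axis)
  qed measurable
  show "(\<lambda>\<omega>. gradf X t \<omega> - Amat \<delta> s t *v Yv \<delta> s \<omega>) \<in> borel_measurable (gen_algebra (Rf \<delta> s))" for t
    by (rule borel_measurable_vecI[OF g0j])
  show "(\<lambda>\<omega>. hessf X t \<omega> - Bmat \<delta> s t (Yv \<delta> s \<omega>)) \<in> borel_measurable (gen_algebra (Rf \<delta> s))" for t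
  proof (rule borel_measurable_matI, rule borel_measurable_LIMSEQ_real)
    fix j k \<omega> assume "\<omega> \<in> space (gen_algebra (Rf \<delta> s))"
    then have \<omega>: "\<omega> \<in> space M" by simp
    from has_derivative_imp_LIMSEQ[OF bounded_linear.has_derivative[OF bounded_linear_vec_nth[of j] Rf_grad_deriv[OF \<omega>, of \<delta> s t]], of "axis k 1"]
    show "(\<lambda>n. ((gradf X (t + inverse (real (Suc n)) *\<^sub>R axis k 1) \<omega> - Amat \<delta> s (t + inverse (real (Suc n)) *\<^sub>R axis k 1) *v Yv \<delta> s \<omega>) $ j
        - (gradf X t \<omega> - Amat \<delta> s t *v Yv \<delta> s \<omega>) $ j) / inverse (real (Suc n)))
        \<longlonglongrightarrow> (hessf X t \<omega> - Bmat \<delta> s t (Yv \<delta> s \<omega>)) $ j $ k"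
      by (simp add: matrix_vector_mult_basis column_def)
  qed (intro borel_measurable_divide borel_measurable_diff g0j borel_measurable_const)
  show "continuous_on UNIV (\<lambda>t. Rf \<delta> s t \<omega>)" if "\<omega> \<in> space M" for \<omega>
    using Rf_deriv[OF that] by (meson continuous_at_imp_continuous_on has_derivative_continuous)
  show "((\<lambda>t. gradf X t \<omega> - Amat \<delta> s t *v Yv \<delta> s \<omega>) has_derivative
     (*v) (hessf X t \<omega> - Bmat \<delta> s t (Yv \<delta> s \<omega>))) (at t)" if "\<omega> \<in> space M" for \<omega> t
    by (rule Rf_grad_deriv[OF that])
  show "continuous_on UNIV (\<lambda>t. hessf X t \<omega> - Bmat \<delta> s t (Yv \<delta> s \<omega>))" if "\<omega> \<in> space M" for \<omega>
  proof -
    have "continuous_on UNIV (\<lambda>t. Bmat \<delta> s t (Yv \<delta> s \<omega>))"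
      using continuous_on_compose2[OF Bmat_cont, of UNIV "\<lambda>t. (t, Yv \<delta> s \<omega>)" \<delta> s] by (simp add: continuous_on_Pair)
    then show ?thesis by (intro continuous_on_diff hess_cont that)
  qed
  show "indep_pair M (gen_algebra (Rf \<delta> s)) (\<lambda>\<omega>. \<omega>) borel (Yv \<delta> s)"
  proof (rule gaussian_indep[where U="Rf \<delta> s" and W="\<lambda>i \<omega>. Yv \<delta> s \<omega> $ i"])
    show "gaussian_rv M (\<lambda>\<omega>. (\<Sum>i\<in>I. a i * Rf \<delta> s i \<omega>) + (\<Sum>j\<in>J. b j * Yv \<delta> s \<omega> $ j))" for I J a b
      by (intro lincomb_gauss lincomb_add lincomb_sum lincomb_cmult lincomb_R lincomb_Y)
    show "Yv \<delta> s \<in> borel_measurable (gen_algebra (\<lambda>i \<omega>. Yv \<delta> s \<omega> $ i))"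
      by (rule borel_measurable_vecI) (rule measurable_gen_algebra[of "\<lambda>i \<omega>. Yv \<delta> s \<omega> $ i"])
  qed (use s2 in \<open>simp_all add: mean_R mean_Y cov_RY\<close>)
  have "distributed M lborel (\<lambda>\<omega>. \<chi> i. Yv \<delta> s \<omega> $ i) (\<lambda>y. ennreal (normal_vec_density (sqrt (s2 \<delta>)) y))"
    by (rule gaussian_vector[where W="\<lambda>i \<omega>. Yv \<delta> s \<omega> $ i"])
       (use s2 in \<open>simp_all add: mean_Y cov_YY lincomb_gauss lincomb_sum lincomb_cmult lincomb_Y\<close>)
  then show "distributed M lborel (Yv \<delta> s) (\<lambda>y. ennreal (normal_vec_density (sqrt (s2 \<delta>)) y))" by simp
  show "normal_vec_density (sqrt (s2 \<delta>)) \<in> borel_measurable borel"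
    by (rule borel_measurable_continuous_onI[OF continuous_normal_vec_density])
  show "open {t. det (Amat \<delta> s t) \<noteq> 0}"
    by (rule open_Collect_neq[OF continuous_on_det[OF Amat_cont] continuous_on_const])
qed (use normal_vec_density_nonneg amap_cont Amat_cont Amat_deriv Bmat_cont in auto)

lemma kac_rice_near:
  fixes \<psi> :: "real \<Rightarrow> real^'n^'n \<Rightarrow> real"
  assumes d: "\<delta> > 0" "C' (\<delta>\<^sup>2 / 2) \<noteq> 0" "C (2 * \<delta>\<^sup>2) < 1"
    and V: "fsigma_in euclidean V" "V \<subseteq> {t. det (Amat \<delta> s t) \<noteq> 0}"
  shows "continuous_on UNIV (\<lambda>(x, h). \<psi> x h) \<Longrightarrow> (\<And>x h. \<psi> x h > 0 \<Longrightarrow> det h \<noteq> 0) \<Longrightarrow>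
    (\<integral>\<^sup>+\<omega>. emeasure (count_space UNIV) {t\<in>V. gradf X t \<omega> = 0 \<and> \<psi> (X t \<omega>) (hessf X t \<omega>) > 0} \<partial>M) =
    (\<integral>\<^sup>+t. ennreal (normal_vec_density (sqrt \<gamma>0) (0::real^'n)) * (\<integral>\<^sup>+\<omega>. ennreal (\<bar>det (hessf X t \<omega>)\<bar> *
        of_bool (\<psi> (X t \<omega>) (hessf X t \<omega>) > 0)) \<partial>M) * indicator V t \<partial>lborel)"
    and "AE \<omega> in M. \<not> (\<exists>t\<in>V. gradf X t \<omega> = 0 \<and> det (hessf X t \<omega>) = 0)"
proof -
  interpret S: split_field M "gen_algebra (Rf \<delta> s)" "\<lambda>\<omega> t. Rf \<delta> s t \<omega>"
     "\<lambda>\<omega> t. gradf X t \<omega> - Amat \<delta> s t *v Yv \<delta> s \<omega>" "\<lambda>\<omega> t. hessf X t \<omega> - Bmat \<delta> s t (Yv \<delta> s \<omega>)"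
     "Yv \<delta> s" "normal_vec_density (sqrt (s2 \<delta>))" "amap \<delta> s" "Amat \<delta> s" "Bmat \<delta> s" "{t. det (Amat \<delta> s t) \<noteq> 0}"
    by (rule split_field_near[OF d])
  have eqs: "Rf \<delta> s t \<omega> + amap \<delta> s t (Yv \<delta> s \<omega>) = X t \<omega>"
    "gradf X t \<omega> - Amat \<delta> s t *v Yv \<delta> s \<omega> + Amat \<delta> s t *v Yv \<delta> s \<omega> = gradf X t \<omega>"
    "hessf X t \<omega> - Bmat \<delta> s t (Yv \<delta> s \<omega>) + Bmat \<delta> s t (Yv \<delta> s \<omega>) = hessf X t \<omega>" for t \<omega>
    by (simp_all add: Rf_def)
  show "AE \<omega> in M. \<not> (\<exists>t\<in>V. gradf X t \<omega> = 0 \<and> det (hessf X t \<omega>) = 0)"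
    using S.AE_no_degenerate_local[OF V] unfolding eqs .
  assume \<psi>: "continuous_on UNIV (\<lambda>(x, h). \<psi> x h)" "\<And>x h. \<psi> x h > 0 \<Longrightarrow> det h \<noteq> 0"
  show "(\<integral>\<^sup>+\<omega>. emeasure (count_space UNIV) {t\<in>V. gradf X t \<omega> = 0 \<and> \<psi> (X t \<omega>) (hessf X t \<omega>) > 0} \<partial>M) =
    (\<integral>\<^sup>+t. ennreal (normal_vec_density (sqrt \<gamma>0) (0::real^'n)) * (\<integral>\<^sup>+\<omega>. ennreal (\<bar>det (hessf X t \<omega>)\<bar> *
        of_bool (\<psi> (X t \<omega>) (hessf X t \<omega>) > 0)) \<partial>M) * indicator V t \<partial>lborel)"
    by (rule S.expected_count_split[OF V \<psi>(1), where q="normal_vec_density (sqrt \<gamma>0)", unfolded eqs,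
        OF _ grad_indep_jet grad_distributed normal_vec_density_nonneg continuous_normal_vec_density
         continuous_normal_vec_density normal_vec_density_le], erule \<psi>(2))
qed

text \<open>Dyadic cells whose diameter is below the uniform radius of \<open>Amat_nonsing\<close> cut \<open>V\<close> into countably many pieces, each inside the
  domain of one splitting. Cells are half-open, which is why \<open>V\<close> ranges over countable unions of closed sets.\<close>

theorem kac_rice:
  fixes \<psi> :: "real \<Rightarrow> real^'n^'n \<Rightarrow> real"
  assumes V: "fsigma_in euclidean V"
  shows "continuous_on UNIV (\<lambda>(x, h). \<psi> x h) \<Longrightarrow> (\<And>x h. \<psi> x h > 0 \<Longrightarrow> det h \<noteq> 0) \<Longrightarrow>
    (\<integral>\<^sup>+\<omega>. emeasure (count_space UNIV) {t\<in>V. gradf X t \<omega> = 0 \<and> \<psi> (X t \<omega>) (hessf X t \<omega>) > 0} \<partial>M) =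
    (\<integral>\<^sup>+t. ennreal (normal_vec_density (sqrt \<gamma>0) (0::real^'n)) * (\<integral>\<^sup>+\<omega>. ennreal (\<bar>det (hessf X t \<omega>)\<bar> *
        of_bool (\<psi> (X t \<omega>) (hessf X t \<omega>) > 0)) \<partial>M) * indicator V t \<partial>lborel)"
    and "AE \<omega> in M. \<not> (\<exists>t\<in>V. gradf X t \<omega> = 0 \<and> det (hessf X t \<omega>) = 0)"
proof -
  obtain \<delta> where d: "\<delta> > 0" "C' (\<delta>\<^sup>2 / 2) \<noteq> 0" "C (2 * \<delta>\<^sup>2) < 1" using small_step by blast
  obtain r where r: "r > 0" "\<And>s. ball s r \<subseteq> {t. det (Amat \<delta> s t) \<noteq> 0}" using Amat_nonsing[OF d] by blast
  obtain m :: nat where m: "real CARD('n) * (1/2) ^ m < r"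
  proof -
    obtain m where "(1/2 :: real) ^ m < r / real CARD('n)"
      using real_arch_pow_inv[of "r / real CARD('n)" "1/2"] r(1) by auto
    then show ?thesis using that by (simp add: field_simps)
  qed
  have cell_ball: "t \<in> ball s r" if "cell m s = cell m t" for s t :: "real^'n"
  proof -
    have "\<bar>s $ i - t $ i\<bar> \<le> (1/2) ^ m" for i
    proof -
      have "\<lfloor>2 ^ m * s $ i\<rfloor> = \<lfloor>2 ^ m * t $ i\<rfloor>" using that by (simp add: cell_def fun_eq_iff)
      then have "\<bar>2 ^ m * s $ i - 2 ^ m * t $ i\<bar> \<le> 1" by linarith
      then have "2 ^ m * \<bar>s $ i - t $ i\<bar> \<le> 1" by (simp add: abs_mult flip: right_diff_distrib)
      then show ?thesis by (simp add: power_one_over field_simps)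
    qed
    then have "(\<Sum>i\<in>UNIV. \<bar>(s - t) $ i\<bar>) \<le> (\<Sum>i\<in>(UNIV::'n set). (1/2) ^ m)" by (intro sum_mono) simp
    then have "norm (s - t) \<le> real CARD('n) * (1/2) ^ m"
      using norm_le_l1_cart[of "s - t"] by simp
    then show ?thesis using m by (simp add: dist_norm)
  qed
  define U where "U j = V \<inter> {t. to_nat (cell m t) = j}" for j
  have U: "fsigma_in euclidean (U j) \<and> (\<exists>s. U j \<subseteq> {t. det (Amat \<delta> s t) \<noteq> 0})" for j
  proof (cases "U j = {}")
    case False
    then obtain s where s: "s \<in> U j" by blast
    then have Ueq: "U j = V \<inter> {t. cell m t = cell m s}" by (auto simp: U_def)
    have "U j \<subseteq> ball s r" using cell_ball Ueq by auto
    then show ?thesis using r(2) unfolding Ueq using V fsigma_cell by (blast intro: fsigma_in_Int)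
  qed simp
  have VU: "V = (\<Union>j. U j)" by (auto simp: U_def)
  have Udisj: "disjoint_family U" by (auto simp: disjoint_family_on_def U_def)
  have "AE \<omega> in M. \<not> (\<exists>t\<in>U j. gradf X t \<omega> = 0 \<and> det (hessf X t \<omega>) = 0)" for j
    using U[of j] kac_rice_near(2)[OF d] by blast
  then have "AE \<omega> in M. \<forall>j. \<not> (\<exists>t\<in>U j. gradf X t \<omega> = 0 \<and> det (hessf X t \<omega>) = 0)"
    by (simp add: AE_all_countable)
  then show "AE \<omega> in M. \<not> (\<exists>t\<in>V. gradf X t \<omega> = 0 \<and> det (hessf X t \<omega>) = 0)"
    by eventually_elim (auto simp: VU)
  assume \<psi>: "continuous_on UNIV (\<lambda>(x, h). \<psi> x h)" "\<And>x h. \<psi> x h > 0 \<Longrightarrow> det h \<noteq> 0"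
  let ?Z = "\<lambda>A \<omega>. {t\<in>A. gradf X t \<omega> = 0 \<and> \<psi> (X t \<omega>) (hessf X t \<omega>) > 0}"
  let ?e = "\<lambda>t. ennreal (normal_vec_density (sqrt \<gamma>0) (0::real^'n)) * (\<integral>\<^sup>+\<omega>. ennreal (\<bar>det (hessf X t \<omega>)\<bar> *
        of_bool (\<psi> (X t \<omega>) (hessf X t \<omega>) > 0)) \<partial>M)"
  note \<psi>m = borel_measurable_compose_pair[OF \<psi>(1)]
  have Zm: "(\<lambda>\<omega>. emeasure (count_space UNIV) (?Z (U j) \<omega>)) \<in> borel_measurable M" for j
  proof -
    have "(\<lambda>\<omega>. emeasure (count_space UNIV) {t\<in>U j. norm (gradf X t \<omega>) = 0 \<and> \<psi> (X t \<omega>) (hessf X t \<omega>) > 0}) \<in> borel_measurable M"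
    proof (rule measurable_zero_count)
      show "fsigma_in euclidean (U j)" using U by blast
      fix \<omega> assume \<omega>: "\<omega> \<in> space M"
      have g: "continuous_on UNIV (\<lambda>t. gradf X t \<omega>)"
        using grad_deriv[OF \<omega>] by (meson continuous_at_imp_continuous_on has_derivative_continuous)
      show "continuous_on (U j) (\<lambda>t. norm (gradf X t \<omega>))"
        by (intro continuous_on_norm continuous_on_subset[OF g]) auto
      have "continuous_on UNIV (\<lambda>t. \<psi> (X t \<omega>) (hessf X t \<omega>))"
        using continuous_on_compose2[OF \<psi>(1) continuous_on_Pair[OF X_cont[OF \<omega>] hess_cont[OF \<omega>]]] by simp
      then show "continuous_on (U j) (\<lambda>t. \<psi> (X t \<omega>) (hessf X t \<omega>))" by (rule continuous_on_subset) auto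
    qed (auto intro!: \<psi>m)
    then show ?thesis by simp
  qed
  have cnt: "emeasure (count_space UNIV) (?Z V \<omega>) = (\<Sum>j. emeasure (count_space UNIV) (?Z (U j) \<omega>))" for \<omega>
  proof -
    have "?Z V \<omega> = (\<Union>j. ?Z (U j) \<omega>)" by (auto simp: VU)
    moreover have "disjoint_family (\<lambda>j. ?Z (U j) \<omega>)" using Udisj by (auto simp: disjoint_family_on_def)
    ultimately show ?thesis by (subst suminf_emeasure) auto
  qed
  have [measurable]: "V \<in> sets borel" "U j \<in> sets borel" for j
    using V U fsigma_imp_borel by blast+
  have em: "?e \<in> borel_measurable borel"
  proof -
    have jX: "(\<lambda>(\<omega>, t). X t \<omega>) \<in> borel_measurable (M \<Otimes>\<^sub>M borel)"
      by (rule measurable_continuous_field) (auto intro: X_cont)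
    have jH: "(\<lambda>(\<omega>, t). hessf X t \<omega>) \<in> borel_measurable (M \<Otimes>\<^sub>M borel)"
      by (rule measurable_continuous_field) (auto intro: hess_cont)
    have j\<psi>: "(\<lambda>(\<omega>, t). \<psi> (X t \<omega>) (hessf X t \<omega>)) \<in> borel_measurable (M \<Otimes>\<^sub>M borel)"
      using measurable_compose[OF borel_measurable_Pair[OF jX jH] borel_measurable_continuous_onI[OF \<psi>(1)]]
      by (simp add: case_prod_unfold)
    have sw: "(\<lambda>(t, \<omega>). (\<omega>, t)) \<in> borel \<Otimes>\<^sub>M M \<rightarrow>\<^sub>M M \<Otimes>\<^sub>M (borel :: (real^'n) measure)"
      by (rule measurable_pair_swap')
    note [measurable] = measurable_compose[OF sw jH, simplified case_prod_unfold fst_conv snd_conv]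
      measurable_compose[OF sw j\<psi>, simplified case_prod_unfold fst_conv snd_conv]
    have "(\<lambda>t. \<integral>\<^sup>+\<omega>. ennreal (\<bar>det (hessf X t \<omega>)\<bar> * of_bool (\<psi> (X t \<omega>) (hessf X t \<omega>) > 0)) \<partial>M) \<in> borel_measurable borel"
      by (rule borel_measurable_nn_integral) measurable
    then show ?thesis by simp
  qed
  have ind: "(\<Sum>j. indicator (U j) t) = (indicator V t :: ennreal)" for t
    using suminf_indicator[OF Udisj, of t] by (simp add: VU)
  have "(\<integral>\<^sup>+\<omega>. emeasure (count_space UNIV) (?Z V \<omega>) \<partial>M) = (\<Sum>j. \<integral>\<^sup>+\<omega>. emeasure (count_space UNIV) (?Z (U j) \<omega>) \<partial>M)"
    unfolding cnt by (rule nn_integral_suminf[OF Zm])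
  also have "\<dots> = (\<Sum>j. \<integral>\<^sup>+t. ?e t * indicator (U j) t \<partial>lborel)"
  proof (rule suminf_cong)
    fix j
    obtain s where s: "U j \<subseteq> {t. det (Amat \<delta> s t) \<noteq> 0}" using U by blast
    show "(\<integral>\<^sup>+\<omega>. emeasure (count_space UNIV) (?Z (U j) \<omega>) \<partial>M) = (\<integral>\<^sup>+t. ?e t * indicator (U j) t \<partial>lborel)"
      by (rule kac_rice_near(1)[OF d _ s \<psi>]) (use U in auto)
  qed
  also have "\<dots> = (\<integral>\<^sup>+t. (\<Sum>j. ?e t * indicator (U j) t) \<partial>lborel)"
    using em by (intro nn_integral_suminf[symmetric]) auto
  also have "\<dots> = (\<integral>\<^sup>+t. ?e t * indicator V t \<partial>lborel)" by (simp add: ind)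
  finally show "(\<integral>\<^sup>+\<omega>. emeasure (count_space UNIV) (?Z V \<omega>) \<partial>M) = (\<integral>\<^sup>+t. ?e t * indicator V t \<partial>lborel)" .
qed

end

section \<open>The index of a symmetric matrix in dimensions one and two\<close>

lemma matrix_vector_mult_singleton:
  assumes "(UNIV :: 'n::finite set) = {i}"
  shows "(A :: real^'n^'n) *v v = (A $ i $ i) *\<^sub>R v"
proof -
  have "(A *v v) $ j = A $ i $ i * v $ j" for j
  proof -
    have "j \<in> {i}" using assms by blast
    then show ?thesis by (simp add: matrix_vector_mult_def assms)
  qed
  then show ?thesis by (simp add: vec_eq_iff)
qed

lemma neg_index_1:
  fixes A :: "real^'n^'n"
  assumes i: "(UNIV :: 'n set) = {i}"
  shows "neg_index A = (if A $ i $ i < 0 then 1 else 0)"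
proof -
  have eig: "A *v v = l *\<^sub>R v \<longleftrightarrow> A $ i $ i = l" if "v \<noteq> 0" for v l
    unfolding matrix_vector_mult_singleton[OF i] using that by (simp add: scaleR_cancel_right)
  have ex: "\<exists>v::real^'n. v \<noteq> 0" by (intro exI[of _ "axis i 1"]) (simp add: axis_eq_0_iff)
  have "{l. l < 0 \<and> (\<exists>v. v \<noteq> 0 \<and> A *v v = l *\<^sub>R v)} = (if A $ i $ i < 0 then {A $ i $ i} else {})"
    using eig ex by auto
  moreover have "{v. A *v v = (A $ i $ i) *\<^sub>R v} = UNIV" by (simp add: matrix_vector_mult_singleton[OF i])
  moreover have "CARD('n) = 1" unfolding i by simp
  ultimately show ?thesis unfolding neg_index_def by (simp add: dim_UNIV)
qed

lemma det_1:
  fixes A :: "real^'n^'n"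
  assumes i: "(UNIV :: 'n set) = {i}"
  shows "det A = A $ i $ i"
proof -
  have "{p. p permutes (UNIV :: 'n set)} = {id}" unfolding i by (simp add: permutes_sing)
  then show ?thesis by (simp add: det_def i)
qed

lemma det_2':
  fixes A :: "real^'n^'n"
  assumes ij: "(UNIV :: 'n set) = {i, j}" "i \<noteq> j"
  shows "det A = A $ i $ i * A $ j $ j - A $ i $ j * A $ j $ i"
proof -
  have "{p. p permutes (UNIV :: 'n set)} = {id, Transposition.transpose i j}"
    unfolding ij(1) by (auto simp: permutes_doubleton_iff)
  moreover have "id \<noteq> Transposition.transpose i j" using ij(2) by (metis id_apply transpose_apply_first)
  ultimately show ?thesis using ij(2) by (simp add: det_def ij(1) sign_swap_id)
qed

text \<open>The eigenvalues \<open>l1\<close> and \<open>l2\<close> are the roots of the characteristic polynomial, with product \<open>det A\<close> and sum the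
  trace. Their eigenspaces are lines, except for \<open>l1 = l2\<close>, when \<open>A\<close> is scalar and the single eigenspace has
  dimension two.\<close>

lemma neg_index_2:
  fixes A :: "real^'n^'n"
  assumes ij: "(UNIV :: 'n set) = {i, j}" "i \<noteq> j"
    and sym: "A $ i $ j = A $ j $ i" and nz: "det A \<noteq> 0"
  shows "neg_index A = (if det A < 0 then 1 else if A $ i $ i + A $ j $ j < 0 then 2 else 0)"
proof -
  define a b c where "a = A $ i $ i" and "b = A $ i $ j" and "c = A $ j $ j"
  have dA: "det A = a * c - b\<^sup>2" using det_2'[OF ij, of A] sym by (simp add: a_def b_def c_def power2_eq_square)
  define r where "r = sqrt (((a - c) / 2)\<^sup>2 + b\<^sup>2)"
  define l1 l2 where "l1 = (a + c) / 2 + r" and "l2 = (a + c) / 2 - r"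
  have r0: "r \<ge> 0" by (simp add: r_def)
  have r2: "r\<^sup>2 = ((a - c) / 2)\<^sup>2 + b\<^sup>2" by (simp add: r_def)
  have prod: "l1 * l2 = det A" unfolding l1_def l2_def dA
    using r2 by (simp add: power2_eq_square field_simps)
  have sum: "l1 + l2 = a + c" by (simp add: l1_def l2_def)
  have UN: "k = i \<or> k = j" for k using ij(1) by blast
  have vext: "v = w \<longleftrightarrow> v $ i = w $ i \<and> v $ j = w $ j" for v w :: "real^'n"
    unfolding vec_eq_iff using UN by metis
  have Av: "(A *v v) $ i = a * v $ i + b * v $ j" "(A *v v) $ j = b * v $ i + c * v $ j" for v
    using ij(2) sym by (simp_all add: matrix_vector_mult_def ij(1) a_def b_def c_def)
  have eigen: "A *v v = l *\<^sub>R v \<longleftrightarrow> (a - l) * v $ i + b * v $ j = 0 \<and> b * v $ i + (c - l) * v $ j = 0" for v l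
    unfolding vext Av by (auto simp: algebra_simps)
  have card2: "CARD('n) = 2" unfolding ij(1) using ij(2) by simp
  have char: "(a - l) * (c - l) - b\<^sup>2 = (l - l1) * (l - l2)" for l
  proof -
    have "(a - l) * (c - l) - b\<^sup>2 = (a * c - b\<^sup>2) - l * (a + c) + l * l" by (simp add: algebra_simps)
    moreover have "(l - l1) * (l - l2) = l1 * l2 - l * (l1 + l2) + l * l" by (simp add: algebra_simps)
    ultimately show ?thesis using prod sum dA by simp
  qed
  define V where "V l = {v. A *v v = l *\<^sub>R v}" for l
  have subV: "subspace (V l)" for l
    unfolding V_def by (auto simp: subspace_def matrix_vector_right_distrib scaleR_add_right matrix_vector_mult_scaleR mult.commute)
  have ev_iff: "(\<exists>v. v \<noteq> 0 \<and> A *v v = l *\<^sub>R v) \<longleftrightarrow> l = l1 \<or> l = l2" for l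
  proof
    assume "\<exists>v. v \<noteq> 0 \<and> A *v v = l *\<^sub>R v"
    then obtain v where v: "v \<noteq> 0" "(a - l) * v $ i + b * v $ j = 0" "b * v $ i + (c - l) * v $ j = 0"
      using eigen by blast
    have "((a - l) * (c - l) - b\<^sup>2) * v $ i = (c - l) * ((a - l) * v $ i + b * v $ j) - b * (b * v $ i + (c - l) * v $ j)"
      by (simp add: algebra_simps power2_eq_square)
    moreover have "((a - l) * (c - l) - b\<^sup>2) * v $ j = (a - l) * (b * v $ i + (c - l) * v $ j) - b * ((a - l) * v $ i + b * v $ j)"
      by (simp add: algebra_simps power2_eq_square)
    moreover have "v $ i \<noteq> 0 \<or> v $ j \<noteq> 0" using v(1) vext[of v 0] by auto
    ultimately have "(a - l) * (c - l) - b\<^sup>2 = 0" using v by auto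
    then show "l = l1 \<or> l = l2" using char by simp
  next
    assume "l = l1 \<or> l = l2"
    then have z: "(a - l) * (c - l) = b * b" using char[of l] by (auto simp: power2_eq_square)
    show "\<exists>v. v \<noteq> 0 \<and> A *v v = l *\<^sub>R v"
    proof (cases "b = 0 \<and> a - l = 0")
      case True
      let ?v = "\<chi> k. if k = i then (1::real) else 0"
      have "?v \<noteq> 0" unfolding vext by simp
      moreover have "A *v ?v = l *\<^sub>R ?v" unfolding eigen using True ij(2) by simp
      ultimately show ?thesis by blast
    next
      case False
      let ?v = "\<chi> k. if k = i then b else l - a"
      have "?v \<noteq> 0" unfolding vext using False ij(2) by auto
      moreover have "A *v ?v = l *\<^sub>R ?v" unfolding eigen using z ij(2) by (simp add: algebra_simps)
      ultimately show ?thesis by blast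
    qed
  qed
  have dim1: "dim (V l) = 1" if l12: "l = l1 \<or> l = l2" and ne: "l1 \<noteq> l2" for l
  proof -
    have "\<exists>v. v \<noteq> 0 \<and> A *v v = l *\<^sub>R v" using ev_iff[of l] l12 by simp
    then obtain v0 where v0: "v0 \<noteq> 0" "A *v v0 = l *\<^sub>R v0" by (elim exE conjE)
    have nn: "a - l \<noteq> 0 \<or> b \<noteq> 0 \<or> c - l \<noteq> 0"
    proof (rule ccontr)
      assume "\<not> ?thesis"
      then have "r\<^sup>2 = 0" unfolding r2 by auto
      then show False using ne by (simp add: l1_def l2_def)
    qed
    have "V l = span {v0}"
    proof
      show "span {v0} \<subseteq> V l" using v0 by (intro span_minimal subV) (auto simp: V_def)
      show "V l \<subseteq> span {v0}"
      proof
        fix v assume "v \<in> V l"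
        then have v: "(a - l) * v $ i + b * v $ j = 0" "b * v $ i + (c - l) * v $ j = 0" by (auto simp: V_def eigen)
        have w: "(a - l) * v0 $ i + b * v0 $ j = 0" "b * v0 $ i + (c - l) * v0 $ j = 0" using v0 eigen by auto
        have D: "v $ i * v0 $ j = v $ j * v0 $ i"
        proof -
          have "(a - l) * (v $ i * v0 $ j - v $ j * v0 $ i) =
              ((a - l) * v $ i + b * v $ j) * v0 $ j - ((a - l) * v0 $ i + b * v0 $ j) * v $ j"
            by (simp add: algebra_simps)
          moreover have "b * (v $ i * v0 $ j - v $ j * v0 $ i) =
              ((a - l) * v0 $ i + b * v0 $ j) * v $ i - ((a - l) * v $ i + b * v $ j) * v0 $ i"
            by (simp add: algebra_simps)
          moreover have "(c - l) * (v $ i * v0 $ j - v $ j * v0 $ i) =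
              (b * v0 $ i + (c - l) * v0 $ j) * v $ i - (b * v $ i + (c - l) * v $ j) * v0 $ i"
            by (simp add: algebra_simps)
          ultimately have "(a - l) * (v $ i * v0 $ j - v $ j * v0 $ i) = 0"
            "b * (v $ i * v0 $ j - v $ j * v0 $ i) = 0" "(c - l) * (v $ i * v0 $ j - v $ j * v0 $ i) = 0"
            unfolding v w by simp_all
          then show ?thesis using nn by auto
        qed
        have "v0 $ i \<noteq> 0 \<or> v0 $ j \<noteq> 0" using v0(1) vext[of v0 0] by auto
        then have "\<exists>k. v = k *\<^sub>R v0"
        proof
          assume "v0 $ i \<noteq> 0"
          then have "v = (v $ i / v0 $ i) *\<^sub>R v0" unfolding vext using D by (simp add: field_simps)
          then show ?thesis by blast
        next
          assume "v0 $ j \<noteq> 0"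
          then have "v = (v $ j / v0 $ j) *\<^sub>R v0" unfolding vext using D by (simp add: field_simps)
          then show ?thesis by blast
        qed
        then show "v \<in> span {v0}" by (auto simp: span_singleton)
      qed
    qed
    then show ?thesis using v0(1) by (simp add: dim_span)
  qed
  have set_eq: "{l. l < 0 \<and> (\<exists>v. v \<noteq> 0 \<and> A *v v = l *\<^sub>R v)} = {l. l < 0 \<and> (l = l1 \<or> l = l2)}"
    unfolding ev_iff ..
  have NI: "neg_index A = (\<Sum>l | l < 0 \<and> (l = l1 \<or> l = l2). dim (V l))"
    unfolding neg_index_def set_eq V_def ..
  consider "det A < 0" | "det A > 0" "a + c < 0" | "det A > 0" "a + c \<ge> 0" using nz by linarith
  then show ?thesis
  proof cases
    case 1
    then have "l1 * l2 < 0" using prod by simp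
    moreover have "l2 \<le> l1" using r0 by (simp add: l1_def l2_def)
    ultimately have "l1 > 0" "l2 < 0" by (auto simp: mult_less_0_iff)
    then have "{l. l < 0 \<and> (l = l1 \<or> l = l2)} = {l2}" by auto
    then show ?thesis using 1 dim1[of l2] \<open>l1 > 0\<close> \<open>l2 < 0\<close> by (simp add: NI)
  next
    case 2
    then have "0 < l1 * l2" "l1 + l2 < 0" using prod sum by simp_all
    then have neg: "l1 < 0" "l2 < 0" by (auto simp: zero_less_mult_iff)
    show ?thesis
    proof (cases "l1 = l2")
      case True
      then have "r = 0" by (simp add: l1_def l2_def)
      then have z: "((a - c) / 2)\<^sup>2 + b\<^sup>2 = 0" using r2 by simp
      then have "a = c" "b = 0" by (auto simp: sum_power2_eq_zero_iff)
      then have "V l1 = UNIV" using \<open>r = 0\<close> by (auto simp: V_def eigen l1_def)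
      then have "dim (V l1) = 2" by (simp add: dim_UNIV card2)
      moreover have "{l. l < 0 \<and> (l = l1 \<or> l = l2)} = {l1}" using True neg by auto
      ultimately show ?thesis using 2 by (simp add: NI a_def c_def)
    next
      case False
      then have "{l. l < 0 \<and> (l = l1 \<or> l = l2)} = {l1, l2}" using neg by auto
      then show ?thesis using 2 False dim1[of l1] dim1[of l2] by (simp add: NI a_def c_def)
    qed
  next
    case 3
    have "0 < l1 * l2" "0 \<le> l1 + l2" using 3 prod sum by simp_all
    then have "l1 > 0" "l2 > 0" by (auto simp: zero_less_mult_iff)
    then have E: "{l. l < 0 \<and> (l = l1 \<or> l = l2)} = {}" by auto
    have "neg_index A = 0" unfolding NI E by simp
    then show ?thesis using 3 by (simp add: a_def c_def)
  qed
qed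

section \<open>Gaussian integrals\<close>

definition norm_tail :: "real \<Rightarrow> real \<Rightarrow> real" where
  "norm_tail \<mu> s = (LINT u:{0<..}|lborel. normal_density \<mu> s u)"

lemma norm_tail_erfc:
  assumes s: "s > 0"
  shows "norm_tail \<mu> s = erfc (- \<mu> / (sqrt 2 * s)) / 2"
proof -
  define c where "c = sqrt 2 * s"
  have c: "c > 0" using s by (simp add: c_def)
  have c2: "c\<^sup>2 = 2 * s\<^sup>2" by (simp add: c_def power_mult_distrib)
  have "norm_tail \<mu> s = (\<integral>u. indicator {0<..} u * normal_density \<mu> s u \<partial>lborel)"
    by (simp add: norm_tail_def set_lebesgue_integral_def)
  also have "\<dots> = \<bar>c\<bar> *\<^sub>R (\<integral>t. indicator {0<..} (\<mu> + c * t) * normal_density \<mu> s (\<mu> + c * t) \<partial>lborel)"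
    using c by (intro lborel_integral_real_affine) simp
  also have "(\<lambda>t. indicator {0<..} (\<mu> + c * t) * normal_density \<mu> s (\<mu> + c * t)) =
      (\<lambda>t. (indicator {- \<mu> / c<..} t *\<^sub>R exp (- t\<^sup>2)) / (c * sqrt pi))"
  proof
    fix t
    have "0 < \<mu> + c * t \<longleftrightarrow> - \<mu> / c < t" using c by (simp add: field_simps) linarith
    moreover have "normal_density \<mu> s (\<mu> + c * t) = exp (- t\<^sup>2) / (c * sqrt pi)"
    proof -
      have "sqrt (2 * pi * s\<^sup>2) = c * sqrt pi"
        using s by (simp add: c_def real_sqrt_mult)
      moreover have "(c * t)\<^sup>2 / (2 * s\<^sup>2) = t\<^sup>2" using s by (simp add: power_mult_distrib c2)
      ultimately show ?thesis unfolding normal_density_def by simp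
    qed
    ultimately show "indicator {0<..} (\<mu> + c * t) * normal_density \<mu> s (\<mu> + c * t) =
      (indicator {- \<mu> / c<..} t *\<^sub>R exp (- t\<^sup>2)) / (c * sqrt pi)"
      by (simp add: indicator_def)
  qed
  also have "\<bar>c\<bar> *\<^sub>R (\<integral>t. (indicator {- \<mu> / c<..} t *\<^sub>R exp (- t\<^sup>2)) / (c * sqrt pi) \<partial>lborel) =
      (\<integral>t. indicator {- \<mu> / c<..} t *\<^sub>R exp (- t\<^sup>2) \<partial>lborel) / sqrt pi"
    using c by simp
  also have "(\<integral>t. indicator {- \<mu> / c<..} t *\<^sub>R exp (- t\<^sup>2) \<partial>lborel) = (\<integral>t. indicator {- \<mu> / c..} t *\<^sub>R exp (- t\<^sup>2) \<partial>lborel)"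
  proof (rule integral_cong_AE)
    show "AE t in lborel. indicator {- \<mu> / c<..} t *\<^sub>R exp (- t\<^sup>2) = indicator {- \<mu> / c..} t *\<^sub>R exp (- t\<^sup>2)"
      using AE_lborel_singleton[of "- \<mu> / c"] by eventually_elim (auto simp: indicator_def)
  qed auto
  finally show ?thesis by (simp add: erfc_def set_lebesgue_integral_def c_def)
qed

lemma normal_density_deriv:
  assumes s: "s > 0"
  shows "(normal_density \<mu> s has_real_derivative - ((u - \<mu>) / s\<^sup>2) * normal_density \<mu> s u) (at u)"
proof -
  have "((\<lambda>u. k * exp (- (u - \<mu>)\<^sup>2 / (2 * s\<^sup>2))) has_real_derivative
      - ((u - \<mu>) / s\<^sup>2) * (k * exp (- (u - \<mu>)\<^sup>2 / (2 * s\<^sup>2)))) (at u)" for k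
  proof -
    have "((\<lambda>u. - (u - \<mu>)\<^sup>2 / (2 * s\<^sup>2)) has_real_derivative - ((u - \<mu>) / s\<^sup>2)) (at u)"
      using s by (auto intro!: derivative_eq_intros simp: power4_eq_xxxx power2_eq_square field_simps)
    from DERIV_cmult[OF DERIV_chain2[OF DERIV_exp this], of k] show ?thesis by (simp add: mult_ac)
  qed
  then show ?thesis unfolding normal_density_def[abs_def] .
qed

lemma integrable_normal_1: "s > 0 \<Longrightarrow> integrable lborel (\<lambda>u. normal_density \<mu> s u * u)"
  using integrable_normal_moment_nz_1 .

lemma integrable_normal_2:
  assumes s: "s > 0"
  shows "integrable lborel (\<lambda>u. normal_density \<mu> s u * u\<^sup>2)"
proof -
  have "(\<lambda>u. normal_density \<mu> s u * u\<^sup>2) =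
      (\<lambda>u. normal_density \<mu> s u * (u - \<mu>)\<^sup>2 + 2 * \<mu> * (normal_density \<mu> s u * u) - \<mu>\<^sup>2 * normal_density \<mu> s u)"
    by (auto simp: power2_eq_square algebra_simps)
  then show ?thesis
    using integrable_normal_moment[OF s, of \<mu> 2] integrable_normal_1[OF s, of \<mu>] integrable_normal_density[OF s, of \<mu>]
    by simp
qed

lemma integrable_set: "integrable lborel f \<Longrightarrow> A \<in> sets borel \<Longrightarrow> set_integrable lborel A f" for f :: "real \<Rightarrow> real"
  unfolding set_integrable_def by (rule integrable_mult_indicator) auto

text \<open>Completing the square; the bound makes powers times the density vanish at infinity.\<close>

lemma normal_density_bound:
  assumes s: "s > 0"
  shows "normal_density \<mu> s u \<le> (exp (\<mu> + s\<^sup>2 / 2) / sqrt (2 * pi * s\<^sup>2)) * exp (- u)"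
proof -
  have "0 \<le> (u - \<mu> - s\<^sup>2)\<^sup>2 / (2 * s\<^sup>2)" by simp
  also have "\<dots> = (u - \<mu>)\<^sup>2 / (2 * s\<^sup>2) - (u - \<mu>) + s\<^sup>2 / 2"
    using s by (simp add: power2_eq_square field_simps)
  finally have "- ((u - \<mu>)\<^sup>2 / (2 * s\<^sup>2)) \<le> \<mu> + s\<^sup>2 / 2 + - u" by simp
  then have "exp (- ((u - \<mu>)\<^sup>2 / (2 * s\<^sup>2))) \<le> exp (\<mu> + s\<^sup>2 / 2) * exp (- u)"
    by (simp flip: exp_add)
  from mult_left_mono[OF this, of "1 / sqrt (2 * pi * s\<^sup>2)"]
  show ?thesis unfolding normal_density_def by simp
qed

lemma normal_density_tendsto:
  assumes s: "s > 0"
  shows "((\<lambda>u. normal_density \<mu> s u * u ^ k) \<longlongrightarrow> 0) at_top"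
proof (rule Lim_null_comparison)
  let ?c = "exp (\<mu> + s\<^sup>2 / 2) / sqrt (2 * pi * s\<^sup>2)"
  show "((\<lambda>u. ?c * (u ^ k / exp u)) \<longlongrightarrow> 0) at_top"
    by (rule tendsto_mult_right_zero[OF tendsto_power_div_exp_0])
  show "\<forall>\<^sub>F u in at_top. norm (normal_density \<mu> s u * u ^ k) \<le> ?c * (u ^ k / exp u)"
    using eventually_ge_at_top[of 0]
  proof eventually_elim
    case (elim u)
    have "normal_density \<mu> s u * u ^ k \<le> ?c * exp (- u) * u ^ k"
      using normal_density_bound[OF s, of \<mu> u] elim by (intro mult_right_mono) auto
    then show ?case using elim by (simp add: exp_minus field_simps)
  qed
qed

text \<open>\<open>- s\<^sup>2\<close> times the density is an antiderivative of the density times \<open>u - \<mu>\<close>.\<close>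

lemma tail_moment_1:
  assumes s: "s > 0"
  shows "(LINT u:{0<..}|lborel. normal_density \<mu> s u * u) = s\<^sup>2 * normal_density \<mu> s 0 + \<mu> * norm_tail \<mu> s"
proof -
  let ?n = "normal_density \<mu> s"
  have i: "integrable lborel (\<lambda>u. ?n u * (u - \<mu>))" using integrable_normal_moment[OF s, of \<mu> 1] by simp
  have "(LBINT u=ereal 0..\<infinity>. ?n u * (u - \<mu>)) = 0 - (- s\<^sup>2 * ?n 0)"
  proof (rule interval_integral_FTC_integrable[where F="\<lambda>u. - s\<^sup>2 * ?n u"])
    show "((\<lambda>u. - s\<^sup>2 * ?n u) has_vector_derivative ?n u * (u - \<mu>)) (at u)" for u
      unfolding has_real_derivative_iff_has_vector_derivative[symmetric]
      using s by (auto intro!: derivative_eq_intros normal_density_deriv)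
    show "isCont (\<lambda>u. ?n u * (u - \<mu>)) u" for u
      using normal_density_deriv[OF s, of \<mu> u] by (intro continuous_intros) (rule DERIV_isCont)
    show "set_integrable lborel (einterval (ereal 0) \<infinity>) (\<lambda>u. ?n u * (u - \<mu>))"
      using i by (intro integrable_set) auto
    show "(((\<lambda>u. - s\<^sup>2 * ?n u) \<circ> real_of_ereal) \<longlongrightarrow> - s\<^sup>2 * ?n 0) (at_right (ereal 0))"
      unfolding ereal_tendsto_simps
      using DERIV_isCont[OF normal_density_deriv[OF s, of \<mu> 0]]
      by (intro tendsto_intros) (simp add: isCont_def filterlim_at_split)
    show "(((\<lambda>u. - s\<^sup>2 * ?n u) \<circ> real_of_ereal) \<longlongrightarrow> 0) (at_left \<infinity>)"
      unfolding ereal_tendsto_simps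
      using normal_density_tendsto[OF s, of \<mu> 0] by (auto intro!: tendsto_mult_right_zero tendsto_minus_cancel_left[THEN iffD1])
  qed simp
  then have e: "(LINT u:{0<..}|lborel. ?n u * (u - \<mu>)) = s\<^sup>2 * ?n 0"
    by (simp add: interval_integral_to_infinity_eq)
  have "(LINT u:{0<..}|lborel. ?n u * u) = (LINT u:{0<..}|lborel. ?n u * (u - \<mu>) + \<mu> * ?n u)"
    by (intro set_lebesgue_integral_cong) (auto simp: algebra_simps)
  also have "\<dots> = (LINT u:{0<..}|lborel. ?n u * (u - \<mu>)) + (LINT u:{0<..}|lborel. \<mu> * ?n u)"
    using i integrable_normal_density[OF s, of \<mu>] by (intro set_integral_add integrable_set) auto
  finally show ?thesis using e by (simp add: norm_tail_def)
qed

lemma tail_moment_2: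
  assumes s: "s > 0"
  shows "(LINT u:{0<..}|lborel. normal_density \<mu> s u * u\<^sup>2) =
     \<mu> * s\<^sup>2 * normal_density \<mu> s 0 + (\<mu>\<^sup>2 + s\<^sup>2) * norm_tail \<mu> s"
proof -
  let ?n = "normal_density \<mu> s"
  have i: "integrable lborel (\<lambda>u. ?n u * u\<^sup>2 - \<mu> * (?n u * u) - s\<^sup>2 * ?n u)"
    using integrable_normal_2[OF s, of \<mu>] integrable_normal_1[OF s, of \<mu>] integrable_normal_density[OF s, of \<mu>] by simp
  have "(LBINT u=ereal 0..\<infinity>. ?n u * u\<^sup>2 - \<mu> * (?n u * u) - s\<^sup>2 * ?n u) = 0 - (- s\<^sup>2 * (?n 0 * 0))"
  proof (rule interval_integral_FTC_integrable[where F="\<lambda>u. - s\<^sup>2 * (?n u * u)"])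
    show "((\<lambda>u. - s\<^sup>2 * (?n u * u)) has_vector_derivative ?n u * u\<^sup>2 - \<mu> * (?n u * u) - s\<^sup>2 * ?n u) (at u)" for u
      unfolding has_real_derivative_iff_has_vector_derivative[symmetric]
      using s by (auto intro!: derivative_eq_intros normal_density_deriv simp: field_simps power2_eq_square)
    show "isCont (\<lambda>u. ?n u * u\<^sup>2 - \<mu> * (?n u * u) - s\<^sup>2 * ?n u) u" for u
      using DERIV_isCont[OF normal_density_deriv[OF s, of \<mu> u]] by (intro continuous_intros)
    show "set_integrable lborel (einterval (ereal 0) \<infinity>) (\<lambda>u. ?n u * u\<^sup>2 - \<mu> * (?n u * u) - s\<^sup>2 * ?n u)"
      using i by (intro integrable_set) auto
    show "(((\<lambda>u. - s\<^sup>2 * (?n u * u)) \<circ> real_of_ereal) \<longlongrightarrow> - s\<^sup>2 * (?n 0 * 0)) (at_right (ereal 0))"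
      unfolding ereal_tendsto_simps
      using DERIV_isCont[OF normal_density_deriv[OF s, of \<mu> 0]]
      by (intro tendsto_intros) (simp add: isCont_def filterlim_at_split)
    show "(((\<lambda>u. - s\<^sup>2 * (?n u * u)) \<circ> real_of_ereal) \<longlongrightarrow> 0) (at_left \<infinity>)"
      unfolding ereal_tendsto_simps
      using normal_density_tendsto[OF s, of \<mu> 1] by (auto intro!: tendsto_mult_right_zero tendsto_minus_cancel_left[THEN iffD1])
  qed simp
  then have e: "(LINT u:{0<..}|lborel. ?n u * u\<^sup>2 - \<mu> * (?n u * u) - s\<^sup>2 * ?n u) = 0"
    by (simp add: interval_integral_to_infinity_eq)
  have "(LINT u:{0<..}|lborel. ?n u * u\<^sup>2 - \<mu> * (?n u * u) - s\<^sup>2 * ?n u) =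
      (LINT u:{0<..}|lborel. ?n u * u\<^sup>2) - \<mu> * (LINT u:{0<..}|lborel. ?n u * u) - s\<^sup>2 * norm_tail \<mu> s"
    using integrable_set[OF integrable_normal_2[OF s, of \<mu>], of "{0<..}"] integrable_set[OF integrable_normal_1[OF s, of \<mu>], of "{0<..}"]
      integrable_set[OF integrable_normal_density[OF s, of \<mu>], of "{0<..}"]
    by (simp add: set_integral_diff norm_tail_def)
  then show ?thesis using e tail_moment_1[OF s, of \<mu>] by (simp add: algebra_simps power2_eq_square)
qed

lemma nn_set_integral:
  fixes f :: "real \<Rightarrow> real"
  assumes "integrable lborel f" "\<And>u. u \<in> A \<Longrightarrow> 0 \<le> f u" "A \<in> sets borel"
  shows "(\<integral>\<^sup>+u\<in>A. ennreal (f u) \<partial>lborel) = ennreal (LINT u:A|lborel. f u)"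
proof -
  have "(\<integral>\<^sup>+u\<in>A. ennreal (f u) \<partial>lborel) = (\<integral>\<^sup>+u. ennreal (indicator A u *\<^sub>R f u) \<partial>lborel)"
    by (intro nn_integral_cong) (auto split: split_indicator)
  also have "\<dots> = ennreal (LINT u:A|lborel. f u)"
    unfolding set_lebesgue_integral_def
    by (rule nn_integral_eq_integral)
       (use assms integrable_set[OF assms(1,3)] in \<open>auto simp: set_integrable_def indicator_def\<close>)
  finally show ?thesis .
qed

text \<open>Completing the square: tilting a normal law by a centred Gaussian weight gives a normal law again.\<close>

lemma normal_density_mult_exp:
  assumes s: "s > 0" and \<tau>: "\<tau> > 0"
  shows "normal_density \<mu> s u * exp (- u\<^sup>2 / (2 * \<tau>)) =
    (exp (- \<mu>\<^sup>2 / (2 * (s\<^sup>2 + \<tau>))) * sqrt (\<tau> / (s\<^sup>2 + \<tau>))) *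
    normal_density (\<mu> * \<tau> / (s\<^sup>2 + \<tau>)) (s * sqrt (\<tau> / (s\<^sup>2 + \<tau>))) u"
proof -
  define v where "v = s\<^sup>2 + \<tau>"
  have v: "v > 0" using s \<tau> by (simp add: v_def add_pos_pos)
  define q where "q = sqrt (\<tau> / v)"
  have q: "q > 0" "q\<^sup>2 = \<tau> / v" using \<tau> v by (simp_all add: q_def)
  define k where "k = 1 / sqrt (2 * pi * s\<^sup>2)"
  define e1 where "e1 = - (u - \<mu>)\<^sup>2 / (2 * s\<^sup>2)"
  define e2 where "e2 = - u\<^sup>2 / (2 * \<tau>)"
  define e3 where "e3 = - \<mu>\<^sup>2 / (2 * v)"
  define e4 where "e4 = - (u - \<mu> * \<tau> / v)\<^sup>2 / (2 * (s\<^sup>2 * (\<tau> / v)))"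
  have e: "e1 + e2 = e3 + e4"
  proof -
    have s2: "s\<^sup>2 = v - \<tau>" by (simp add: v_def)
    have nz: "v - \<tau> \<noteq> 0" using s2 s by (metis power_eq_0_iff less_irrefl)
    show ?thesis unfolding e1_def e2_def e3_def e4_def s2 using nz v \<tau>
      by (simp add: divide_simps) (simp add: algebra_simps power2_eq_square)
  qed
  have n1: "normal_density \<mu> s u = k * exp e1" by (simp add: normal_density_def k_def e1_def)
  have n2: "normal_density (\<mu> * \<tau> / v) (s * q) u = (k / q) * exp e4"
  proof -
    have "(s * q)\<^sup>2 = s\<^sup>2 * (\<tau> / v)" using q(2) by (simp add: power_mult_distrib)
    moreover have "1 / sqrt (2 * pi * (s * q)\<^sup>2) = k / q"
      using s q(1) by (simp add: k_def real_sqrt_mult power_mult_distrib)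
    ultimately show ?thesis unfolding normal_density_def e4_def by simp
  qed
  have "normal_density \<mu> s u * exp e2 = k * exp (e1 + e2)" by (simp add: n1 exp_add)
  also have "\<dots> = (exp e3 * q) * ((k / q) * exp e4)" unfolding e exp_add using q(1) by simp
  finally have "normal_density \<mu> s u * exp e2 = (exp e3 * q) * normal_density (\<mu> * \<tau> / v) (s * q) u" unfolding n2 .
  then show ?thesis unfolding e2_def e3_def q_def v_def .
qed

text \<open>Polar coordinates with the slope \<open>s = y / x\<close> as second coordinate: substitute \<open>y = x * s\<close>, exchange the
  integrals, and substitute \<open>r = x * sqrt (1 + s\<^sup>2)\<close>. The factor with the integral over \<open>s\<close> is identified in \<open>gauss_polar\<close>.\<close>

lemma polar_substitution:
  fixes g :: "real \<Rightarrow> ennreal"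
  assumes [measurable]: "g \<in> borel_measurable borel"
  shows "(\<integral>\<^sup>+x. \<integral>\<^sup>+y. g (x\<^sup>2 + y\<^sup>2) \<partial>lborel \<partial>lborel) =
    (\<integral>\<^sup>+s. ennreal (1 / (1 + s\<^sup>2)) \<partial>lborel) * (\<integral>\<^sup>+r. ennreal \<bar>r\<bar> * g (r\<^sup>2) \<partial>lborel)"
proof -
  have "(\<integral>\<^sup>+x. \<integral>\<^sup>+y. g (x\<^sup>2 + y\<^sup>2) \<partial>lborel \<partial>lborel) =
      (\<integral>\<^sup>+x. \<integral>\<^sup>+s. ennreal \<bar>x\<bar> * g (x\<^sup>2 * (1 + s\<^sup>2)) \<partial>lborel \<partial>lborel)"
  proof (rule nn_integral_cong_AE)
    show "AE x in lborel. (\<integral>\<^sup>+y. g (x\<^sup>2 + y\<^sup>2) \<partial>lborel) = (\<integral>\<^sup>+s. ennreal \<bar>x\<bar> * g (x\<^sup>2 * (1 + s\<^sup>2)) \<partial>lborel)"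
      using AE_lborel_singleton[of "0::real"]
    proof eventually_elim
      case (elim x)
      have "(\<integral>\<^sup>+y. g (x\<^sup>2 + y\<^sup>2) \<partial>lborel) = ennreal \<bar>x\<bar> * (\<integral>\<^sup>+s. g (x\<^sup>2 + (0 + x * s)\<^sup>2) \<partial>lborel)"
        using elim by (intro nn_integral_real_affine) auto
      also have "\<dots> = (\<integral>\<^sup>+s. ennreal \<bar>x\<bar> * g (x\<^sup>2 * (1 + s\<^sup>2)) \<partial>lborel)"
        by (subst nn_integral_cmult[symmetric]) (auto simp: power_mult_distrib algebra_simps)
      finally show ?case .
    qed
  qed
  also have "\<dots> = (\<integral>\<^sup>+s. \<integral>\<^sup>+x. ennreal \<bar>x\<bar> * g (x\<^sup>2 * (1 + s\<^sup>2)) \<partial>lborel \<partial>lborel)"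
    by (rule lborel_pair.Fubini'[symmetric]) measurable
  also have "\<dots> = (\<integral>\<^sup>+s. ennreal (1 / (1 + s\<^sup>2)) * (\<integral>\<^sup>+r. ennreal \<bar>r\<bar> * g (r\<^sup>2) \<partial>lborel) \<partial>lborel)"
  proof (rule nn_integral_cong)
    fix s :: real
    define c where "c = 1 / sqrt (1 + s\<^sup>2)"
    have p: "1 + s\<^sup>2 > 0" by (simp add: add_pos_nonneg)
    have c: "c > 0" "c\<^sup>2 * (1 + s\<^sup>2) = 1" "c * c = 1 / (1 + s\<^sup>2)" using p by (auto simp: c_def power_divide power2_eq_square[symmetric] field_simps)
    have "(\<integral>\<^sup>+x. ennreal \<bar>x\<bar> * g (x\<^sup>2 * (1 + s\<^sup>2)) \<partial>lborel) =
        ennreal \<bar>c\<bar> * (\<integral>\<^sup>+r. ennreal \<bar>0 + c * r\<bar> * g ((0 + c * r)\<^sup>2 * (1 + s\<^sup>2)) \<partial>lborel)"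
      using c by (intro nn_integral_real_affine) auto
    also have "\<dots> = (\<integral>\<^sup>+r. ennreal (1 / (1 + s\<^sup>2)) * (ennreal \<bar>r\<bar> * g (r\<^sup>2)) \<partial>lborel)"
    proof (subst nn_integral_cmult[symmetric], simp, rule nn_integral_cong)
      fix r
      have "(0 + c * r)\<^sup>2 * (1 + s\<^sup>2) = r\<^sup>2" using c(2) by (simp add: power_mult_distrib mult.assoc mult.left_commute[of "r\<^sup>2"])
      moreover have "ennreal \<bar>c\<bar> * ennreal \<bar>0 + c * r\<bar> = ennreal (1 / (1 + s\<^sup>2)) * ennreal \<bar>r\<bar>"
        using c by (simp add: abs_mult flip: ennreal_mult mult.assoc)
      ultimately show "ennreal \<bar>c\<bar> * (ennreal \<bar>0 + c * r\<bar> * g ((0 + c * r)\<^sup>2 * (1 + s\<^sup>2))) = ennreal (1 / (1 + s\<^sup>2)) * (ennreal \<bar>r\<bar> * g (r\<^sup>2))"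
        by (simp flip: mult.assoc)
    qed
    finally show "(\<integral>\<^sup>+x. ennreal \<bar>x\<bar> * g (x\<^sup>2 * (1 + s\<^sup>2)) \<partial>lborel) = ennreal (1 / (1 + s\<^sup>2)) * (\<integral>\<^sup>+r. ennreal \<bar>r\<bar> * g (r\<^sup>2) \<partial>lborel)"
      by (simp add: nn_integral_cmult)
  qed
  also have "\<dots> = (\<integral>\<^sup>+s. ennreal (1 / (1 + s\<^sup>2)) \<partial>lborel) * (\<integral>\<^sup>+r. ennreal \<bar>r\<bar> * g (r\<^sup>2) \<partial>lborel)"
    by (rule nn_integral_multc) measurable
  finally show ?thesis .
qed

lemma nn_integral_even:
  fixes f :: "real \<Rightarrow> ennreal"
  assumes [measurable]: "f \<in> borel_measurable borel" and even: "\<And>x. f (- x) = f x"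
  shows "(\<integral>\<^sup>+x. f x \<partial>lborel) = 2 * (\<integral>\<^sup>+x\<in>{0<..}. f x \<partial>lborel)"
proof -
  have "(\<integral>\<^sup>+x. f x \<partial>lborel) = (\<integral>\<^sup>+x. f x * indicator {0<..} x + f x * indicator {..<0} x \<partial>lborel)"
  proof (rule nn_integral_cong_AE)
    show "AE x in lborel. f x = f x * indicator {0<..} x + f x * indicator {..<0} x"
      using AE_lborel_singleton[of "0::real"] by eventually_elim (auto split: split_indicator)
  qed
  also have "\<dots> = (\<integral>\<^sup>+x\<in>{0<..}. f x \<partial>lborel) + (\<integral>\<^sup>+x\<in>{..<0}. f x \<partial>lborel)"
    by (rule nn_integral_add) auto
  also have "(\<integral>\<^sup>+x\<in>{..<0}. f x \<partial>lborel) = ennreal \<bar>-1\<bar> * (\<integral>\<^sup>+x. f (0 + (-1) * x) * indicator {..<0} (0 + (-1) * x) \<partial>lborel)"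
    by (rule nn_integral_real_affine) auto
  also have "\<dots> = (\<integral>\<^sup>+x\<in>{0<..}. f x \<partial>lborel)"
    by (auto simp: even intro!: nn_integral_cong split: split_indicator)
  finally show ?thesis by (simp add: mult_2)
qed

lemma nn_integral_greater_eq_atLeast:
  fixes f :: "real \<Rightarrow> ennreal"
  shows "(\<integral>\<^sup>+x\<in>{a<..}. f x \<partial>lborel) = (\<integral>\<^sup>+x\<in>{a..}. f x \<partial>lborel)"
proof (rule nn_integral_cong_AE)
  show "AE x in lborel. f x * indicator {a<..} x = f x * indicator {a..} x"
    using AE_lborel_singleton[of a] by eventually_elim (auto split: split_indicator)
qed

text \<open>The function \<open>r / \<tau> * exp (- r\<^sup>2 / (2 * \<tau>))\<close> is the density of the modulus \<open>r\<close> of a planar Gaussian vector with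
  independent coordinates of variance \<open>\<tau>\<close> (\<open>gauss_polar\<close>).\<close>

lemma rayleigh_tail:
  assumes \<tau>: "\<tau> > 0" and v: "v \<ge> 0"
  shows "(\<integral>\<^sup>+r\<in>{v..}. ennreal (r / \<tau> * exp (- r\<^sup>2 / (2 * \<tau>)) * (r\<^sup>2 - v\<^sup>2)) \<partial>lborel) = ennreal (2 * \<tau> * exp (- v\<^sup>2 / (2 * \<tau>)))"
    and "(\<integral>\<^sup>+r\<in>{0..}. ennreal (r / \<tau> * exp (- r\<^sup>2 / (2 * \<tau>))) \<partial>lborel) = 1"
proof -
  let ?F = "\<lambda>r. - (r\<^sup>2 - v\<^sup>2 + 2 * \<tau>) * exp (- r\<^sup>2 / (2 * \<tau>))"
  have e: "LIM r at_top. r\<^sup>2 / (2 * \<tau>) :> at_top"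
  proof -
    have "LIM r at_top. (1 / (2 * \<tau>)) * (r::real) ^ 2 :> at_top"
      using \<tau> by (intro filterlim_tendsto_pos_mult_at_top[OF tendsto_const] filterlim_pow_at_top filterlim_ident) auto
    then show ?thesis by simp
  qed
  have "((\<lambda>r. ?F r) \<longlongrightarrow> 0) at_top"
  proof -
    have "((\<lambda>w. (w ^ 1 / exp w) * (- 2 * \<tau>) + (v\<^sup>2 - 2 * \<tau>) * (w ^ 0 / exp w)) \<longlongrightarrow> 0 * (- 2 * \<tau>) + (v\<^sup>2 - 2 * \<tau>) * 0) at_top"
      by (intro tendsto_intros tendsto_power_div_exp_0)
    then have "((\<lambda>w. (w ^ 1 / exp w) * (- 2 * \<tau>) + (v\<^sup>2 - 2 * \<tau>) * (w ^ 0 / exp w)) \<longlongrightarrow> 0) at_top" by simp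
    from filterlim_compose[OF this e] show ?thesis
      by (rule tendsto_eq_rhs[OF Lim_transform_eventually]) (use \<tau> in \<open>auto simp: exp_minus field_simps intro!: always_eventually\<close>)
  qed
  then have "(\<integral>\<^sup>+r. ennreal (r / \<tau> * exp (- r\<^sup>2 / (2 * \<tau>)) * (r\<^sup>2 - v\<^sup>2)) * indicator {v..} r \<partial>lborel) = ennreal (0 - ?F v)"
  proof (rule nn_integral_FTC_atLeast[rotated 3])
    show "DERIV ?F r :> r / \<tau> * exp (- r\<^sup>2 / (2 * \<tau>)) * (r\<^sup>2 - v\<^sup>2)" for r
      using \<tau> by (auto intro!: derivative_eq_intros simp: field_simps power2_eq_square)
    show "0 \<le> r / \<tau> * exp (- r\<^sup>2 / (2 * \<tau>)) * (r\<^sup>2 - v\<^sup>2)" if "v \<le> r" for r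
      using that v \<tau> by (auto intro!: mult_nonneg_nonneg power_mono)
  qed auto
  then show "(\<integral>\<^sup>+r\<in>{v..}. ennreal (r / \<tau> * exp (- r\<^sup>2 / (2 * \<tau>)) * (r\<^sup>2 - v\<^sup>2)) \<partial>lborel) = ennreal (2 * \<tau> * exp (- v\<^sup>2 / (2 * \<tau>)))"
    by simp
  let ?G = "\<lambda>r. - exp (- r\<^sup>2 / (2 * \<tau>))"
  have "((\<lambda>w::real. - (w ^ 0 / exp w)) \<longlongrightarrow> - 0) at_top" by (intro tendsto_intros tendsto_power_div_exp_0)
  from filterlim_compose[OF this e] have "(?G \<longlongrightarrow> 0) at_top"
    by (rule tendsto_eq_rhs[OF Lim_transform_eventually]) (auto simp: exp_minus field_simps intro!: always_eventually)
  then have "(\<integral>\<^sup>+r. ennreal (r / \<tau> * exp (- r\<^sup>2 / (2 * \<tau>))) * indicator {0..} r \<partial>lborel) = ennreal (0 - ?G 0)"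
  proof (rule nn_integral_FTC_atLeast[rotated 3])
    show "DERIV ?G r :> r / \<tau> * exp (- r\<^sup>2 / (2 * \<tau>))" for r
      using \<tau> by (auto intro!: derivative_eq_intros simp: field_simps power2_eq_square)
  qed (use \<tau> in auto)
  then show "(\<integral>\<^sup>+r\<in>{0..}. ennreal (r / \<tau> * exp (- r\<^sup>2 / (2 * \<tau>))) \<partial>lborel) = 1" by simp
qed

lemma rayleigh_head:
  assumes \<tau>: "\<tau> > 0" and v: "v \<ge> 0"
  shows "(\<integral>\<^sup>+r\<in>{0..v}. ennreal (r / \<tau> * exp (- r\<^sup>2 / (2 * \<tau>)) * (v\<^sup>2 - r\<^sup>2)) \<partial>lborel) =
    ennreal (v\<^sup>2 - 2 * \<tau> + 2 * \<tau> * exp (- v\<^sup>2 / (2 * \<tau>)))"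
proof -
  let ?F = "\<lambda>r. (r\<^sup>2 - v\<^sup>2 + 2 * \<tau>) * exp (- r\<^sup>2 / (2 * \<tau>))"
  have "(\<integral>\<^sup>+r. ennreal (r / \<tau> * exp (- r\<^sup>2 / (2 * \<tau>)) * (v\<^sup>2 - r\<^sup>2)) * indicator {0..v} r \<partial>lborel) = ennreal (?F v - ?F 0)"
  proof (rule nn_integral_FTC_Icc)
    show "(?F has_real_derivative r / \<tau> * exp (- r\<^sup>2 / (2 * \<tau>)) * (v\<^sup>2 - r\<^sup>2)) (at r)" for r
      using \<tau> by (auto intro!: derivative_eq_intros simp: field_simps power2_eq_square)
    show "0 \<le> r / \<tau> * exp (- r\<^sup>2 / (2 * \<tau>)) * (v\<^sup>2 - r\<^sup>2)" if "r \<in> {0..v}" for r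
      using that \<tau> by (auto intro!: mult_nonneg_nonneg power_mono)
  qed (use v in auto)
  moreover have "?F v - ?F 0 = v\<^sup>2 - 2 * \<tau> + 2 * \<tau> * exp (- v\<^sup>2 / (2 * \<tau>))" by simp
  ultimately show ?thesis by (simp only:)
qed

text \<open>The angular constant is found by comparing total masses, that is by taking \<open>g = 1\<close>.\<close>

lemma gauss_polar:
  fixes g :: "real \<Rightarrow> ennreal"
  assumes \<tau>: "\<tau> > 0" and [measurable]: "g \<in> borel_measurable borel"
  shows "(\<integral>\<^sup>+x. \<integral>\<^sup>+y. ennreal (normal_density 0 (sqrt \<tau>) x) * (ennreal (normal_density 0 (sqrt \<tau>) y) * g (x\<^sup>2 + y\<^sup>2)) \<partial>lborel \<partial>lborel) =
    (\<integral>\<^sup>+r\<in>{0..}. ennreal (r / \<tau> * exp (- r\<^sup>2 / (2 * \<tau>))) * g (r\<^sup>2) \<partial>lborel)"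
proof -
  define c where "c = (\<integral>\<^sup>+s. ennreal (1 / (1 + s\<^sup>2)) \<partial>(lborel :: real measure))"
  define w where "w q = 1 / (2 * pi * \<tau>) * exp (- q / (2 * \<tau>))" for q
  have prod: "normal_density 0 (sqrt \<tau>) x * normal_density 0 (sqrt \<tau>) y = w (x\<^sup>2 + y\<^sup>2)" for x y
  proof -
    have "exp (- x\<^sup>2 / (2 * \<tau>)) * exp (- y\<^sup>2 / (2 * \<tau>)) = exp (- (x\<^sup>2 + y\<^sup>2) / (2 * \<tau>))"
      by (simp flip: exp_add add: add_divide_distrib diff_divide_distrib)
    moreover have "(1 / sqrt (2 * pi * \<tau>)) * (1 / sqrt (2 * pi * \<tau>)) = 1 / (2 * pi * \<tau>)" using \<tau> by simp
    ultimately show ?thesis unfolding normal_density_def w_def using \<tau>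
      by simp
  qed
  have main: "(\<integral>\<^sup>+x. \<integral>\<^sup>+y. ennreal (normal_density 0 (sqrt \<tau>) x) * (ennreal (normal_density 0 (sqrt \<tau>) y) * g (x\<^sup>2 + y\<^sup>2)) \<partial>lborel \<partial>lborel) =
     c * (ennreal (1 / pi) * (\<integral>\<^sup>+r\<in>{0..}. ennreal (r / \<tau> * exp (- r\<^sup>2 / (2 * \<tau>))) * g (r\<^sup>2) \<partial>lborel))"
    if [measurable]: "g \<in> borel_measurable borel" for g
  proof -
    have [measurable]: "w \<in> borel_measurable borel" unfolding w_def by measurable
    have "(\<integral>\<^sup>+x. \<integral>\<^sup>+y. ennreal (normal_density 0 (sqrt \<tau>) x) * (ennreal (normal_density 0 (sqrt \<tau>) y) * g (x\<^sup>2 + y\<^sup>2)) \<partial>lborel \<partial>lborel) =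
       (\<integral>\<^sup>+x. \<integral>\<^sup>+y. (\<lambda>q. ennreal (w q) * g q) (x\<^sup>2 + y\<^sup>2) \<partial>lborel \<partial>lborel)"
    proof (intro nn_integral_cong)
      fix x y
      have "ennreal (normal_density 0 (sqrt \<tau>) x) * ennreal (normal_density 0 (sqrt \<tau>) y) = ennreal (w (x\<^sup>2 + y\<^sup>2))"
        by (simp add: prod[symmetric] ennreal_mult)
      then show "ennreal (normal_density 0 (sqrt \<tau>) x) * (ennreal (normal_density 0 (sqrt \<tau>) y) * g (x\<^sup>2 + y\<^sup>2)) =
          ennreal (w (x\<^sup>2 + y\<^sup>2)) * g (x\<^sup>2 + y\<^sup>2)"
        by (simp only: mult.assoc[symmetric])
    qed
    also have "\<dots> = c * (\<integral>\<^sup>+r. ennreal \<bar>r\<bar> * (ennreal (w (r\<^sup>2)) * g (r\<^sup>2)) \<partial>lborel)"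
      unfolding c_def by (rule polar_substitution) measurable
    also have "(\<integral>\<^sup>+r. ennreal \<bar>r\<bar> * (ennreal (w (r\<^sup>2)) * g (r\<^sup>2)) \<partial>lborel) =
        2 * (\<integral>\<^sup>+r\<in>{0..}. ennreal \<bar>r\<bar> * (ennreal (w (r\<^sup>2)) * g (r\<^sup>2)) \<partial>lborel)"
      by (subst nn_integral_even) (auto simp: nn_integral_greater_eq_atLeast)
    also have "\<dots> = (\<integral>\<^sup>+r. 2 * (ennreal \<bar>r\<bar> * (ennreal (w (r\<^sup>2)) * g (r\<^sup>2)) * indicator {0..} r) \<partial>lborel)"
      by (rule nn_integral_cmult[symmetric]) measurable
    also have "\<dots> = (\<integral>\<^sup>+r. ennreal (1 / pi) * (ennreal (r / \<tau> * exp (- r\<^sup>2 / (2 * \<tau>))) * g (r\<^sup>2) * indicator {0..} r) \<partial>lborel)"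
    proof (rule nn_integral_cong)
      fix r :: real
      show "2 * (ennreal \<bar>r\<bar> * (ennreal (w (r\<^sup>2)) * g (r\<^sup>2)) * indicator {0..} r) =
        ennreal (1 / pi) * (ennreal (r / \<tau> * exp (- r\<^sup>2 / (2 * \<tau>))) * g (r\<^sup>2) * indicator {0..} r)"
      proof (cases "0 \<le> r")
        case True
        have "2 * (ennreal r * ennreal (w (r\<^sup>2))) = ennreal (1 / pi) * ennreal (r / \<tau> * exp (- r\<^sup>2 / (2 * \<tau>)))"
        proof -
          have "0 \<le> w (r\<^sup>2)" using \<tau> by (simp add: w_def)
          then have "2 * (ennreal r * ennreal (w (r\<^sup>2))) = ennreal (2 * (r * w (r\<^sup>2)))"
            using True by (simp add: ennreal_mult)
          also have "2 * (r * w (r\<^sup>2)) = (1 / pi) * (r / \<tau> * exp (- r\<^sup>2 / (2 * \<tau>)))" by (simp add: w_def)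
          also have "ennreal ((1 / pi) * (r / \<tau> * exp (- r\<^sup>2 / (2 * \<tau>)))) = ennreal (1 / pi) * ennreal (r / \<tau> * exp (- r\<^sup>2 / (2 * \<tau>)))"
            by (rule ennreal_mult) (use True \<tau> in auto)
          finally show ?thesis .
        qed
        then show ?thesis using True by (simp flip: mult.assoc)
      qed simp
    qed
    also have "\<dots> = ennreal (1 / pi) * (\<integral>\<^sup>+r\<in>{0..}. ennreal (r / \<tau> * exp (- r\<^sup>2 / (2 * \<tau>))) * g (r\<^sup>2) \<partial>lborel)"
      by (rule nn_integral_cmult) measurable
    finally show ?thesis .
  qed
  have one: "(\<integral>\<^sup>+x. ennreal (normal_density 0 (sqrt \<tau>) x) \<partial>lborel) = 1"
    using \<tau> by (subst nn_integral_eq_integral) auto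
  have "c * (ennreal (1 / pi) * 1) = (\<integral>\<^sup>+x. \<integral>\<^sup>+y. ennreal (normal_density 0 (sqrt \<tau>) x) * (ennreal (normal_density 0 (sqrt \<tau>) y) * 1) \<partial>lborel \<partial>lborel)"
    using main[of "\<lambda>_. 1"] rayleigh_tail(2)[OF \<tau> order_refl] by simp
  also have "\<dots> = 1" by (simp add: nn_integral_cmult one)
  finally have c1: "c * ennreal (1 / pi) = 1" by simp
  show ?thesis using main[of g] c1 by (simp flip: mult.assoc)
qed

lemma continuous_on_erfc: "continuous_on S erfc"
proof -
  have int: "integrable lborel (\<lambda>t::real. exp (- t\<^sup>2))"
  proof -
    have "integrable lborel (\<lambda>t. sqrt pi * normal_density 0 (1 / sqrt 2) t)" by simp
    moreover have "sqrt pi * normal_density 0 (1 / sqrt 2) t = exp (- t\<^sup>2)" for t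
      by (simp add: normal_density_def power_divide real_sqrt_divide)
    ultimately show ?thesis by simp
  qed
  have "isCont (\<lambda>x. LINT t:{x..}|lborel. exp (- t\<^sup>2)) x" for x :: real
    unfolding continuous_at_sequentially
  proof (rule allI, rule impI)
    fix s :: "nat \<Rightarrow> real" assume s: "s \<longlonglongrightarrow> x"
    have "(\<lambda>i. LINT t|lborel. indicator {s i..} t *\<^sub>R exp (- t\<^sup>2)) \<longlonglongrightarrow> (LINT t|lborel. indicator {x..} t *\<^sub>R exp (- t\<^sup>2))"
    proof (rule integral_dominated_convergence[where w="\<lambda>t. exp (- t\<^sup>2)"])
      show "AE t in lborel. (\<lambda>i. indicator {s i..} t *\<^sub>R exp (- t\<^sup>2)) \<longlonglongrightarrow> indicator {x..} t *\<^sub>R exp (- t\<^sup>2)"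
        using AE_lborel_singleton[of x]
      proof eventually_elim
        case (elim t)
        have "\<forall>\<^sub>F i in sequentially. indicator {s i..} t *\<^sub>R exp (- t\<^sup>2) = indicator {x..} t *\<^sub>R exp (- t\<^sup>2)"
        proof (cases "t < x")
          case True
          from order_tendstoD(1)[OF s True] show ?thesis
            by eventually_elim (use True in \<open>auto simp: indicator_def\<close>)
        next
          case False
          then have "x < t" using elim by simp
          from order_tendstoD(2)[OF s this] show ?thesis
            by eventually_elim (use \<open>x < t\<close> in \<open>auto simp: indicator_def\<close>)
        qed
        then show ?case by (rule tendsto_eventually)
      qed
    qed (use int in \<open>auto simp: indicator_def\<close>)
    then show "((\<lambda>x. LINT t:{x..}|lborel. exp (- t\<^sup>2)) \<circ> s) \<longlonglongrightarrow> (LINT t:{x..}|lborel. exp (- t\<^sup>2))"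
      by (simp add: comp_def set_lebesgue_integral_def)
  qed
  then have "isCont erfc x" for x
    unfolding erfc_def[abs_def] by (intro continuous_mult continuous_const)
  then show ?thesis by (simp add: continuous_at_imp_continuous_on)
qed

text \<open>The means of the determinant on positive definite Hessians in dimensions one and two, for a normally distributed
  (half) trace \<open>u\<close>. In dimension two the anisotropy \<open>r < u\<close> has been integrated out by \<open>rayleigh_head\<close>.\<close>

definition half_mean :: "real \<Rightarrow> real \<Rightarrow> real" where
  "half_mean s \<mu> = (LINT u:{0<..}|lborel. normal_density \<mu> s u * u)"

definition half_det_mean :: "real \<Rightarrow> real \<Rightarrow> real \<Rightarrow> real" where
  "half_det_mean \<tau> s \<mu> =
     (LINT u:{0<..}|lborel. normal_density \<mu> s u * (u\<^sup>2 - 2 * \<tau> + 2 * \<tau> * exp (- u\<^sup>2 / (2 * \<tau>))))"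

lemma half_mean_eq:
  assumes "s > 0"
  shows "half_mean s \<mu> = s / sqrt (2 * pi) * exp (- \<mu>\<^sup>2 / (2 * s\<^sup>2)) + \<mu> * (erfc (- \<mu> / (sqrt 2 * s)) / 2)"
proof -
  have "s\<^sup>2 * normal_density \<mu> s 0 = s / sqrt (2 * pi) * exp (- \<mu>\<^sup>2 / (2 * s\<^sup>2))"
    using assms by (simp add: normal_density_def real_sqrt_mult power2_eq_square)
  then show ?thesis unfolding half_mean_def tail_moment_1[OF assms] norm_tail_erfc[OF assms] by simp
qed

lemma half_mean_nonneg: "0 \<le> half_mean s \<mu>"
  unfolding half_mean_def set_lebesgue_integral_def by (rule integral_nonneg_AE) (auto simp: indicator_def)

lemma half_mean_nn:
  assumes "s > 0"
  shows "(\<integral>\<^sup>+u\<in>{0<..}. ennreal (normal_density \<mu> s u * u) \<partial>lborel) = ennreal (half_mean s \<mu>)"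
  unfolding half_mean_def by (rule nn_set_integral) (auto simp: integrable_normal_1[OF assms])

lemma rayleigh_head_nonneg:
  fixes \<tau> u :: real
  assumes "\<tau> > 0"
  shows "0 \<le> u\<^sup>2 - 2 * \<tau> + 2 * \<tau> * exp (- u\<^sup>2 / (2 * \<tau>))"
proof -
  have "2 * \<tau> * (1 + - u\<^sup>2 / (2 * \<tau>)) \<le> 2 * \<tau> * exp (- u\<^sup>2 / (2 * \<tau>))"
    using assms exp_ge_add_one_self[of "- u\<^sup>2 / (2 * \<tau>)"] by (intro mult_left_mono) auto
  moreover have "2 * \<tau> * (1 + - u\<^sup>2 / (2 * \<tau>)) = 2 * \<tau> - u\<^sup>2" using assms by (simp add: field_simps)
  ultimately show ?thesis by simp
qed

lemma half_det_mean_nonneg: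
  assumes "\<tau> > 0"
  shows "0 \<le> half_det_mean \<tau> s \<mu>"
proof -
  have "0 \<le> indicator {0<..} u *\<^sub>R (normal_density \<mu> s u * (u\<^sup>2 - 2 * \<tau> + 2 * \<tau> * exp (- u\<^sup>2 / (2 * \<tau>))))" for u
    using rayleigh_head_nonneg[OF assms, of u] by (intro scaleR_nonneg_nonneg mult_nonneg_nonneg) auto
  then show ?thesis
    unfolding half_det_mean_def set_lebesgue_integral_def by (intro integral_nonneg_AE AE_I2)
qed

context
  fixes \<tau> s \<mu> :: real
  assumes s: "s > 0" and \<tau>: "\<tau> > 0"
begin

private abbreviation (input) "w \<equiv> exp (- \<mu>\<^sup>2 / (2 * (s\<^sup>2 + \<tau>))) * sqrt (\<tau> / (s\<^sup>2 + \<tau>))"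
private abbreviation (input) "m' \<equiv> \<mu> * \<tau> / (s\<^sup>2 + \<tau>)"
private abbreviation (input) "s' \<equiv> s * sqrt (\<tau> / (s\<^sup>2 + \<tau>))"

lemma s'_pos: "s' > 0" using s \<tau> by (simp add: add_pos_pos)

lemma half_det_split: "normal_density \<mu> s u * (u\<^sup>2 - 2 * \<tau> + 2 * \<tau> * exp (- u\<^sup>2 / (2 * \<tau>))) =
    normal_density \<mu> s u * u\<^sup>2 - 2 * \<tau> * normal_density \<mu> s u + 2 * \<tau> * w * normal_density m' s' u"
proof -
  have "normal_density \<mu> s u * (u\<^sup>2 - 2 * \<tau> + 2 * \<tau> * exp (- u\<^sup>2 / (2 * \<tau>))) =
      normal_density \<mu> s u * u\<^sup>2 - 2 * \<tau> * normal_density \<mu> s u + 2 * \<tau> * (normal_density \<mu> s u * exp (- u\<^sup>2 / (2 * \<tau>)))"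
    by (simp add: algebra_simps)
  then show ?thesis unfolding normal_density_mult_exp[OF s \<tau>] by simp
qed

lemma half_det_integrable:
  "integrable lborel (\<lambda>u. normal_density \<mu> s u * (u\<^sup>2 - 2 * \<tau> + 2 * \<tau> * exp (- u\<^sup>2 / (2 * \<tau>))))"
  unfolding half_det_split
  using integrable_normal_2[OF s, of \<mu>] integrable_normal_density[OF s, of \<mu>] integrable_normal_density[OF s'_pos, of m']
  by simp

lemma half_det_mean_nn:
  "(\<integral>\<^sup>+u\<in>{0<..}. ennreal (normal_density \<mu> s u * (u\<^sup>2 - 2 * \<tau> + 2 * \<tau> * exp (- u\<^sup>2 / (2 * \<tau>)))) \<partial>lborel) =
    ennreal (half_det_mean \<tau> s \<mu>)"
  unfolding half_det_mean_def
  by (rule nn_set_integral[OF half_det_integrable])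
     (simp_all only: normal_density_nonneg mult_nonneg_nonneg rayleigh_head_nonneg[OF \<tau>] borel_open open_greaterThan)

lemma half_det_mean_eq:
  "half_det_mean \<tau> s \<mu> = \<mu> * (s / sqrt (2 * pi) * exp (- \<mu>\<^sup>2 / (2 * s\<^sup>2)))
     + (\<mu>\<^sup>2 + s\<^sup>2 - 2 * \<tau>) * (erfc (- \<mu> / (sqrt 2 * s)) / 2) + 2 * \<tau> * w * (erfc (- m' / (sqrt 2 * s')) / 2)"
proof -
  have m0: "\<mu> * s\<^sup>2 * normal_density \<mu> s 0 = \<mu> * (s / sqrt (2 * pi) * exp (- \<mu>\<^sup>2 / (2 * s\<^sup>2)))"
    using s by (simp add: normal_density_def real_sqrt_mult power2_eq_square)
  have i: "set_integrable lborel {0<..} (\<lambda>u. normal_density \<mu> s u * u\<^sup>2)"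
    "set_integrable lborel {0<..} (\<lambda>u. 2 * \<tau> * normal_density \<mu> s u)"
    "set_integrable lborel {0<..} (\<lambda>u. 2 * \<tau> * w * normal_density m' s' u)"
    using integrable_normal_2[OF s, of \<mu>] integrable_normal_density[OF s, of \<mu>] integrable_normal_density[OF s'_pos, of m']
    by (auto intro!: integrable_set)
  have "half_det_mean \<tau> s \<mu> = (LINT u:{0<..}|lborel. normal_density \<mu> s u * u\<^sup>2 - 2 * \<tau> * normal_density \<mu> s u
       + 2 * \<tau> * w * normal_density m' s' u)"
    unfolding half_det_mean_def half_det_split ..
  also have "\<dots> = (LINT u:{0<..}|lborel. normal_density \<mu> s u * u\<^sup>2) - 2 * \<tau> * norm_tail \<mu> s + 2 * \<tau> * w * norm_tail m' s'"
    unfolding norm_tail_def set_integral_mult_right[symmetric]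
    by (simp only: set_integral_add(2)[OF set_integral_diff(1)[OF i(1,2)] i(3)] set_integral_diff(2)[OF i(1,2)])
  finally show ?thesis
    unfolding tail_moment_2[OF s] norm_tail_erfc[OF s] norm_tail_erfc[OF s'_pos] using m0 by (simp add: algebra_simps)
qed

lemma full_exp_nn:
  "(\<integral>\<^sup>+u. ennreal (normal_density \<mu> s u * (2 * \<tau> * exp (- u\<^sup>2 / (2 * \<tau>)))) \<partial>lborel) = ennreal (2 * \<tau> * w)"
proof -
  have "(\<integral>\<^sup>+u. ennreal (normal_density \<mu> s u * (2 * \<tau> * exp (- u\<^sup>2 / (2 * \<tau>)))) \<partial>lborel) =
      (\<integral>\<^sup>+u. ennreal (2 * \<tau> * w * normal_density m' s' u) \<partial>lborel)"
  proof (intro nn_integral_cong arg_cong[where f=ennreal])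
    fix u show "normal_density \<mu> s u * (2 * \<tau> * exp (- u\<^sup>2 / (2 * \<tau>))) = 2 * \<tau> * w * normal_density m' s' u"
      using normal_density_mult_exp[OF s \<tau>, of \<mu> u] by (simp add: mult.left_commute[of _ "2 * \<tau>"] mult.assoc)
  qed
  also have "\<dots> = ennreal (LINT u|lborel. 2 * \<tau> * w * normal_density m' s' u)"
    using integrable_normal_density[OF s'_pos, of m'] \<tau> s by (intro nn_integral_eq_integral) auto
  also have "(LINT u|lborel. 2 * \<tau> * w * normal_density m' s' u) = 2 * \<tau> * w"
    using integral_normal_density[OF s'_pos, of m'] by simp
  finally show ?thesis .
qed

end

section \<open>The conditional law of the Hessian\<close>

lemma nn_integral_normal_shift:
  fixes g :: "real \<Rightarrow> ennreal"
  assumes [measurable]: "g \<in> borel_measurable borel"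
  shows "(\<integral>\<^sup>+x. ennreal (normal_density 0 s x) * g (x + m) \<partial>lborel) =
    (\<integral>\<^sup>+u. ennreal (normal_density m s u) * g u \<partial>lborel)"
proof -
  have "normal_density m s (m + x) = normal_density 0 s x" for x by (simp add: normal_density_def)
  then show ?thesis
    using nn_integral_real_affine[of "\<lambda>u. ennreal (normal_density m s u) * g u" 1 m]
    by (simp add: add.commute[of _ m])
qed

lemma nn_integral_normal_reflect:
  fixes g :: "real \<Rightarrow> ennreal"
  assumes [measurable]: "g \<in> borel_measurable borel"
  shows "(\<integral>\<^sup>+u. ennreal (normal_density m s u) * g (- u) \<partial>lborel) =
    (\<integral>\<^sup>+u. ennreal (normal_density (- m) s u) * g u \<partial>lborel)"
proof -
  have "normal_density m s (- u) = normal_density (- m) s u" for u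
    using power2_commute[of "- u" m] by (simp add: normal_density_def add.commute)
  then show ?thesis
    using nn_integral_real_affine[of "\<lambda>u. ennreal (normal_density m s (- u)) * g u" "- 1" 0]
    by simp
qed

context isotropic_gaussian_field
begin

lemma jetcomb_indep:
  fixes W :: "'j::finite \<Rightarrow> 'w \<Rightarrow> real"
  assumes "jetcomb t f" "\<And>j. jetcomb t (W j)" "\<And>j. expectation (\<lambda>\<omega>. f \<omega> * W j \<omega>) = 0"
    and H: "H \<in> gen_algebra W \<rightarrow>\<^sub>M N"
  shows "indep_pair M borel f N H"
proof (rule gaussian_indep[where U="\<lambda>_::unit. f" and W=W])
  show "gaussian_rv M (\<lambda>\<omega>. (\<Sum>i\<in>I. a i * f \<omega>) + (\<Sum>j\<in>J. b j * W j \<omega>))" for I :: "unit set" and J a b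
    using assms(1,2) by (intro jetcomb_gauss jetcomb_add jetcomb_sum jetcomb_cmult)
  show "f \<in> borel_measurable (gen_algebra (\<lambda>_::unit. f))"
    using measurable_gen_algebra[of "\<lambda>_::unit. f" "()"] .
qed (use assms jetcomb_mean in auto)

lemma jetcomb_distributed:
  assumes "jetcomb t f" "expectation (\<lambda>\<omega>. f \<omega> * f \<omega>) = s\<^sup>2" "s > 0"
  shows "distributed M lborel f (\<lambda>x. ennreal (normal_density 0 s x))"
  using gaussian_rvD(5)[OF jetcomb_gauss jetcomb_mean, OF assms(1,1)] assms(2,3) by (simp add: power2_eq_square)

text \<open>Removing from \<open>L\<close> its regression on \<open>X\<close> leaves a variable independent of \<open>X\<close>.\<close>

lemma jet_disintegration:
  fixes W :: "'j::finite \<Rightarrow> 'w \<Rightarrow> real" and g :: "real \<Rightarrow> 'b \<Rightarrow> ennreal"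
  assumes L: "jetcomb t L" and W: "\<And>j. jetcomb t (W j)"
    and LX: "expectation (\<lambda>\<omega>. L \<omega> * X t \<omega>) = - \<gamma>0" and LL: "expectation (\<lambda>\<omega>. L \<omega> * L \<omega>) = s\<^sup>2 + \<gamma>0\<^sup>2" and s: "s > 0"
    and WX: "\<And>j. expectation (\<lambda>\<omega>. W j \<omega> * X t \<omega>) = 0" and WL: "\<And>j. expectation (\<lambda>\<omega>. W j \<omega> * L \<omega>) = 0"
    and Z: "Z \<in> gen_algebra W \<rightarrow>\<^sub>M N"
    and g[measurable]: "(\<lambda>(u, z). g u z) \<in> borel_measurable (borel \<Otimes>\<^sub>M N)"
  shows "(\<integral>\<^sup>+\<omega>. indicator {\<nu><..} (X t \<omega>) * g (L \<omega>) (Z \<omega>) \<partial>M) =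
    (\<integral>\<^sup>+x\<in>{\<nu><..}. ennreal (std_normal_density x) *
       (\<integral>\<^sup>+u. ennreal (normal_density (- (\<gamma>0 * x)) s u) * (\<integral>\<^sup>+\<omega>. g u (Z \<omega>) \<partial>M) \<partial>lborel) \<partial>lborel)"
proof -
  define S where "S = (\<lambda>\<omega>. L \<omega> + \<gamma>0 * X t \<omega>)"
  have S: "jetcomb t S" unfolding S_def using L by (intro jetcomb_intros)
  note i = jetcomb_integrable(2)
  have XX: "expectation (\<lambda>\<omega>. X t \<omega> * X t \<omega>) = 1" using jet_covariance(1)[of t] by (simp add: power2_eq_square)
  have SX: "expectation (\<lambda>\<omega>. X t \<omega> * S \<omega>) = 0"
  proof -
    have "(\<lambda>\<omega>. X t \<omega> * S \<omega>) = (\<lambda>\<omega>. L \<omega> * X t \<omega> + \<gamma>0 * (X t \<omega> * X t \<omega>))" by (simp add: S_def fun_eq_iff algebra_simps)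
    then show ?thesis using i[OF L jetcomb_X] i[OF jetcomb_X jetcomb_X, of t] LX XX by simp
  qed
  have SS: "expectation (\<lambda>\<omega>. S \<omega> * S \<omega>) = s\<^sup>2"
  proof -
    have "(\<lambda>\<omega>. S \<omega> * S \<omega>) = (\<lambda>\<omega>. L \<omega> * L \<omega> + (2 * \<gamma>0) * (L \<omega> * X t \<omega>) + \<gamma>0\<^sup>2 * (X t \<omega> * X t \<omega>))"
      by (simp add: S_def fun_eq_iff power2_eq_square algebra_simps)
    then show ?thesis using i[OF L L] i[OF L jetcomb_X] i[OF jetcomb_X jetcomb_X, of t] LX XX LL
      by (simp add: power2_eq_square)
  qed
  have SW: "expectation (\<lambda>\<omega>. S \<omega> * W j \<omega>) = 0" for j
  proof -
    have "(\<lambda>\<omega>. S \<omega> * W j \<omega>) = (\<lambda>\<omega>. W j \<omega> * L \<omega> + \<gamma>0 * (W j \<omega> * X t \<omega>))"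
      by (simp add: S_def fun_eq_iff algebra_simps)
    then show ?thesis using i[OF W L, of j] i[OF W jetcomb_X, of j] WX[of j] WL[of j] by simp
  qed
  have Zm[measurable]: "Z \<in> M \<rightarrow>\<^sub>M N"
    using measurable_mono[OF order_refl refl subalgebra_gen_algebra[of W], of N] Z gaussian_rvD(1)[OF jetcomb_gauss[OF W]] by auto
  have Sm[measurable]: "S \<in> borel_measurable M" using gaussian_rvD(1)[OF jetcomb_gauss[OF S]] .
  define W' where "W' k = (case k of None \<Rightarrow> S | Some j \<Rightarrow> W j)" for k
  have sub: "sets (gen_algebra W) \<subseteq> sets (gen_algebra W')"
    unfolding sets_gen_algebra
  proof (rule sigma_sets_mono', safe)
    fix j and A :: "real set" assume "A \<in> sets borel"
    then show "\<exists>i A'. W j -` A \<inter> space M = W' i -` A' \<inter> space M \<and> A' \<in> sets borel"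
      by (intro exI[of _ "Some j"] exI[of _ A]) (simp add: W'_def)
  qed
  have I1: "indep_pair M borel (X t) (borel \<Otimes>\<^sub>M N) (\<lambda>\<omega>. (S \<omega>, Z \<omega>))"
  proof (rule jetcomb_indep[OF jetcomb_X, where W=W'])
    show "jetcomb t (W' k)" for k using S W by (auto simp: W'_def split: option.split)
    show "expectation (\<lambda>\<omega>. X t \<omega> * W' k \<omega>) = 0" for k
      using SX WX by (auto simp: W'_def mult.commute split: option.split)
    have "S \<in> borel_measurable (gen_algebra W')"
      using measurable_gen_algebra[of W' None] by (simp add: W'_def)
    moreover have "Z \<in> gen_algebra W' \<rightarrow>\<^sub>M N"
      using measurable_mono[OF order_refl refl sub, of N] Z by auto
    ultimately show "(\<lambda>\<omega>. (S \<omega>, Z \<omega>)) \<in> gen_algebra W' \<rightarrow>\<^sub>M borel \<Otimes>\<^sub>M N" by simp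
  qed
  have I2: "indep_pair M borel S N Z" by (rule jetcomb_indep[OF S W SW Z])
  have dX: "distributed M lborel (X t) (\<lambda>x. ennreal (std_normal_density x))"
    using jetcomb_distributed[OF jetcomb_X, of t 1] XX by simp
  have dS: "distributed M lborel S (\<lambda>x. ennreal (normal_density 0 s x))"
    using jetcomb_distributed[OF S SS s] .
  have "(\<integral>\<^sup>+\<omega>. indicator {\<nu><..} (X t \<omega>) * g (L \<omega>) (Z \<omega>) \<partial>M) =
      (\<integral>\<^sup>+\<omega>. (\<lambda>x (s, z). indicator {\<nu><..} x * g (s - \<gamma>0 * x) z) (X t \<omega>) (S \<omega>, Z \<omega>) \<partial>M)"
    by (simp add: S_def)
  also have "\<dots> = (\<integral>\<^sup>+x. ennreal (std_normal_density x) *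
      (\<integral>\<^sup>+\<omega>. (\<lambda>x (s, z). indicator {\<nu><..} x * g (s - \<gamma>0 * x) z) x (S \<omega>, Z \<omega>) \<partial>M) \<partial>lborel)"
    by (rule nn_integral_indep_pair[OF I1 dX]) (unfold case_prod_unfold, measurable)
  also have "\<dots> = (\<integral>\<^sup>+x\<in>{\<nu><..}. ennreal (std_normal_density x) * (\<integral>\<^sup>+\<omega>. g (S \<omega> - \<gamma>0 * x) (Z \<omega>) \<partial>M) \<partial>lborel)"
    by (intro nn_integral_cong) (auto split: split_indicator)
  also have "(\<lambda>x. \<integral>\<^sup>+\<omega>. g (S \<omega> - \<gamma>0 * x) (Z \<omega>) \<partial>M) =
      (\<lambda>x. \<integral>\<^sup>+u. ennreal (normal_density (- (\<gamma>0 * x)) s u) * (\<integral>\<^sup>+\<omega>. g u (Z \<omega>) \<partial>M) \<partial>lborel)"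
  proof
    fix x
    have "(\<integral>\<^sup>+\<omega>. g (S \<omega> - \<gamma>0 * x) (Z \<omega>) \<partial>M) =
        (\<integral>\<^sup>+u. ennreal (normal_density 0 s u) * (\<integral>\<^sup>+\<omega>. g (u - \<gamma>0 * x) (Z \<omega>) \<partial>M) \<partial>lborel)"
      by (rule nn_integral_indep_pair[OF I2 dS]) (unfold case_prod_unfold, measurable)
    also have "\<dots> = (\<integral>\<^sup>+u. ennreal (normal_density 0 s u) * (\<lambda>u. \<integral>\<^sup>+\<omega>. g u (Z \<omega>) \<partial>M) (u + - (\<gamma>0 * x)) \<partial>lborel)" by simp
    also have "\<dots> = (\<integral>\<^sup>+u. ennreal (normal_density (- (\<gamma>0 * x)) s u) * (\<integral>\<^sup>+\<omega>. g u (Z \<omega>) \<partial>M) \<partial>lborel)"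
      by (rule nn_integral_normal_shift) measurable
    finally show "(\<integral>\<^sup>+\<omega>. g (S \<omega> - \<gamma>0 * x) (Z \<omega>) \<partial>M) =
       (\<integral>\<^sup>+u. ennreal (normal_density (- (\<gamma>0 * x)) s u) * (\<integral>\<^sup>+\<omega>. g u (Z \<omega>) \<partial>M) \<partial>lborel)" .
  qed
  finally show ?thesis by simp
qed

end

section \<open>From critical point counts to number densities\<close>

text \<open>Integrals over \<open>{x<..y}\<close> are differences of tail integrals; differentiate in \<open>y\<close>.\<close>

lemma continuous_eq_of_tail_integrals:
  fixes f g :: "real \<Rightarrow> real"
  assumes c: "continuous_on UNIV f" "continuous_on UNIV g"
    and i: "\<And>\<nu>. set_integrable lborel {\<nu><..} f" "\<And>\<nu>. set_integrable lborel {\<nu><..} g"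
    and eq: "\<And>\<nu>. (LINT v:{\<nu><..}|lborel. f v) = (LINT v:{\<nu><..}|lborel. g v)"
  shows "f = g"
proof
  fix x
  define h where "h v = f v - g v" for v
  have hc: "continuous_on UNIV h" unfolding h_def[abs_def] by (intro continuous_intros c)
  have hi: "set_integrable lborel {\<nu><..} h" for \<nu> unfolding h_def by (intro set_integral_diff i)
  have h0: "(LINT v:{\<nu><..}|lborel. h v) = 0" for \<nu>
    unfolding h_def by (subst set_integral_diff(2)[OF i]) (simp add: eq)
  have "integral {x..y} h = 0" if "x \<le> y" for y
  proof -
    have sub: "set_integrable lborel {x<..y} h" by (rule set_integrable_subset[OF hi[of x]]) auto
    have "(LINT v:{x<..}|lborel. h v) = (LINT v:{x<..y} \<union> {y<..}|lborel. h v)"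
      using that by (intro arg_cong[where f="\<lambda>A. set_lebesgue_integral lborel A h"]) auto
    also have "\<dots> = (LINT v:{x<..y}|lborel. h v) + (LINT v:{y<..}|lborel. h v)"
      by (rule set_integral_Un) (use sub hi in auto)
    finally have "(LINT v:{x<..y}|lborel. h v) = 0" by (simp add: h0)
    then have "integral {x<..y} h = 0" using set_borel_integral_eq_integral(2)[OF sub] by simp
    moreover have "integral {x<..y} h = integral {x..y} h"
      by (rule integral_subset_negligible[symmetric] integral_subset_negligible)
         (use that in \<open>auto intro: negligible_subset[of "{x}"]\<close>)
    ultimately show ?thesis by simp
  qed
  then have z: "integral {x..y} h = 0" if "y \<in> {x..x+1}" for y using that by auto
  have "((\<lambda>y. integral {x..y} h) has_vector_derivative h x) (at x within {x..x+1})"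
    by (rule integral_has_vector_derivative) (auto intro: continuous_on_subset[OF hc])
  moreover have "((\<lambda>y. integral {x..y} h) has_vector_derivative 0) (at x within {x..x+1})"
    by (rule has_vector_derivative_transform[OF _ _ has_vector_derivative_const[of 0]]) (use z in auto)
  ultimately have "h x = 0"
    by (rule vector_derivative_unique_within[rotated])
       (simp add: trivial_limit_within islimpt_Icc)
  then show "f x = g x" by (simp add: h_def)
qed

lemma is_number_density_unique:
  assumes "is_number_density M X m f" "is_number_density M X m g"
  shows "f = g"
proof (rule continuous_eq_of_tail_integrals)
  let ?V = "ball (0::real^'n) 1"
  have V: "open ?V \<and> connected ?V \<and> 0 < emeasure lborel ?V \<and> emeasure lborel ?V < \<infinity>"
    using emeasure_lborel_ball_finite[of "0::real^'n" 1] content_ball_pos[of 1 "0::real^'n"]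
    by (auto simp: measure_def enn2real_positive_iff)
  show "continuous_on UNIV f" "continuous_on UNIV g" using assms by (auto simp: is_number_density_def)
  show "set_integrable lborel {\<nu><..} f" "set_integrable lborel {\<nu><..} g"
    "(LINT v:{\<nu><..}|lborel. f v) = (LINT v:{\<nu><..}|lborel. g v)" for \<nu>
    using assms V unfolding is_number_density_def by auto
qed

lemma number_density_eqI: "is_number_density M X m f \<Longrightarrow> number_density M X m = f"
  unfolding number_density_def using is_number_density_unique by (metis the_equality)

context isotropic_gaussian_field
begin

text \<open>At a fixed point the covariances give \<open>E (H_ij - H_ji)\<^sup>2 = 0\<close>. A countable dense set of points suffices,
  because the Hessian is continuous.\<close>

lemma hess_symmetric_AE: "AE \<omega> in M. \<forall>t. transpose (hessf X t \<omega>) = hessf X t \<omega>"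
proof -
  have fixed: "AE \<omega> in M. \<forall>i j. hessf X t \<omega> $ i $ j = hessf X t \<omega> $ j $ i" for t
  proof -
    have "AE \<omega> in M. hessf X t \<omega> $ i $ j = hessf X t \<omega> $ j $ i" for i j
    proof -
      let ?d = "\<lambda>\<omega>. hessf X t \<omega> $ i $ j - hessf X t \<omega> $ j $ i"
      have sq: "(?d \<omega>)\<^sup>2 = hessf X t \<omega> $ i $ j * hessf X t \<omega> $ i $ j - hessf X t \<omega> $ i $ j * hessf X t \<omega> $ j $ i
          - hessf X t \<omega> $ j $ i * hessf X t \<omega> $ i $ j + hessf X t \<omega> $ j $ i * hessf X t \<omega> $ j $ i" for \<omega>
        by (simp add: power2_eq_square algebra_simps)
      have int: "integrable M (\<lambda>\<omega>. (?d \<omega>)\<^sup>2)" unfolding sq by (intro Bochner_Integration.integrable_add Bochner_Integration.integrable_diff jetcomb_integrable(2)[OF jetcomb_H jetcomb_H])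
      have lin: "expectation (\<lambda>\<omega>. p \<omega> - q \<omega> - r \<omega> + s \<omega>) = expectation p - expectation q - expectation r + expectation s"
        if "integrable M p" "integrable M q" "integrable M r" "integrable M s" for p q r s :: "'w \<Rightarrow> real"
        using that by simp
      have "expectation (\<lambda>\<omega>. (?d \<omega>)\<^sup>2) =
          expectation (\<lambda>\<omega>. hessf X t \<omega> $ i $ j * hessf X t \<omega> $ i $ j) - expectation (\<lambda>\<omega>. hessf X t \<omega> $ i $ j * hessf X t \<omega> $ j $ i)
          - expectation (\<lambda>\<omega>. hessf X t \<omega> $ j $ i * hessf X t \<omega> $ i $ j) + expectation (\<lambda>\<omega>. hessf X t \<omega> $ j $ i * hessf X t \<omega> $ j $ i)"
        unfolding sq by (rule lin[OF jetcomb_integrable(2)[OF jetcomb_H jetcomb_H] jetcomb_integrable(2)[OF jetcomb_H jetcomb_H] jetcomb_integrable(2)[OF jetcomb_H jetcomb_H] jetcomb_integrable(2)[OF jetcomb_H jetcomb_H]])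
      also have "\<dots> = 0"
        unfolding jet_covariance(6) by (cases "i = j") (simp_all only: of_bool_def simp_thms if_True if_False, simp_all)
      finally have "expectation (\<lambda>\<omega>. (?d \<omega>)\<^sup>2) = 0" .
      then have "AE \<omega> in M. (?d \<omega>)\<^sup>2 = 0"
        using integral_nonneg_eq_0_iff_AE[OF int] by simp
      then show ?thesis by eventually_elim simp
    qed
    then show ?thesis by (simp add: AE_all_countable)
  qed
  obtain Q :: "(real^'n) set" where Q: "countable Q" "\<And>U. open U \<Longrightarrow> U \<noteq> {} \<Longrightarrow> \<exists>q\<in>Q. q \<in> U"
    by (erule countable_dense_setE)
  have "AE \<omega> in M. \<forall>q\<in>Q. \<forall>i j. hessf X q \<omega> $ i $ j = hessf X q \<omega> $ j $ i"
    using Q(1) fixed by (simp add: AE_ball_countable)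
  moreover have "AE \<omega> in M. \<omega> \<in> space M" by simp
  ultimately show ?thesis
  proof eventually_elim
    case (elim \<omega>)
    have "hessf X t \<omega> $ i $ j = hessf X t \<omega> $ j $ i" for t i j
    proof (rule ccontr)
      assume ne: "hessf X t \<omega> $ i $ j \<noteq> hessf X t \<omega> $ j $ i"
      have "open {t. hessf X t \<omega> $ i $ j \<noteq> hessf X t \<omega> $ j $ i}"
        by (intro open_Collect_neq continuous_on_component hess_cont elim)
      then obtain q where "q \<in> Q" "hessf X q \<omega> $ i $ j \<noteq> hessf X q \<omega> $ j $ i"
        using Q(2) ne by blast
      then show False using elim by blast
    qed
    then show ?case by (simp add: transpose_def vec_eq_iff)
  qed
qed

text \<open>The index is not continuous, but on nondegenerate symmetric matrices the condition of having index \<open>m\<close> is an open one, expressed by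
  \<open>\<kappa> h > 0\<close> with a continuous \<open>\<kappa>\<close>; almost surely only such Hessians occur at critical points. Kac--Rice is applied
  to \<open>min (x - \<nu>) (\<kappa> h) > 0\<close>. The function \<open>J\<close> is the conditional mean of \<open>\<bar>det H\<bar>\<close> on this index given \<open>X = v\<close>.\<close>

lemma is_number_densityI:
  fixes \<kappa> :: "real^'n^'n \<Rightarrow> real"
  assumes \<kappa>: "continuous_on UNIV \<kappa>" "\<And>h. \<kappa> h > 0 \<Longrightarrow> det h \<noteq> 0"
    and idx: "\<And>h. transpose h = h \<Longrightarrow> det h \<noteq> 0 \<Longrightarrow> neg_index h = m \<longleftrightarrow> \<kappa> h > 0"
    and J: "\<And>t \<nu>. (\<integral>\<^sup>+\<omega>. ennreal (\<bar>det (hessf X t \<omega>)\<bar> * of_bool (\<nu> < X t \<omega> \<and> \<kappa> (hessf X t \<omega>) > 0)) \<partial>M) =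
        (\<integral>\<^sup>+v\<in>{\<nu><..}. ennreal (std_normal_density v * J v) \<partial>lborel)"
    and J_nonneg: "\<And>v. 0 \<le> J v" and J_cont: "continuous_on UNIV J"
    and det_int: "integrable M (\<lambda>\<omega>. det (hessf X 0 \<omega>))"
    and F: "\<And>v. F v = normal_vec_density (sqrt \<gamma>0) (0::real^'n) * (std_normal_density v * J v)"
  shows "is_number_density M X m F"
  unfolding is_number_density_def
proof (intro conjI allI impI)
  let ?q = "normal_vec_density (sqrt \<gamma>0) (0::real^'n)"
  have Fc: "continuous_on UNIV F" unfolding F[abs_def]
    by (intro continuous_intros J_cont continuous_on_normal_density)
  show "continuous_on UNIV F" by (rule Fc)
  have [measurable]: "F \<in> borel_measurable borel" using Fc by (rule borel_measurable_continuous_onI)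
  have F0: "0 \<le> F v" for v using J_nonneg normal_vec_density_nonneg[of "sqrt \<gamma>0" "0::real^'n"] by (simp add: F)
  have Jm[measurable]: "J \<in> borel_measurable borel" using J_cont by (rule borel_measurable_continuous_onI)
  fix V :: "(real^'n) set" and \<nu> :: real
  assume V: "open V \<and> connected V \<and> 0 < emeasure lborel V \<and> emeasure lborel V < \<infinity>"
  then have Vf: "fsigma_in euclidean V" by (simp add: open_imp_fsigma_in metrizable_space_euclidean)
  have [measurable]: "V \<in> sets borel" using V by simp
  define I where "I = (\<integral>\<^sup>+v\<in>{\<nu><..}. ennreal (F v) \<partial>lborel)"
  have Ieq: "I = ennreal ?q * (\<integral>\<^sup>+v\<in>{\<nu><..}. ennreal (std_normal_density v * J v) \<partial>lborel)"
    unfolding I_def F using normal_vec_density_nonneg[of "sqrt \<gamma>0" "0::real^'n"] J_nonneg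
    by (subst nn_integral_cmult[symmetric]) (auto intro!: nn_integral_cong simp: ennreal_mult mult.assoc)
  have Ifin: "I < \<infinity>"
  proof -
    have "(\<integral>\<^sup>+v\<in>{\<nu><..}. ennreal (std_normal_density v * J v) \<partial>lborel) \<le> (\<integral>\<^sup>+\<omega>. ennreal (norm (det (hessf X 0 \<omega>))) \<partial>M)"
      unfolding J[of 0, symmetric] by (intro nn_integral_mono) auto
    also have "\<dots> < \<infinity>" using det_int by (simp add: integrable_iff_bounded)
    finally show ?thesis unfolding Ieq by (simp add: ennreal_mult_less_top)
  qed
  define \<psi> where "\<psi> x h = min (x - \<nu>) (\<kappa> h)" for x and h :: "real^'n^'n"
  have \<psi>: "continuous_on UNIV (\<lambda>(x, h). \<psi> x h)"
    unfolding \<psi>_def case_prod_unfold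
    by (intro continuous_intros continuous_on_compose2[OF \<kappa>(1)]) auto
  have \<psi>nd: "det h \<noteq> 0" if "\<psi> x h > 0" for x h using that \<kappa>(2) by (simp add: \<psi>_def)
  have "AE \<omega> in M. \<not> (\<exists>t\<in>V. gradf X t \<omega> = 0 \<and> det (hessf X t \<omega>) = 0)"
    by (rule kac_rice(2)[OF Vf])
  with hess_symmetric_AE have "AE \<omega> in M. {x \<in> CP X m \<omega> \<inter> V. X x \<omega> > \<nu>} =
      {t\<in>V. gradf X t \<omega> = 0 \<and> \<psi> (X t \<omega>) (hessf X t \<omega>) > 0}"
    by eventually_elim (use idx in \<open>auto simp: CP_def \<psi>_def\<close>)
  then have "expected_number M X m V \<nu> =
      (\<integral>\<^sup>+\<omega>. emeasure (count_space UNIV) {t\<in>V. gradf X t \<omega> = 0 \<and> \<psi> (X t \<omega>) (hessf X t \<omega>) > 0} \<partial>M)"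
    unfolding expected_number_def by (intro nn_integral_cong_AE) (auto elim: eventually_mono)
  also have "\<dots> = (\<integral>\<^sup>+t. ennreal ?q * (\<integral>\<^sup>+\<omega>. ennreal (\<bar>det (hessf X t \<omega>)\<bar> *
        of_bool (\<psi> (X t \<omega>) (hessf X t \<omega>) > 0)) \<partial>M) * indicator V t \<partial>lborel)"
    by (rule kac_rice(1)[OF Vf \<psi> \<psi>nd])
  also have "\<dots> = (\<integral>\<^sup>+t. I * indicator V t \<partial>lborel)"
    unfolding Ieq by (simp add: \<psi>_def J)
  also have "\<dots> = I * emeasure lborel V" by (simp add: nn_integral_cmult_indicator)
  finally have EN: "expected_number M X m V \<nu> = I * emeasure lborel V" .
  show "expected_number M X m V \<nu> < \<infinity>" using EN Ifin V by (simp add: ennreal_mult_less_top)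
  have Ieq2: "(\<integral>\<^sup>+v. ennreal (indicator {\<nu><..} v *\<^sub>R F v) \<partial>lborel) = I"
    unfolding I_def by (intro nn_integral_cong) (auto split: split_indicator)
  show si: "set_integrable lborel {\<nu><..} F"
    unfolding set_integrable_def
    by (rule integrableI_nonneg) (use Ifin Ieq2 F0 in auto)
  have "(LINT v:{\<nu><..}|lborel. F v) = enn2real I"
    unfolding set_lebesgue_integral_def Ieq2[symmetric]
    by (rule integral_eq_nn_integral) (use F0 in auto)
  moreover have "enn2real (I * emeasure lborel V) / measure lborel V = enn2real I"
  proof -
    have "emeasure lborel V \<noteq> 0" "emeasure lborel V \<noteq> \<infinity>" using V by (force, force)
    then have "measure lborel V \<noteq> 0" by (simp add: measure_def enn2real_eq_0_iff)
    then show ?thesis by (simp add: enn2real_mult flip: measure_def)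
  qed
  ultimately show "(LINT v:{\<nu><..}|lborel. F v) = enn2real (expected_number M X m V \<nu>) / measure lborel V"
    unfolding EN by simp
qed

end

section \<open>The densities in dimension one and two\<close>

lemma continuous_erfc_compose [continuous_intros]:
  "continuous_on S f \<Longrightarrow> continuous_on S (\<lambda>x. erfc (f x))"
  using continuous_on_compose2[OF continuous_on_erfc[of UNIV]] by auto

lemma continuous_half_mean:
  assumes s: "s > 0" shows "continuous_on UNIV (half_mean s)"
proof -
  have "continuous_on UNIV (\<lambda>\<mu>. s / sqrt (2 * pi) * exp (- \<mu>\<^sup>2 / (2 * s\<^sup>2)) + \<mu> * (erfc (- \<mu> / (sqrt 2 * s)) / 2))"
    using s by (intro continuous_intros) auto
  then show ?thesis by (simp only: half_mean_eq[OF s, symmetric])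
qed

lemma continuous_half_det_mean:
  assumes s: "s > 0" and \<tau>: "\<tau> > 0" shows "continuous_on UNIV (half_det_mean \<tau> s)"
proof -
  have nz: "s\<^sup>2 + \<tau> \<noteq> 0" "s * sqrt (\<tau> / (s\<^sup>2 + \<tau>)) \<noteq> 0" using s'_pos[OF s \<tau>] s \<tau> by (auto simp: add_pos_pos less_imp_neq[symmetric])
  have "continuous_on UNIV (\<lambda>\<mu>. \<mu> * (s / sqrt (2 * pi) * exp (- \<mu>\<^sup>2 / (2 * s\<^sup>2)))
     + (\<mu>\<^sup>2 + s\<^sup>2 - 2 * \<tau>) * (erfc (- \<mu> / (sqrt 2 * s)) / 2) +
     2 * \<tau> * (exp (- \<mu>\<^sup>2 / (2 * (s\<^sup>2 + \<tau>))) * sqrt (\<tau> / (s\<^sup>2 + \<tau>))) *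
      (erfc (- (\<mu> * \<tau> / (s\<^sup>2 + \<tau>)) / (sqrt 2 * (s * sqrt (\<tau> / (s\<^sup>2 + \<tau>))))) / 2))"
    using s nz by (intro continuous_intros) auto
  then show ?thesis by (simp only: half_det_mean_eq[OF s \<tau>, symmetric])
qed

lemma transpose_eq_entry:
  assumes "transpose A = A" shows "A $ i $ j = A $ j $ i"
proof -
  have "transpose A $ i $ j = A $ i $ j" using assms by simp
  then show ?thesis by (simp add: transpose_def)
qed

text \<open>A symmetric matrix with half trace \<open>u\<close> and eigenvalues \<open>u + r\<close>, \<open>u - r\<close> is positive definite iff \<open>r < u\<close>, and
  indefinite iff \<open>r > \<bar>u\<bar>\<close>.\<close>

lemma rayleigh_mean_minimum:
  assumes \<tau>: "\<tau> > 0"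
  shows "(\<integral>\<^sup>+r\<in>{0..}. ennreal (r / \<tau> * exp (- r\<^sup>2 / (2 * \<tau>))) * ennreal (\<bar>u\<^sup>2 - r\<^sup>2\<bar> * of_bool (r\<^sup>2 < u\<^sup>2 \<and> 0 < u)) \<partial>lborel) =
    ennreal (u\<^sup>2 - 2 * \<tau> + 2 * \<tau> * exp (- u\<^sup>2 / (2 * \<tau>))) * indicator {0<..} u"
proof (cases "0 < u")
  case True
  have "ennreal (r / \<tau> * exp (- r\<^sup>2 / (2 * \<tau>))) * ennreal (\<bar>u\<^sup>2 - r\<^sup>2\<bar> * of_bool (r\<^sup>2 < u\<^sup>2 \<and> 0 < u)) * indicator {0..} r =
      ennreal (r / \<tau> * exp (- r\<^sup>2 / (2 * \<tau>)) * (u\<^sup>2 - r\<^sup>2)) * indicator {0..u} r" for r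
  proof (cases "0 \<le> r \<and> r < u")
    case True
    have "r\<^sup>2 < u\<^sup>2" using True by (intro power_strict_mono) auto
    moreover have "ennreal (r / \<tau> * exp (- r\<^sup>2 / (2 * \<tau>))) * ennreal (u\<^sup>2 - r\<^sup>2) = ennreal (r / \<tau> * exp (- r\<^sup>2 / (2 * \<tau>)) * (u\<^sup>2 - r\<^sup>2))"
      using calculation True \<tau> by (intro ennreal_mult[symmetric]) auto
    ultimately show ?thesis using True \<open>0 < u\<close> by simp
  next
    case False
    show ?thesis
    proof (cases "0 \<le> r")
      case True
      then have "u \<le> r" using False by auto
      then have "u\<^sup>2 \<le> r\<^sup>2" using \<open>0 < u\<close> by (intro power_mono) auto
      then show ?thesis using \<open>u \<le> r\<close> by (auto simp: indicator_def)
    qed (auto simp: indicator_def)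
  qed
  then show ?thesis using rayleigh_head[OF \<tau>, of u] True by simp
qed simp

lemma rayleigh_mean_saddle:
  assumes \<tau>: "\<tau> > 0"
  shows "(\<integral>\<^sup>+r\<in>{0..}. ennreal (r / \<tau> * exp (- r\<^sup>2 / (2 * \<tau>))) * ennreal (\<bar>u\<^sup>2 - r\<^sup>2\<bar> * of_bool (u\<^sup>2 < r\<^sup>2)) \<partial>lborel) =
    ennreal (2 * \<tau> * exp (- u\<^sup>2 / (2 * \<tau>)))"
proof -
  have "ennreal (r / \<tau> * exp (- r\<^sup>2 / (2 * \<tau>))) * ennreal (\<bar>u\<^sup>2 - r\<^sup>2\<bar> * of_bool (u\<^sup>2 < r\<^sup>2)) * indicator {0..} r =
      ennreal (r / \<tau> * exp (- r\<^sup>2 / (2 * \<tau>)) * (r\<^sup>2 - \<bar>u\<bar>\<^sup>2)) * indicator {\<bar>u\<bar>..} r" for r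
  proof (cases "\<bar>u\<bar> < r")
    case True
    have "\<bar>u\<bar>\<^sup>2 < r\<^sup>2" using True by (intro power_strict_mono) auto
    moreover have "ennreal (r / \<tau> * exp (- r\<^sup>2 / (2 * \<tau>))) * ennreal (r\<^sup>2 - u\<^sup>2) = ennreal (r / \<tau> * exp (- r\<^sup>2 / (2 * \<tau>)) * (r\<^sup>2 - u\<^sup>2))"
      using calculation True \<tau> by (intro ennreal_mult[symmetric]) auto
    ultimately show ?thesis using True by simp
  next
    case False
    show ?thesis
    proof (cases "0 \<le> r")
      case True
      then have "r\<^sup>2 \<le> \<bar>u\<bar>\<^sup>2" using False by (intro power_mono) auto
      moreover have "r = \<bar>u\<bar>" if "\<bar>u\<bar> \<le> r" using that False by simp
      ultimately show ?thesis by (auto simp: indicator_def)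
    qed (auto simp: indicator_def)
  qed
  then show ?thesis using rayleigh_tail(1)[OF \<tau>, of "\<bar>u\<bar>"] by simp
qed

context isotropic_gaussian_field
begin

lemma hess_second_moments:
  "expectation (\<lambda>\<omega>. hessf X t \<omega> $ i $ j * X t \<omega>) = - \<gamma>0 * of_bool (i = j)"
  "expectation (\<lambda>\<omega>. hessf X t \<omega> $ i $ j * hessf X t \<omega> $ k $ l) =
         C'' 0 * (of_bool (i = k \<and> j = l) + of_bool (i = j \<and> k = l) + of_bool (i = l \<and> j = k))"
  using jet_covariance(3)[of t i j] jet_covariance(6)[of t i j k l] by (simp_all add: mult.commute)

lemma number_densities_1:
  assumes i: "(UNIV :: 'n set) = {i}" and s: "s > 0" "s\<^sup>2 = 3 * C'' 0 - \<gamma>0\<^sup>2"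
  shows "is_number_density M X 0 (\<lambda>v. normal_vec_density (sqrt \<gamma>0) (0::real^'n) * (std_normal_density v * half_mean s (- (\<gamma>0 * v))))"
    and "is_number_density M X 1 (\<lambda>v. normal_vec_density (sqrt \<gamma>0) (0::real^'n) * (std_normal_density v * half_mean s (\<gamma>0 * v)))"
proof -
  note d1 = det_1[OF i] and n1 = neg_index_1[OF i]
  have det_int: "integrable M (\<lambda>\<omega>. hessf X 0 \<omega> $ i $ i)"
    using jetcomb_integrable(1)[OF jetcomb_H jetcomb_H] .
  have dis: "(\<integral>\<^sup>+\<omega>. indicator {\<nu><..} (X t \<omega>) * g (hessf X t \<omega> $ i $ i) \<partial>M) =
    (\<integral>\<^sup>+x\<in>{\<nu><..}. ennreal (std_normal_density x) * (\<integral>\<^sup>+u. ennreal (normal_density (- (\<gamma>0 * x)) s u) * g u \<partial>lborel) \<partial>lborel)"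
    if [measurable]: "g \<in> borel_measurable borel" for g :: "real \<Rightarrow> ennreal" and t \<nu>
  proof -
    have "(\<integral>\<^sup>+\<omega>. indicator {\<nu><..} (X t \<omega>) * (\<lambda>u _. g u) (hessf X t \<omega> $ i $ i) ((\<lambda>_. ()) \<omega>) \<partial>M) =
    (\<integral>\<^sup>+x\<in>{\<nu><..}. ennreal (std_normal_density x) *
       (\<integral>\<^sup>+u. ennreal (normal_density (- (\<gamma>0 * x)) s u) * (\<integral>\<^sup>+\<omega>. (\<lambda>u _. g u) u ((\<lambda>_. ()) \<omega>) \<partial>M) \<partial>lborel) \<partial>lborel)"
    proof (rule jet_disintegration[where W="\<lambda>_::unit. \<lambda>_. 0" and N="count_space UNIV", OF jetcomb_H jetcomb_0 _ _ s(1)])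
      show "expectation (\<lambda>\<omega>. hessf X t \<omega> $ i $ i * X t \<omega>) = - \<gamma>0" unfolding hess_second_moments by simp
      show "expectation (\<lambda>\<omega>. hessf X t \<omega> $ i $ i * hessf X t \<omega> $ i $ i) = s\<^sup>2 + \<gamma>0\<^sup>2"
        unfolding hess_second_moments s(2) by simp
      show "(\<lambda>_. ()) \<in> gen_algebra (\<lambda>_::unit. \<lambda>_::'w. 0) \<rightarrow>\<^sub>M count_space UNIV" by (rule measurable_const) simp
      show "(\<lambda>(u, z). (\<lambda>u _. g u) u z) \<in> borel_measurable (borel \<Otimes>\<^sub>M count_space (UNIV :: unit set))"
        unfolding case_prod_unfold by measurable
    qed simp_all
    then show ?thesis by (simp add: emeasure_space_1)
  qed
  have half: "(\<integral>\<^sup>+u. ennreal (normal_density m s u) * ennreal (\<bar>u\<bar> * of_bool (0 < u)) \<partial>lborel) = ennreal (half_mean s m)" for m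
    unfolding half_mean_nn[OF s(1), symmetric]
    by (intro nn_integral_cong) (auto simp: ennreal_mult split: split_indicator)
  have half': "(\<integral>\<^sup>+u. ennreal (normal_density m s u) * ennreal (\<bar>u\<bar> * of_bool (u < 0)) \<partial>lborel) = ennreal (half_mean s (- m))" for m
    using nn_integral_normal_reflect[of "\<lambda>u. ennreal (\<bar>u\<bar> * of_bool (0 < u))" m s] half[of "- m"] by simp
  show "is_number_density M X 0 (\<lambda>v. normal_vec_density (sqrt \<gamma>0) (0::real^'n) * (std_normal_density v * half_mean s (- (\<gamma>0 * v))))"
  proof (rule is_number_densityI[where \<kappa>="\<lambda>h. h $ i $ i"])
    show "(\<integral>\<^sup>+\<omega>. ennreal (\<bar>det (hessf X t \<omega>)\<bar> * of_bool (\<nu> < X t \<omega> \<and> hessf X t \<omega> $ i $ i > 0)) \<partial>M) =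
        (\<integral>\<^sup>+v\<in>{\<nu><..}. ennreal (std_normal_density v * half_mean s (- (\<gamma>0 * v))) \<partial>lborel)" for t \<nu>
    proof -
      have "(\<integral>\<^sup>+\<omega>. ennreal (\<bar>det (hessf X t \<omega>)\<bar> * of_bool (\<nu> < X t \<omega> \<and> hessf X t \<omega> $ i $ i > 0)) \<partial>M) =
          (\<integral>\<^sup>+\<omega>. indicator {\<nu><..} (X t \<omega>) * (\<lambda>u. ennreal (\<bar>u\<bar> * of_bool (0 < u))) (hessf X t \<omega> $ i $ i) \<partial>M)"
        unfolding d1 by (intro nn_integral_cong) (auto split: split_indicator)
      also have "\<dots> = (\<integral>\<^sup>+x\<in>{\<nu><..}. ennreal (std_normal_density x) *
          (\<integral>\<^sup>+u. ennreal (normal_density (- (\<gamma>0 * x)) s u) * ennreal (\<bar>u\<bar> * of_bool (0 < u)) \<partial>lborel) \<partial>lborel)"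
        by (rule dis) measurable
      finally show ?thesis unfolding half by (simp only: ennreal_mult[OF normal_density_nonneg half_mean_nonneg])
    qed
    show "continuous_on UNIV (\<lambda>v. half_mean s (- (\<gamma>0 * v)))"
      by (rule continuous_on_compose2[OF continuous_half_mean[OF s(1)]]) (auto intro!: continuous_intros)
  qed (auto simp: d1 n1 half_mean_nonneg det_int intro!: continuous_intros)
  show "is_number_density M X 1 (\<lambda>v. normal_vec_density (sqrt \<gamma>0) (0::real^'n) * (std_normal_density v * half_mean s (\<gamma>0 * v)))"
  proof (rule is_number_densityI[where \<kappa>="\<lambda>h. - h $ i $ i"])
    show "(\<integral>\<^sup>+\<omega>. ennreal (\<bar>det (hessf X t \<omega>)\<bar> * of_bool (\<nu> < X t \<omega> \<and> - hessf X t \<omega> $ i $ i > 0)) \<partial>M) =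
        (\<integral>\<^sup>+v\<in>{\<nu><..}. ennreal (std_normal_density v * half_mean s (\<gamma>0 * v)) \<partial>lborel)" for t \<nu>
    proof -
      have "(\<integral>\<^sup>+\<omega>. ennreal (\<bar>det (hessf X t \<omega>)\<bar> * of_bool (\<nu> < X t \<omega> \<and> - hessf X t \<omega> $ i $ i > 0)) \<partial>M) =
          (\<integral>\<^sup>+\<omega>. indicator {\<nu><..} (X t \<omega>) * (\<lambda>u. ennreal (\<bar>u\<bar> * of_bool (u < 0))) (hessf X t \<omega> $ i $ i) \<partial>M)"
        unfolding d1 by (intro nn_integral_cong) (auto split: split_indicator)
      also have "\<dots> = (\<integral>\<^sup>+x\<in>{\<nu><..}. ennreal (std_normal_density x) *
          (\<integral>\<^sup>+u. ennreal (normal_density (- (\<gamma>0 * x)) s u) * ennreal (\<bar>u\<bar> * of_bool (u < 0)) \<partial>lborel) \<partial>lborel)"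
        by (rule dis) measurable
      finally show ?thesis unfolding half' by (simp only: ennreal_mult[OF normal_density_nonneg half_mean_nonneg] minus_minus)
    qed
    show "continuous_on UNIV (\<lambda>v. half_mean s (\<gamma>0 * v))"
      by (rule continuous_on_compose2[OF continuous_half_mean[OF s(1)]]) (auto intro!: continuous_intros)
  qed (auto simp: d1 n1 half_mean_nonneg det_int intro!: continuous_intros)
qed

text \<open>Half the trace, half the difference of the diagonal entries and the off-diagonal entry are uncorrelated; the last two
  are also uncorrelated with \<open>X\<close> and have the same variance \<open>\<tau>\<close>.\<close>

lemma hess_disintegration_2:
  fixes g :: "real \<Rightarrow> real \<Rightarrow> ennreal"
  assumes ij: "(UNIV :: 'n set) = {i, j}" "i \<noteq> j" and \<tau>: "C'' 0 = \<tau>" "\<tau> > 0" and s: "s > 0" "s\<^sup>2 = 2 * \<tau> - \<gamma>0\<^sup>2"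
    and g[measurable]: "(\<lambda>(u, q). g u q) \<in> borel_measurable (borel \<Otimes>\<^sub>M borel)"
  shows "(\<integral>\<^sup>+\<omega>. indicator {\<nu><..} (X t \<omega>) * g ((hessf X t \<omega> $ i $ i + hessf X t \<omega> $ j $ j) / 2)
        (((hessf X t \<omega> $ i $ i - hessf X t \<omega> $ j $ j) / 2)\<^sup>2 + (hessf X t \<omega> $ i $ j)\<^sup>2) \<partial>M) =
    (\<integral>\<^sup>+x\<in>{\<nu><..}. ennreal (std_normal_density x) * (\<integral>\<^sup>+u. ennreal (normal_density (- (\<gamma>0 * x)) s u) *
        (\<integral>\<^sup>+r\<in>{0..}. ennreal (r / \<tau> * exp (- r\<^sup>2 / (2 * \<tau>))) * g u (r\<^sup>2) \<partial>lborel) \<partial>lborel) \<partial>lborel)"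
proof -
  define L where "L = (\<lambda>\<omega>. (hessf X t \<omega> $ i $ i + hessf X t \<omega> $ j $ j) / 2)"
  define D where "D = (\<lambda>\<omega>. (hessf X t \<omega> $ i $ i - hessf X t \<omega> $ j $ j) / 2)"
  define E where "E = (\<lambda>\<omega>. hessf X t \<omega> $ i $ j)"
  define W where "W b = (if b then D else E)" for b
  have L: "jetcomb t L" and D: "jetcomb t D" and E: "jetcomb t E"
    unfolding L_def D_def E_def by (intro jetcomb_intros)+
  have HH: "integrable M (\<lambda>\<omega>. hessf X t \<omega> $ i' $ j' * hessf X t \<omega> $ k $ l)"
    and HX: "integrable M (\<lambda>\<omega>. hessf X t \<omega> $ i' $ j' * X t \<omega>)" for i' j' k l
    using jetcomb_integrable(2)[OF jetcomb_H jetcomb_H] jetcomb_integrable(2)[OF jetcomb_H jetcomb_X] by blast+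
  note exp = L_def D_def E_def add_divide_distrib diff_divide_distrib distrib_left distrib_right
    left_diff_distrib right_diff_distrib times_divide_eq_left times_divide_eq_right divide_divide_eq_left
  have LX: "expectation (\<lambda>\<omega>. L \<omega> * X t \<omega>) = - \<gamma>0" unfolding exp using HX by (simp add: hess_second_moments)
  have LL: "expectation (\<lambda>\<omega>. L \<omega> * L \<omega>) = s\<^sup>2 + \<gamma>0\<^sup>2" unfolding exp using HH ij(2) s(2) by (simp add: hess_second_moments \<tau>)
  have DX: "expectation (\<lambda>\<omega>. D \<omega> * X t \<omega>) = 0" unfolding exp using HX by (simp add: hess_second_moments)
  have EX: "expectation (\<lambda>\<omega>. E \<omega> * X t \<omega>) = 0" unfolding exp using HX ij(2) by (simp add: hess_second_moments)
  have DL: "expectation (\<lambda>\<omega>. D \<omega> * L \<omega>) = 0" unfolding exp using HH ij(2) by (simp add: hess_second_moments)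
  have EL: "expectation (\<lambda>\<omega>. E \<omega> * L \<omega>) = 0" unfolding exp using HH ij(2) by (simp add: hess_second_moments)
  have DE: "expectation (\<lambda>\<omega>. D \<omega> * E \<omega>) = 0" unfolding exp using HH ij(2) by (simp add: hess_second_moments)
  have DD: "expectation (\<lambda>\<omega>. D \<omega> * D \<omega>) = (sqrt \<tau>)\<^sup>2" unfolding exp using HH ij(2) \<tau>(2) by (simp add: hess_second_moments \<tau>(1))
  have EE: "expectation (\<lambda>\<omega>. E \<omega> * E \<omega>) = (sqrt \<tau>)\<^sup>2" unfolding exp using HH ij(2) \<tau>(2) by (simp add: hess_second_moments \<tau>(1))
  have sq: "sqrt \<tau> > 0" using \<tau>(2) by simp
  have mW: "D \<in> borel_measurable (gen_algebra W)" "E \<in> borel_measurable (gen_algebra W)"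
    using measurable_gen_algebra[of W True] measurable_gen_algebra[of W False] by (simp_all add: W_def)
  have Dm[measurable]: "D \<in> borel_measurable M" and Em[measurable]: "E \<in> borel_measurable M"
    using gaussian_rvD(1)[OF jetcomb_gauss] D E by blast+
  have I: "indep_pair M borel D borel E"
    by (rule jetcomb_indep[OF D, where W="\<lambda>_::unit. E"]) (auto simp: E DE measurable_gen_algebra[of "\<lambda>_::unit. E" "()"])
  have "(\<integral>\<^sup>+\<omega>. indicator {\<nu><..} (X t \<omega>) * (\<lambda>u (d, e). g u (d\<^sup>2 + e\<^sup>2)) (L \<omega>) (D \<omega>, E \<omega>) \<partial>M) =
    (\<integral>\<^sup>+x\<in>{\<nu><..}. ennreal (std_normal_density x) * (\<integral>\<^sup>+u. ennreal (normal_density (- (\<gamma>0 * x)) s u) *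
      (\<integral>\<^sup>+\<omega>. (\<lambda>u (d, e). g u (d\<^sup>2 + e\<^sup>2)) u (D \<omega>, E \<omega>) \<partial>M) \<partial>lborel) \<partial>lborel)"
  proof (rule jet_disintegration[OF L _ LX LL s(1), where W=W and N="borel \<Otimes>\<^sub>M borel"])
    show "jetcomb t (W b)" "expectation (\<lambda>\<omega>. W b \<omega> * X t \<omega>) = 0" "expectation (\<lambda>\<omega>. W b \<omega> * L \<omega>) = 0" for b
      using D E DX EX DL EL by (simp_all add: W_def)
    show "(\<lambda>\<omega>. (D \<omega>, E \<omega>)) \<in> gen_algebra W \<rightarrow>\<^sub>M borel \<Otimes>\<^sub>M borel" using mW by simp
  qed (unfold case_prod_unfold, measurable)
  also have "(\<lambda>u. \<integral>\<^sup>+\<omega>. (\<lambda>u (d, e). g u (d\<^sup>2 + e\<^sup>2)) u (D \<omega>, E \<omega>) \<partial>M) =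
      (\<lambda>u. \<integral>\<^sup>+r\<in>{0..}. ennreal (r / \<tau> * exp (- r\<^sup>2 / (2 * \<tau>))) * g u (r\<^sup>2) \<partial>lborel)"
  proof
    fix u
    have "(\<integral>\<^sup>+\<omega>. g u ((D \<omega>)\<^sup>2 + (E \<omega>)\<^sup>2) \<partial>M) =
        (\<integral>\<^sup>+d. ennreal (normal_density 0 (sqrt \<tau>) d) * (\<integral>\<^sup>+\<omega>. g u (d\<^sup>2 + (E \<omega>)\<^sup>2) \<partial>M) \<partial>lborel)"
      by (rule nn_integral_indep_pair[OF I jetcomb_distributed[OF D DD sq]]) measurable
    also have "\<dots> = (\<integral>\<^sup>+d. ennreal (normal_density 0 (sqrt \<tau>) d) *
        (\<integral>\<^sup>+e. ennreal (normal_density 0 (sqrt \<tau>) e) * g u (d\<^sup>2 + e\<^sup>2) \<partial>lborel) \<partial>lborel)"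
      by (subst distributed_nn_integral[OF jetcomb_distributed[OF E EE sq], symmetric]) auto
    also have "\<dots> = (\<integral>\<^sup>+d. \<integral>\<^sup>+e. ennreal (normal_density 0 (sqrt \<tau>) d) *
        (ennreal (normal_density 0 (sqrt \<tau>) e) * g u (d\<^sup>2 + e\<^sup>2)) \<partial>lborel \<partial>lborel)"
      by (subst nn_integral_cmult) auto
    also have "\<dots> = (\<integral>\<^sup>+r\<in>{0..}. ennreal (r / \<tau> * exp (- r\<^sup>2 / (2 * \<tau>))) * g u (r\<^sup>2) \<partial>lborel)"
      by (rule gauss_polar[OF \<tau>(2)]) measurable
    finally show "(\<integral>\<^sup>+\<omega>. (\<lambda>u (d, e). g u (d\<^sup>2 + e\<^sup>2)) u (D \<omega>, E \<omega>) \<partial>M) = \<dots>" by simp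
  qed
  finally show ?thesis by (simp add: L_def D_def E_def)
qed

text \<open>For a symmetric matrix \<open>det h = u\<^sup>2 - q\<close> with \<open>u\<close> half the trace and \<open>q\<close> the sum of squares below, so that the
  condition \<open>\<kappa> h > 0\<close> becomes a condition \<open>P u q\<close>.\<close>

lemma number_density_2:
  fixes \<kappa> :: "real^'n^'n \<Rightarrow> real"
  assumes ij: "(UNIV :: 'n set) = {i, j}" "i \<noteq> j" and \<tau>: "C'' 0 = \<tau>" "\<tau> > 0" and s: "s > 0" "s\<^sup>2 = 2 * \<tau> - \<gamma>0\<^sup>2"
    and \<kappa>: "continuous_on UNIV \<kappa>" "\<And>h. \<kappa> h > 0 \<Longrightarrow> det h \<noteq> 0"
    and idx: "\<And>h. transpose h = h \<Longrightarrow> det h \<noteq> 0 \<Longrightarrow> neg_index h = m \<longleftrightarrow> \<kappa> h > 0"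
    and P: "\<And>h. h $ i $ j = h $ j $ i \<Longrightarrow> \<kappa> h > 0 \<longleftrightarrow>
        P ((h $ i $ i + h $ j $ j) / 2) (((h $ i $ i - h $ j $ j) / 2)\<^sup>2 + (h $ i $ j)\<^sup>2)"
    and Pm[measurable]: "Measurable.pred (borel \<Otimes>\<^sub>M borel) (\<lambda>(u, q). P u q)"
    and J: "\<And>x. (\<integral>\<^sup>+u. ennreal (normal_density (- (\<gamma>0 * x)) s u) *
        (\<integral>\<^sup>+r\<in>{0..}. ennreal (r / \<tau> * exp (- r\<^sup>2 / (2 * \<tau>))) * ennreal (\<bar>u\<^sup>2 - r\<^sup>2\<bar> * of_bool (P u (r\<^sup>2))) \<partial>lborel) \<partial>lborel) = ennreal (J x)"
    and J_nonneg: "\<And>v. 0 \<le> J v" and J_cont: "continuous_on UNIV J"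
  shows "is_number_density M X m (\<lambda>v. normal_vec_density (sqrt \<gamma>0) (0::real^'n) * (std_normal_density v * J v))"
proof (rule is_number_densityI[OF \<kappa> idx _ J_nonneg J_cont])
  note d2 = det_2'[OF ij]
  show "integrable M (\<lambda>\<omega>. det (hessf X 0 \<omega>))"
  proof -
    have HH: "integrable M (\<lambda>\<omega>. hessf X 0 \<omega> $ i' $ j' * hessf X 0 \<omega> $ k $ l)" for i' j' k l
      using jetcomb_integrable(2)[OF jetcomb_H jetcomb_H] .
    show ?thesis unfolding d2 by (rule Bochner_Integration.integrable_diff[OF HH HH])
  qed
  show "(\<integral>\<^sup>+\<omega>. ennreal (\<bar>det (hessf X t \<omega>)\<bar> * of_bool (\<nu> < X t \<omega> \<and> \<kappa> (hessf X t \<omega>) > 0)) \<partial>M) =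
      (\<integral>\<^sup>+v\<in>{\<nu><..}. ennreal (std_normal_density v * J v) \<partial>lborel)" for t \<nu>
  proof -
    let ?g = "\<lambda>u q. ennreal (\<bar>u\<^sup>2 - q\<bar> * of_bool (P u q))"
    have "(\<integral>\<^sup>+\<omega>. ennreal (\<bar>det (hessf X t \<omega>)\<bar> * of_bool (\<nu> < X t \<omega> \<and> \<kappa> (hessf X t \<omega>) > 0)) \<partial>M) =
      (\<integral>\<^sup>+\<omega>. indicator {\<nu><..} (X t \<omega>) * ?g ((hessf X t \<omega> $ i $ i + hessf X t \<omega> $ j $ j) / 2)
        (((hessf X t \<omega> $ i $ i - hessf X t \<omega> $ j $ j) / 2)\<^sup>2 + (hessf X t \<omega> $ i $ j)\<^sup>2) \<partial>M)"
    proof (rule nn_integral_cong_AE)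
      show "AE \<omega> in M. ennreal (\<bar>det (hessf X t \<omega>)\<bar> * of_bool (\<nu> < X t \<omega> \<and> \<kappa> (hessf X t \<omega>) > 0)) =
        indicator {\<nu><..} (X t \<omega>) * ?g ((hessf X t \<omega> $ i $ i + hessf X t \<omega> $ j $ j) / 2)
        (((hessf X t \<omega> $ i $ i - hessf X t \<omega> $ j $ j) / 2)\<^sup>2 + (hessf X t \<omega> $ i $ j)\<^sup>2)"
        using hess_symmetric_AE
      proof eventually_elim
        case (elim \<omega>)
        let ?h = "hessf X t \<omega>"
        have sym: "?h $ i $ j = ?h $ j $ i" by (rule transpose_eq_entry) (use elim in simp)
        have "det ?h = ((?h $ i $ i + ?h $ j $ j) / 2)\<^sup>2 - (((?h $ i $ i - ?h $ j $ j) / 2)\<^sup>2 + (?h $ i $ j)\<^sup>2)"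
          unfolding d2 sym by (simp add: power2_eq_square field_simps)
        then show ?case using P[OF sym] by (simp add: indicator_def)
      qed
    qed
    also have "\<dots> = (\<integral>\<^sup>+x\<in>{\<nu><..}. ennreal (std_normal_density x) * (\<integral>\<^sup>+u. ennreal (normal_density (- (\<gamma>0 * x)) s u) *
        (\<integral>\<^sup>+r\<in>{0..}. ennreal (r / \<tau> * exp (- r\<^sup>2 / (2 * \<tau>))) * ?g u (r\<^sup>2) \<partial>lborel) \<partial>lborel) \<partial>lborel)"
      by (rule hess_disintegration_2[OF ij \<tau> s]) (unfold case_prod_unfold, measurable)
    finally show ?thesis unfolding J by (simp add: ennreal_mult J_nonneg)
  qed
qed auto

lemma number_densities_2:
  assumes ij: "(UNIV :: 'n set) = {i, j}" "i \<noteq> j" and \<tau>: "C'' 0 = \<tau>" "\<tau> > 0" and s: "s > 0" "s\<^sup>2 = 2 * \<tau> - \<gamma>0\<^sup>2"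
  shows "is_number_density M X 0 (\<lambda>v. normal_vec_density (sqrt \<gamma>0) (0::real^'n) * (std_normal_density v * half_det_mean \<tau> s (- (\<gamma>0 * v))))"
    and "is_number_density M X 1 (\<lambda>v. normal_vec_density (sqrt \<gamma>0) (0::real^'n) *
       (std_normal_density v * (2 * \<tau> * (exp (- (\<gamma>0 * v)\<^sup>2 / (2 * (s\<^sup>2 + \<tau>))) * sqrt (\<tau> / (s\<^sup>2 + \<tau>))))))"
    and "is_number_density M X 2 (\<lambda>v. normal_vec_density (sqrt \<gamma>0) (0::real^'n) * (std_normal_density v * half_det_mean \<tau> s (\<gamma>0 * v)))"
proof -
  note d2 = det_2'[OF ij]
  have dsym: "det h = ((h $ i $ i + h $ j $ j) / 2)\<^sup>2 - (((h $ i $ i - h $ j $ j) / 2)\<^sup>2 + (h $ i $ j)\<^sup>2)"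
    if "h $ i $ j = h $ j $ i" for h :: "real^'n^'n"
    unfolding d2 that by (simp add: power2_eq_square field_simps)
  have n2: "neg_index h = (if det h < 0 then 1 else if h $ i $ i + h $ j $ j < 0 then 2 else 0)"
    if "transpose h = h" "det h \<noteq> 0" for h :: "real^'n^'n"
  proof (rule neg_index_2[OF ij _ that(2)])
    show "h $ i $ j = h $ j $ i" by (rule transpose_eq_entry[OF that(1)]) 
  qed
  have tr: "h $ i $ i + h $ j $ j \<noteq> 0" if "transpose h = h" "det h > 0" for h :: "real^'n^'n"
  proof
    assume "h $ i $ i + h $ j $ j = 0"
    moreover have "h $ i $ j = h $ j $ i" by (rule transpose_eq_entry[OF that(1)]) 
    ultimately have "det h = - (((h $ i $ i - h $ j $ j) / 2)\<^sup>2 + (h $ i $ j)\<^sup>2)" using dsym by simp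
    then show False using that(2) by (smt (verit) zero_le_power2)
  qed
  have cd: "continuous_on UNIV (det :: real^'n^'n \<Rightarrow> real)"
    unfolding d2[abs_def] by (intro continuous_intros)
  have inner: "(\<integral>\<^sup>+u. ennreal (normal_density m s u) *
     (ennreal (u\<^sup>2 - 2 * \<tau> + 2 * \<tau> * exp (- u\<^sup>2 / (2 * \<tau>))) * indicator {0<..} u) \<partial>lborel) = ennreal (half_det_mean \<tau> s m)" for m
    unfolding half_det_mean_nn[OF s(1) \<tau>(2), symmetric]
  proof (intro nn_integral_cong)
    fix u show "ennreal (normal_density m s u) * (ennreal (u\<^sup>2 - 2 * \<tau> + 2 * \<tau> * exp (- u\<^sup>2 / (2 * \<tau>))) * indicator {0<..} u) =
      ennreal (normal_density m s u * (u\<^sup>2 - 2 * \<tau> + 2 * \<tau> * exp (- u\<^sup>2 / (2 * \<tau>)))) * indicator {0<..} u"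
      unfolding ennreal_mult[OF normal_density_nonneg rayleigh_head_nonneg[OF \<tau>(2)]] by (simp only: mult.assoc)
  qed
  show "is_number_density M X 0 (\<lambda>v. normal_vec_density (sqrt \<gamma>0) (0::real^'n) * (std_normal_density v * half_det_mean \<tau> s (- (\<gamma>0 * v))))"
  proof (rule number_density_2[OF ij \<tau> s, where \<kappa>="\<lambda>h. min (det h) (h $ i $ i + h $ j $ j)" and P="\<lambda>u q. q < u\<^sup>2 \<and> 0 < u"])
    show "continuous_on UNIV (\<lambda>h::real^'n^'n. min (det h) (h $ i $ i + h $ j $ j))"
      by (intro continuous_intros cd)
    show "neg_index h = 0 \<longleftrightarrow> min (det h) (h $ i $ i + h $ j $ j) > 0" if "transpose h = h" "det h \<noteq> 0" for h :: "real^'n^'n"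
      using n2[OF that] tr[OF that(1)] that(2) by auto
    show "min (det h) (h $ i $ i + h $ j $ j) > 0 \<longleftrightarrow>
        ((h $ i $ i - h $ j $ j) / 2)\<^sup>2 + (h $ i $ j)\<^sup>2 < ((h $ i $ i + h $ j $ j) / 2)\<^sup>2 \<and> 0 < (h $ i $ i + h $ j $ j) / 2"
      if "h $ i $ j = h $ j $ i" for h :: "real^'n^'n"
      unfolding dsym[OF that] by auto
    show "(\<integral>\<^sup>+u. ennreal (normal_density (- (\<gamma>0 * x)) s u) *
        (\<integral>\<^sup>+r\<in>{0..}. ennreal (r / \<tau> * exp (- r\<^sup>2 / (2 * \<tau>))) * ennreal (\<bar>u\<^sup>2 - r\<^sup>2\<bar> * of_bool (r\<^sup>2 < u\<^sup>2 \<and> 0 < u)) \<partial>lborel) \<partial>lborel) =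
        ennreal (half_det_mean \<tau> s (- (\<gamma>0 * x)))" for x
      unfolding rayleigh_mean_minimum[OF \<tau>(2)] by (rule inner)
    show "continuous_on UNIV (\<lambda>v. half_det_mean \<tau> s (- (\<gamma>0 * v)))"
      by (rule continuous_on_compose2[OF continuous_half_det_mean[OF s(1) \<tau>(2)]]) (auto intro!: continuous_intros)
  qed (auto simp: half_det_mean_nonneg[OF \<tau>(2)])
  show "is_number_density M X 2 (\<lambda>v. normal_vec_density (sqrt \<gamma>0) (0::real^'n) * (std_normal_density v * half_det_mean \<tau> s (\<gamma>0 * v)))"
  proof (rule number_density_2[OF ij \<tau> s, where \<kappa>="\<lambda>h. min (det h) (- (h $ i $ i + h $ j $ j))" and P="\<lambda>u q. q < u\<^sup>2 \<and> u < 0"])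
    show "continuous_on UNIV (\<lambda>h::real^'n^'n. min (det h) (- (h $ i $ i + h $ j $ j)))"
      by (intro continuous_intros cd)
    show "neg_index h = 2 \<longleftrightarrow> min (det h) (- (h $ i $ i + h $ j $ j)) > 0" if "transpose h = h" "det h \<noteq> 0" for h :: "real^'n^'n"
      using n2[OF that] tr[OF that(1)] that(2) by auto
    show "min (det h) (- (h $ i $ i + h $ j $ j)) > 0 \<longleftrightarrow>
        ((h $ i $ i - h $ j $ j) / 2)\<^sup>2 + (h $ i $ j)\<^sup>2 < ((h $ i $ i + h $ j $ j) / 2)\<^sup>2 \<and> (h $ i $ i + h $ j $ j) / 2 < 0"
      if "h $ i $ j = h $ j $ i" for h :: "real^'n^'n"
      unfolding dsym[OF that] by auto
    show "(\<integral>\<^sup>+u. ennreal (normal_density (- (\<gamma>0 * x)) s u) *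
        (\<integral>\<^sup>+r\<in>{0..}. ennreal (r / \<tau> * exp (- r\<^sup>2 / (2 * \<tau>))) * ennreal (\<bar>u\<^sup>2 - r\<^sup>2\<bar> * of_bool (r\<^sup>2 < u\<^sup>2 \<and> u < 0)) \<partial>lborel) \<partial>lborel) =
        ennreal (half_det_mean \<tau> s (\<gamma>0 * x))" for x
    proof -
      let ?G = "\<lambda>u. ennreal (u\<^sup>2 - 2 * \<tau> + 2 * \<tau> * exp (- u\<^sup>2 / (2 * \<tau>))) * indicator {0<..} u"
      have "(\<integral>\<^sup>+r\<in>{0..}. ennreal (r / \<tau> * exp (- r\<^sup>2 / (2 * \<tau>))) * ennreal (\<bar>u\<^sup>2 - r\<^sup>2\<bar> * of_bool (r\<^sup>2 < u\<^sup>2 \<and> u < 0)) \<partial>lborel) = ?G (- u)" for u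
        unfolding rayleigh_mean_minimum[OF \<tau>(2), symmetric] by simp
      then show ?thesis
        using nn_integral_normal_reflect[of ?G "- (\<gamma>0 * x)" s] inner[of "\<gamma>0 * x"] by simp
    qed
    show "continuous_on UNIV (\<lambda>v. half_det_mean \<tau> s (\<gamma>0 * v))"
      by (rule continuous_on_compose2[OF continuous_half_det_mean[OF s(1) \<tau>(2)]]) (auto intro!: continuous_intros)
  qed (auto simp: half_det_mean_nonneg[OF \<tau>(2)])
  show "is_number_density M X 1 (\<lambda>v. normal_vec_density (sqrt \<gamma>0) (0::real^'n) *
       (std_normal_density v * (2 * \<tau> * (exp (- (\<gamma>0 * v)\<^sup>2 / (2 * (s\<^sup>2 + \<tau>))) * sqrt (\<tau> / (s\<^sup>2 + \<tau>))))))"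
  proof (rule number_density_2[OF ij \<tau> s, where \<kappa>="\<lambda>h. - det h" and P="\<lambda>u q. u\<^sup>2 < q"])
    show "continuous_on UNIV (\<lambda>h::real^'n^'n. - det h)"
      by (intro continuous_intros cd)
    show "neg_index h = 1 \<longleftrightarrow> - det h > 0" if "transpose h = h" "det h \<noteq> 0" for h :: "real^'n^'n"
      using n2[OF that] by auto
    show "(\<integral>\<^sup>+u. ennreal (normal_density (- (\<gamma>0 * x)) s u) *
        (\<integral>\<^sup>+r\<in>{0..}. ennreal (r / \<tau> * exp (- r\<^sup>2 / (2 * \<tau>))) * ennreal (\<bar>u\<^sup>2 - r\<^sup>2\<bar> * of_bool (u\<^sup>2 < r\<^sup>2)) \<partial>lborel) \<partial>lborel) =
        ennreal (2 * \<tau> * (exp (- (\<gamma>0 * x)\<^sup>2 / (2 * (s\<^sup>2 + \<tau>))) * sqrt (\<tau> / (s\<^sup>2 + \<tau>))))" for x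
      unfolding rayleigh_mean_saddle[OF \<tau>(2)]
      using full_exp_nn[OF s(1) \<tau>(2), of "- (\<gamma>0 * x)"] \<tau>(2)
      by (simp only: ennreal_mult[OF normal_density_nonneg] exp_ge_zero mult_nonneg_nonneg zero_le_numeral less_imp_le power2_minus)
    show "continuous_on UNIV (\<lambda>v. 2 * \<tau> * (exp (- (\<gamma>0 * v)\<^sup>2 / (2 * (s\<^sup>2 + \<tau>))) * sqrt (\<tau> / (s\<^sup>2 + \<tau>))))"
    proof -
      have "2 * s\<^sup>2 + 2 * \<tau> > 0" "s\<^sup>2 + \<tau> > 0" using s(1) \<tau>(2) by (simp_all add: add_pos_pos)
      then show ?thesis by (intro continuous_intros) auto
    qed
  qed (use \<tau>(2) dsym in auto)
qed

end

lemma half_mean_scaled: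
  assumes a: "a > 0" and b: "b > 0" and c: "c > 0"
  shows "1 / sqrt (2 * pi * (a * b)) * half_mean (a * c) (a * b * v) =
    sqrt (a * b / (2*pi)) * (c * exp (- (b\<^sup>2 * v\<^sup>2) / (2 * c\<^sup>2)) / (sqrt (2*pi) * b) + 1/2 * v * erfc (- (b * v) / (sqrt 2 * c)))"
proof -
  define g where "g = a * b"
  define q where "q = sqrt (g / (2*pi))"
  have g: "g > 0" using a b by (simp add: g_def)
  have "1 / sqrt (2 * pi * g) = q / g"
    unfolding q_def using g by (simp add: real_sqrt_divide real_sqrt_mult field_simps)
  moreover have "half_mean (a * c) (g * v) = g * (c * exp (- (b\<^sup>2 * v\<^sup>2) / (2 * c\<^sup>2)) / (sqrt (2*pi) * b) + 1/2 * v * erfc (- (b * v) / (sqrt 2 * c)))"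
  proof -
    have e: "- (g * v)\<^sup>2 / (2 * (a * c)\<^sup>2) = - (b\<^sup>2 * v\<^sup>2) / (2 * c\<^sup>2)"
      using a c by (simp add: g_def power_mult_distrib field_simps)
    have f: "- (g * v) / (sqrt 2 * (a * c)) = - (b * v) / (sqrt 2 * c)"
      using a c by (simp add: g_def field_simps)
    have "half_mean (a * c) (g * v) = a * c / sqrt (2 * pi) * exp (- (g * v)\<^sup>2 / (2 * (a * c)\<^sup>2)) + g * v * (erfc (- (g * v) / (sqrt 2 * (a * c))) / 2)"
      by (rule half_mean_eq) (use a c in simp)
    then show ?thesis unfolding e f using b by (simp add: g_def field_simps)
  qed
  ultimately show ?thesis unfolding g_def[symmetric] q_def[symmetric] using g by simp
qed

text \<open>With \<open>\<tau> = a\<^sup>2\<close>, \<open>1 - 2\<sigma> = b\<^sup>2\<close>, \<open>2 + 2\<sigma> = c\<^sup>2\<close> and \<open>1 + 2\<sigma> = k\<^sup>2\<close> one has \<open>\<gamma> = a * b\<close>, and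
  all formulas become rational in \<open>a\<close>, \<open>b\<close>, \<open>c\<close>, \<open>k\<close> apart from \<open>exp\<close> and \<open>erfc\<close>. Here \<open>k\<close> and \<open>c\<close> satisfy \<open>c\<^sup>2 = k\<^sup>2 + 1\<close>, so that the tilted Gaussian
  has mean \<open>a b v / c\<^sup>2\<close> and standard deviation \<open>a k / c\<close>.\<close>

lemma half_det_mean_scaled:
  assumes a: "a > 0" and b: "b > 0" and c: "c > 0" and k: "k > 0" and ck: "c\<^sup>2 = k\<^sup>2 + 1" and bk: "b\<^sup>2 + k\<^sup>2 = 2"
  shows "half_det_mean (a\<^sup>2) (a * k) (a * b * v) = (a * b)\<^sup>2 * (k * v * exp (- (b\<^sup>2 * v\<^sup>2) / (2 * k\<^sup>2)) / (sqrt (2*pi) * b)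
     + exp (- (b\<^sup>2 * v\<^sup>2) / (2 * c\<^sup>2)) * erfc (- (b * v) / (sqrt 2 * k * c)) / (b\<^sup>2 * c)
     + 1/2 * (v\<^sup>2 - 1) * erfc (- (b * v) / (sqrt 2 * k)))" (is ?A)
    and "2 * a\<^sup>2 * (exp (- (a * b * v)\<^sup>2 / (2 * ((a * k)\<^sup>2 + a\<^sup>2))) * sqrt (a\<^sup>2 / ((a * k)\<^sup>2 + a\<^sup>2))) =
      (a * b)\<^sup>2 * (2 * exp (- (b\<^sup>2 * v\<^sup>2) / (2 * c\<^sup>2)) / (b\<^sup>2 * c))" (is ?B)
proof -
  have sum: "(a * k)\<^sup>2 + a\<^sup>2 = a\<^sup>2 * c\<^sup>2" by (simp add: ck power_mult_distrib algebra_simps)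
  have sq: "sqrt (a\<^sup>2 / (a\<^sup>2 * c\<^sup>2)) = 1 / c"
    using a c by (simp add: real_sqrt_divide)
  have e1: "- (a * b * v)\<^sup>2 / (2 * (a * k)\<^sup>2) = - (b\<^sup>2 * v\<^sup>2) / (2 * k\<^sup>2)"
    using a k by (simp add: power_mult_distrib)
  have e2: "- (a * b * v)\<^sup>2 / (2 * (a\<^sup>2 * c\<^sup>2)) = - (b\<^sup>2 * v\<^sup>2) / (2 * c\<^sup>2)"
    using a c by (simp add: power_mult_distrib)
  have f1: "- (a * b * v) / (sqrt 2 * (a * k)) = - (b * v) / (sqrt 2 * k)"
    using a k by (simp add: field_simps)
  have f2: "- (a * b * v * a\<^sup>2 / (a\<^sup>2 * c\<^sup>2)) / (sqrt 2 * (a * k * (1 / c))) = - (b * v) / (sqrt 2 * k * c)"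
    using a k c by (simp add: field_simps power2_eq_square)
  have m: "(a * b * v)\<^sup>2 + (a * k)\<^sup>2 - 2 * a\<^sup>2 = (a * b)\<^sup>2 * (v\<^sup>2 - 1)"
  proof -
    have "(a * b * v)\<^sup>2 + (a * k)\<^sup>2 - 2 * a\<^sup>2 = (a * b * v)\<^sup>2 + a\<^sup>2 * (k\<^sup>2 - (b\<^sup>2 + k\<^sup>2))"
      unfolding bk by (simp add: power_mult_distrib algebra_simps)
    then show ?thesis by (simp add: power_mult_distrib algebra_simps)
  qed
  define x1 where "x1 = exp (- (b\<^sup>2 * v\<^sup>2) / (2 * k\<^sup>2))"
  define x2 where "x2 = exp (- (b\<^sup>2 * v\<^sup>2) / (2 * c\<^sup>2))"
  define r1 where "r1 = erfc (- (b * v) / (sqrt 2 * k))"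
  define r2 where "r2 = erfc (- (b * v) / (sqrt 2 * k * c))"
  have "half_det_mean (a\<^sup>2) (a * k) (a * b * v) = a * b * v * (a * k / sqrt (2 * pi) * x1)
     + (a * b)\<^sup>2 * (v\<^sup>2 - 1) * (r1 / 2) + 2 * a\<^sup>2 * (x2 * (1 / c)) * (r2 / 2)"
    using half_det_mean_eq[of "a * k" "a\<^sup>2" "a * b * v"] a k
    unfolding sum sq e1 e2 f1 f2 m x1_def x2_def r1_def r2_def by simp
  also have "\<dots> = (a * b)\<^sup>2 * (k * v * x1 / (sqrt (2*pi) * b) + x2 * r2 / (b\<^sup>2 * c) + 1/2 * (v\<^sup>2 - 1) * r1)"
    using b c by (simp add: field_simps power2_eq_square)
  finally show ?A unfolding x1_def[symmetric] x2_def[symmetric] r1_def[symmetric] r2_def[symmetric] .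
  show ?B unfolding sum sq e2 x2_def[symmetric] using b c by (simp add: field_simps power2_eq_square)
qed

text \<open>The variance \<open>3 * C'' 0 - \<gamma>\<^sup>2\<close> of \<open>H_ii + \<gamma> X\<close> is nonnegative and \<open>\<gamma> > 0\<close>.\<close>

lemma (in isotropic_gaussian_field) C''_pos: "C'' 0 > 0"
proof -
  fix i :: 'n
  have XX: "expectation (\<lambda>\<omega>. X 0 \<omega> * X 0 \<omega>) = 1" using jet_covariance(1)[of 0] by (simp add: power2_eq_square)
  have "(\<lambda>\<omega>. (hessf X 0 \<omega> $ i $ i + \<gamma>0 * X 0 \<omega>)\<^sup>2) = (\<lambda>\<omega>. hessf X 0 \<omega> $ i $ i * hessf X 0 \<omega> $ i $ i
      + 2 * \<gamma>0 * (hessf X 0 \<omega> $ i $ i * X 0 \<omega>) + \<gamma>0\<^sup>2 * (X 0 \<omega> * X 0 \<omega>))"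
    by (simp add: fun_eq_iff power2_eq_square algebra_simps)
  then have "expectation (\<lambda>\<omega>. (hessf X 0 \<omega> $ i $ i + \<gamma>0 * X 0 \<omega>)\<^sup>2) = 3 * C'' 0 - \<gamma>0\<^sup>2"
    using jetcomb_integrable(2)[OF jetcomb_H[of 0 i i] jetcomb_H[of 0 i i]] jetcomb_integrable(2)[OF jetcomb_H[of 0 i i] jetcomb_X]
      jetcomb_integrable(2)[OF jetcomb_X[of 0] jetcomb_X[of 0]]
    by (simp add: hess_second_moments XX power2_eq_square)
  moreover have "0 \<le> expectation (\<lambda>\<omega>. (hessf X 0 \<omega> $ i $ i + \<gamma>0 * X 0 \<omega>)\<^sup>2)" by simp
  moreover have "\<gamma>0\<^sup>2 > 0" using C'_0 by simp
  ultimately show ?thesis by linarith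
qed

theorem mainTheorem7:
  fixes M :: "'w measure"
    and X :: "real^'n::{finite,linorder} \<Rightarrow> 'w \<Rightarrow> real"
    and C C' C'' :: "real \<Rightarrow> real"
    and \<gamma> \<sigma> :: real
  assumes dim: "CARD('n) \<in> {1, 2}"
    and field: "isotropic_gaussian_field M X C C' C''"
    and regular: "kac_rice_regular M X"
    and gamma: "\<gamma> = - C' 0"
    and sigma: "\<sigma> = (C'' 0 - (C' 0)\<^sup>2) / (2 * C'' 0)"
    and sigma_range: "\<sigma> \<in> {- 1 / real CARD('n) <..< 1 / 2}"
  shows "(\<forall>m\<le>CARD('n). is_number_density M X m (number_density M X m)) \<and>
    (CARD('n) = 1 \<longrightarrow> (\<forall>\<nu> z. gen_fun M X \<nu> z =
       sqrt (\<gamma> / (2*pi)) * std_normal_density \<nu> *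
       ((sqrt (2 + 2*\<sigma>) * exp (- ((1 - 2*\<sigma>) * \<nu>\<^sup>2) / (2 * (2 + 2*\<sigma>))) / (sqrt (2*pi) * sqrt (1 - 2*\<sigma>))
          - 1/2 * \<nu> * erfc (sqrt (1 - 2*\<sigma>) * \<nu> / (sqrt 2 * sqrt (2 + 2*\<sigma>))))
        + z * (sqrt (2 + 2*\<sigma>) * exp (- ((1 - 2*\<sigma>) * \<nu>\<^sup>2) / (2 * (2 + 2*\<sigma>))) / (sqrt (2*pi) * sqrt (1 - 2*\<sigma>))
          + 1/2 * \<nu> * erfc (- (sqrt (1 - 2*\<sigma>) * \<nu>) / (sqrt 2 * sqrt (2 + 2*\<sigma>))))))) \<and>
    (CARD('n) = 2 \<longrightarrow> (\<forall>\<nu> z. gen_fun M X \<nu> z =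
       \<gamma> / (2*pi) * std_normal_density \<nu> * (A0 \<sigma> \<nu> + z * A1 \<sigma> \<nu> + z\<^sup>2 * A2 \<sigma> \<nu>)))"
proof -
  interpret isotropic_gaussian_field M X C C' C'' by (rule field)
  define a where "a = sqrt (C'' 0)"
  define b where "b = sqrt (1 - 2 * \<sigma>)"
  define c where "c = sqrt (2 + 2 * \<sigma>)"
  have \<tau>: "C'' 0 > 0" by (rule C''_pos)
  have \<sigma>: "\<sigma> < 1 / 2" "- 1 / real CARD('n) < \<sigma>" using sigma_range by simp_all
  have \<sigma>1: "- 1 < \<sigma>" using \<sigma>(2) dim by auto
  have a: "a > 0" "C'' 0 = a\<^sup>2" using \<tau> by (simp_all add: a_def)
  have b: "b > 0" "1 - 2 * \<sigma> = b\<^sup>2" using \<sigma> by (simp_all add: b_def)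
  have c: "c > 0" "2 + 2 * \<sigma> = c\<^sup>2" using \<sigma>1 by (simp_all add: c_def)
  have g0: "\<gamma> > 0" using C'_0 gamma by simp
  have "\<gamma>\<^sup>2 = (a * b)\<^sup>2"
    using \<tau> unfolding power_mult_distrib a(2)[symmetric] b(2)[symmetric] sigma gamma by (simp add: field_simps)
  then have g: "- C' 0 = a * b" using g0 a(1) b(1) unfolding gamma[symmetric] by (simp add: power2_eq_iff_nonneg)
  have gab: "\<gamma> = a * b" using gamma g by simp
  have q0: "normal_vec_density (sqrt (- C' 0)) (0 :: real^'n::{finite,linorder}) = (1 / sqrt (2 * pi * (a * b))) ^ CARD('n)"
    unfolding normal_vec_density_0 g using a b by simp
  let ?q = "normal_vec_density (sqrt (- C' 0)) (0 :: real^'n::{finite,linorder})"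
  from dim consider "CARD('n) = 1" | "CARD('n) = 2" by auto
  then show ?thesis
  proof cases
    case 1
    then obtain i :: 'n where i: "(UNIV :: 'n set) = {i}" by (auto simp: card_1_singleton_iff)
    have s: "a * c > 0" "(a * c)\<^sup>2 = 3 * C'' 0 - (- C' 0)\<^sup>2"
      using a b c unfolding g a(2) by (auto simp: power_mult_distrib c(2)[symmetric] b(2)[symmetric] algebra_simps)
    note D = number_densities_1[OF i s]
    note E = number_density_eqI[OF D(1)] number_density_eqI[OF D(2)]
    have half: "?q * (std_normal_density v * half_mean (a * c) (a * b * v)) = sqrt (a * b / (2*pi)) * std_normal_density v *
       (c * exp (- (b\<^sup>2 * v\<^sup>2) / (2 * c\<^sup>2)) / (sqrt (2*pi) * b) + 1/2 * v * erfc (- (b * v) / (sqrt 2 * c)))" for v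
      using half_mean_scaled[OF a(1) b(1) c(1), of v] unfolding q0 1 by (simp add: mult_ac)
    have G: "gen_fun M X \<nu> z = sqrt (\<gamma> / (2*pi)) * std_normal_density \<nu> *
       ((c * exp (- (b\<^sup>2 * \<nu>\<^sup>2) / (2 * c\<^sup>2)) / (sqrt (2*pi) * b)
          - 1/2 * \<nu> * erfc (b * \<nu> / (sqrt 2 * c)))
        + z * (c * exp (- (b\<^sup>2 * \<nu>\<^sup>2) / (2 * c\<^sup>2)) / (sqrt (2*pi) * b)
          + 1/2 * \<nu> * erfc (- (b * \<nu>) / (sqrt 2 * c))))" for \<nu> z
    proof -
      have "gen_fun M X \<nu> z = ?q * (std_normal_density \<nu> * half_mean (a * c) (a * b * (- \<nu>)))
          + ?q * (std_normal_density \<nu> * half_mean (a * c) (a * b * \<nu>)) * z"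
        unfolding gen_fun_def 1 using E g by simp
      also have "?q * (std_normal_density \<nu> * half_mean (a * c) (a * b * (- \<nu>))) =
          ?q * (std_normal_density (- \<nu>) * half_mean (a * c) (a * b * (- \<nu>)))"
        by (simp add: normal_density_def)
      finally show ?thesis unfolding half gab by (simp add: normal_density_def algebra_simps)
    qed
    have "is_number_density M X m (number_density M X m)" if "m \<le> CARD('n)" for m
    proof -
      have "m = 0 \<or> m = 1" using that 1 by auto
      then show ?thesis using D E by auto
    qed
    moreover have "sqrt (b\<^sup>2) = b" "sqrt (c\<^sup>2) = c" using b(1) c(1) by simp_all
    ultimately show ?thesis unfolding b(2) c(2) 1 by (simp add: G)
  next
    case 2
    define k where "k = sqrt (1 + 2 * \<sigma>)"
    have k: "k > 0" "1 + 2 * \<sigma> = k\<^sup>2" using \<sigma> 2 by (simp_all add: k_def)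
    obtain i j :: 'n where ij: "(UNIV :: 'n set) = {i, j}" "i \<noteq> j" using 2 by (auto simp: card_2_iff)
    have s: "a * k > 0" "(a * k)\<^sup>2 = 2 * a\<^sup>2 - (- C' 0)\<^sup>2"
      using a b k unfolding g by (auto simp: power_mult_distrib k(2)[symmetric] b(2)[symmetric] algebra_simps)
    have a2: "a\<^sup>2 > 0" using a by simp
    have ck: "c\<^sup>2 = k\<^sup>2 + 1" "b\<^sup>2 + k\<^sup>2 = 2" unfolding b(2)[symmetric] c(2)[symmetric] k(2)[symmetric] by simp_all
    have sr: "sqrt (b\<^sup>2) = b" "sqrt (c\<^sup>2) = c" "sqrt (k\<^sup>2) = k" using b(1) c(1) k(1) by simp_all
    note D = number_densities_2[OF ij a(2) a2 s]
    note E = number_density_eqI[OF D(1)] number_density_eqI[OF D(2)] number_density_eqI[OF D(3)]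
    note S = half_det_mean_scaled[OF a(1) b(1) c(1) k(1) ck]
    have q: "?q * (x * ((a * b)\<^sup>2 * y)) = \<gamma> / (2*pi) * x * y" for x y
      unfolding q0 2 gab using a b by (simp add: power2_eq_square field_simps)
    have A: "half_det_mean (a\<^sup>2) (a * k) (- (a * b * v)) = (a * b)\<^sup>2 * A0 \<sigma> v"
      "2 * a\<^sup>2 * (exp (- (a * b * v)\<^sup>2 / (2 * ((a * k)\<^sup>2 + a\<^sup>2))) * sqrt (a\<^sup>2 / ((a * k)\<^sup>2 + a\<^sup>2))) = (a * b)\<^sup>2 * A1 \<sigma> v"
      "half_det_mean (a\<^sup>2) (a * k) (a * b * v) = (a * b)\<^sup>2 * A2 \<sigma> v" for v
    proof -
      show "half_det_mean (a\<^sup>2) (a * k) (a * b * v) = (a * b)\<^sup>2 * A2 \<sigma> v"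
        unfolding A2_def S(1) b(2) c(2) k(2) sr ..
      show "2 * a\<^sup>2 * (exp (- (a * b * v)\<^sup>2 / (2 * ((a * k)\<^sup>2 + a\<^sup>2))) * sqrt (a\<^sup>2 / ((a * k)\<^sup>2 + a\<^sup>2))) = (a * b)\<^sup>2 * A1 \<sigma> v"
        unfolding A1_def S(2) b(2) c(2) k(2) sr ..
      show "half_det_mean (a\<^sup>2) (a * k) (- (a * b * v)) = (a * b)\<^sup>2 * A0 \<sigma> v"
        using S(1)[of "- v"] unfolding A0_def b(2) c(2) k(2) sr by simp
    qed
    have n: "number_density M X 0 \<nu> = \<gamma> / (2*pi) * std_normal_density \<nu> * A0 \<sigma> \<nu>"
      "number_density M X 1 \<nu> = \<gamma> / (2*pi) * std_normal_density \<nu> * A1 \<sigma> \<nu>"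
      "number_density M X 2 \<nu> = \<gamma> / (2*pi) * std_normal_density \<nu> * A2 \<sigma> \<nu>" for \<nu>
      unfolding E by (simp_all only: g A q[unfolded g])
    have "gen_fun M X \<nu> z = \<gamma> / (2*pi) * std_normal_density \<nu> * (A0 \<sigma> \<nu> + z * A1 \<sigma> \<nu> + z\<^sup>2 * A2 \<sigma> \<nu>)" for \<nu> z
    proof -
      have "{0..2} = {0, 1, 2 :: nat}" by auto
      then show ?thesis unfolding gen_fun_def 2 by (simp add: n n(2)[unfolded One_nat_def] algebra_simps)
    qed
    moreover have "is_number_density M X m (number_density M X m)" if "m \<le> CARD('n)" for m
    proof -
      have "m = 0 \<or> m = 1 \<or> m = 2" using that 2 by auto
      then show ?thesis using D E by auto
    qed
    ultimately show ?thesis using 2 by simp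
  qed
qed

end
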